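(* Assume that $W$ satisfies the following three conditions. (1) For every $\delta>0$ there exists $\eta>0$ such that for every $x\in\mathbb{R}^d$, every $\xi\in\mathrm{dom}\,W(x,\cdot)$ and every $t\in[0,1)$: $1-t\le\eta$ implies $W(x,t\xi)\le W(x,\xi)+\delta$. (2) For every compact set $K\subset\mathrm{int}\,C$, the function $x\mapsto\sup\{W(x,\xi):\xi\in K\}$ belongs to $L^\infty_{\rm loc}(\mathbb{R}^d)$. (3) For every $s>0$ there exists a compact set $K_s\subset\mathrm{int}\,C$ such that for every $x\in\mathbb{R}^d$, $\inf\{W(x,\xi):\xi\in\overline{C}\setminus K_s\}\ge s$. For $\varepsilon>0$ let $I_\varepsilon:W^{1,\infty}(\Omega;\mathbb{R}^m)\to[0,+\infty]$ be given by $I_\varepsilon(u)=\int_\Omega W\left(\frac{x}{\varepsilon},\nabla u(x)\right)dx$. Then $\{I_\varepsilon\}_{\varepsilon>0}$ $\Gamma$-converges, with respect to $L^1(\Omega;\mathbb{R}^m)$-convergence as $\varepsilon\to0$, to $I_{\rm hom}$, where for every $u\in W^{1,\infty}(\Omega;\mathbb{R}^m)$ $$I_{\rm hom}(u)=\int_\Omega W_{\rm hom}(\nabla u(x))\,dx,\qquad W_{\rm hom}=\overline{\mathcal{H}W},$$ and $\overline{\mathcal{H}W}$ is the lower semicontinuous envelope of $\mathcal{H}W$.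
   Context: Let $m,d\ge1$ be integers, $\mathbb{M}^{m\times d}$ the space of real $m\times d$ matrices, $Y=(0,1)^d$, and $\Omega\subset\mathbb{R}^d$ a nonempty bounded open domain with Lipschitz boundary. Let $C\subset\mathbb{M}^{m\times d}$ be a bounded convex set with $0\in\mathrm{int}\,C$; $\overline{C}$ is its closure. Let $W:\mathbb{R}^d\times\mathbb{M}^{m\times d}\to[0,+\infty]$ be Borel measurable, $Y$-periodic in its first variable ($W(x+z,\xi)=W(x,\xi)$ for all $z\in\mathbb{Z}^d$), with $\mathrm{dom}\,W(x,\cdot):=\{\xi:W(x,\xi)<+\infty\}\subset\overline{C}$ for all $x\in\mathbb{R}^d$. For a bounded open $D\subset\mathbb{R}^d$ with $|\partial D|=0$, $W^{1,\infty}_0(D;\mathbb{R}^m)=\{\varphi\in W^{1,\infty}(D;\mathbb{R}^m):\varphi=0\text{ on }\partial D\}$. Define $\mathcal{H}W:\mathbb{M}^{m\times d}\to[0,+\infty]$ by $$\mathcal{H}W(\xi)=\inf_{n\ge1}\frac1{n^d}\inf\left\{\int_{nY}W(x,\xi+\nabla\phi(x))\,dx:\phi\in W^{1,\infty}_0(nY;\mathbb{R}^m)\right\}.$$ $\Gamma$-convergence of $\{F_\varepsilon\}$ to $F$ (functionals $W^{1,\infty}(\Omega;\mathbb{R}^m)\to[0,+\infty]$) with respect to $L^1$-convergence as $\varepsilon\to0$ means that for every $u\in W^{1,\infty}(\Omega;\mathbb{R}^m)$, $\Gamma\text{-}\liminf_{\varepsilon\to0}F_\varepsilon(u)\ge F(u)$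 and $\Gamma\text{-}\limsup_{\varepsilon\to0}F_\varepsilon(u)\le F(u)$, where $\Gamma\text{-}\liminf_{\varepsilon\to0}F_\varepsilon(u)=\inf\{\liminf_{\varepsilon\to0}F_\varepsilon(u_\varepsilon):u_\varepsilon\to u\text{ in }L^1(\Omega;\mathbb{R}^m)\}$ and $\Gamma\text{-}\limsup_{\varepsilon\to0}F_\varepsilon(u)=\inf\{\limsup_{\varepsilon\to0}F_\varepsilon(u_\varepsilon):u_\varepsilon\to u\text{ in }L^1(\Omega;\mathbb{R}^m)\}$, with $u_\varepsilon\in W^{1,\infty}(\Omega;\mathbb{R}^m)$. *)

theory Defs
  imports "HOL-Analysis.Analysis"
begin

text \<open>
  Vectors of $R^d$ have type \<open>real ^ 'd\<close>; an $m \times d$ matrix has type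
  \<open>real ^ 'd ^ 'm\<close>, so that \<open>A $ i $ j\<close> is its entry in row \<open>i\<close> and column \<open>j\<close>.
  Elements of function spaces are represented by functions, not by classes modulo null sets;
  the sets and functionals below do not depend on the representative.
\<close>

subsection \<open>Test functions\<close>

definition partial_deriv :: "'d::finite \<Rightarrow> (real ^ 'd \<Rightarrow> real) \<Rightarrow> real ^ 'd \<Rightarrow> real" where
  "partial_deriv j f x = frechet_derivative f (at x) (axis j 1)"

primrec C_k :: "nat \<Rightarrow> (real ^ 'd::finite \<Rightarrow> real) \<Rightarrow> bool" where
  "C_k 0 f \<longleftrightarrow> continuous_on UNIV f"
| "C_k (Suc k) f \<longleftrightarrow> f differentiable_on UNIV \<and> (\<forall>j. C_k k (partial_deriv j f))"

definition test_function :: "(real ^ 'd::finite) set \<Rightarrow> (real ^ 'd \<Rightarrow> real) \<Rightarrow> bool" where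
  "test_function D \<psi> \<longleftrightarrow>
     (\<forall>k. C_k k \<psi>) \<and> compact (closure {x. \<psi> x \<noteq> 0}) \<and> closure {x. \<psi> x \<noteq> 0} \<subseteq> D"

subsection \<open>Sobolev spaces\<close>

definition Linfty :: "'a::euclidean_space set \<Rightarrow> ('a \<Rightarrow> 'b::real_normed_vector) set" where
  "Linfty D = {f \<in> borel_measurable (lebesgue_on D).
                 \<exists>B. AE x in lebesgue_on D. norm (f x) \<le> B}"

definition locally_integrable ::
    "'a::euclidean_space set \<Rightarrow> ('a \<Rightarrow> 'b::euclidean_space) \<Rightarrow> bool" where
  "locally_integrable D f \<longleftrightarrow> (\<forall>K. compact K \<and> K \<subseteq> D \<longrightarrow> f absolutely_integrable_on K)"

definition is_weak_gradient ::
    "(real ^ 'd::finite) set \<Rightarrow> (real ^ 'd \<Rightarrow> real ^ 'm::finite) \<Rightarrow> (real ^ 'd \<Rightarrow> real ^ 'd ^ 'm) \<Rightarrow> bool"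
  where
  "is_weak_gradient D u G \<longleftrightarrow> locally_integrable D u \<and> locally_integrable D G \<and>
     (\<forall>\<psi> i j. test_function D \<psi> \<longrightarrow>
        (LINT x|lebesgue_on D. u x $ i * partial_deriv j \<psi> x)
          = - (LINT x|lebesgue_on D. G x $ i $ j * \<psi> x))"

text \<open>A weak gradient is unique up to null sets; \<open>weak_gradient\<close> selects a representative.\<close>

definition weak_gradient ::
    "(real ^ 'd::finite) set \<Rightarrow> (real ^ 'd \<Rightarrow> real ^ 'm::finite) \<Rightarrow> real ^ 'd \<Rightarrow> real ^ 'd ^ 'm" where
  "weak_gradient D u = (SOME G. is_weak_gradient D u G)"

definition W1inf :: "(real ^ 'd::finite) set \<Rightarrow> (real ^ 'd \<Rightarrow> real ^ 'm::finite) set" where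
  "W1inf D = {u \<in> Linfty D. \<exists>G \<in> Linfty D. is_weak_gradient D u G}"

text \<open>The boundary condition refers to the continuous representative.\<close>

definition W1inf0 :: "(real ^ 'd::finite) set \<Rightarrow> (real ^ 'd \<Rightarrow> real ^ 'm::finite) set" where
  "W1inf0 D = {u \<in> W1inf D. \<exists>v. continuous_on (closure D) v \<and>
                 (AE x in lebesgue_on D. v x = u x) \<and> (\<forall>x \<in> frontier D. v x = 0)}"

definition Linfty_loc_ennreal :: "('a::euclidean_space \<Rightarrow> ennreal) \<Rightarrow> bool" where
  "Linfty_loc_ennreal f \<longleftrightarrow> f \<in> borel_measurable lebesgue \<and>
     (\<forall>K. compact K \<longrightarrow> (\<exists>B::real. AE x in lebesgue_on K. f x \<le> ennreal B))"

subsection \<open>Lipschitz boundary\<close>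

text \<open>Near each boundary point the set is the part of a ball above the graph, in some direction
  \<open>\<nu>\<close>, of a Lipschitz function \<open>g\<close> defined on the hyperplane orthogonal to \<open>\<nu>\<close>.\<close>

definition Lipschitz_boundary :: "'a::euclidean_space set \<Rightarrow> bool" where
  "Lipschitz_boundary D \<longleftrightarrow>
     (\<forall>p \<in> frontier D. \<exists>r > 0. \<exists>\<nu> g L. norm \<nu> = 1 \<and> L-lipschitz_on {y. \<nu> \<bullet> y = 0} g \<and>
        D \<inter> ball p r = {x \<in> ball p r. \<nu> \<bullet> x > g (x - (\<nu> \<bullet> x) *\<^sub>R \<nu>)})"

subsection \<open>Gamma-convergence\<close>

text \<open>\<open>L1_families D u\<close> consists of the families \<open>(u\<^sub>\<epsilon>)\<^bsub>\<epsilon> > 0\<^esub>\<close> in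
  \<open>W1inf D\<close> converging to \<open>u\<close> in $L^1$; values at \<open>\<epsilon> \<le> 0\<close> are irrelevant.\<close>

definition L1_families ::
    "(real ^ 'd::finite) set \<Rightarrow> (real ^ 'd \<Rightarrow> real ^ 'm::finite) \<Rightarrow> (real \<Rightarrow> real ^ 'd \<Rightarrow> real ^ 'm) set"
  where
  "L1_families D u = {U. (\<forall>\<epsilon> > 0. U \<epsilon> \<in> W1inf D) \<and>
     ((\<lambda>\<epsilon>. \<integral>\<^sup>+ x. ennreal (norm (U \<epsilon> x - u x)) \<partial>lebesgue_on D) \<longlongrightarrow> 0) (at_right 0)}"

definition Gamma_liminf ::
    "(real ^ 'd::finite) set \<Rightarrow> (real \<Rightarrow> (real ^ 'd \<Rightarrow> real ^ 'm::finite) \<Rightarrow> ennreal)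
       \<Rightarrow> (real ^ 'd \<Rightarrow> real ^ 'm) \<Rightarrow> ennreal" where
  "Gamma_liminf D F u = (INF U \<in> L1_families D u. Liminf (at_right 0) (\<lambda>\<epsilon>. F \<epsilon> (U \<epsilon>)))"

definition Gamma_limsup ::
    "(real ^ 'd::finite) set \<Rightarrow> (real \<Rightarrow> (real ^ 'd \<Rightarrow> real ^ 'm::finite) \<Rightarrow> ennreal)
       \<Rightarrow> (real ^ 'd \<Rightarrow> real ^ 'm) \<Rightarrow> ennreal" where
  "Gamma_limsup D F u = (INF U \<in> L1_families D u. Limsup (at_right 0) (\<lambda>\<epsilon>. F \<epsilon> (U \<epsilon>)))"

definition Gamma_converges ::
    "(real ^ 'd::finite) set \<Rightarrow> (real \<Rightarrow> (real ^ 'd \<Rightarrow> real ^ 'm::finite) \<Rightarrow> ennreal)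
       \<Rightarrow> ((real ^ 'd \<Rightarrow> real ^ 'm) \<Rightarrow> ennreal) \<Rightarrow> bool" where
  "Gamma_converges D F F0 \<longleftrightarrow>
     (\<forall>u \<in> W1inf D. Gamma_liminf D F u \<ge> F0 u \<and> Gamma_limsup D F u \<le> F0 u)"

subsection \<open>The integrand and its homogenization\<close>

definition effective_dom :: "('a \<Rightarrow> ennreal) \<Rightarrow> 'a set" where
  "effective_dom f = {\<xi>. f \<xi> < \<infinity>}"

definition lsc :: "('a::topological_space \<Rightarrow> ennreal) \<Rightarrow> bool" where
  "lsc f \<longleftrightarrow> (\<forall>x. f x \<le> Liminf (at x) f)"

definition lsc_envelope :: "('a::topological_space \<Rightarrow> ennreal) \<Rightarrow> 'a \<Rightarrow> ennreal" where
  "lsc_envelope f x = (SUP g \<in> {g. lsc g \<and> g \<le> f}. g x)"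

definition unit_cell :: "(real ^ 'd::finite) set" where
  "unit_cell = {x. \<forall>i. 0 < x $ i \<and> x $ i < 1}"

definition cell :: "nat \<Rightarrow> (real ^ 'd::finite) set" where
  "cell n = (\<lambda>x. real n *\<^sub>R x) ` unit_cell"

definition HW ::
    "(real ^ 'd::finite \<Rightarrow> real ^ 'd ^ 'm::finite \<Rightarrow> ennreal) \<Rightarrow> real ^ 'd ^ 'm \<Rightarrow> ennreal" where
  "HW W \<xi> = (INF n \<in> {1..}.
     (INF \<phi> \<in> W1inf0 (cell n). \<integral>\<^sup>+ x. W x (\<xi> + weak_gradient (cell n) \<phi> x) \<partial>lebesgue_on (cell n))
       / ennreal (real n ^ CARD('d)))"

definition I_eps ::
    "(real ^ 'd::finite \<Rightarrow> real ^ 'd ^ 'm::finite \<Rightarrow> ennreal) \<Rightarrow> (real ^ 'd) set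
       \<Rightarrow> real \<Rightarrow> (real ^ 'd \<Rightarrow> real ^ 'm) \<Rightarrow> ennreal" where
  "I_eps W \<Omega> \<epsilon> u = (\<integral>\<^sup>+ x. W (x /\<^sub>R \<epsilon>) (weak_gradient \<Omega> u x) \<partial>lebesgue_on \<Omega>)"

definition I_hom ::
    "(real ^ 'd::finite \<Rightarrow> real ^ 'd ^ 'm::finite \<Rightarrow> ennreal) \<Rightarrow> (real ^ 'd) set
       \<Rightarrow> (real ^ 'd \<Rightarrow> real ^ 'm) \<Rightarrow> ennreal" where
  "I_hom W \<Omega> u = (\<integral>\<^sup>+ x. lsc_envelope (HW W) (weak_gradient \<Omega> u x) \<partial>lebesgue_on \<Omega>)"

end

theory Submission
  imports Defs
begin

text \<open>
  Both inequalities are local. Up to a set of small measure, \<open>\<Omega>\<close> is a finite union of grid cubes on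
  which \<open>u\<close> is uniformly close to an affine map whose gradient \<open>\<xi>\<close> is close to that of \<open>u\<close> off a
  small set. Multiplying by some \<open>t < 1\<close> costs little energy by condition (1) and moves all gradients
  into a compact subset of the interior of \<open>C\<close>, near which the integrand is bounded by a constant
  \<open>M\<close> by condition (2). Hence two functions that are uniformly close can be glued by a cutoff in a
  thin layer at the boundary of a cube: the extra gradient term is small, so the integrand is at most
  \<open>M\<close> on the layer.

  For the lower bound, gradients of finite energy are bounded, so \<open>L\<^sup>1\<close>-convergence of \<open>u\<^sub>\<epsilon>\<close> to \<open>u\<close> is
  uniform on each cube, and gluing \<open>t u\<^sub>\<epsilon>\<close> to the affine map gives a competitor for \<open>HW (t \<xi>)\<close>. For
  the upper bound, rescaled almost optimal functions for \<open>HW (t \<xi>)\<close> fill the cubes and the affine maps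
  are glued to \<open>t u\<close>. The same gluing makes \<open>HW\<close> uniformly continuous on convex compact subsets of
  the interior of \<open>C\<close>, hence \<open>HW (t \<xi>)\<close> exceeds the lower semicontinuous envelope at \<open>\<xi>\<close> by an
  arbitrarily small amount only; the limit \<open>t \<rightarrow> 1\<close> in the lower bound is taken by Fatou's lemma.
\<close>

text \<open>\<open>W\<close> may jump in its second variable and is infinite outside the closure of
  \<open>C\<close>, so even a small pointwise change of a gradient can alter the energy without
  control. Apart from the factor \<open>t\<close>, gradients are therefore blended only in layers of
  controlled volume, where nothing but the bound \<open>M\<close> is used, and continuity is
  obtained for \<open>HW\<close> rather than for \<open>W\<close>. Blending works because of a scale
  invariance. In a cube of side \<open>h\<close>, functions at distance \<open>\<kappa> * h\<close>
  glued in a layer of width \<open>r * h\<close> produce an extra term of order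
  \<open>\<kappa> / r\<close>, whatever \<open>h\<close> is; the rest of the gradient is a convex
  combination of matrices of the compact set and stays in it. Hence the distance to the affine map
  must be small relative to the side of the cube; closeness in absolute terms is too weak. The
  parameters are fixed in the order \<open>\<delta>\<close>, \<open>t\<close>, the compact set, its
  margin \<open>\<rho>\<close> and bound \<open>M\<close>, then \<open>r\<close>,
  \<open>\<kappa>\<close>, the grid size \<open>h\<close>, and last
  \<open>\<epsilon>\<close>.\<close>

section \<open>Smooth functions of one real variable\<close>

primrec Ck1 :: "nat \<Rightarrow> (real \<Rightarrow> real) \<Rightarrow> bool" where
  "Ck1 0 f \<longleftrightarrow> continuous_on UNIV f"
| "Ck1 (Suc k) f \<longleftrightarrow> (\<exists>f'. (\<forall>x. (f has_real_derivative f' x) (at x)) \<and> Ck1 k f')"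

lemma Ck1_SucD: "Ck1 (Suc k) f \<Longrightarrow> Ck1 k f"
proof (induction k arbitrary: f)
  case 0
  then obtain f' where "\<And>x. (f has_real_derivative f' x) (at x)" by auto
  then show ?case
    by (auto intro!: continuous_at_imp_continuous_on DERIV_isCont)
next
  case (Suc k)
  then obtain f' where "\<And>x. (f has_real_derivative f' x) (at x)" "Ck1 (Suc k) f'"
    unfolding Ck1.simps(2)[of "Suc k"] by blast
  then show ?case using Suc.IH[of f'] unfolding Ck1.simps(2)[of k] by blast
qed

lemma Ck1_const: "Ck1 k (\<lambda>_. c)"
  by (induction k arbitrary: c) (auto intro!: exI[of _ "\<lambda>_. 0"])

lemma Ck1_affine: "Ck1 k (\<lambda>x. c * x + e)"
  by (cases k) (auto intro!: exI[of _ "\<lambda>_. c"] Ck1_const continuous_intros derivative_eq_intros)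

lemma Ck1_add: "Ck1 k f \<Longrightarrow> Ck1 k g \<Longrightarrow> Ck1 k (\<lambda>x. f x + g x)"
proof (induction k arbitrary: f g)
  case 0 then show ?case by (auto intro!: continuous_intros)
next
  case (Suc k)
  then obtain f' g' where "\<And>x. (f has_real_derivative f' x) (at x)" "Ck1 k f'"
    "\<And>x. (g has_real_derivative g' x) (at x)" "Ck1 k g'" by auto
  then show ?case using Suc.IH[of f' g']
    by (auto intro!: exI[of _ "\<lambda>x. f' x + g' x"] derivative_eq_intros)
qed

lemma Ck1_mult: "Ck1 k f \<Longrightarrow> Ck1 k g \<Longrightarrow> Ck1 k (\<lambda>x. f x * g x)"
proof (induction k arbitrary: f g)
  case 0 then show ?case by (auto intro!: continuous_intros)
next
  case (Suc k)
  then have fg: "Ck1 k f" "Ck1 k g" using Ck1_SucD by blast+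
  obtain f' g' where d: "\<And>x. (f has_real_derivative f' x) (at x)" "Ck1 k f'"
    "\<And>x. (g has_real_derivative g' x) (at x)" "Ck1 k g'" using Suc.prems by auto
  have "Ck1 k (\<lambda>x. f' x * g x + g' x * f x)"
    using Suc.IH[of f' g] Suc.IH[of g' f] d fg by (auto intro: Ck1_add)
  with d show ?case
    by (auto intro!: exI[of _ "\<lambda>x. f' x * g x + g' x * f x"] DERIV_mult)
qed

lemma Ck1_compose: "Ck1 k f \<Longrightarrow> Ck1 k g \<Longrightarrow> Ck1 k (\<lambda>x. f (g x))"
proof (induction k arbitrary: f g)
  case 0 then show ?case
    by (auto intro: continuous_on_compose2[where t=UNIV and g=f])
next
  case (Suc k)
  then have fg: "Ck1 k f" "Ck1 k g" using Ck1_SucD by blast+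
  obtain f' g' where d: "\<And>x. (f has_real_derivative f' x) (at x)" "Ck1 k f'"
    "\<And>x. (g has_real_derivative g' x) (at x)" "Ck1 k g'" using Suc.prems by auto
  have "Ck1 k (\<lambda>x. f' (g x) * g' x)"
    using Suc.IH[of f' g] d fg by (auto intro: Ck1_mult)
  with d show ?case
    by (auto intro!: exI[of _ "\<lambda>x. f' (g x) * g' x"] intro: DERIV_chain2[of f])
qed

text \<open>For \<open>p = 1\<close> this is the classical flat function. The polynomial factor in
  \<open>1 / t\<close> makes the family closed under differentiation, so that smoothness follows by
  one induction over all \<open>p\<close>.\<close>

definition flat :: "real poly \<Rightarrow> real \<Rightarrow> real" where
  "flat p t = (if t > 0 then poly p (inverse t) * exp (- inverse t) else 0)"

lemma poly_times_exp_tendsto_0: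
  "((\<lambda>y::real. poly p y * exp (- y)) \<longlongrightarrow> 0) at_top"
proof -
  have "((\<lambda>y::real. \<Sum>i\<le>degree p. coeff p i * (y ^ i / exp y)) \<longlongrightarrow> (\<Sum>i\<le>degree p. coeff p i * 0)) at_top"
    by (intro tendsto_intros tendsto_power_div_exp_0)
  also have "(\<lambda>y::real. \<Sum>i\<le>degree p. coeff p i * (y ^ i / exp y)) = (\<lambda>y. poly p y * exp (- y))"
    by (auto simp: poly_altdef sum_distrib_right exp_minus divide_inverse mult.assoc intro!: ext sum.cong)
  finally show ?thesis by simp
qed

text \<open>With \<open>y = 1 / t\<close> the derivative of \<open>y\<close> is
  \<open>- y^2\<close>. The factor \<open>[:0,0,1:]\<close> is this \<open>y^2\<close>, and
  \<open>p - pderiv p\<close> comes from the product rule with the exponential.\<close>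

lemma flat_has_derivative:
  "(flat p has_real_derivative flat ([:0,0,1:] * (p - pderiv p)) t) (at t)"
proof -
  let ?q = "[:0,0,1:] * (p - pderiv p)"
  consider "t > 0" | "t < 0" | "t = 0" by linarith
  then show ?thesis
  proof cases
    case 1
    have "((\<lambda>t. poly p (inverse t) * exp (- inverse t)) has_real_derivative flat ?q t) (at t)"
      using 1 unfolding flat_def
      by (auto intro!: derivative_eq_intros poly_DERIV[THEN DERIV_chain2]
          simp: algebra_simps power2_eq_square)
    then show ?thesis
      by (rule has_field_derivative_transform_within_open[where S="{0<..}"])
        (use 1 in \<open>auto simp: flat_def\<close>)
  next
    case 2
    have "((\<lambda>t. 0) has_real_derivative flat ?q t) (at t)"
      using 2 by (auto simp: flat_def)
    then show ?thesis
      by (rule has_field_derivative_transform_within_open[where S="{..<0}"])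
        (use 2 in \<open>auto simp: flat_def\<close>)
  next
    case 3
    \<comment> \<open>Division by \<open>h\<close> only multiplies the polynomial by its variable,
      and the exponential still dominates.\<close>
    have "((\<lambda>h. flat p h / h) \<longlongrightarrow> 0) (at_right 0)"
    proof (rule Lim_transform_eventually)
      show "((\<lambda>h. poly ([:0,1:] * p) (inverse h) * exp (- inverse h)) \<longlongrightarrow> 0) (at_right 0)"
        by (rule filterlim_compose[OF poly_times_exp_tendsto_0 filterlim_inverse_at_top_right])
      show "\<forall>\<^sub>F h in at_right 0. poly ([:0,1:] * p) (inverse h) * exp (- inverse h) = flat p h / h"
        using eventually_at_right_less[of "0::real"]
        by eventually_elim (auto simp: flat_def field_simps)
    qed
    moreover have "((\<lambda>h. flat p h / h) \<longlongrightarrow> 0) (at_left 0)"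
      by (rule Lim_transform_eventually[of "\<lambda>_. 0"])
        (auto simp: eventually_at_left_field flat_def intro!: exI[of _ "-1"])
    ultimately have "((\<lambda>h. flat p h / h) \<longlongrightarrow> 0) (at 0)"
      by (simp add: filterlim_at_split)
    with 3 show ?thesis by (simp add: DERIV_def flat_def)
  qed
qed

lemma Ck1_flat: "Ck1 k (flat p)"
proof (induction k arbitrary: p)
  case 0
  show ?case using flat_has_derivative[of p]
    by (auto intro!: continuous_at_imp_continuous_on DERIV_isCont)
next
  case (Suc k)
  then show ?case using flat_has_derivative[of p] by auto
qed

text \<open>A smooth step that is \<open>0\<close> on the negative and \<open>1\<close> beyond \<open>1\<close>: the inner \<open>flat\<close> is \<open>0\<close> beyond
  \<open>1\<close> and at least \<open>exp (-1)\<close> on the negative half line.\<close>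

definition sstep :: "real \<Rightarrow> real" where
  "sstep t = flat 1 (exp (-1) + (-1) * flat 1 ((-1) * t + 1)) * inverse (flat 1 (exp (-1)))"

lemma Ck1_sstep: "Ck1 k sstep"
proof -
  have "Ck1 k (\<lambda>t. flat 1 ((-1) * t + 1))"
    by (rule Ck1_compose[OF Ck1_flat Ck1_affine])
  then have "Ck1 k (\<lambda>t. exp (-1) + (-1) * flat 1 ((-1) * t + 1))"
    by (rule Ck1_add[OF Ck1_const Ck1_mult[OF Ck1_const]])
  then have "Ck1 k (\<lambda>t. flat 1 (exp (-1) + (-1) * flat 1 ((-1) * t + 1)))"
    by (rule Ck1_compose[OF Ck1_flat])
  then show ?thesis unfolding sstep_def[abs_def]
    by (rule Ck1_mult[OF _ Ck1_const])
qed

lemma flat_1_mono: "s \<le> t \<Longrightarrow> flat 1 s \<le> flat 1 t"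
  by (auto simp: flat_def le_imp_inverse_le)

lemma flat_1_nonneg: "0 \<le> flat 1 t"
  by (simp add: flat_def)

lemma sstep_0: "t \<le> 0 \<Longrightarrow> sstep t = 0"
proof -
  assume "t \<le> 0"
  then have "flat 1 ((-1) * t + 1) \<ge> flat 1 1" by (intro flat_1_mono) auto
  moreover have "flat 1 1 = exp (-1)" by (simp add: flat_def)
  ultimately show ?thesis by (simp add: sstep_def flat_def)
qed

lemma sstep_1: "t \<ge> 1 \<Longrightarrow> sstep t = 1"
  by (simp add: sstep_def flat_def)

lemma sstep_nonneg: "0 \<le> sstep t"
  unfolding sstep_def by (intro mult_nonneg_nonneg) (auto simp: flat_1_nonneg)

lemma sstep_le_1: "sstep t \<le> 1"
proof -
  have "flat 1 (exp (-1) + (-1) * flat 1 ((-1) * t + 1)) \<le> flat 1 (exp (-1))"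
    using flat_1_nonneg[of "-1 * t + 1"] by (intro flat_1_mono) auto
  moreover have "flat 1 (exp (-1)) > 0" by (simp add: flat_def)
  ultimately show ?thesis by (simp add: sstep_def field_simps)
qed

text \<open>Outside the open unit interval \<open>sstep\<close> attains its minimum 0 or its maximum
  1, so the derivative vanishes there without being computed. Compactness of the unit interval gives
  the bound.\<close>

lemma sstep_deriv:
  obtains s' L where "\<And>t. (sstep has_real_derivative s' t) (at t)" "\<And>k. Ck1 k s'"
    "\<And>t. \<bar>s' t\<bar> \<le> L" "\<And>t. t \<le> 0 \<or> t \<ge> 1 \<Longrightarrow> s' t = 0"
proof -
  obtain s' where s': "\<And>t. (sstep has_real_derivative s' t) (at t)"
    using Ck1_sstep[of 1] by auto
  have k: "Ck1 k s'" for k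
  proof -
    obtain f' where "\<And>t. (sstep has_real_derivative f' t) (at t)" "Ck1 k f'"
      using Ck1_sstep[of "Suc k"] by auto
    then have "f' = s'" using s' DERIV_unique by (metis ext)
    then show ?thesis using \<open>Ck1 k f'\<close> by simp
  qed
  have cont: "continuous_on UNIV s'" using k[of 0] by simp
  have 0: "s' t = 0" if "t \<le> 0" for t
    by (rule DERIV_local_min[OF s', of 1]) (use that in \<open>auto simp: sstep_0 sstep_nonneg\<close>)
  have 1: "s' t = 0" if "t \<ge> 1" for t
    by (rule DERIV_local_max[OF s', of 1]) (use that in \<open>auto simp: sstep_1 sstep_le_1\<close>)
  have "compact (s' ` {0..1})"
    by (rule compact_continuous_image) (auto intro: continuous_on_subset[OF cont])
  then obtain B where B: "\<And>t. t \<in> {0..1} \<Longrightarrow> \<bar>s' t\<bar> \<le> B"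
    using compact_imp_bounded[of "s' ` {0..1}"] unfolding bounded_iff real_norm_def by (meson imageI)
  have L: "\<bar>s' t\<bar> \<le> max B 0" for t
    using B[of t] 0[of t] 1[of t] by (cases "t \<in> {0..1}") auto
  have Z: "s' t = 0" if "t \<le> 0 \<or> t \<ge> 1" for t
    using that 0[of t] 1[of t] by argo
  show thesis by (rule that[of s' "max B 0", OF s' k L Z])
qed

subsection \<open>Smooth functions of several variables\<close>

lemma partial_deriv_eq:
  "(f has_derivative f') (at x) \<Longrightarrow> partial_deriv j f x = f' (axis j 1)"
  unfolding partial_deriv_def by (drule frechet_derivative_at) (rule fun_cong, rule sym)

lemma C_k_SucD: "C_k (Suc k) f \<Longrightarrow> C_k k f"
proof (induction k arbitrary: f)
  case 0 then show ?case by (auto intro: differentiable_imp_continuous_on)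
next
  case (Suc k)
  then have "f differentiable_on UNIV" "\<And>j. C_k (Suc k) (partial_deriv j f)"
    unfolding C_k.simps(2)[of "Suc k"] by auto
  then show ?case using Suc.IH unfolding C_k.simps(2)[of k] by blast
qed

lemma differentiable_UNIV_has_derivative:
  "f differentiable_on UNIV \<Longrightarrow> (f has_derivative frechet_derivative f (at x)) (at x)"
  by (auto simp: differentiable_on_def frechet_derivative_works[symmetric])

lemma partial_deriv_const: "partial_deriv j (\<lambda>_. c) = (\<lambda>_. 0)"
  by (rule ext, subst partial_deriv_eq[OF has_derivative_const]) simp

lemma C_k_const: "C_k k (\<lambda>_::real^'d::finite. c)"
  by (induction k arbitrary: c) (auto simp: partial_deriv_const)

lemma partial_deriv_add:
  assumes "f differentiable_on UNIV" "g differentiable_on UNIV"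
  shows "partial_deriv j (\<lambda>x. f x + g x) = (\<lambda>x. partial_deriv j f x + partial_deriv j g x)"
  using has_derivative_add[OF assms[THEN differentiable_UNIV_has_derivative]]
  by (intro ext) (subst partial_deriv_eq, assumption, simp add: partial_deriv_def)

lemma partial_deriv_mult:
  assumes "f differentiable_on UNIV" "g differentiable_on UNIV"
  shows "partial_deriv j (\<lambda>x. f x * g x) = (\<lambda>x. f x * partial_deriv j g x + partial_deriv j f x * g x)"
  using has_derivative_mult[OF assms[THEN differentiable_UNIV_has_derivative]]
  by (intro ext) (subst partial_deriv_eq, assumption, simp add: partial_deriv_def)

lemma C_k_add: "C_k k f \<Longrightarrow> C_k k g \<Longrightarrow> C_k k (\<lambda>x. f x + g x)"
proof (induction k arbitrary: f g)
  case 0 then show ?case by (auto intro!: continuous_intros)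
next
  case (Suc k)
  then show ?case by (auto simp: partial_deriv_add intro: differentiable_on_add)
qed

lemma C_k_mult: "C_k k f \<Longrightarrow> C_k k g \<Longrightarrow> C_k k (\<lambda>x. f x * g x)"
proof (induction k arbitrary: f g)
  case 0 then show ?case by (auto intro!: continuous_intros)
next
  case (Suc k)
  then have fg: "C_k k f" "C_k k g" using C_k_SucD by blast+
  from Suc.prems Suc.IH[OF fg(1)] Suc.IH[OF _ fg(2)] show ?case
    by (auto simp: partial_deriv_mult intro!: differentiable_on_mult C_k_add)
qed

lemma C_k_cmult: "C_k k f \<Longrightarrow> C_k k (\<lambda>x. c * f x)"
  by (intro C_k_mult C_k_const)

lemma C_k_prod: "(\<And>i. i \<in> I \<Longrightarrow> C_k k (f i)) \<Longrightarrow> C_k k (\<lambda>x. \<Prod>i\<in>I. f i x)"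
proof (induction I rule: infinite_finite_induct)
  case (insert i I) then show ?case by (simp add: C_k_mult)
qed (auto simp: C_k_const)

lemma has_derivative_coord:
  fixes x :: "real^'d::finite"
  assumes "(b has_real_derivative b') (at (x $ i))"
  shows "((\<lambda>x. b (x $ i)) has_derivative (\<lambda>h. b' * h $ i)) (at x)"
proof -
  have "((\<lambda>x. x $ i) has_derivative (\<lambda>h. h $ i)) (at x)"
    by (rule bounded_linear_imp_has_derivative[OF bounded_linear_vec_nth])
  from has_derivative_compose[OF this, of b "\<lambda>h. b' * h"] assms
  show ?thesis by (simp add: has_field_derivative_def)
qed

lemma C_k_coord: "Ck1 k b \<Longrightarrow> C_k k (\<lambda>x::real^'d::finite. b (x $ i))"
proof (induction k arbitrary: b)
  case 0 then show ?case
    by (auto intro!: continuous_on_compose2[where t=UNIV and g=b] continuous_intros)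
next
  case (Suc k)
  then obtain b' where b': "\<And>x. (b has_real_derivative b' x) (at x)" "Ck1 k b'" by auto
  have "partial_deriv j (\<lambda>x::real^'d. b (x $ i)) = (\<lambda>x. (\<lambda>_. if i = j then 1 else 0) x * b' (x $ i))" for j
    by (rule ext, subst partial_deriv_eq[OF has_derivative_coord[OF b'(1)]]) (auto simp: axis_def)
  moreover have "C_k k (\<lambda>x::real^'d. (\<lambda>_. if i = j then 1 else 0) x * b' (x $ i))" for j
    by (rule C_k_mult) (auto intro: C_k_const Suc.IH b')
  ultimately show ?case using has_derivative_coord[OF b'(1)]
    by (simp add: differentiable_on_def differentiable_def) blast
qed

lemma has_derivative_affine_arg:
  fixes f :: "real^'d::finite \<Rightarrow> real"
  assumes "f differentiable_on UNIV"
  shows "((\<lambda>x. f (c *\<^sub>R x + a)) has_derivative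
           (\<lambda>h. frechet_derivative f (at (c *\<^sub>R x + a)) (c *\<^sub>R h))) (at x)"
proof -
  have "((\<lambda>x. c *\<^sub>R x + a) has_derivative (\<lambda>h. c *\<^sub>R h)) (at x)"
    by (auto intro!: derivative_eq_intros)
  from has_derivative_compose[OF this differentiable_UNIV_has_derivative[OF assms]]
  show ?thesis .
qed

lemma partial_deriv_affine_arg:
  fixes f :: "real^'d::finite \<Rightarrow> real"
  assumes "f differentiable_on UNIV"
  shows "partial_deriv j (\<lambda>x. f (c *\<^sub>R x + a)) = (\<lambda>x. c * partial_deriv j f (c *\<^sub>R x + a))"
proof
  fix x
  interpret l: linear "frechet_derivative f (at (c *\<^sub>R x + a))"
    using differentiable_UNIV_has_derivative[OF assms] has_derivative_linear by blast
  show "partial_deriv j (\<lambda>x. f (c *\<^sub>R x + a)) x = c * partial_deriv j f (c *\<^sub>R x + a)"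
    by (subst partial_deriv_eq[OF has_derivative_affine_arg[OF assms]])
      (simp add: partial_deriv_def l.scale)
qed

lemma C_k_affine_arg: "C_k k f \<Longrightarrow> C_k k (\<lambda>x::real^'d::finite. f (c *\<^sub>R x + a))"
proof (induction k arbitrary: f)
  case 0 then show ?case
    by (auto intro!: continuous_on_compose2[where t=UNIV and g=f] continuous_intros)
next
  case (Suc k)
  then show ?case
    using has_derivative_affine_arg[of f c a]
    by (auto simp: partial_deriv_affine_arg intro!: C_k_cmult)
      (auto simp: differentiable_on_def differentiable_def)
qed

definition smooth :: "(real ^ 'd::finite \<Rightarrow> real) \<Rightarrow> bool" where
  "smooth f \<longleftrightarrow> (\<forall>k. C_k k f)"

lemma smooth_const: "smooth (\<lambda>_::real^'d::finite. c)" by (simp add: smooth_def C_k_const)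
lemma smooth_add: "smooth f \<Longrightarrow> smooth g \<Longrightarrow> smooth (\<lambda>x. f x + g x)" by (simp add: smooth_def C_k_add)
lemma smooth_mult: "smooth f \<Longrightarrow> smooth g \<Longrightarrow> smooth (\<lambda>x. f x * g x)" by (simp add: smooth_def C_k_mult)
lemma smooth_affine_arg: "smooth f \<Longrightarrow> smooth (\<lambda>x. f (c *\<^sub>R x + a))" by (simp add: smooth_def C_k_affine_arg)
lemma smooth_coord: "smooth (\<lambda>x::real^'d::finite. x $ i)"
  unfolding smooth_def using C_k_coord[OF Ck1_affine[of _ 1 0], where i=i] by simp

lemma smooth_differentiable: "smooth f \<Longrightarrow> f differentiable_on UNIV"
  unfolding smooth_def using C_k.simps(2) by blast

lemma smooth_partial_deriv: "smooth f \<Longrightarrow> smooth (partial_deriv j f)"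
  unfolding smooth_def using C_k.simps(2) by blast

lemma smooth_continuous: "smooth f \<Longrightarrow> continuous_on S f"
  unfolding smooth_def using C_k.simps(1) continuous_on_subset by blast

lemma smooth_has_derivative:
  fixes f :: "real^'d::finite \<Rightarrow> real"
  assumes "smooth f"
  shows "(f has_derivative (\<lambda>h. \<Sum>j\<in>UNIV. h $ j * partial_deriv j f x)) (at x)"
proof -
  let ?D = "frechet_derivative f (at x)"
  have D: "(f has_derivative ?D) (at x)"
    by (rule differentiable_UNIV_has_derivative[OF smooth_differentiable[OF assms]])
  interpret l: linear ?D by (rule has_derivative_linear[OF D])
  have "?D h = (\<Sum>j\<in>UNIV. h $ j * partial_deriv j f x)" for h
  proof -
    have "?D h = ?D (\<Sum>j\<in>UNIV. h $ j *\<^sub>R axis j 1)"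
      by (metis basis_expansion scalar_mult_eq_scaleR)
    also have "\<dots> = (\<Sum>j\<in>UNIV. h $ j * partial_deriv j f x)"
      by (simp add: l.sum l.scale partial_deriv_def)
    finally show ?thesis .
  qed
  then have "?D = (\<lambda>h. \<Sum>j\<in>UNIV. h $ j * partial_deriv j f x)" by auto
  with D show ?thesis by simp
qed

subsection \<open>Test functions\<close>

lemma test_function_smooth: "test_function D \<psi> \<Longrightarrow> smooth \<psi>"
  by (simp add: test_function_def smooth_def)

lemma test_function_mono: "test_function D \<psi> \<Longrightarrow> D \<subseteq> E \<Longrightarrow> test_function E \<psi>"
  by (auto simp: test_function_def)

text \<open>Any compact set off which the function vanishes contains the closure in
  \<open>test_function\<close> and can replace it.\<close>

lemma test_functionI:
  assumes "smooth \<psi>" "compact K" "K \<subseteq> D" "\<And>x. x \<notin> K \<Longrightarrow> \<psi> x = 0"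
  shows "test_function D \<psi>"
proof -
  have "closure {x. \<psi> x \<noteq> 0} \<subseteq> K"
    using assms by (intro closure_minimal compact_imp_closed) auto
  moreover then have "compact (closure {x. \<psi> x \<noteq> 0})"
    using assms(2) by (meson bounded_subset closed_closure compact_eq_bounded_closed)
  ultimately show ?thesis using assms by (auto simp: test_function_def smooth_def)
qed

lemma test_functionE:
  assumes "test_function D \<psi>"
  obtains K where "compact K" "K \<subseteq> D" "\<And>x. x \<notin> K \<Longrightarrow> \<psi> x = 0" "\<And>j x. x \<notin> K \<Longrightarrow> partial_deriv j \<psi> x = 0"
proof -
  let ?K = "closure {x. \<psi> x \<noteq> 0}"
  have 1: "\<psi> x = 0" if "x \<notin> ?K" for x using that closure_subset[of "{x. \<psi> x \<noteq> 0}"] by auto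
  have "partial_deriv j \<psi> x = 0" if "x \<notin> ?K" for j x
  proof -
    have "(\<psi> has_derivative (\<lambda>_. 0)) (at x)"
      by (rule has_derivative_transform_within_open[OF has_derivative_const, where s="-?K"])
        (simp_all only: open_Compl closed_closure Compl_iff that 1 not_False_eq_True)
    then show ?thesis by (rule partial_deriv_eq)
  qed
  moreover have "compact ?K" "?K \<subseteq> D" using assms by (simp_all add: test_function_def)
  ultimately show thesis using 1 by (intro that[of ?K])
qed

lemma test_function_mult:
  assumes "test_function D \<psi>" "smooth \<eta>"
  shows "test_function D (\<lambda>x. \<eta> x * \<psi> x)"
  using assms(1)
proof (rule test_functionE)
  fix K assume "compact K" "K \<subseteq> D" "\<And>x. x \<notin> K \<Longrightarrow> \<psi> x = 0"
  then show ?thesis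
    using assms test_function_smooth by (intro test_functionI[of _ K]) (auto intro!: smooth_mult)
qed

lemma test_function_partial_deriv:
  assumes "test_function D \<psi>"
  shows "test_function D (partial_deriv j \<psi>)"
  using assms
proof (rule test_functionE)
  fix K assume "compact K" "K \<subseteq> D" "\<And>j x. x \<notin> K \<Longrightarrow> partial_deriv j \<psi> x = 0"
  then show ?thesis
    using assms test_function_smooth by (intro test_functionI[of _ K]) (auto intro!: smooth_partial_deriv)
qed

lemma test_function_affine_arg:
  assumes "test_function D \<psi>" "c \<noteq> 0" "\<And>x. c *\<^sub>R x + a \<in> D \<Longrightarrow> x \<in> E"
  shows "test_function E (\<lambda>x. \<psi> (c *\<^sub>R x + a))"
  using assms(1)
proof (rule test_functionE)
  fix K assume K: "compact K" "K \<subseteq> D" "\<And>x. x \<notin> K \<Longrightarrow> \<psi> x = 0"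
  let ?f = "\<lambda>y. (1 / c) *\<^sub>R (y - a)"
  have "compact (?f ` K)" by (intro compact_continuous_image continuous_intros K)
  moreover have "?f ` K \<subseteq> E" using K assms(2) by (force intro: assms(3))
  moreover have "\<psi> (c *\<^sub>R x + a) = 0" if "x \<notin> ?f ` K" for x
  proof (rule K(3), rule)
    assume "c *\<^sub>R x + a \<in> K"
    then have "?f (c *\<^sub>R x + a) \<in> ?f ` K" by blast
    with that assms(2) show False by simp
  qed
  ultimately show ?thesis
    using assms test_function_smooth by (intro test_functionI[of _ "?f ` K"]) (auto intro!: smooth_affine_arg)
qed

section \<open>Cutoff functions of boxes\<close>

text \<open>Each coordinate contributes a rising and a falling step. The shift by \<open>- 1\<close>
  delays both by \<open>r\<close>: the function vanishes up to depth \<open>r\<close> below the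
  faces, which gives compact support in the open box, and equals 1 from depth \<open>2 * r\<close>
  on.\<close>

definition cutoff :: "real ^ 'd::finite \<Rightarrow> real ^ 'd \<Rightarrow> real \<Rightarrow> real ^ 'd \<Rightarrow> real" where
  "cutoff a b r x = (\<Prod>i\<in>UNIV. sstep ((x $ i - a $ i) / r - 1) * sstep ((b $ i - x $ i) / r - 1))"

lemma cutoff_smooth: "smooth (cutoff a b r)"
proof -
  have "Ck1 k (\<lambda>t. sstep ((t - c) / r - 1) * sstep ((e - t) / r - 1))" for k c e
  proof (rule Ck1_mult)
    have "Ck1 k (\<lambda>t. sstep ((1/r) * t + (- c / r - 1)))"
      by (rule Ck1_compose[OF Ck1_sstep Ck1_affine])
    moreover have "(1/r) * t + (- c / r - 1) = (t - c) / r - 1" for t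
      by (simp add: diff_divide_distrib)
    ultimately show "Ck1 k (\<lambda>t. sstep ((t - c) / r - 1))" by (simp only:)
    have "Ck1 k (\<lambda>t. sstep ((-1/r) * t + (e / r - 1)))"
      by (rule Ck1_compose[OF Ck1_sstep Ck1_affine])
    moreover have "(-1/r) * t + (e / r - 1) = (e - t) / r - 1" for t
      by (simp add: diff_divide_distrib)
    ultimately show "Ck1 k (\<lambda>t. sstep ((e - t) / r - 1))" by (simp only:)
  qed
  then have "C_k k (\<lambda>x::real^'a. (\<lambda>t. sstep ((t - c) / r - 1) * sstep ((e - t) / r - 1)) (x $ i))" for k c e i
    by (rule C_k_coord)
  then have "C_k k (cutoff a b r)" for k
    unfolding cutoff_def[abs_def] by (intro C_k_prod)
  then show ?thesis unfolding smooth_def by blast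
qed

lemma sstep_mult_bounds: "0 \<le> sstep s * sstep t" "sstep s * sstep t \<le> 1"
  by (rule mult_nonneg_nonneg[OF sstep_nonneg sstep_nonneg])
    (rule mult_le_one[OF sstep_le_1 sstep_nonneg sstep_le_1])

lemma cutoff_bounds: "0 \<le> cutoff a b r x" "cutoff a b r x \<le> 1"
  unfolding cutoff_def
  by (rule prod_nonneg, rule sstep_mult_bounds) (rule prod_le_1, simp only: sstep_mult_bounds simp_thms)

lemma cutoff_eq_1:
  assumes "r > 0" "\<And>i. a $ i + 2 * r \<le> x $ i" "\<And>i. x $ i \<le> b $ i - 2 * r"
  shows "cutoff a b r x = 1"
proof -
  have "(x $ i - a $ i) / r - 1 \<ge> 1" "(b $ i - x $ i) / r - 1 \<ge> 1" for i
    using assms(2,3)[of i] assms(1) by (auto simp: field_simps)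
  then show ?thesis by (simp add: cutoff_def sstep_1)
qed

lemma cutoff_eq_0:
  assumes "r > 0" "x $ i \<le> a $ i + r \<or> x $ i \<ge> b $ i - r"
  shows "cutoff a b r x = 0"
proof -
  have "(x $ i - a $ i) / r - 1 \<le> 0 \<or> (b $ i - x $ i) / r - 1 \<le> 0"
    using assms by (auto simp: field_simps)
  then have "sstep ((x $ i - a $ i) / r - 1) * sstep ((b $ i - x $ i) / r - 1) = 0"
    by (auto simp: sstep_0)
  then show ?thesis unfolding cutoff_def by (intro prod_zero) auto
qed

lemma cutoff_test_function:
  assumes "r > 0" shows "test_function (box a b) (cutoff a b r)"
proof (rule test_functionI[OF cutoff_smooth, of "cbox (a + vec r) (b - vec r)"])
  show "cbox (a + vec r) (b - vec r) \<subseteq> box a b"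
    using assms by (auto simp: mem_box_cart) (smt (verit))+
  show "cutoff a b r x = 0" if "x \<notin> cbox (a + vec r) (b - vec r)" for x
  proof -
    from that have "\<not> (\<forall>i. a $ i + r \<le> x $ i \<and> x $ i \<le> b $ i - r)"
      by (simp add: mem_box_cart)
    then obtain i where "x $ i < a $ i + r \<or> b $ i - r < x $ i"
      using not_le by blast
    then show ?thesis using cutoff_eq_0[OF assms, of x i a b] by linarith
  qed
qed (rule compact_cbox)

text \<open>One derivative of \<open>sstep\<close> is fixed globally, so that its bound becomes a
  number that depends neither on the box nor on the layer width.\<close>

definition sstep' :: "real \<Rightarrow> real" where "sstep' = (SOME s'. \<exists>L. (\<forall>t. (sstep has_real_derivative s' t) (at t)) \<and>
    (\<forall>t. \<bar>s' t\<bar> \<le> L) \<and> (\<forall>t. t \<le> 0 \<or> t \<ge> 1 \<longrightarrow> s' t = 0))"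

text \<open>The factor 2 pays for the two terms of the product rule, one for the rising and one for
  the falling step.\<close>

definition cutL :: real where "cutL = 2 * (SUP t. \<bar>sstep' t\<bar>)"

lemma sstep':
  "(sstep has_real_derivative sstep' t) (at t)"
  "t \<le> 0 \<or> t \<ge> 1 \<Longrightarrow> sstep' t = 0"
  "2 * \<bar>sstep' t\<bar> \<le> cutL"
proof -
  obtain s' L where "\<And>t. (sstep has_real_derivative s' t) (at t)"
    "\<And>t. \<bar>s' t\<bar> \<le> L" "\<And>t. t \<le> 0 \<or> t \<ge> 1 \<Longrightarrow> s' t = 0" using sstep_deriv by metis
  then have "\<exists>s' L. (\<forall>t. (sstep has_real_derivative s' t) (at t)) \<and>
    (\<forall>t. \<bar>s' t\<bar> \<le> L) \<and> (\<forall>t. t \<le> 0 \<or> t \<ge> 1 \<longrightarrow> s' t = 0)" by blast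
  from someI_ex[OF this] obtain L where *: "(\<forall>t. (sstep has_real_derivative sstep' t) (at t))"
    "(\<forall>t. \<bar>sstep' t\<bar> \<le> L)" "(\<forall>t. t \<le> 0 \<or> t \<ge> 1 \<longrightarrow> sstep' t = 0)"
    unfolding sstep'_def by blast
  then show "(sstep has_real_derivative sstep' t) (at t)"
  "t \<le> 0 \<or> t \<ge> 1 \<Longrightarrow> sstep' t = 0" by auto
  have "\<bar>sstep' t\<bar> \<le> (SUP t. \<bar>sstep' t\<bar>)"
    by (rule cSUP_upper) (use *(2) in \<open>auto intro!: bdd_aboveI[of _ L]\<close>)
  then show "2 * \<bar>sstep' t\<bar> \<le> cutL" by (simp add: cutL_def)
qed

lemma cutL_nonneg: "0 \<le> cutL" using sstep'(3)[of 0] by linarith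

text \<open>Along the line through \<open>x\<close> in direction \<open>j\<close> only factor
  \<open>j\<close> varies, so the formula is a product rule in one variable.\<close>

lemma partial_deriv_cutoff:
  fixes x :: "real^'d::finite"
  assumes "r > 0"
  shows "partial_deriv j (cutoff a b r) x =
    (\<Prod>i\<in>UNIV - {j}. sstep ((x $ i - a $ i) / r - 1) * sstep ((b $ i - x $ i) / r - 1)) *
    (sstep' ((x $ j - a $ j) / r - 1) / r * sstep ((b $ j - x $ j) / r - 1)
     - sstep ((x $ j - a $ j) / r - 1) * sstep' ((b $ j - x $ j) / r - 1) / r)" (is "_ = ?P x * ?d")
proof -
  have "((\<lambda>t. sstep ((t - a$j) / r - 1)) has_real_derivative sstep' ((x$j - a$j) / r - 1) * (1/r)) (at (x$j))"
    by (rule DERIV_chain2[OF sstep'(1)]) (use assms in \<open>auto intro!: derivative_eq_intros\<close>)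
  moreover have "((\<lambda>t. sstep ((b$j - t) / r - 1)) has_real_derivative sstep' ((b$j - x$j) / r - 1) * (-1/r)) (at (x$j))"
    by (rule DERIV_chain2[OF sstep'(1)]) (use assms in \<open>auto intro!: derivative_eq_intros\<close>)
  ultimately have 1: "((\<lambda>t. sstep ((t - a$j) / r - 1) * sstep ((b$j - t) / r - 1)) has_real_derivative ?d) (at (x$j))"
  proof (rule DERIV_cong[OF DERIV_mult])
    show "sstep' ((x $ j - a $ j) / r - 1) * (1 / r) * sstep ((b $ j - x $ j) / r - 1) +
        sstep' ((b $ j - x $ j) / r - 1) * (- 1 / r) * sstep ((x $ j - a $ j) / r - 1) = ?d"
      by (simp add: algebra_simps)
  qed
  have D: "(cutoff a b r has_derivative (\<lambda>h. frechet_derivative (cutoff a b r) (at x) h)) (at x)"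
    by (rule differentiable_UNIV_has_derivative[OF smooth_differentiable[OF cutoff_smooth]])
  have l: "((\<lambda>t. x + t *\<^sub>R axis j 1) has_derivative (\<lambda>t. t *\<^sub>R axis j 1)) (at 0)"
    by (auto intro!: derivative_eq_intros)
  have D': "(cutoff a b r has_derivative (\<lambda>h. frechet_derivative (cutoff a b r) (at x) h)) (at (x + 0 *\<^sub>R axis j 1))"
    using D by simp
  have A: "((\<lambda>t. cutoff a b r (x + t *\<^sub>R axis j 1)) has_derivative
     (\<lambda>t. frechet_derivative (cutoff a b r) (at x) (t *\<^sub>R axis j 1))) (at 0)"
    using has_derivative_compose[OF l D'] .
  have "cutoff a b r (x + t *\<^sub>R axis j 1) = ?P x *
     ((\<lambda>t. sstep ((t - a$j) / r - 1) * sstep ((b$j - t) / r - 1)) (x $ j + t))" for t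
    unfolding cutoff_def
    by (subst prod.remove[of UNIV j]) (auto simp: axis_def intro!: prod.cong)
  then have B: "((\<lambda>t. cutoff a b r (x + t *\<^sub>R axis j 1)) has_real_derivative ?P x * ?d) (at 0)"
    using DERIV_cmult[OF DERIV_shift[THEN iffD1, of _ _ 0 "x$j"], of "\<lambda>t. sstep ((t - a$j) / r - 1) * sstep ((b$j - t) / r - 1)" ?d "?P x"] 1
    by (simp add: add.commute)
  from has_derivative_unique[OF A B[unfolded has_field_derivative_def]]
  have "frechet_derivative (cutoff a b r) (at x) (1 *\<^sub>R axis j 1) = ?P x * ?d * 1" by metis
  then show ?thesis by (simp add: partial_deriv_def)
qed

lemma partial_deriv_cutoff_bound:
  assumes "r > 0"
  shows "\<bar>partial_deriv j (cutoff a b r) x\<bar> \<le> cutL / r"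
proof -
  let ?P = "\<Prod>i\<in>UNIV - {j}. sstep ((x $ i - a $ i) / r - 1) * sstep ((b $ i - x $ i) / r - 1)"
  have P: "0 \<le> ?P" "?P \<le> 1"
    by (rule prod_nonneg, rule sstep_mult_bounds) (rule prod_le_1, simp only: sstep_mult_bounds simp_thms)
  have *: "\<bar>sstep' s\<bar> * sstep t \<le> cutL / 2" for s t
    using mult_left_mono[OF sstep_le_1[of t], of "\<bar>sstep' s\<bar>"] sstep'(3)[of s] by simp
  let ?s = "(x $ j - a $ j) / r - 1" and ?t = "(b $ j - x $ j) / r - 1"
  have "\<bar>sstep' ?s / r * sstep ?t - sstep ?s * sstep' ?t / r\<bar>
     \<le> \<bar>sstep' ?s / r * sstep ?t\<bar> + \<bar>sstep ?s * sstep' ?t / r\<bar>" by linarith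
  also have "\<dots> = (\<bar>sstep' ?s\<bar> * sstep ?t + \<bar>sstep' ?t\<bar> * sstep ?s) / r"
    using assms by (simp add: abs_mult sstep_nonneg add_divide_distrib)
  also have "\<dots> \<le> cutL / r"
    using *[of ?s ?t] *[of ?t ?s] assms by (intro divide_right_mono) auto
  finally have d: "\<bar>sstep' ?s / r * sstep ?t - sstep ?s * sstep' ?t / r\<bar> \<le> cutL / r" .
  show ?thesis unfolding partial_deriv_cutoff[OF assms] abs_mult
    using mult_mono[OF P(2) d] P(1) by simp
qed

lemma partial_deriv_cutoff_eq_0:
  assumes "r > 0" "a $ j + 2 * r \<le> x $ j \<and> x $ j \<le> b $ j - 2 * r \<or> x $ j \<le> a $ j + r \<or> x $ j \<ge> b $ j - r"
  shows "partial_deriv j (cutoff a b r) x = 0"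
proof -
  let ?s = "(x $ j - a $ j) / r - 1" and ?t = "(b $ j - x $ j) / r - 1"
  have "1 \<le> ?s \<and> 1 \<le> ?t \<or> ?s \<le> 0 \<or> ?t \<le> 0"
    using assms by (auto simp: field_simps)
  then show ?thesis unfolding partial_deriv_cutoff[OF assms(1)] by (auto simp: sstep' sstep_0)
qed

section \<open>Measurability of vector and matrix valued functions\<close>

lemma borel_measurable_vec_nth [measurable (raw)]:
  fixes f :: "'a \<Rightarrow> 'b::euclidean_space ^ 'n::finite"
  assumes "f \<in> borel_measurable M"
  shows "(\<lambda>x. f x $ i) \<in> borel_measurable M"
  by (rule measurable_compose[OF assms borel_measurable_continuous_onI])
    (intro continuous_intros)

lemma borel_measurable_vec_lambda:
  fixes f :: "'n::finite \<Rightarrow> 'a \<Rightarrow> 'b::euclidean_space"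
  assumes "\<And>i. f i \<in> borel_measurable M"
  shows "(\<lambda>x. \<chi> i. f i x) \<in> borel_measurable M"
proof -
  have e: "(\<lambda>x. \<chi> i. f i x) = (\<lambda>x. \<Sum>i\<in>UNIV. axis i (f i x))"
    by (auto simp: vec_eq_iff axis_def if_distrib cong: if_cong)
  have "linear (axis i :: 'b \<Rightarrow> 'b^'n)" for i
    by (rule linearI) (auto simp: axis_def vec_eq_iff)
  then have "continuous_on UNIV (axis i :: 'b \<Rightarrow> 'b^'n)" for i
    by (rule linear_continuous_on[OF linear_conv_bounded_linear[THEN iffD1]])
  from measurable_compose[OF assms borel_measurable_continuous_onI[OF this]]
  show ?thesis unfolding e by (intro borel_measurable_sum)
qed

text \<open>\<open>outer (u x) (grad \<eta> x)\<close> is the term that the product rule adds to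
  \<open>\<eta> x\<close> times the gradient of \<open>u\<close>.\<close>

definition outer :: "real ^ 'm::finite \<Rightarrow> real ^ 'd::finite \<Rightarrow> real ^ 'd ^ 'm" where
  "outer a v = (\<chi> i j. a $ i * v $ j)"

definition grad :: "(real ^ 'd::finite \<Rightarrow> real) \<Rightarrow> real ^ 'd \<Rightarrow> real ^ 'd" where
  "grad \<eta> x = (\<chi> j. partial_deriv j \<eta> x)"

lemma norm_outer: "norm (outer a v) = norm a * norm v"
proof -
  have "norm (outer a v $ i) = norm (a $ i) * norm v" for i
  proof -
    have "outer a v $ i = a $ i *\<^sub>R v" by (simp add: outer_def vec_eq_iff)
    then show ?thesis by simp
  qed
  then show ?thesis
    unfolding norm_vec_def[of "outer a v"] norm_vec_def[of a] by (simp add: L2_set_left_distrib)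
qed

lemma norm_grad_le:
  fixes \<eta> :: "real ^ 'd::finite \<Rightarrow> real"
  assumes "\<And>j. \<bar>partial_deriv j \<eta> x\<bar> \<le> B"
  shows "norm (grad \<eta> x) \<le> real CARD('d) * B"
proof -
  have "norm (grad \<eta> x) \<le> (\<Sum>j\<in>UNIV. \<bar>grad \<eta> x $ j\<bar>)" by (rule norm_le_l1_cart)
  also have "\<dots> \<le> (\<Sum>j\<in>(UNIV::'d set). B)" by (rule sum_mono) (simp add: grad_def assms)
  finally show ?thesis by simp
qed

section \<open>Weak gradients of locally bounded Borel functions\<close>

text \<open>Affine maps are unbounded on the whole space; boundedness on balls admits them and still
  suffices against compactly supported test functions.\<close>

definition bdd_local :: "('a::real_normed_vector \<Rightarrow> 'b::real_normed_vector) \<Rightarrow> bool" where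
  "bdd_local f \<longleftrightarrow> (\<forall>R. \<exists>B. \<forall>x. norm x \<le> R \<longrightarrow> norm (f x) \<le> B)"

lemma bdd_localI: "(\<And>x. norm (f x) \<le> B) \<Longrightarrow> bdd_local f"
  unfolding bdd_local_def by blast

lemma bdd_local_add: "bdd_local f \<Longrightarrow> bdd_local g \<Longrightarrow> bdd_local (\<lambda>x. f x + g x)"
  unfolding bdd_local_def by (meson norm_triangle_mono)

lemma bdd_local_dominated:
  assumes "bdd_local f" "bdd_local g" "\<And>x. norm (h x) \<le> norm (f x) * norm (g x)"
  shows "bdd_local h"
  unfolding bdd_local_def
proof
  fix R
  obtain A B where "\<And>x. norm x \<le> R \<Longrightarrow> norm (f x) \<le> A" "\<And>x. norm x \<le> R \<Longrightarrow> norm (g x) \<le> B"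
    using assms unfolding bdd_local_def by metis
  then have "norm (h x) \<le> A * B" if "norm x \<le> R" for x
    using mult_mono'[of "norm (f x)" A "norm (g x)" B] assms(3)[of x] that
    by (meson norm_ge_zero order_trans)
  then show "\<exists>B. \<forall>x. norm x \<le> R \<longrightarrow> norm (h x) \<le> B" by blast
qed

lemma bdd_local_const: "bdd_local (\<lambda>_. c)" by (rule bdd_localI[of _ "norm c"]) simp

lemma bdd_local_continuous:
  fixes f :: "'a::euclidean_space \<Rightarrow> 'b::real_normed_vector"
  assumes "continuous_on UNIV f" shows "bdd_local f"
  unfolding bdd_local_def
proof
  fix R
  have "compact (f ` cball 0 R)"
    by (intro compact_continuous_image continuous_on_subset[OF assms]) auto
  from compact_imp_bounded[OF this] obtain B where "\<forall>x\<in>f ` cball 0 R. norm x \<le> B"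
    unfolding bounded_iff ..
  then have "\<forall>x. norm x \<le> R \<longrightarrow> norm (f x) \<le> B" by auto
  then show "\<exists>B. \<forall>x. norm x \<le> R \<longrightarrow> norm (f x) \<le> B" ..
qed

lemma bdd_local_vec_nth: "bdd_local f \<Longrightarrow> bdd_local (\<lambda>x. f x $ i)"
  unfolding bdd_local_def by (meson order_trans Finite_Cartesian_Product.norm_nth_le)

lemma integrable_mult_test:
  fixes f :: "'a::euclidean_space \<Rightarrow> 'b::euclidean_space"
  assumes [measurable]: "f \<in> borel_measurable borel" and f: "bdd_local f"
    and \<psi>: "continuous_on UNIV \<psi>" and K: "compact K" "\<And>x. x \<notin> K \<Longrightarrow> \<psi> x = (0::real)"
  shows "integrable lborel (\<lambda>x. \<psi> x *\<^sub>R f x)"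
proof -
  have [measurable]: "\<psi> \<in> borel_measurable borel" by (rule borel_measurable_continuous_onI[OF \<psi>])
  obtain R where R: "\<And>x. x \<in> K \<Longrightarrow> norm x \<le> R"
    using compact_imp_bounded[OF K(1)] unfolding bounded_iff by blast
  have "bdd_local (\<lambda>x. \<psi> x *\<^sub>R f x)"
    by (rule bdd_local_dominated[OF bdd_local_continuous[OF \<psi>] f]) simp
  then obtain B where B: "\<And>x. norm x \<le> R \<Longrightarrow> norm (\<psi> x *\<^sub>R f x) \<le> B"
    unfolding bdd_local_def by metis
  show ?thesis
  proof (rule integrableI_bounded_set[where A = K and B = B])
    show "K \<in> sets lborel" using K by (simp add: borel_compact)
    show "emeasure lborel K < \<infinity>" by (rule emeasure_compact_finite[OF K(1)])
  qed (use K R B in auto)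
qed

lemma integrable_test:
  assumes "test_function D \<psi>" shows "integrable lborel \<psi>"
proof -
  obtain K where K: "compact K" "\<And>x. x \<notin> K \<Longrightarrow> \<psi> x = 0"
    using test_functionE[OF assms] by metis
  show ?thesis
    using integrable_mult_test[of "\<lambda>_. 1::real", OF _ bdd_local_const
       smooth_continuous[OF test_function_smooth[OF assms]] K] by simp
qed

text \<open>The representatives are everywhere defined, Borel and bounded on bounded sets, so that every
  integral against a test function of \<open>D\<close> exists over the whole space.\<close>

definition WG :: "(real^'d::finite) set \<Rightarrow> (real^'d \<Rightarrow> real^'m::finite) \<Rightarrow> (real^'d \<Rightarrow> real^'d^'m) \<Rightarrow> bool" where
  "WG D u G \<longleftrightarrow> u \<in> borel_measurable borel \<and> G \<in> borel_measurable borel \<and> bdd_local u \<and> bdd_local G \<and>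
    (\<forall>\<psi> i j. test_function D \<psi> \<longrightarrow>
       (LINT x|lborel. u x $ i * partial_deriv j \<psi> x) = - (LINT x|lborel. G x $ i $ j * \<psi> x))"

lemma WG_meas:
  assumes "WG D u G"
  shows "u \<in> borel_measurable borel" "G \<in> borel_measurable borel" "bdd_local u" "bdd_local G"
  using assms by (auto simp: WG_def)

lemma WG_weak: "WG D u G \<Longrightarrow> test_function D \<psi> \<Longrightarrow>
       (LINT x|lborel. u x $ i * partial_deriv j \<psi> x) = - (LINT x|lborel. G x $ i $ j * \<psi> x)"
  by (auto simp: WG_def)

lemma WG_integrable:
  assumes "WG D u G" "test_function UNIV \<psi>"
  shows "integrable lborel (\<lambda>x. u x $ i * \<psi> x)" "integrable lborel (\<lambda>x. G x $ i $ j * \<psi> x)"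
    "integrable lborel (\<lambda>x. u x $ i * partial_deriv k \<psi> x)"
proof -
  note [measurable] = WG_meas(1,2)[OF assms(1)]
  obtain K where K: "compact K" "\<And>x. x \<notin> K \<Longrightarrow> \<psi> x = 0" "\<And>j x. x \<notin> K \<Longrightarrow> partial_deriv j \<psi> x = 0"
    using test_functionE[OF assms(2)] by metis
  have c: "continuous_on UNIV \<psi>" "continuous_on UNIV (partial_deriv k \<psi>)"
    using test_function_smooth[OF assms(2)] by (auto intro: smooth_continuous smooth_partial_deriv)
  have u: "bdd_local (\<lambda>x. u x $ i)" and G: "bdd_local (\<lambda>x. G x $ i $ j)"
    using WG_meas(3,4)[OF assms(1)] by (auto intro!: bdd_local_vec_nth)
  show "integrable lborel (\<lambda>x. u x $ i * \<psi> x)"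
    using integrable_mult_test[OF _ u c(1) K(1,2)] by (simp add: mult.commute)
  show "integrable lborel (\<lambda>x. G x $ i $ j * \<psi> x)"
    using integrable_mult_test[OF _ G c(1) K(1,2)] by (simp add: mult.commute)
  show "integrable lborel (\<lambda>x. u x $ i * partial_deriv k \<psi> x)"
    using integrable_mult_test[OF _ u c(2) K(1,3)] by (simp add: mult.commute)
qed

lemma WG_integrable':
  assumes "WG D u G" "test_function E \<psi>"
  shows "integrable lborel (\<lambda>x. u x $ i * \<psi> x)" "integrable lborel (\<lambda>x. G x $ i $ j * \<psi> x)"
    "integrable lborel (\<lambda>x. u x $ i * partial_deriv k \<psi> x)"
  using WG_integrable[OF assms(1)] test_function_mono[OF assms(2), of UNIV] by auto

lemma WG_subset: "WG D u G \<Longrightarrow> E \<subseteq> D \<Longrightarrow> WG E u G"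
  unfolding WG_def by (blast intro: test_function_mono[of E])

lemma WG_zero: "WG D (\<lambda>_. 0) (\<lambda>_. 0)"
  by (auto simp: WG_def bdd_local_const)

lemma WG_add:
  assumes "WG D u G" "WG D v H" shows "WG D (\<lambda>x. u x + v x) (\<lambda>x. G x + H x)"
  unfolding WG_def
proof (intro conjI allI impI)
  note [measurable] = WG_meas(1,2)[OF assms(1)] WG_meas(1,2)[OF assms(2)]
  show "(\<lambda>x. u x + v x) \<in> borel_measurable borel" "(\<lambda>x. G x + H x) \<in> borel_measurable borel" by measurable
  show "bdd_local (\<lambda>x. u x + v x)" "bdd_local (\<lambda>x. G x + H x)"
    using assms by (auto intro: bdd_local_add WG_meas)
  fix \<psi> i j assume \<psi>: "test_function D \<psi>"
  note I = WG_integrable'[OF assms(1) \<psi>] WG_integrable'[OF assms(2) \<psi>]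
  show "(LINT x|lborel. (u x + v x) $ i * partial_deriv j \<psi> x) = - (LINT x|lborel. (G x + H x) $ i $ j * \<psi> x)"
    using WG_weak[OF assms(1) \<psi>, of i j] WG_weak[OF assms(2) \<psi>, of i j] I
    by (simp add: distrib_right)
qed

lemma WG_cmul:
  assumes "WG D u G" shows "WG D (\<lambda>x. c *\<^sub>R u x) (\<lambda>x. c *\<^sub>R G x)"
  unfolding WG_def
proof (intro conjI allI impI)
  note [measurable] = WG_meas(1,2)[OF assms(1)]
  show "(\<lambda>x. c *\<^sub>R u x) \<in> borel_measurable borel" "(\<lambda>x. c *\<^sub>R G x) \<in> borel_measurable borel" by measurable
  show "bdd_local (\<lambda>x. c *\<^sub>R u x)" "bdd_local (\<lambda>x. c *\<^sub>R G x)"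
    by (rule bdd_local_dominated[OF bdd_local_const[of c] WG_meas(3)[OF assms]], simp)
      (rule bdd_local_dominated[OF bdd_local_const[of c] WG_meas(4)[OF assms]], simp)
  fix \<psi> i j assume \<psi>: "test_function D \<psi>"
  show "(LINT x|lborel. (c *\<^sub>R u x) $ i * partial_deriv j \<psi> x) = - (LINT x|lborel. (c *\<^sub>R G x) $ i $ j * \<psi> x)"
    using WG_weak[OF assms(1) \<psi>, of i j] by (simp add: mult.assoc)
qed

lemma WG_diff:
  assumes "WG D u G" "WG D v H" shows "WG D (\<lambda>x. u x - v x) (\<lambda>x. G x - H x)"
  using WG_add[OF assms(1) WG_cmul[OF assms(2), of "-1"]] by simp

lemma WG_sum:
  assumes "\<And>z. z \<in> I \<Longrightarrow> WG D (u z) (G z)"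
  shows "WG D (\<lambda>x. \<Sum>z\<in>I. u z x) (\<lambda>x. \<Sum>z\<in>I. G z x)"
  using assms by (induction I rule: infinite_finite_induct) (auto intro: WG_zero WG_add)

lemma WG_cong_AE:
  assumes "WG D u G" "v \<in> borel_measurable borel" "H \<in> borel_measurable borel" "bdd_local v" "bdd_local H"
    "AE x in lborel. x \<in> D \<longrightarrow> u x = v x" "AE x in lborel. x \<in> D \<longrightarrow> G x = H x"
  shows "WG D v H"
  unfolding WG_def
proof (intro conjI allI impI assms)
  fix \<psi> i j assume \<psi>: "test_function D \<psi>"
  obtain K where K: "compact K" "K \<subseteq> D" "\<And>x. x \<notin> K \<Longrightarrow> \<psi> x = 0" "\<And>j x. x \<notin> K \<Longrightarrow> partial_deriv j \<psi> x = 0"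
    using test_functionE[OF \<psi>] by metis
  have [measurable]: "\<psi> \<in> borel_measurable borel" "partial_deriv j \<psi> \<in> borel_measurable borel"
    using test_function_smooth[OF \<psi>]
    by (auto intro!: borel_measurable_continuous_onI smooth_continuous smooth_partial_deriv)
  note [measurable] = WG_meas(1,2)[OF assms(1)] assms(2,3)
  have "(LINT x|lborel. v x $ i * partial_deriv j \<psi> x) = (LINT x|lborel. u x $ i * partial_deriv j \<psi> x)"
    by (rule integral_cong_AE) (use assms(6) K in \<open>auto elim!: eventually_mono\<close>)
  also have "\<dots> = - (LINT x|lborel. G x $ i $ j * \<psi> x)" by (rule WG_weak[OF assms(1) \<psi>])
  also have "(LINT x|lborel. G x $ i $ j * \<psi> x) = (LINT x|lborel. H x $ i $ j * \<psi> x)"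
    by (rule integral_cong_AE) (use assms(7) K in \<open>auto elim!: eventually_mono\<close>)
  finally show "(LINT x|lborel. v x $ i * partial_deriv j \<psi> x) = - (LINT x|lborel. H x $ i $ j * \<psi> x)" .
qed

lemma grad_measurable: "smooth \<eta> \<Longrightarrow> grad \<eta> \<in> borel_measurable borel"
  unfolding grad_def[abs_def]
  by (intro borel_measurable_vec_lambda borel_measurable_continuous_onI smooth_continuous smooth_partial_deriv)

lemma outer_measurable:
  assumes [measurable]: "f \<in> borel_measurable M" "g \<in> borel_measurable M"
  shows "(\<lambda>x. outer (f x) (g x)) \<in> borel_measurable M"
  unfolding outer_def by (intro borel_measurable_vec_lambda) measurable

text \<open>The weak identity of \<open>u\<close> is applied to \<open>\<eta> * \<psi>\<close>. Only
  these products have to be test functions of \<open>D\<close>, which allows \<open>E\<close> to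
  differ from \<open>D\<close>.\<close>

lemma WG_mult_gen:
  assumes "WG D u G" and \<eta>: "smooth \<eta>"
    and *: "\<And>\<psi>. test_function E \<psi> \<Longrightarrow> test_function D (\<lambda>x. \<eta> x * \<psi> x)"
  shows "WG E (\<lambda>x. \<eta> x *\<^sub>R u x) (\<lambda>x. \<eta> x *\<^sub>R G x + outer (u x) (grad \<eta> x))"
  unfolding WG_def
proof (intro conjI allI impI)
  have c: "continuous_on UNIV \<eta>" by (rule smooth_continuous[OF \<eta>])
  have c': "continuous_on UNIV (grad \<eta>)" unfolding grad_def[abs_def]
    by (intro continuous_on_vec_lambda smooth_continuous smooth_partial_deriv \<eta>)
  note [measurable] = WG_meas(1,2)[OF assms(1)] borel_measurable_continuous_onI[OF c] grad_measurable[OF \<eta>] outer_measurable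
  show "(\<lambda>x. \<eta> x *\<^sub>R u x) \<in> borel_measurable borel" by measurable
  show "(\<lambda>x. \<eta> x *\<^sub>R G x + outer (u x) (grad \<eta> x)) \<in> borel_measurable borel" by measurable
  show "bdd_local (\<lambda>x. \<eta> x *\<^sub>R u x)"
    by (rule bdd_local_dominated[OF bdd_local_continuous[OF c] WG_meas(3)[OF assms(1)]]) simp
  show "bdd_local (\<lambda>x. \<eta> x *\<^sub>R G x + outer (u x) (grad \<eta> x))"
    by (rule bdd_local_add) (rule bdd_local_dominated[OF bdd_local_continuous[OF c] WG_meas(4)[OF assms(1)]], simp,
      rule bdd_local_dominated[OF WG_meas(3)[OF assms(1)] bdd_local_continuous[OF c']], simp add: norm_outer)
  fix \<psi> i j assume \<psi>: "test_function E \<psi>"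
  have t: "test_function D (\<lambda>x. \<eta> x * \<psi> x)" by (rule *[OF \<psi>])
  have d: "partial_deriv j (\<lambda>x. \<eta> x * \<psi> x) = (\<lambda>x. \<eta> x * partial_deriv j \<psi> x + partial_deriv j \<eta> x * \<psi> x)"
    by (intro partial_deriv_mult smooth_differentiable \<eta> test_function_smooth[OF \<psi>])
  have "test_function E (\<lambda>x. partial_deriv j \<eta> x * \<psi> x)"
    by (intro test_function_mult[OF \<psi>] smooth_partial_deriv \<eta>)
  note I1 = WG_integrable'(1)[OF assms(1) this, of i]
  note I2 = WG_integrable'[OF assms(1) t, of i]
  have I3: "integrable lborel (\<lambda>x. u x $ i * (\<eta> x * partial_deriv j \<psi> x))"
    using Bochner_Integration.integrable_diff[OF I2(3)[of j] I1] unfolding d by (simp add: algebra_simps)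
  have "(LINT x|lborel. u x $ i * (\<eta> x * partial_deriv j \<psi> x)) + (LINT x|lborel. u x $ i * (partial_deriv j \<eta> x * \<psi> x))
     = (LINT x|lborel. u x $ i * partial_deriv j (\<lambda>x. \<eta> x * \<psi> x) x)"
    unfolding d using I1 I3 by (simp add: distrib_left)
  also have "\<dots> = - (LINT x|lborel. G x $ i $ j * (\<eta> x * \<psi> x))" by (rule WG_weak[OF assms(1) t])
  finally have e: "(LINT x|lborel. u x $ i * (\<eta> x * partial_deriv j \<psi> x)) =
     - ((LINT x|lborel. G x $ i $ j * (\<eta> x * \<psi> x)) + (LINT x|lborel. u x $ i * (partial_deriv j \<eta> x * \<psi> x)))"
    by simp
  also have "(LINT x|lborel. G x $ i $ j * (\<eta> x * \<psi> x)) + (LINT x|lborel. u x $ i * (partial_deriv j \<eta> x * \<psi> x))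
     = (LINT x|lborel. G x $ i $ j * (\<eta> x * \<psi> x) + u x $ i * (partial_deriv j \<eta> x * \<psi> x))"
    using I1 I2(2)[of j] by simp
  finally show "(LINT x|lborel. (\<eta> x *\<^sub>R u x) $ i * partial_deriv j \<psi> x) =
     - (LINT x|lborel. (\<eta> x *\<^sub>R G x + outer (u x) (grad \<eta> x)) $ i $ j * \<psi> x)"
    by (simp add: outer_def grad_def algebra_simps)
qed

text \<open>As \<open>\<eta>\<close> is supported in \<open>D\<close>, so is
  \<open>\<eta> * \<psi>\<close> for every test function \<open>\<psi>\<close>. The product is thus
  weakly differentiable on every \<open>E\<close>, in particular on the whole space; this is how
  local modifications become global functions.\<close>

lemma WG_mult_test:
  assumes "WG D u G" "test_function D \<eta>"
  shows "WG E (\<lambda>x. \<eta> x *\<^sub>R u x) (\<lambda>x. \<eta> x *\<^sub>R G x + outer (u x) (grad \<eta> x))"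
proof (rule WG_mult_gen[OF assms(1) test_function_smooth[OF assms(2)]])
  fix \<psi> :: "real^'a \<Rightarrow> real" assume "test_function E \<psi>"
  from test_function_mult[OF assms(2) test_function_smooth[OF this]]
  show "test_function D (\<lambda>x. \<eta> x * \<psi> x)" by (simp add: mult.commute)
qed

subsection \<open>Changes of variables\<close>

lemma integral_lborel_affine:
  fixes f :: "'a::euclidean_space \<Rightarrow> real"
  assumes [measurable]: "f \<in> borel_measurable borel" and c: "c \<noteq> 0"
  shows "(LINT x|lborel. f x) = \<bar>c\<bar> ^ DIM('a) * (LINT x|lborel. f (t + c *\<^sub>R x))"
  by (subst lborel_affine[OF c, of t])
    (simp add: integral_density integral_distr)

lemma nn_integral_lborel_affine:
  fixes f :: "'a::euclidean_space \<Rightarrow> ennreal"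
  assumes [measurable]: "f \<in> borel_measurable borel" and c: "c \<noteq> 0"
  shows "(\<integral>\<^sup>+x. f x \<partial>lborel) = ennreal (\<bar>c\<bar> ^ DIM('a)) * (\<integral>\<^sup>+x. f (t + c *\<^sub>R x) \<partial>lborel)"
  by (subst lborel_affine[OF c, of t])
    (simp add: nn_integral_density nn_integral_distr nn_integral_cmult)

lemma AE_lborel_affine:
  assumes P: "AE x in lborel. P x" and c: "c \<noteq> 0"
  shows "AE x in lborel. P (t + c *\<^sub>R (x::'a::euclidean_space))"
proof -
  obtain N where N: "{x. \<not> P x} \<subseteq> N" "emeasure lborel N = 0" "N \<in> sets lborel"
    using AE_E[OF P] by auto
  have [measurable]: "N \<in> sets borel" using N(3) by simp
  have "0 = (\<integral>\<^sup>+x. indicator N x \<partial>(lborel::'a measure))" using N by simp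
  also have "\<dots> = ennreal (\<bar>c\<bar> ^ DIM('a)) * (\<integral>\<^sup>+x. indicator N (t + c *\<^sub>R x) \<partial>(lborel::'a measure))"
    by (rule nn_integral_lborel_affine[OF _ c]) measurable
  finally have "(\<integral>\<^sup>+x. indicator N (t + c *\<^sub>R x) \<partial>(lborel::'a measure)) = 0"
    using c by (simp add: eq_commute[of 0])
  then have "AE x in lborel. indicator N (t + c *\<^sub>R x) = (0::ennreal)"
    by (subst (asm) nn_integral_0_iff_AE) auto
  then show ?thesis
    by eventually_elim (use N(1) in \<open>auto simp: indicator_def split: if_splits\<close>)
qed

text \<open>The inverse dilation is applied to the test function. Both sides of the weak identity
  acquire the same nonzero Jacobian factor, which cancels.\<close>

lemma WG_dilate:
  fixes u :: "real^'d::finite \<Rightarrow> real^'m::finite"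
  assumes "WG D u G" "c > 0"
  shows "WG {x. a + c *\<^sub>R x \<in> D} (\<lambda>x. u (a + c *\<^sub>R x)) (\<lambda>x. c *\<^sub>R G (a + c *\<^sub>R x))"
  unfolding WG_def
proof (intro conjI allI impI)
  note [measurable] = WG_meas(1,2)[OF assms(1)]
  show "(\<lambda>x. u (a + c *\<^sub>R x)) \<in> borel_measurable borel" "(\<lambda>x. c *\<^sub>R G (a + c *\<^sub>R x)) \<in> borel_measurable borel"
    by measurable
  have *: "bdd_local (\<lambda>x. f (a + c *\<^sub>R x))" if "bdd_local f" for f :: "real^'d \<Rightarrow> 'b::real_normed_vector"
    unfolding bdd_local_def
  proof
    fix R
    obtain B where B: "\<And>x. norm x \<le> norm a + c * R \<Longrightarrow> norm (f x) \<le> B" using \<open>bdd_local f\<close> unfolding bdd_local_def by metis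
    have "norm (f (a + c *\<^sub>R x)) \<le> B" if "norm x \<le> R" for x
    proof (rule B)
      have "c * norm x \<le> c * R" using that assms(2) by (intro mult_left_mono) auto
      moreover have "norm (c *\<^sub>R x) = c * norm x" using assms(2) by simp
      ultimately show "norm (a + c *\<^sub>R x) \<le> norm a + c * R"
        using norm_triangle_ineq[of a "c *\<^sub>R x"] by linarith
    qed
    then show "\<exists>B. \<forall>x. norm x \<le> R \<longrightarrow> norm (f (a + c *\<^sub>R x)) \<le> B" by blast
  qed
  show "bdd_local (\<lambda>x. u (a + c *\<^sub>R x))" by (rule *[OF WG_meas(3)[OF assms(1)]])
  show "bdd_local (\<lambda>x. c *\<^sub>R G (a + c *\<^sub>R x))"
    by (rule bdd_local_dominated[OF bdd_local_const[of c] *[OF WG_meas(4)[OF assms(1)]]]) simp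
  fix \<psi> i j assume \<psi>: "test_function {x. a + c *\<^sub>R x \<in> D} \<psi>"
  let ?\<psi> = "\<lambda>y. \<psi> ((1/c) *\<^sub>R y + (- (1/c) *\<^sub>R a))"
  have t: "test_function D ?\<psi>"
    by (rule test_function_affine_arg[OF \<psi>]) (use assms(2) in \<open>auto simp: algebra_simps\<close>)
  have s: "smooth \<psi>" by (rule test_function_smooth[OF \<psi>])
  have d: "partial_deriv j ?\<psi> = (\<lambda>x. (1/c) * partial_deriv j \<psi> ((1/c) *\<^sub>R x + (- (1/c) *\<^sub>R a)))"
    by (rule partial_deriv_affine_arg[OF smooth_differentiable[OF s]])
  have [measurable]: "\<psi> \<in> borel_measurable borel" "partial_deriv j \<psi> \<in> borel_measurable borel"
    using s by (auto intro!: borel_measurable_continuous_onI smooth_continuous smooth_partial_deriv)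
  have e: "(1/c) *\<^sub>R (a + c *\<^sub>R x) + (- (1/c) *\<^sub>R a) = x" for x
    using assms(2) by (simp add: algebra_simps)
  have "(LINT x|lborel. u x $ i * partial_deriv j ?\<psi> x) =
     \<bar>c\<bar> ^ DIM(real^'d) * (LINT x|lborel. u (a + c *\<^sub>R x) $ i * partial_deriv j ?\<psi> (a + c *\<^sub>R x))"
  proof (rule integral_lborel_affine)
    show "(\<lambda>x. u x $ i * partial_deriv j ?\<psi> x) \<in> borel_measurable borel"
      unfolding d by measurable
  qed (use assms(2) in simp)
  also have "\<dots> = \<bar>c\<bar> ^ DIM(real^'d) * ((1/c) * (LINT x|lborel. u (a + c *\<^sub>R x) $ i * partial_deriv j \<psi> x))"
    unfolding d e by (subst integral_mult_right_zero[symmetric]) (simp add: mult_ac)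
  finally have 1: "(LINT x|lborel. u x $ i * partial_deriv j ?\<psi> x) = \<dots>" .
  have "(LINT x|lborel. G x $ i $ j * ?\<psi> x) =
     \<bar>c\<bar> ^ DIM(real^'d) * (LINT x|lborel. G (a + c *\<^sub>R x) $ i $ j * ?\<psi> (a + c *\<^sub>R x))"
    by (rule integral_lborel_affine) (use assms(2) in auto)
  also have "\<dots> = \<bar>c\<bar> ^ DIM(real^'d) * ((1/c) * (LINT x|lborel. (c *\<^sub>R G (a + c *\<^sub>R x)) $ i $ j * \<psi> x))"
    unfolding e using assms(2) by (simp add: mult.assoc)
  finally have 2: "(LINT x|lborel. G x $ i $ j * ?\<psi> x) = \<dots>" .
  have "\<bar>c\<bar> ^ DIM(real^'d) * (1/c) \<noteq> 0" using assms(2) by simp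
  moreover have "\<bar>c\<bar> ^ DIM(real^'d) * (1/c) * (LINT x|lborel. u (a + c *\<^sub>R x) $ i * partial_deriv j \<psi> x)
    = \<bar>c\<bar> ^ DIM(real^'d) * (1/c) * (- (LINT x|lborel. (c *\<^sub>R G (a + c *\<^sub>R x)) $ i $ j * \<psi> x))"
    using WG_weak[OF assms(1) t, of i j] unfolding 1 2 by (simp only: mult.assoc mult_minus_right)
  ultimately show "(LINT x|lborel. u (a + c *\<^sub>R x) $ i * partial_deriv j \<psi> x) =
      - (LINT x|lborel. (c *\<^sub>R G (a + c *\<^sub>R x)) $ i $ j * \<psi> x)"
    using mult_left_cancel by blast
qed

lemma test_function_lipschitz:
  assumes "test_function D \<psi>"
  obtains B where "B \<ge> 0" "\<And>x y. \<bar>\<psi> x - \<psi> y\<bar> \<le> B * norm (x - y)"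
proof -
  obtain K where K: "compact K" "\<And>j x. x \<notin> K \<Longrightarrow> partial_deriv j \<psi> x = 0"
    using test_functionE[OF assms] by metis
  have s: "smooth \<psi>" by (rule test_function_smooth[OF assms])
  have "\<exists>B. \<forall>x. \<bar>partial_deriv j \<psi> x\<bar> \<le> B" for j
  proof -
    have "compact (partial_deriv j \<psi> ` K)"
      by (intro compact_continuous_image K smooth_continuous smooth_partial_deriv s)
    from compact_imp_bounded[OF this] obtain B where B: "\<forall>x\<in>partial_deriv j \<psi> ` K. norm x \<le> B"
      unfolding bounded_iff ..
    have "\<bar>partial_deriv j \<psi> x\<bar> \<le> max B 0" for x
      using B K(2)[of x j] by (cases "x \<in> K") auto
    then show ?thesis by blast
  qed
  then obtain B where B: "\<And>j x. \<bar>partial_deriv j \<psi> x\<bar> \<le> B j" by metis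
  have *: "norm (\<psi> x - \<psi> y) \<le> (\<Sum>j\<in>UNIV. B j) * norm (x - y)" for x y
  proof (rule differentiable_bound[where S = UNIV and f' = "\<lambda>x h. \<Sum>j\<in>UNIV. h $ j * partial_deriv j \<psi> x"])
    show "(\<psi> has_derivative (\<lambda>h. \<Sum>j\<in>UNIV. h $ j * partial_deriv j \<psi> x)) (at x within UNIV)" for x
      using smooth_has_derivative[OF s] by simp
    show "onorm (\<lambda>h. \<Sum>j\<in>UNIV. h $ j * partial_deriv j \<psi> x) \<le> (\<Sum>j\<in>UNIV. B j)" for x
    proof (rule onorm_le)
      fix h
      have "norm (\<Sum>j\<in>UNIV. h $ j * partial_deriv j \<psi> x) \<le> (\<Sum>j\<in>UNIV. norm h * B j)"
        by (rule sum_norm_le) (auto simp: abs_mult intro!: mult_mono component_le_norm_cart B)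
      then show "norm (\<Sum>j\<in>UNIV. h $ j * partial_deriv j \<psi> x) \<le> (\<Sum>j\<in>UNIV. B j) * norm h"
        by (simp add: sum_distrib_right[symmetric] mult.commute)
    qed
  qed auto
  moreover have "(\<Sum>j\<in>UNIV. B j) \<ge> 0"
    using B by (intro sum_nonneg) (meson abs_ge_zero order_trans)
  ultimately show thesis using that[of "\<Sum>j\<in>UNIV. B j"] by simp
qed

text \<open>Integrals of difference quotients vanish by translation invariance.\<close>

lemma integral_partial_deriv_eq_0:
  fixes \<psi> :: "real^'d::finite \<Rightarrow> real"
  assumes "test_function UNIV \<psi>"
  shows "(LINT x|lborel. partial_deriv j \<psi> x) = 0"
proof -
  obtain K where K: "compact K" "\<And>x. x \<notin> K \<Longrightarrow> \<psi> x = 0"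
    using test_functionE[OF assms] by metis
  obtain R where R: "\<And>x. x \<in> K \<Longrightarrow> norm x \<le> R"
    using compact_imp_bounded[OF K(1)] unfolding bounded_iff by blast
  have s: "smooth \<psi>" by (rule test_function_smooth[OF assms])
  note [measurable] = borel_measurable_continuous_onI[OF smooth_continuous[OF s]]
    borel_measurable_continuous_onI[OF smooth_continuous[OF smooth_partial_deriv[OF s]]]
  obtain B where B: "B \<ge> 0" "\<And>x y. \<bar>\<psi> x - \<psi> y\<bar> \<le> B * norm (x - y)"
    using test_function_lipschitz[OF assms] by metis
  define h where "h n = inverse (real (Suc n))" for n
  have h: "h n > 0" "h n \<le> 1" for n by (auto simp: h_def field_simps)
  have hl: "h \<longlonglongrightarrow> 0" unfolding h_def by (rule LIMSEQ_inverse_real_of_nat)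
  define q where "q n x = (\<psi> (x + h n *\<^sub>R axis j 1) - \<psi> x) / h n" for n x
  have I: "integrable lborel \<psi>" by (rule integrable_test[OF assms])
  have 0: "(LINT x|lborel. q n x) = 0" for n
  proof -
    have "(LINT x|lborel. \<psi> x) = (LINT x|lborel. \<psi> (h n *\<^sub>R axis j 1 + x))"
      using integral_lborel_affine[of \<psi> 1 "h n *\<^sub>R axis j 1"] by simp
    moreover have "integrable lborel (\<lambda>x. \<psi> (1 *\<^sub>R x + h n *\<^sub>R axis j 1))"
      by (rule integrable_test, rule test_function_affine_arg[OF assms, where E = UNIV]) auto
    ultimately show ?thesis unfolding q_def using I by (simp add: add.commute)
  qed
  have "(\<lambda>n. LINT x|lborel. q n x) \<longlonglongrightarrow> (LINT x|lborel. partial_deriv j \<psi> x)"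
  proof (rule integral_dominated_convergence[where w = "\<lambda>x. B * indicator (cball 0 (R + 1)) x"])
    show "q n \<in> borel_measurable lborel" for n unfolding q_def by measurable
    show "integrable lborel (\<lambda>x. B * indicator (cball 0 (R + 1)) x :: real)"
      by (intro integrable_mult_right integrable_real_indicator) (simp_all add: emeasure_compact_finite[OF compact_cball, unfolded infinity_ennreal_def])
    show "AE x in lborel. (\<lambda>n. q n x) \<longlonglongrightarrow> partial_deriv j \<psi> x"
    proof (rule AE_I2)
      fix x :: "real^'d"
      have l: "((\<lambda>t. x + t *\<^sub>R axis j 1) has_derivative (\<lambda>t. t *\<^sub>R axis j 1)) (at 0)"
        by (auto intro!: derivative_eq_intros)
      have "(\<psi> has_derivative (\<lambda>v. \<Sum>k\<in>UNIV. v $ k * partial_deriv k \<psi> x)) (at (x + 0 *\<^sub>R axis j 1))"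
        using smooth_has_derivative[OF s] by simp
      from has_derivative_compose[OF l this]
      have "((\<lambda>t. \<psi> (x + t *\<^sub>R axis j 1)) has_derivative (\<lambda>t. \<Sum>k\<in>UNIV. (t *\<^sub>R axis j (1::real)) $ k * partial_deriv k \<psi> x)) (at 0)"
        by simp
      moreover have "(\<Sum>k\<in>UNIV. (t *\<^sub>R axis j (1::real)) $ k * partial_deriv k \<psi> x) = partial_deriv j \<psi> x * t" for t
        by (subst sum.remove[of UNIV j]) (auto simp: axis_def intro!: sum.neutral)
      ultimately have "((\<lambda>t. \<psi> (x + t *\<^sub>R axis j 1)) has_real_derivative partial_deriv j \<psi> x) (at 0)"
        by (simp add: has_field_derivative_def)
      then have "((\<lambda>t. (\<psi> (x + t *\<^sub>R axis j 1) - \<psi> x) / t) \<longlongrightarrow> partial_deriv j \<psi> x) (at 0)"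
        by (simp add: DERIV_def)
      moreover have "filterlim h (at 0) sequentially"
        using hl h(1) by (auto simp: filterlim_at intro!: always_eventually) (metis less_irrefl)
      ultimately show "(\<lambda>n. q n x) \<longlonglongrightarrow> partial_deriv j \<psi> x"
        unfolding q_def by (rule filterlim_compose)
    qed
    show "AE x in lborel. norm (q n x) \<le> B * indicator (cball 0 (R + 1)) x" for n
    proof (rule AE_I2)
      fix x
      show "norm (q n x) \<le> B * indicator (cball 0 (R + 1)) x"
      proof (cases "norm x \<le> R + 1")
        case True
        have "\<bar>q n x\<bar> \<le> B"
          using B(2)[of "x + h n *\<^sub>R axis j 1" x] h(1)[of n]
          by (simp add: q_def field_simps)
        then show ?thesis using True by simp
      next
        case False
        have "norm x \<le> norm (x + h n *\<^sub>R axis j 1) + norm (h n *\<^sub>R axis j 1 :: real^'d)"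
          using norm_triangle_ineq4[of "x + h n *\<^sub>R axis j 1" "h n *\<^sub>R axis j 1"] by simp
        then have "norm (x + h n *\<^sub>R axis j 1) > R" "norm x > R" using False h[of n] by auto
        then have "\<psi> (x + h n *\<^sub>R axis j 1) = 0" "\<psi> x = 0" using K(2) R not_less by blast+
        then show ?thesis using False by (simp add: q_def)
      qed
    qed
  qed measurable
  then show ?thesis using LIMSEQ_unique[OF tendsto_const[of 0]] unfolding 0 by metis
qed

lemma smooth_cmult: "smooth f \<Longrightarrow> smooth (\<lambda>x. c * f x)" by (intro smooth_mult smooth_const)

lemma smooth_sum: "(\<And>i. i \<in> I \<Longrightarrow> smooth (f i)) \<Longrightarrow> smooth (\<lambda>x::real^'d::finite. \<Sum>i\<in>I. f i x)"
  by (induction I rule: infinite_finite_induct) (auto intro: smooth_const smooth_add)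

text \<open>The partial derivative of an affine component times \<open>\<psi>\<close> has integral
  zero; expanding it by the product rule gives the weak identity.\<close>

lemma WG_affine: "WG D (\<lambda>x. A *v x + b) (\<lambda>_. A)"
  unfolding WG_def
proof (intro conjI allI impI)
  have c: "continuous_on UNIV (\<lambda>x. A *v x + b)"
    by (intro continuous_intros linear_continuous_on[OF matrix_vector_mul_bounded_linear])
  show "(\<lambda>x. A *v x + b) \<in> borel_measurable borel" by (rule borel_measurable_continuous_onI[OF c])
  show "bdd_local (\<lambda>x. A *v x + b)" by (rule bdd_local_continuous[OF c])
  show "bdd_local (\<lambda>_. A)" by (rule bdd_local_const)
  fix \<psi> i j assume "test_function D \<psi>"
  then have \<psi>: "test_function UNIV \<psi>" by (rule test_function_mono) simp
  let ?l = "\<lambda>x. (A *v x + b) $ i"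
  have s: "smooth ?l"
    unfolding matrix_vector_mult_def vector_add_component vec_lambda_beta
    by (intro smooth_add smooth_sum smooth_cmult smooth_const smooth_coord)
  have "partial_deriv j ?l x = A $ i $ j" for x
  proof -
    have "((\<lambda>x. (A *v x + b) $ i) has_derivative (\<lambda>h. (A *v h) $ i)) (at x)"
      by (intro bounded_linear.has_derivative[OF bounded_linear_vec_nth])
        (auto intro!: derivative_eq_intros bounded_linear.has_derivative[OF matrix_vector_mul_bounded_linear])
    then show ?thesis by (subst partial_deriv_eq, assumption) (simp add: matrix_vector_mult_basis column_def)
  qed
  then have d: "partial_deriv j (\<lambda>x. ?l x * \<psi> x) = (\<lambda>x. ?l x * partial_deriv j \<psi> x + A $ i $ j * \<psi> x)"
    unfolding partial_deriv_mult[OF smooth_differentiable[OF s] smooth_differentiable[OF test_function_smooth[OF \<psi>]]]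
    by simp
  obtain K where K: "compact K" "\<And>x. x \<notin> K \<Longrightarrow> \<psi> x = 0" "\<And>j x. x \<notin> K \<Longrightarrow> partial_deriv j \<psi> x = 0"
    using test_functionE[OF \<psi>] by metis
  have sp: "smooth \<psi>" by (rule test_function_smooth[OF \<psi>])
  have cl: "continuous_on UNIV ?l" by (rule smooth_continuous[OF s])
  have 1: "integrable lborel (\<lambda>x. ?l x * partial_deriv j \<psi> x)"
    using integrable_mult_test[OF borel_measurable_continuous_onI[OF cl] bdd_local_continuous[OF cl]
       smooth_continuous[OF smooth_partial_deriv[OF sp]] K(1) K(3)] by (simp add: mult.commute)
  have 2: "integrable lborel (\<lambda>x. A $ i $ j * \<psi> x)"
    using integrable_mult_test[of "\<lambda>_. A $ i $ j", OF _ bdd_local_const smooth_continuous[OF sp] K(1,2)]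
    by (simp add: mult.commute)
  have "0 = (LINT x|lborel. partial_deriv j (\<lambda>x. ?l x * \<psi> x) x)"
    by (rule integral_partial_deriv_eq_0[symmetric]) (rule test_function_mult[OF \<psi> s])
  also have "\<dots> = (LINT x|lborel. ?l x * partial_deriv j \<psi> x) + (LINT x|lborel. A $ i $ j * \<psi> x)"
    unfolding d using 1 2 by (rule Bochner_Integration.integral_add)
  finally show "(LINT x|lborel. (A *v x + b) $ i * partial_deriv j \<psi> x) = - (LINT x|lborel. A $ i $ j * \<psi> x)"
    by linarith
qed simp

section \<open>From Lebesgue to Borel measurable functions\<close>

lemma AE_lebesgue_on_iff:
  assumes "D \<in> sets lebesgue"
  shows "(AE x in lebesgue_on D. P x) \<longleftrightarrow> (AE x in lborel. x \<in> D \<longrightarrow> P x)"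
  using assms by (subst AE_restrict_space_iff) (auto simp: AE_completion_iff)

lemma lebesgue_ex_borel:
  fixes f :: "'a::euclidean_space \<Rightarrow> 'b::euclidean_space"
  assumes "f \<in> borel_measurable lebesgue"
  shows "\<exists>g\<in>borel_measurable borel. AE x in lborel. f x = g x"
proof -
  have "\<forall>b\<in>Basis. \<exists>g\<in>borel_measurable lborel. AE x in lborel. f x \<bullet> b = g x"
    using assms by (intro ballI completion_ex_borel_measurable_real) simp
  then obtain g where g: "\<And>b. b \<in> Basis \<Longrightarrow> g b \<in> borel_measurable lborel"
    "\<And>b. b \<in> Basis \<Longrightarrow> AE x in lborel. f x \<bullet> b = g b x" by metis
  have "(\<lambda>x. \<Sum>b\<in>Basis. g b x *\<^sub>R b) \<in> borel_measurable borel"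
    using g(1) by simp
  moreover have "AE x in lborel. \<forall>b\<in>Basis. f x \<bullet> b = g b x"
    using g(2) by (subst AE_ball_countable) (auto intro: countable_finite)
  then have "AE x in lborel. f x = (\<Sum>b\<in>Basis. g b x *\<^sub>R b)"
  proof eventually_elim
    case (elim x)
    have "f x = (\<Sum>b\<in>Basis. (f x \<bullet> b) *\<^sub>R b)" by (rule euclidean_representation[symmetric])
    also have "\<dots> = (\<Sum>b\<in>Basis. g b x *\<^sub>R b)" by (rule sum.cong) (use elim in auto)
    finally show ?case .
  qed
  ultimately show ?thesis by (rule bexI[of "\<lambda>g. AE x in lborel. f x = g x", rotated])
qed

text \<open>Where the Borel representative exceeds the essential bound it is replaced by 0, so that
  the bound holds everywhere.\<close>

lemma Linfty_borel:
  fixes f :: "'a::euclidean_space \<Rightarrow> 'b::euclidean_space"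
  assumes "D \<in> sets lebesgue" "f \<in> Linfty D"
  obtains g B where "g \<in> borel_measurable borel" "\<And>x. norm (g x) \<le> B" "AE x in lborel. x \<in> D \<longrightarrow> f x = g x"
proof -
  obtain B where f: "f \<in> borel_measurable (lebesgue_on D)" and B: "AE x in lborel. x \<in> D \<longrightarrow> norm (f x) \<le> B"
    using assms by (auto simp: Linfty_def AE_lebesgue_on_iff)
  have "(\<lambda>x. if x \<in> D then f x else 0) \<in> borel_measurable lebesgue"
    using f assms(1) by (simp add: borel_measurable_if)
  then obtain g where [measurable]: "g \<in> borel_measurable borel"
    and g: "AE x in lborel. (if x \<in> D then f x else 0) = g x"
    using lebesgue_ex_borel by blast
  have "(\<lambda>x. if norm (g x) \<le> B then g x else 0) \<in> borel_measurable borel" by measurable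
  moreover have "norm (if norm (g x) \<le> B then g x else 0) \<le> max B 0" for x by auto
  moreover have "AE x in lborel. x \<in> D \<longrightarrow> f x = (if norm (g x) \<le> B then g x else 0)"
    using g B by eventually_elim auto
  ultimately show thesis by (rule that)
qed

lemma integral_lebesgue_on_eq:
  fixes f g :: "'a::euclidean_space \<Rightarrow> 'b::euclidean_space"
  assumes "D \<in> sets lebesgue" "g \<in> borel_measurable borel" "AE x in lborel. x \<in> D \<longrightarrow> f x = g x"
    "\<And>x. x \<notin> D \<Longrightarrow> g x = 0"
  shows "(LINT x|lebesgue_on D. f x) = (LINT x|lborel. g x)"
proof -
  let ?h = "\<lambda>x. indicator D x *\<^sub>R f x"
  have ae: "AE x in lebesgue. g x = ?h x"
    unfolding AE_completion_iff using assms(3) by eventually_elim (use assms(4) in \<open>auto simp: indicator_def\<close>)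
  have g: "g \<in> borel_measurable lebesgue" using assms(2) by (simp add: measurable_completion)
  have h: "?h \<in> borel_measurable lebesgue" using borel_measurable_AE[OF g ae] .
  have "(LINT x|lebesgue_on D. f x) = (LINT x|lebesgue. ?h x)"
    using assms(1) by (intro integral_restrict_space) simp
  also have "\<dots> = (LINT x|lebesgue. g x)"
    using ae by (intro integral_cong_AE h g) (auto elim!: eventually_mono)
  also have "\<dots> = (LINT x|lborel. g x)" using assms(2) by (intro integral_completion) simp
  finally show ?thesis .
qed

lemma nn_integral_lebesgue_on_eq:
  fixes f g :: "'a::euclidean_space \<Rightarrow> ennreal"
  assumes "D \<in> sets borel" "g \<in> borel_measurable borel" "AE x in lborel. x \<in> D \<longrightarrow> f x = g x"
  shows "(\<integral>\<^sup>+x. f x \<partial>lebesgue_on D) = (\<integral>\<^sup>+x. g x * indicator D x \<partial>lborel)"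
proof -
  have "(\<integral>\<^sup>+x. f x \<partial>lebesgue_on D) = (\<integral>\<^sup>+x. f x * indicator D x \<partial>lebesgue)"
    using assms(1) by (intro nn_integral_restrict_space) auto
  also have "\<dots> = (\<integral>\<^sup>+x. g x * indicator D x \<partial>lebesgue)"
    using assms(3) by (intro nn_integral_cong_AE)
      (auto simp: AE_completion_iff indicator_def elim!: eventually_mono)
  also have "\<dots> = (\<integral>\<^sup>+x. g x * indicator D x \<partial>lborel)"
    by (rule nn_integral_completion)
  finally show ?thesis .
qed

subsection \<open>The fundamental lemma of the calculus of variations\<close>

lemma One_cart: "(\<Sum>Basis :: real^'d::finite) = vec 1"
proof (rule euclidean_eqI)
  fix b :: "real^'d" assume b: "b \<in> Basis"
  then obtain i where i: "b = axis i 1" by (auto simp: Basis_vec_def)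
  have "(\<Sum>Basis) \<bullet> b = (\<Sum>c\<in>Basis. c \<bullet> b)" by (rule inner_sum_left)
  also have "\<dots> = (\<Sum>c\<in>Basis. if c = b then 1 else 0)"
    by (rule sum.cong) (simp_all add: inner_Basis b)
  also have "\<dots> = 1" using b by simp
  also have "\<dots> = vec 1 \<bullet> b" by (simp add: i inner_axis)
  finally show "(\<Sum>Basis) \<bullet> b = vec 1 \<bullet> b" .
qed

lemma vec_1_scale: "h *\<^sub>R vec 1 = (vec h :: real^'d::finite)" by (simp add: vec_eq_iff)

lemma cutoff_tendsto:
  assumes "\<And>k. r k > 0" "r \<longlonglongrightarrow> 0"
  shows "(\<lambda>k. cutoff a b (r k) x) \<longlonglongrightarrow> indicator (box a b) x"
proof (cases "x \<in> box a b")
  case True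
  define e where "e = Min (range (\<lambda>i. min (x $ i - a $ i) (b $ i - x $ i)))"
  have "e > 0" using True unfolding e_def by (subst Min_gr_iff) (auto simp: mem_box_cart)
  have e: "e \<le> x $ i - a $ i" "e \<le> b $ i - x $ i" for i
  proof -
    have "e \<le> min (x $ i - a $ i) (b $ i - x $ i)" unfolding e_def by (rule Min_le) auto
    then show "e \<le> x $ i - a $ i" "e \<le> b $ i - x $ i" by auto
  qed
  have "eventually (\<lambda>k. r k < e / 2) sequentially"
    using assms(2) \<open>e > 0\<close> by (intro order_tendstoD) auto
  then have "eventually (\<lambda>k. cutoff a b (r k) x = indicator (box a b) x) sequentially"
  proof eventually_elim
    case (elim k)
    have "cutoff a b (r k) x = 1"
    proof (rule cutoff_eq_1[OF assms(1)])
      show "a $ i + 2 * r k \<le> x $ i" "x $ i \<le> b $ i - 2 * r k" for i using e[of i] elim by auto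
    qed
    then show ?case using True by simp
  qed
  then show ?thesis by (rule tendsto_eventually)
next
  case False
  then have "\<not> (\<forall>i. a $ i < x $ i \<and> x $ i < b $ i)" by (simp add: mem_box_cart)
  then obtain i where i: "x $ i \<le> a $ i \<or> b $ i \<le> x $ i" using not_le by blast
  have "cutoff a b (r k) x = 0" for k
    using i assms(1)[of k] by (intro cutoff_eq_0[where i = i]) auto
  then show ?thesis using False by simp
qed

lemma cutoff_le_indicator: "r > 0 \<Longrightarrow> cutoff a b r x \<le> indicator (box a b) x"
proof (cases "x \<in> box a b")
  case False
  assume "r > 0"
  obtain K where "K \<subseteq> box a b" "\<And>x. x \<notin> K \<Longrightarrow> cutoff a b r x = 0"
    using test_functionE[OF cutoff_test_function[OF \<open>r > 0\<close>]] by metis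
  moreover from this(1) False have "x \<notin> K" by blast
  ultimately have "cutoff a b r x = 0" by blast
  then show ?thesis by simp
qed (simp add: cutoff_bounds)

lemma cutoff_measurable [measurable]: "cutoff a b r \<in> borel_measurable borel"
  by (intro borel_measurable_continuous_onI smooth_continuous cutoff_smooth)

lemma cutoff_integral_tendsto:
  fixes F :: "real^'d::finite \<Rightarrow> 'b::euclidean_space"
  assumes "integrable lborel F" "\<And>k. r k > 0" "r \<longlonglongrightarrow> 0"
  shows "(\<lambda>k. LINT y|lborel. cutoff a b (r k) y *\<^sub>R F y) \<longlonglongrightarrow> (LINT y|lborel. indicator (box a b) y *\<^sub>R F y)"
proof (rule integral_dominated_convergence[where w = "\<lambda>y. norm (F y)"])
  have [measurable]: "F \<in> borel_measurable borel" using borel_measurable_integrable[OF assms(1)] by simp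
  show "(\<lambda>y. indicator (box a b) y *\<^sub>R F y) \<in> borel_measurable lborel"
    "(\<lambda>y. cutoff a b (r k) y *\<^sub>R F y) \<in> borel_measurable lborel" for k by measurable
  show "integrable lborel (\<lambda>y. norm (F y))" using assms(1) by simp
  show "AE y in lborel. (\<lambda>k. cutoff a b (r k) y *\<^sub>R F y) \<longlonglongrightarrow> indicator (box a b) y *\<^sub>R F y"
    by (intro AE_I2 tendsto_intros cutoff_tendsto assms)
  show "AE y in lborel. norm (cutoff a b (r k) y *\<^sub>R F y) \<le> norm (F y)" for k
    using cutoff_bounds[of a b "r k"] by (intro AE_I2) (auto intro!: mult_left_le_one_le)
qed

lemma inverse_Suc_seq: "inverse (real (Suc k)) > 0" "(\<lambda>k. inverse (real (Suc k))) \<longlonglongrightarrow> 0"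
  using LIMSEQ_inverse_real_of_nat by auto

lemma emeasure_box_cart:
  fixes a b :: "real^'d::finite"
  assumes "\<And>i. a $ i \<le> b $ i"
  shows "emeasure lborel (box a b) = ennreal (\<Prod>i\<in>UNIV. b $ i - a $ i)"
    "emeasure lborel (cbox a b) = ennreal (\<Prod>i\<in>UNIV. b $ i - a $ i)"
    "measure lborel (box a b) = (\<Prod>i\<in>UNIV. b $ i - a $ i)"
    "measure lborel (cbox a b) = (\<Prod>i\<in>UNIV. b $ i - a $ i)"
proof -
  have e: "(\<Prod>c\<in>Basis. (b - a) \<bullet> c) = (\<Prod>i\<in>UNIV. b $ i - a $ i)"
  proof -
    have "inj (\<lambda>i::'d. axis i (1::real))" by (auto simp: inj_on_def axis_eq_axis)
    then have "(\<Prod>c\<in>range (\<lambda>i::'d. axis i (1::real)). (b - a) \<bullet> c) = (\<Prod>i\<in>UNIV. (b - a) \<bullet> axis i 1)"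
      by (subst prod.reindex) auto
    moreover have "(Basis :: (real^'d) set) = range (\<lambda>i. axis i 1)" by (auto simp: Basis_vec_def)
    ultimately show ?thesis by (simp only: inner_axis vector_minus_component mult_1_right inner_real_def)
  qed
  have le: "\<And>c. c \<in> Basis \<Longrightarrow> a \<bullet> c \<le> b \<bullet> c"
    using assms by (auto simp: Basis_vec_def inner_axis)
  have nn: "(\<Prod>i\<in>UNIV. b $ i - a $ i) \<ge> 0" using assms by (intro prod_nonneg) simp
  show 1: "emeasure lborel (box a b) = ennreal (\<Prod>i\<in>UNIV. b $ i - a $ i)"
    using emeasure_lborel_box[OF le] e by simp
  show 2: "emeasure lborel (cbox a b) = ennreal (\<Prod>i\<in>UNIV. b $ i - a $ i)"
    using emeasure_lborel_cbox[OF le] e by simp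
  show "measure lborel (box a b) = (\<Prod>i\<in>UNIV. b $ i - a $ i)"
    "measure lborel (cbox a b) = (\<Prod>i\<in>UNIV. b $ i - a $ i)"
    unfolding measure_def 1 2 using nn by simp_all
qed

lemma measure_cube:
  fixes x :: "real^'d::finite"
  assumes "h \<ge> 0"
  shows "measure lborel (box x (x + vec h)) = h ^ CARD('d)"
    "emeasure lborel (box x (x + vec h)) = ennreal (h ^ CARD('d))"
  using emeasure_box_cart[of x "x + vec h"] assms by auto

lemma box_subset_norm:
  fixes x :: "real^'d::finite"
  assumes "z \<in> box x (x + vec h)" shows "norm (z - x) \<le> real CARD('d) * h"
proof -
  have "norm (z - x) \<le> (\<Sum>i\<in>UNIV. \<bar>(z - x) $ i\<bar>)" by (rule norm_le_l1_cart)
  also have "\<dots> \<le> (\<Sum>i\<in>(UNIV::'d set). h)"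
  proof (rule sum_mono)
    fix i
    have "x $ i < z $ i \<and> z $ i < x $ i + h" using assms by (simp add: mem_box_cart)
    then show "\<bar>(z - x) $ i\<bar> \<le> h" by auto
  qed
  finally show ?thesis by simp
qed

text \<open>Lebesgue differentiation with cubes that have \<open>x\<close> as a corner. The averages
  over closed cubes in the gauge integral are rewritten as Lebesgue integrals over open
  cubes.\<close>

lemma lebesgue_points:
  fixes F :: "real^'d::finite \<Rightarrow> 'b::euclidean_space"
  assumes int: "integrable lborel F"
  shows "AE x in lborel. \<forall>e>0. \<exists>d>0. \<forall>h. 0 < h \<and> h < d \<longrightarrow>
     norm ((LINT z|lborel. indicator (box x (x + vec h)) z *\<^sub>R F z) /\<^sub>R h ^ CARD('d) - F x) < e"
proof -
  have aint: "F absolutely_integrable_on UNIV"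
    using int borel_measurable_integrable[OF int] by (simp add: set_integrable_def integrable_completion)
  have "F integrable_on cbox a b" for a b
    using absolutely_integrable_on_subcbox[OF aint, of a b]
    using set_lebesgue_integral_eq_integral(1) by blast
  then obtain N where N: "negligible N" and
    lim: "\<And>x e. \<lbrakk>x \<notin> N; 0 < e\<rbrakk> \<Longrightarrow>  \<exists>d>0. \<forall>h. 0 < h \<and> h < d \<longrightarrow>
        norm(integral (cbox x (x + h *\<^sub>R One)) F /\<^sub>R h ^ DIM(real^'d) - F x) < e"
    using integrable_ccontinuous_explicit[of F] by blast
  have I: "integral (cbox x (x + h *\<^sub>R One)) F = (LINT y|lborel. indicator (box x (x + vec h)) y *\<^sub>R F y)" for x h
  proof -
    have "set_integrable lborel (box x (x + vec h)) F"
      unfolding set_integrable_def using int by (intro integrable_mult_indicator) auto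
    then have "(LINT y:box x (x + vec h)|lborel. F y) = integral (box x (x + vec h)) F"
      by (rule set_borel_integral_eq_integral(2))
    then show ?thesis unfolding One_cart vec_1_scale
      by (simp add: set_lebesgue_integral_def integral_open_interval)
  qed
  have "AE x in lebesgue. x \<notin> N"
    using N by (simp add: AE_not_in negligible_iff_null_sets)
  then have "AE x in lborel. x \<notin> N" unfolding AE_completion_iff .
  then show ?thesis
  proof eventually_elim
    case (elim x)
    from lim[OF elim] show ?case unfolding I by simp
  qed
qed

lemma open_contains_small_cubes:
  fixes x :: "real^'d::finite"
  assumes "open D" "x \<in> D"
  obtains d where "d > 0" "\<And>h. 0 < h \<Longrightarrow> h < d \<Longrightarrow> box x (x + vec h) \<subseteq> D"
proof -
  obtain e where e: "e > 0" "ball x e \<subseteq> D" using assms open_contains_ball by metis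
  have "box x (x + vec h) \<subseteq> D" if "0 < h" "h < e / real CARD('d)" for h
  proof
    fix z assume "z \<in> box x (x + vec h)"
    then have "norm (z - x) \<le> real CARD('d) * h" by (rule box_subset_norm)
    also have "\<dots> < e" using that by (simp add: field_simps)
    finally show "z \<in> D" using e(2) by (auto simp: dist_norm norm_minus_commute)
  qed
  then show thesis using e by (intro that[of "e / real CARD('d)"]) auto
qed

text \<open>The values are constrained to a closed set instead of to 0. The choice
  \<open>{0}\<close> gives uniqueness of weak gradients, and the closure of \<open>C\<close> gives
  stability of the gradient constraint under limits.\<close>

lemma fundamental_lemma_box:
  fixes f :: "real^'d::finite \<Rightarrow> 'b::euclidean_space"
  assumes int: "integrable lborel F" and f: "\<And>x. x \<in> cbox p q \<Longrightarrow> F x = f x"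
    and S: "closed S"
    and H: "\<And>\<psi>. test_function (box p q) \<psi> \<Longrightarrow> (\<And>x. \<psi> x \<ge> 0) \<Longrightarrow> (LINT x|lborel. \<psi> x) = 1 \<Longrightarrow>
          (LINT x|lborel. \<psi> x *\<^sub>R F x) \<in> S"
  shows "AE x in lborel. x \<in> box p q \<longrightarrow> f x \<in> S"
proof -
  have [measurable]: "F \<in> borel_measurable borel" using borel_measurable_integrable[OF int] by simp
  \<comment> \<open>A cube average is a limit of averages against normalised cutoffs of the cube,
    and \<open>S\<close> is closed. Lebesgue points then pass from averages to values.\<close>
  have avg: "(LINT y|lborel. indicator (box x (x + vec h)) y *\<^sub>R F y) /\<^sub>R h ^ CARD('d) \<in> S"
    if h: "h > 0" and sub: "box x (x + vec h) \<subseteq> box p q" for x h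
  proof -
    let ?B = "box x (x + vec h)"
    define r where "r k = inverse (real (Suc k))" for k
    have r: "r k > 0" "r \<longlonglongrightarrow> 0" for k unfolding r_def by (rule inverse_Suc_seq)+
    define \<psi> where "\<psi> k = cutoff x (x + vec h) (r k)" for k
    have [measurable]: "\<psi> k \<in> borel_measurable borel" for k unfolding \<psi>_def by measurable
    have \<psi>: "test_function ?B (\<psi> k)" "0 \<le> \<psi> k y" "\<psi> k y \<le> indicator ?B y" for k y
      using cutoff_test_function[OF r(1)] cutoff_le_indicator[OF r(1)] by (auto simp: \<psi>_def cutoff_bounds)
    have fin: "emeasure lborel ?B < \<infinity>" by (rule emeasure_bounded_finite) simp
    have lim\<psi>: "(\<lambda>k. \<psi> k y) \<longlonglongrightarrow> indicator ?B y" for y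
      unfolding \<psi>_def by (rule cutoff_tendsto[OF r])
    have "(\<lambda>k. LINT y|lborel. \<psi> k y) \<longlonglongrightarrow> (LINT y|lborel. indicator ?B y)"
      by (rule integral_dominated_convergence[where w = "indicator ?B"])
        (use fin lim\<psi> \<psi> in \<open>auto\<close>)
    then have m: "(\<lambda>k. LINT y|lborel. \<psi> k y) \<longlonglongrightarrow> h ^ CARD('d)"
      using measure_cube(1)[OF less_imp_le[OF h], of x] by simp
    have n: "(\<lambda>k. LINT y|lborel. \<psi> k y *\<^sub>R F y) \<longlonglongrightarrow> (LINT y|lborel. indicator ?B y *\<^sub>R F y)"
      unfolding \<psi>_def by (rule cutoff_integral_tendsto[OF int r])
    have hp: "h ^ CARD('d) > 0" using h by simp
    have limS: "(\<lambda>k. (LINT y|lborel. \<psi> k y *\<^sub>R F y) /\<^sub>R (LINT y|lborel. \<psi> k y)) \<longlonglongrightarrow>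
       (LINT y|lborel. indicator ?B y *\<^sub>R F y) /\<^sub>R h ^ CARD('d)"
      using n m h by (intro tendsto_intros) auto
    have "eventually (\<lambda>k. (LINT y|lborel. \<psi> k y) > 0) sequentially"
      using m hp by (rule order_tendstoD)
    then have "eventually (\<lambda>k. (LINT y|lborel. \<psi> k y *\<^sub>R F y) /\<^sub>R (LINT y|lborel. \<psi> k y) \<in> S) sequentially"
    proof eventually_elim
      case (elim k)
      let ?c = "inverse (LINT y|lborel. \<psi> k y)"
      have "(LINT y|lborel. (?c * \<psi> k y) *\<^sub>R F y) \<in> S"
      proof (rule H)
        show "test_function (box p q) (\<lambda>y. ?c * \<psi> k y)"
          by (intro test_function_mult smooth_const test_function_mono[OF \<psi>(1) sub])
      qed (use elim \<psi>(2) in auto)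
      also have "(LINT y|lborel. (?c * \<psi> k y) *\<^sub>R F y) = (LINT y|lborel. \<psi> k y *\<^sub>R F y) /\<^sub>R (LINT y|lborel. \<psi> k y)"
        by (simp flip: scaleR_scaleR)
      finally show ?case .
    qed
    then show ?thesis by (rule Lim_in_closed_set[OF S _ sequentially_bot limS])
  qed
  from lebesgue_points[OF int] show ?thesis
  proof eventually_elim
    case (elim x)
    show ?case
    proof
      assume x: "x \<in> box p q"
      obtain h0 where h0: "h0 > 0" "\<And>h. 0 < h \<Longrightarrow> h < h0 \<Longrightarrow> box x (x + vec h) \<subseteq> box p q"
        by (rule open_contains_small_cubes[OF open_box x], rule that)
      have "F x \<in> closure S"
        unfolding closure_approachable
      proof (intro allI impI)
        fix e :: real assume "e > 0"
        then obtain d where d: "d > 0" "\<And>h. 0 < h \<and> h < d \<Longrightarrow>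
            norm ((LINT z|lborel. indicator (box x (x + vec h)) z *\<^sub>R F z) /\<^sub>R h ^ CARD('d) - F x) < e"
          using elim by blast
        define h where "h = min d h0 / 2"
        have h: "0 < h" "h < d" "h < h0" using d(1) h0(1) by (auto simp: h_def)
        from d(2)[OF conjI[OF h(1,2)]] show "\<exists>y\<in>S. dist y (F x) < e"
          unfolding dist_norm by (rule bexI[OF _ avg[OF h(1) h0(2)[OF h(1,3)]]])
      qed
      moreover have "x \<in> cbox p q" using x box_subset_cbox by blast
      ultimately show "f x \<in> S" using S f by simp
    qed
  qed
qed

text \<open>By the Lindelof property countably many boxes cover \<open>D\<close>, so that the
  exceptional null sets can be united.\<close>

lemma open_AE_boxes:
  fixes D :: "(real^'d::finite) set"
  assumes "open D" "\<And>p q. cbox p q \<subseteq> D \<Longrightarrow> AE x in lborel. x \<in> box p q \<longrightarrow> P x"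
  shows "AE x in lborel. x \<in> D \<longrightarrow> P x"
proof -
  define \<F> where "\<F> = {box p q | p q. cbox p q \<subseteq> D}"
  obtain \<F>' where F': "\<F>' \<subseteq> \<F>" "countable \<F>'" "\<Union>\<F>' = \<Union>\<F>"
    using Lindelof[of \<F>] unfolding \<F>_def by blast
  have "D \<subseteq> \<Union>\<F>"
  proof
    fix x assume "x \<in> D"
    then obtain e where e: "e > 0" "ball x e \<subseteq> D" using assms(1) open_contains_ball by metis
    obtain a b where ab: "x \<in> box a b" "cbox a b \<subseteq> ball x e"
    proof -
      define h where "h = e / (real CARD('d) + 1)"
      have h: "h > 0" using e by (simp add: h_def)
      have "cbox (x - vec h) (x + vec h) \<subseteq> ball x e"
      proof
        fix y assume y: "y \<in> cbox (x - vec h) (x + vec h)"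
        have "norm (y - x) \<le> (\<Sum>i\<in>UNIV. \<bar>(y - x) $ i\<bar>)" by (rule norm_le_l1_cart)
        also have "\<dots> \<le> (\<Sum>i\<in>(UNIV::'d set). h)"
        proof (rule sum_mono)
          fix i
          have "x $ i - h \<le> y $ i \<and> y $ i \<le> x $ i + h" using y by (simp add: mem_box_cart)
          then show "\<bar>(y - x) $ i\<bar> \<le> h" by auto
        qed
        also have "\<dots> < e" using e by (simp add: h_def field_simps)
        finally show "y \<in> ball x e" by (auto simp: dist_norm norm_minus_commute)
      qed
      moreover have "x \<in> box (x - vec h) (x + vec h)" using h by (simp add: mem_box_cart)
      ultimately show thesis using that by blast
    qed
    then show "x \<in> \<Union>\<F>" unfolding \<F>_def using e(2) by blast
  qed
  moreover have "AE x in lborel. \<forall>X\<in>\<F>'. x \<in> X \<longrightarrow> P x"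
    unfolding AE_ball_countable[OF F'(2)]
  proof
    fix X assume "X \<in> \<F>'"
    then obtain p q where X: "X = box p q" "cbox p q \<subseteq> D" using F'(1) unfolding \<F>_def by blast
    show "AE x in lborel. x \<in> X \<longrightarrow> P x" unfolding X(1) by (rule assms(2)[OF X(2)])
  qed
  then have "AE x in lborel. x \<in> \<Union>\<F>' \<longrightarrow> P x" by eventually_elim blast
  ultimately show ?thesis using F'(3) by (auto elim!: eventually_mono)
qed

text \<open>Each entry of the difference annihilates all test functions. The result frees the later
  argument from the choice operator in \<open>weak_gradient\<close>.\<close>

lemma weak_gradient_unique:
  fixes u :: "real^'d::finite \<Rightarrow> real^'m::finite"
  assumes "open D" "is_weak_gradient D u G1" "is_weak_gradient D u G2"
  shows "AE x in lebesgue_on D. G1 x = G2 x"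
proof -
  have D: "D \<in> sets lebesgue" using assms(1) by (simp add: borel_open)
  have "AE x in lborel. x \<in> D \<longrightarrow> G1 x $ i $ j = G2 x $ i $ j" for i j
  proof (rule open_AE_boxes[OF assms(1)])
    fix p q :: "real^'d" assume pq: "cbox p q \<subseteq> D"
    define f where "f x = G1 x $ i $ j - G2 x $ i $ j" for x
    have "G1 absolutely_integrable_on cbox p q" "G2 absolutely_integrable_on cbox p q"
      using assms(2,3) pq by (auto simp: is_weak_gradient_def locally_integrable_def)
    then have "(\<lambda>x. G1 x - G2 x) absolutely_integrable_on cbox p q" by (rule set_integral_diff(1))
    then have "integrable lebesgue (\<lambda>x. indicator (cbox p q) x *\<^sub>R (G1 x - G2 x))"
      by (simp add: set_integrable_def)
    from integrable_bounded_linear[OF bounded_linear_compose[OF bounded_linear_vec_nth bounded_linear_vec_nth] this, of i j]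
    have i1: "integrable lebesgue (\<lambda>x. indicator (cbox p q) x * f x)"
      by (simp add: f_def)
    obtain F where F: "F \<in> borel_measurable borel" "AE x in lborel. indicator (cbox p q) x * f x = F x"
      using lebesgue_ex_borel[OF borel_measurable_integrable[OF i1]] by blast
    let ?F = "\<lambda>x. indicator (cbox p q) x * F x"
    have [measurable]: "F \<in> borel_measurable borel" by (rule F)
    have ae: "AE x in lborel. indicator (cbox p q) x * f x = ?F x"
      using F(2) by eventually_elim (auto simp: indicator_def)
    have "integrable lebesgue ?F"
      using integrable_cong_AE[of "\<lambda>x. indicator (cbox p q) x * f x" lebesgue ?F] i1 ae
      by (auto simp: AE_completion_iff measurable_completion)
    then have iF: "integrable lborel ?F" by (simp add: integrable_completion)
    have "AE x in lborel. x \<in> box p q \<longrightarrow> ?F x \<in> {0}"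
    proof (rule fundamental_lemma_box[OF iF])
      fix \<psi> :: "real^'d \<Rightarrow> real" assume \<psi>: "test_function (box p q) \<psi>"
      have \<psi>D: "test_function D \<psi>" by (rule test_function_mono[OF \<psi>]) (use pq box_subset_cbox in blast)
      obtain K where K: "compact K" "K \<subseteq> box p q" "\<And>x. x \<notin> K \<Longrightarrow> \<psi> x = 0"
        using test_functionE[OF \<psi>] by metis
      have K': "x \<in> K \<Longrightarrow> x \<in> cbox p q" "x \<in> K \<Longrightarrow> x \<in> D" for x using K(2) box_subset_cbox pq by blast+
      have s: "smooth \<psi>" by (rule test_function_smooth[OF \<psi>])
      have [measurable]: "\<psi> \<in> borel_measurable borel"
        by (rule borel_measurable_continuous_onI[OF smooth_continuous[OF s]])
      have loc: "integrable (lebesgue_on D) (\<lambda>x. G x $ i $ j * \<psi> x)" if "is_weak_gradient D u G" for G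
      proof -
        have "G absolutely_integrable_on K" using that K(1) K' by (auto simp: is_weak_gradient_def locally_integrable_def)
        then have "integrable lebesgue (\<lambda>x. indicator K x *\<^sub>R G x)" by (simp add: set_integrable_def)
        from integrable_bounded_linear[OF bounded_linear_compose[OF bounded_linear_vec_nth bounded_linear_vec_nth] this, of i j]
        have I: "integrable lebesgue (\<lambda>x. indicator K x * G x $ i $ j)" by simp
        have "compact (\<psi> ` K)" by (intro compact_continuous_image smooth_continuous[OF s] K)
        from compact_imp_bounded[OF this] obtain B where B: "\<forall>y\<in>\<psi> ` K. norm y \<le> B" unfolding bounded_iff ..
        have B': "\<bar>\<psi> x\<bar> \<le> max B 0" for x using B K(3)[of x] by (cases "x \<in> K") auto
        have "integrable lebesgue (\<lambda>x. (indicator K x * G x $ i $ j) * \<psi> x)"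
        proof (rule Bochner_Integration.integrable_bound[OF integrable_mult_right[OF I, of "max B 0"]])
          have [measurable]: "\<psi> \<in> borel_measurable lebesgue" by (rule measurable_completion) simp
          note [measurable] = borel_measurable_integrable[OF I]
          show "(\<lambda>x. (indicator K x * G x $ i $ j) * \<psi> x) \<in> borel_measurable lebesgue" by measurable
          show "AE x in lebesgue. norm (indicator K x * G x $ i $ j * \<psi> x) \<le> norm (max B 0 * (indicator K x * G x $ i $ j))"
            using B' by (intro AE_I2) (auto simp: abs_mult mult.commute intro!: mult_mono)
        qed
        also have "(\<lambda>x. (indicator K x * G x $ i $ j) * \<psi> x) = (\<lambda>x. indicator D x *\<^sub>R (G x $ i $ j * \<psi> x))"
          using K(3) K' by (force simp: indicator_def)
        finally show ?thesis using D by (simp add: integrable_restrict_space)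
      qed
      have "(LINT x|lborel. \<psi> x *\<^sub>R ?F x) = (LINT x|lebesgue_on D. f x * \<psi> x)"
      proof (rule integral_lebesgue_on_eq[symmetric, OF D])
        show "AE x in lborel. x \<in> D \<longrightarrow> f x * \<psi> x = \<psi> x *\<^sub>R (indicator (cbox p q) x * F x)"
          using ae
        proof eventually_elim
          case (elim x) then show ?case using K(3)[of x] K'(1)[of x] by (cases "x \<in> K") auto
        qed
        show "\<psi> x *\<^sub>R (indicator (cbox p q) x * F x) = 0" if "x \<notin> D" for x using K(3)[of x] K'(2)[of x] that by auto
      qed simp
      also have "\<dots> = (LINT x|lebesgue_on D. G1 x $ i $ j * \<psi> x) - (LINT x|lebesgue_on D. G2 x $ i $ j * \<psi> x)"
        unfolding f_def left_diff_distrib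
        by (rule Bochner_Integration.integral_diff[OF loc[OF assms(2)] loc[OF assms(3)]])
      also have "\<dots> = 0"
      proof -
        have "(LINT x|lebesgue_on D. G x $ i $ j * \<psi> x) = - (LINT x|lebesgue_on D. u x $ i * partial_deriv j \<psi> x)"
          if "is_weak_gradient D u G" for G
          using that \<psi>D unfolding is_weak_gradient_def by simp
        from this[OF assms(2)] this[OF assms(3)] show ?thesis by simp
      qed
      finally show "(LINT x|lborel. \<psi> x *\<^sub>R ?F x) \<in> {0}" by simp
    qed auto
    with ae show "AE x in lborel. x \<in> box p q \<longrightarrow> G1 x $ i $ j = G2 x $ i $ j"
    proof eventually_elim
      case (elim x)
      then show ?case using box_subset_cbox[of p q] by (auto simp: f_def indicator_def split: if_splits)
    qed
  qed
  then have "AE x in lborel. \<forall>i j. x \<in> D \<longrightarrow> G1 x $ i $ j = G2 x $ i $ j"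
    unfolding AE_all_countable by blast
  then show ?thesis unfolding AE_lebesgue_on_iff[OF D]
  proof eventually_elim
    case (elim x)
    show ?case
    proof
      assume "x \<in> D"
      with elim have "G1 x $ i $ j = G2 x $ i $ j" for i j by blast
      then show "G1 x = G2 x" unfolding vec_eq_iff by blast
    qed
  qed
qed

subsection \<open>Sobolev functions and their Borel representatives\<close>

lemma WG_imp_weak_gradient:
  assumes "open D" "WG D u G"
  shows "is_weak_gradient D u G"
proof -
  have D: "D \<in> sets lebesgue" using assms(1) by (simp add: borel_open)
  note [measurable] = WG_meas(1,2)[OF assms(2)]
  have li: "locally_integrable D f" if [measurable]: "f \<in> borel_measurable borel" and b: "bdd_local f"
    for f :: "real^'a \<Rightarrow> 'c::euclidean_space"
    unfolding locally_integrable_def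
  proof (intro allI impI)
    fix K :: "(real^'a) set" assume K: "compact K \<and> K \<subseteq> D"
    from compact_imp_bounded[of K] obtain R where R: "\<And>x. x \<in> K \<Longrightarrow> norm x \<le> R"
      using K unfolding bounded_iff by blast
    obtain B where B: "\<And>x. norm x \<le> R \<Longrightarrow> norm (f x) \<le> B" using b unfolding bdd_local_def by metis
    have [measurable]: "K \<in> sets borel" using K by (simp add: borel_compact)
    have "integrable lborel (\<lambda>x. indicator K x *\<^sub>R f x)"
    proof (rule integrableI_bounded_set[where A = K and B = B])
      show "emeasure lborel K < \<infinity>" using K emeasure_compact_finite[of K] by simp
    qed (use B R in auto)
    then show "f absolutely_integrable_on K"
      by (simp add: set_integrable_def integrable_completion)
  qed
  show ?thesis
    unfolding is_weak_gradient_def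
  proof (intro conjI allI impI li WG_meas[OF assms(2)])
    fix \<psi> i j assume \<psi>: "test_function D \<psi>"
    obtain K where K: "compact K" "K \<subseteq> D" "\<And>x. x \<notin> K \<Longrightarrow> \<psi> x = 0" "\<And>j x. x \<notin> K \<Longrightarrow> partial_deriv j \<psi> x = 0"
      using test_functionE[OF \<psi>] by metis
    have s: "smooth \<psi>" by (rule test_function_smooth[OF \<psi>])
    have [measurable]: "\<psi> \<in> borel_measurable borel" "partial_deriv j \<psi> \<in> borel_measurable borel"
      by (intro borel_measurable_continuous_onI smooth_continuous smooth_partial_deriv s)+
    have "(LINT x|lebesgue_on D. u x $ i * partial_deriv j \<psi> x) = (LINT x|lborel. u x $ i * partial_deriv j \<psi> x)"
      by (rule integral_lebesgue_on_eq[OF D]) (use K in auto)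
    moreover have "(LINT x|lebesgue_on D. G x $ i $ j * \<psi> x) = (LINT x|lborel. G x $ i $ j * \<psi> x)"
      by (rule integral_lebesgue_on_eq[OF D]) (use K in auto)
    ultimately show "(LINT x|lebesgue_on D. u x $ i * partial_deriv j \<psi> x) = - (LINT x|lebesgue_on D. G x $ i $ j * \<psi> x)"
      using WG_weak[OF assms(2) \<psi>, of i j] by simp
  qed
qed

lemma WG_W1inf:
  assumes "open D" "bounded D" "WG D u G"
  shows "u \<in> W1inf D" "AE x in lborel. x \<in> D \<longrightarrow> weak_gradient D u x = G x"
proof -
  have D: "D \<in> sets lebesgue" using assms(1) by (simp add: borel_open)
  have wg: "is_weak_gradient D u G" by (rule WG_imp_weak_gradient[OF assms(1,3)])
  obtain R where R: "\<And>x. x \<in> D \<Longrightarrow> norm x \<le> R" using assms(2) unfolding bounded_iff by blast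
  have L: "f \<in> Linfty D" if f: "f \<in> borel_measurable borel" and b: "bdd_local f"
    for f :: "real^'a \<Rightarrow> 'c::euclidean_space"
  proof -
    obtain B where B: "\<And>x. norm x \<le> R \<Longrightarrow> norm (f x) \<le> B" using b unfolding bdd_local_def by metis
    have "f \<in> borel_measurable (lebesgue_on D)"
      by (intro measurable_restrict_space1 measurable_completion) (simp add: f)
    then show ?thesis using B R D by (auto simp: Linfty_def AE_lebesgue_on_iff intro!: exI[of _ B])
  qed
  have "u \<in> Linfty D" "G \<in> Linfty D" using WG_meas[OF assms(3)] by (auto intro: L)
  with wg show "u \<in> W1inf D" unfolding W1inf_def by auto
  have "is_weak_gradient D u (weak_gradient D u)"
    unfolding weak_gradient_def by (rule someI[of "is_weak_gradient D u", OF wg])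
  from weak_gradient_unique[OF assms(1) this wg]
  show "AE x in lborel. x \<in> D \<longrightarrow> weak_gradient D u x = G x" unfolding AE_lebesgue_on_iff[OF D] .
qed

text \<open>Together with \<open>WG_W1inf\<close> this translates between the spaces of the theorem
  and \<open>WG\<close>; all constructions are carried out with \<open>WG\<close>.\<close>

lemma W1inf_WG:
  fixes u :: "real^'d::finite \<Rightarrow> real^'m::finite"
  assumes "open D" "u \<in> W1inf D"
  obtains v G B where "WG D v G" "AE x in lborel. x \<in> D \<longrightarrow> u x = v x"
    "AE x in lborel. x \<in> D \<longrightarrow> weak_gradient D u x = G x" "\<And>x. norm (v x) \<le> B" "\<And>x. norm (G x) \<le> B"
proof -
  have D: "D \<in> sets lebesgue" using assms(1) by (simp add: borel_open)
  have *: "u \<in> Linfty D \<and> (\<exists>G\<in>Linfty D. is_weak_gradient D u G)"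
    using assms(2) unfolding W1inf_def mem_Collect_eq .
  then have u: "u \<in> Linfty D" ..
  from conjunct2[OF *] obtain H where H: "H \<in> Linfty D" "is_weak_gradient D u H" ..
  obtain v B1 where v: "v \<in> borel_measurable borel" "\<And>x. norm (v x) \<le> B1" "AE x in lborel. x \<in> D \<longrightarrow> u x = v x"
    by (rule Linfty_borel[OF D u], rule that)
  obtain G B2 where G: "G \<in> borel_measurable borel" "\<And>x. norm (G x) \<le> B2" "AE x in lborel. x \<in> D \<longrightarrow> H x = G x"
    by (rule Linfty_borel[OF D H(1)], rule that)
  note [measurable] = v(1) G(1)
  have "WG D v G"
    unfolding WG_def
  proof (intro conjI allI impI v(1) G(1) bdd_localI[of v, OF v(2)] bdd_localI[of G, OF G(2)])
    fix \<psi> i j assume \<psi>: "test_function D \<psi>"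
    obtain K where K: "compact K" "K \<subseteq> D" "\<And>x. x \<notin> K \<Longrightarrow> \<psi> x = 0" "\<And>j x. x \<notin> K \<Longrightarrow> partial_deriv j \<psi> x = 0"
      using test_functionE[OF \<psi>] by metis
    have s: "smooth \<psi>" by (rule test_function_smooth[OF \<psi>])
    have [measurable]: "\<psi> \<in> borel_measurable borel" "partial_deriv j \<psi> \<in> borel_measurable borel"
      by (intro borel_measurable_continuous_onI smooth_continuous smooth_partial_deriv s)+
    have "(LINT x|lebesgue_on D. u x $ i * partial_deriv j \<psi> x) = (LINT x|lborel. v x $ i * partial_deriv j \<psi> x)"
      by (rule integral_lebesgue_on_eq[OF D]) (use K v(3) in \<open>auto elim!: eventually_mono\<close>)
    moreover have "(LINT x|lebesgue_on D. H x $ i $ j * \<psi> x) = (LINT x|lborel. G x $ i $ j * \<psi> x)"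
      by (rule integral_lebesgue_on_eq[OF D]) (use K G(3) in \<open>auto elim!: eventually_mono\<close>)
    ultimately show "(LINT x|lborel. v x $ i * partial_deriv j \<psi> x) = - (LINT x|lborel. G x $ i $ j * \<psi> x)"
      using conjunct2[OF conjunct2[OF H(2)[unfolded is_weak_gradient_def]], rule_format, OF \<psi>, of i j] by simp
  qed
  moreover have "AE x in lborel. x \<in> D \<longrightarrow> weak_gradient D u x = G x"
  proof -
    have "is_weak_gradient D u (weak_gradient D u)"
      unfolding weak_gradient_def by (rule someI[of "is_weak_gradient D u", OF H(2)])
    from weak_gradient_unique[OF assms(1) this H(2)]
    have "AE x in lborel. x \<in> D \<longrightarrow> weak_gradient D u x = H x" unfolding AE_lebesgue_on_iff[OF D] .
    with G(3) show ?thesis by eventually_elim simp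
  qed
  moreover have "norm (v x) \<le> max B1 B2" "norm (G x) \<le> max B1 B2" for x
    using v(2)[of x] G(2)[of x] by auto
  ultimately show thesis by (intro that[of v G "max B1 B2"] v(3))
qed

lemma WG_W1inf0:
  assumes "WG UNIV \<phi> G" "continuous_on UNIV \<phi>" "\<And>x. x \<notin> box a b \<Longrightarrow> \<phi> x = 0"
  shows "\<phi> \<in> W1inf0 (box a b)" "AE x in lborel. x \<in> box a b \<longrightarrow> weak_gradient (box a b) \<phi> x = G x"
proof -
  have w: "WG (box a b) \<phi> G" by (rule WG_subset[OF assms(1)]) simp
  note w = WG_W1inf[OF open_box bounded_box w]
  show "AE x in lborel. x \<in> box a b \<longrightarrow> weak_gradient (box a b) \<phi> x = G x" by (rule w)
  have "x \<notin> box a b" if "x \<in> frontier (box a b)" for x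
    using that open_box frontier_disjoint_eq[of "box a b"] by blast
  then show "\<phi> \<in> W1inf0 (box a b)"
    unfolding W1inf0_def using w(1) assms by (auto intro!: exI[of _ \<phi>] continuous_on_subset[OF assms(2)])
qed

subsection \<open>Extension by zero\<close>

text \<open>A test function \<open>\<psi>\<close> of the whole space is multiplied by cutoffs
  \<open>\<eta> k\<close> of the box. The error \<open>T k\<close> contains a derivative of the
  cutoff of order \<open>1 / r k\<close>, but it lives on slabs of volume of order
  \<open>r k\<close>, on which \<open>\<phi>'\<close> is uniformly small because it is continuous
  and vanishes on the boundary. So the weak identity survives the limit.\<close>

lemma W1inf0_box_WG:
  fixes \<phi> :: "real^'d::finite \<Rightarrow> real^'m::finite"
  assumes \<phi>: "\<phi> \<in> W1inf0 (box a b)" and ab: "\<And>i. a $ i < b $ i"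
  obtains \<phi>' G B where "WG UNIV \<phi>' G" "continuous_on UNIV \<phi>'"
    "\<And>x. x \<notin> box a b \<Longrightarrow> \<phi>' x = 0" "\<And>x. x \<notin> box a b \<Longrightarrow> G x = 0"
    "AE x in lborel. x \<in> box a b \<longrightarrow> weak_gradient (box a b) \<phi> x = G x"
    "\<And>x. norm (\<phi>' x) \<le> B" "\<And>x. norm (G x) \<le> B"
proof -
  let ?Q = "box a b"
  have ne: "?Q \<noteq> {}"
    using ab by (metis empty_iff interval_ne_empty_cart(2))
  have cl: "closure ?Q = cbox a b" using ne by (rule closure_box)
  have fr: "frontier ?Q = cbox a b - ?Q" unfolding frontier_def cl interior_open[OF open_box] ..
  have *: "\<phi> \<in> W1inf ?Q \<and> (\<exists>v. continuous_on (closure ?Q) v \<and>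
                 (AE x in lebesgue_on ?Q. v x = \<phi> x) \<and> (\<forall>x \<in> frontier ?Q. v x = 0))"
    using \<phi> unfolding W1inf0_def mem_Collect_eq .
  then have \<phi>W: "\<phi> \<in> W1inf ?Q" ..
  from conjunct2[OF *] obtain v where v: "continuous_on (cbox a b) v" "AE x in lborel. x \<in> ?Q \<longrightarrow> v x = \<phi> x"
    "\<And>x. x \<in> cbox a b - ?Q \<Longrightarrow> v x = 0"
    unfolding cl fr by (auto simp: AE_lebesgue_on_iff)
  obtain \<phi>1 G1 B1 where 1: "WG ?Q \<phi>1 G1" "AE x in lborel. x \<in> ?Q \<longrightarrow> \<phi> x = \<phi>1 x"
    "AE x in lborel. x \<in> ?Q \<longrightarrow> weak_gradient ?Q \<phi> x = G1 x" "\<And>x. norm (G1 x) \<le> B1"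
    by (rule W1inf_WG[OF open_box \<phi>W], rule that)
  define \<phi>' where "\<phi>' x = (if x \<in> ?Q then v x else 0)" for x
  define G where "G x = (if x \<in> ?Q then G1 x else 0)" for x
  have cont: "continuous_on UNIV \<phi>'"
  proof -
    have "continuous_on (cbox a b \<union> - ?Q) \<phi>'"
    proof (rule continuous_on_closed_Un)
      show "continuous_on (cbox a b) \<phi>'"
        by (rule continuous_on_eq[OF v(1)]) (use v(3) in \<open>auto simp: \<phi>'_def\<close>)
      show "continuous_on (- ?Q) \<phi>'"
        by (rule continuous_on_eq[of _ "\<lambda>_. 0"]) (auto simp: \<phi>'_def)
    qed (auto intro: closed_Compl)
    moreover have "cbox a b \<union> - ?Q = UNIV" using box_subset_cbox by blast
    ultimately show ?thesis by simp
  qed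
  have m\<phi>: "\<phi>' \<in> borel_measurable borel" by (rule borel_measurable_continuous_onI[OF cont])
  note [measurable] = WG_meas(1,2)[OF 1(1)] m\<phi>
  have mG [measurable]: "G \<in> borel_measurable borel" unfolding G_def by measurable
  have "compact (v ` cbox a b)" by (rule compact_continuous_image[OF v(1)]) simp
  from compact_imp_bounded[OF this] obtain B2 where B2: "\<forall>y\<in>v ` cbox a b. norm y \<le> B2" unfolding bounded_iff ..
  define B where "B = max (max B1 B2) 0"
  have b: "norm (\<phi>' x) \<le> B" "norm (G x) \<le> B" for x
  proof -
    have "norm (v x) \<le> B2" if "x \<in> ?Q" using B2 that box_subset_cbox by blast
    then show "norm (\<phi>' x) \<le> B" by (auto simp: \<phi>'_def B_def)
    show "norm (G x) \<le> B" using 1(4)[of x] by (auto simp: G_def B_def)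
  qed
  have WGQ: "WG ?Q \<phi>' G"
  proof (rule WG_cong_AE[OF 1(1) m\<phi> mG bdd_localI[OF b(1)] bdd_localI[OF b(2)]])
    show "AE x in lborel. x \<in> ?Q \<longrightarrow> \<phi>1 x = \<phi>' x"
      using v(2) 1(2) by eventually_elim (simp add: \<phi>'_def)
    show "AE x in lborel. x \<in> ?Q \<longrightarrow> G1 x = G x" by (simp add: G_def)
  qed
  have "WG UNIV \<phi>' G"
    unfolding WG_def
  proof (intro conjI allI impI m\<phi> mG bdd_localI[of \<phi>', OF b(1)] bdd_localI[of G, OF b(2)])
    fix \<psi> :: "real^'d \<Rightarrow> real" and i :: 'm and j :: 'd assume \<psi>: "test_function UNIV \<psi>"
    define r where "r k = inverse (real (Suc k))" for k
    have r: "r k > 0" "r \<longlonglongrightarrow> 0" for k unfolding r_def by (rule inverse_Suc_seq)+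
    define \<eta> where "\<eta> k = cutoff a b (r k)" for k
    have s\<eta>: "smooth (\<eta> k)" for k unfolding \<eta>_def by (rule cutoff_smooth)
    have s\<psi>: "smooth \<psi>" by (rule test_function_smooth[OF \<psi>])
    have t\<eta>: "test_function ?Q (\<eta> k)" for k unfolding \<eta>_def by (rule cutoff_test_function[OF r(1)])
    have [measurable]: "\<eta> k \<in> borel_measurable borel" "partial_deriv j (\<eta> k) \<in> borel_measurable borel"
       "\<psi> \<in> borel_measurable borel" "partial_deriv j \<psi> \<in> borel_measurable borel" for k
      by (intro borel_measurable_continuous_onI smooth_continuous smooth_partial_deriv s\<eta> s\<psi>)+
    have \<psi>': "test_function UNIV (partial_deriv j \<psi>)" by (rule test_function_partial_deriv[OF \<psi>])
    have t1: "test_function ?Q (\<lambda>x. \<eta> k x * \<psi> x)" for k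
      using test_function_mult[OF t\<eta> s\<psi>, of k] by (simp add: mult.commute)
    have t2: "test_function ?Q (\<lambda>x. \<eta> k x * partial_deriv j \<psi> x)" for k
      using test_function_mult[OF t\<eta>[of k] smooth_partial_deriv[OF s\<psi>], of j] by (simp add: mult.commute)
    have t3: "test_function ?Q (\<lambda>x. partial_deriv j (\<eta> k) x * \<psi> x)" for k
      using test_function_mult[OF test_function_partial_deriv[OF t\<eta>[of k]] s\<psi>, of j] by (simp add: mult.commute)
    define T where "T k = (LINT x|lborel. \<phi>' x $ i * (partial_deriv j (\<eta> k) x * \<psi> x))" for k
    have d: "partial_deriv j (\<lambda>x. \<eta> k x * \<psi> x) = (\<lambda>x. \<eta> k x * partial_deriv j \<psi> x + partial_deriv j (\<eta> k) x * \<psi> x)" for k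
      by (rule partial_deriv_mult[OF smooth_differentiable[OF s\<eta>] smooth_differentiable[OF s\<psi>]])
    have eq: "(LINT x|lborel. \<eta> k x *\<^sub>R (\<phi>' x $ i * partial_deriv j \<psi> x)) = - T k - (LINT x|lborel. \<eta> k x *\<^sub>R (G x $ i $ j * \<psi> x))" for k
    proof -
      have "(LINT x|lborel. \<phi>' x $ i * (\<eta> k x * partial_deriv j \<psi> x)) + T k
         = (LINT x|lborel. \<phi>' x $ i * partial_deriv j (\<lambda>x. \<eta> k x * \<psi> x) x)"
        unfolding d T_def using WG_integrable'(1)[OF WGQ t2] WG_integrable'(1)[OF WGQ t3]
        by (simp add: distrib_left)
      also have "\<dots> = - (LINT x|lborel. G x $ i $ j * (\<eta> k x * \<psi> x))" by (rule WG_weak[OF WGQ t1])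
      finally show ?thesis by (simp add: mult_ac)
    qed
    have l1: "(\<lambda>k. LINT x|lborel. \<eta> k x *\<^sub>R (\<phi>' x $ i * partial_deriv j \<psi> x)) \<longlonglongrightarrow> (LINT x|lborel. \<phi>' x $ i * partial_deriv j \<psi> x)"
    proof -
      have "integrable lborel (\<lambda>x. \<phi>' x $ i * partial_deriv j \<psi> x)" by (rule WG_integrable(1)[OF WGQ \<psi>'])
      note cutoff_integral_tendsto[OF this r, of a b]
      moreover have "indicator ?Q x *\<^sub>R (\<phi>' x $ i * partial_deriv j \<psi> x) = \<phi>' x $ i * partial_deriv j \<psi> x" for x
        by (simp add: indicator_def \<phi>'_def)
      ultimately show ?thesis unfolding \<eta>_def by (simp only:)
    qed
    have l2: "(\<lambda>k. LINT x|lborel. \<eta> k x *\<^sub>R (G x $ i $ j * \<psi> x)) \<longlonglongrightarrow> (LINT x|lborel. G x $ i $ j * \<psi> x)"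
    proof -
      have "integrable lborel (\<lambda>x. G x $ i $ j * \<psi> x)" by (rule WG_integrable(2)[OF WGQ \<psi>])
      note cutoff_integral_tendsto[OF this r, of a b]
      moreover have "indicator ?Q x *\<^sub>R (G x $ i $ j * \<psi> x) = G x $ i $ j * \<psi> x" for x
        by (simp add: indicator_def G_def)
      ultimately show ?thesis unfolding \<eta>_def by (simp only:)
    qed
    obtain K where K: "compact K" "\<And>x. x \<notin> K \<Longrightarrow> \<psi> x = 0" using test_functionE[OF \<psi>] by metis
    have "compact (\<psi> ` K)" by (rule compact_continuous_image[OF smooth_continuous[OF s\<psi>] K(1)])
    from compact_imp_bounded[OF this] obtain B\<psi>0 where B\<psi>0: "\<forall>y\<in>\<psi> ` K. norm y \<le> B\<psi>0" unfolding bounded_iff ..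
    define B\<psi> where "B\<psi> = max B\<psi>0 0"
    have B\<psi>: "\<bar>\<psi> x\<bar> \<le> B\<psi>" for x using B\<psi>0 K(2)[of x] by (cases "x \<in> K") (auto simp: B\<psi>_def)
    have B\<psi>n: "B\<psi> \<ge> 0" by (simp add: B\<psi>_def)
    define P where "P = (\<Prod>i\<in>UNIV - {j}. b $ i - a $ i)"
    have P: "P \<ge> 0" unfolding P_def using ab by (intro prod_nonneg) (auto intro: less_imp_le)
    \<comment> \<open>The slabs \<open>S1 k\<close> and \<open>S2 k\<close> along the two faces
      orthogonal to direction \<open>j\<close> contain all points of the box at which the partial
      derivative of the cutoff can be nonzero.\<close>
    define S1 where "S1 k = cbox a (\<chi> i. if i = j then a $ j + 2 * r k else b $ i)" for k
    define S2 where "S2 k = cbox (\<chi> i. if i = j then b $ j - 2 * r k else a $ i) b" for k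
    have mS: "measure lborel (S1 k) = 2 * r k * P" "measure lborel (S2 k) = 2 * r k * P" for k
      unfolding S1_def S2_def P_def using ab r(1)[of k]
      by ((subst emeasure_box_cart(4); auto simp: less_imp_le), (subst prod.remove[of UNIV j]; auto intro!: prod.cong))+
    have uc: "uniformly_continuous_on (cbox a b) \<phi>'"
      by (rule compact_uniformly_continuous[OF continuous_on_subset[OF cont]]) auto
    have "T \<longlonglongrightarrow> 0"
    proof (rule LIMSEQ_I)
      fix e :: real assume e: "e > 0"
      \<comment> \<open>The product is the layer volume \<open>4 * r k * P\<close> times the
        derivative bound \<open>cutL / r k\<close> times the bound of \<open>\<psi>\<close>; adding
        1 makes \<open>c\<close> positive.\<close>
      define c where "c = cutL * B\<psi> * (4 * P) + 1"
      have c: "c > 0" using cutL_nonneg B\<psi>n P unfolding c_def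
        by (meson add_nonneg_pos mult_nonneg_nonneg zero_le_numeral zero_less_one)
      define \<epsilon> where "\<epsilon> = e / c"
      have \<epsilon>: "\<epsilon> > 0" using e c by (simp add: \<epsilon>_def)
      obtain \<delta> where \<delta>: "\<delta> > 0" "\<And>x y. x \<in> cbox a b \<Longrightarrow> y \<in> cbox a b \<Longrightarrow> dist y x < \<delta> \<Longrightarrow> dist (\<phi>' y) (\<phi>' x) < \<epsilon>"
        using uc \<epsilon> unfolding uniformly_continuous_on_def by meson
      have "eventually (\<lambda>k. r k < \<delta> / 2) sequentially" using r(2) \<delta>(1) by (intro order_tendstoD) auto
      then obtain k0 where k0: "\<And>k. k \<ge> k0 \<Longrightarrow> r k < \<delta> / 2" unfolding eventually_sequentially by metis
      have "norm (T k - 0) < e" if k: "k \<ge> k0" for k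
      proof -
        let ?C = "\<epsilon> * (cutL / r k) * B\<psi>"
        have pt: "norm (\<phi>' x $ i * (partial_deriv j (\<eta> k) x * \<psi> x)) \<le> ?C * (indicator (S1 k) x + indicator (S2 k) x)" for x
        proof (cases "x \<in> ?Q \<and> partial_deriv j (\<eta> k) x \<noteq> 0")
          case False
          then have "\<phi>' x $ i * (partial_deriv j (\<eta> k) x * \<psi> x) = 0" by (auto simp: \<phi>'_def)
          moreover have "0 \<le> ?C * (indicator (S1 k) x + indicator (S2 k) x)"
            using \<epsilon> cutL_nonneg r(1)[of k] B\<psi>n by (intro mult_nonneg_nonneg divide_nonneg_pos) auto
          ultimately show ?thesis by (simp only: norm_zero)
        next
          case True
          then have xc: "x \<in> cbox a b" using box_subset_cbox by blast
          have xb: "a $ i \<le> x $ i" "x $ i \<le> b $ i" for i using xc by (auto simp: mem_box_cart)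
          have "\<not> (a $ j + 2 * r k \<le> x $ j \<and> x $ j \<le> b $ j - 2 * r k)"
            using True partial_deriv_cutoff_eq_0[OF r(1)[of k], of a j x b] unfolding \<eta>_def by blast
          then consider "x $ j < a $ j + 2 * r k" | "x $ j > b $ j - 2 * r k" by linarith
          then have "(x \<in> S1 k \<or> x \<in> S2 k) \<and> (\<exists>y\<in>cbox a b. y \<notin> ?Q \<and> dist y x \<le> 2 * r k)"
          proof cases
            case 1
            \<comment> \<open>The projection of \<open>x\<close> onto the nearby face;
              \<open>\<phi>'\<close> vanishes there, so uniform continuity bounds it at
              \<open>x\<close>.\<close>
            define y where "y = (\<chi> i. if i = j then a $ j else x $ i)"
            have "y - x = (a $ j - x $ j) *\<^sub>R axis j 1" by (auto simp: y_def vec_eq_iff axis_def)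
            then have "dist y x \<le> 2 * r k" using 1 xb[of j] by (simp add: dist_norm)
            moreover have "y \<in> cbox a b" using xb ab by (auto simp: y_def mem_box_cart less_imp_le)
            moreover have "y \<notin> ?Q" by (auto simp: y_def mem_box_cart intro!: exI[of _ j])
            moreover have "x \<in> S1 k" using 1 xb by (auto simp: S1_def mem_box_cart)
            ultimately show ?thesis by blast
          next
            case 2
            define y where "y = (\<chi> i. if i = j then b $ j else x $ i)"
            have "y - x = (b $ j - x $ j) *\<^sub>R axis j 1" by (auto simp: y_def vec_eq_iff axis_def)
            then have "dist y x \<le> 2 * r k" using 2 xb[of j] by (simp add: dist_norm)
            moreover have "y \<in> cbox a b" using xb ab by (auto simp: y_def mem_box_cart less_imp_le)
            moreover have "y \<notin> ?Q" by (auto simp: y_def mem_box_cart intro!: exI[of _ j])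
            moreover have "x \<in> S2 k" using 2 xb by (auto simp: S2_def mem_box_cart)
            ultimately show ?thesis by blast
          qed
          then obtain y where S: "x \<in> S1 k \<or> x \<in> S2 k" and y: "y \<in> cbox a b" "y \<notin> ?Q" "dist y x \<le> 2 * r k" by blast
          have "dist (\<phi>' y) (\<phi>' x) < \<epsilon>" using k0[OF k] y by (intro \<delta>(2) xc) auto
          moreover have "\<phi>' y = 0" using y(2) by (simp add: \<phi>'_def)
          ultimately have "norm (\<phi>' x) \<le> \<epsilon>" by (simp add: dist_norm)
          then have 1: "\<bar>\<phi>' x $ i\<bar> \<le> \<epsilon>" using component_le_norm_cart order_trans by blast
          have 2: "\<bar>partial_deriv j (\<eta> k) x\<bar> \<le> cutL / r k" unfolding \<eta>_def by (rule partial_deriv_cutoff_bound[OF r(1)])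
          have "\<bar>\<phi>' x $ i\<bar> * (\<bar>partial_deriv j (\<eta> k) x\<bar> * \<bar>\<psi> x\<bar>) \<le> \<epsilon> * (cutL / r k * B\<psi>)"
            using \<epsilon> B\<psi>n cutL_nonneg r(1)[of k]
            by (intro mult_mono 1 2 B\<psi> mult_nonneg_nonneg) auto
          also have "\<dots> = ?C * 1" by simp
          also have "\<dots> \<le> ?C * (indicator (S1 k) x + indicator (S2 k) x)"
            using S \<epsilon> cutL_nonneg r(1)[of k] B\<psi>n
            by (intro mult_left_mono mult_nonneg_nonneg divide_nonneg_pos) (auto simp: indicator_def)
          finally show ?thesis by (simp add: abs_mult)
        qed
        have iS: "integrable lborel (indicator (S1 k) :: _ \<Rightarrow> real)" "integrable lborel (indicator (S2 k) :: _ \<Rightarrow> real)"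
          unfolding S1_def S2_def by (auto intro!: integrable_real_indicator emeasure_bounded_finite)
        have "norm (T k) \<le> (LINT x|lborel. ?C * (indicator (S1 k) x + indicator (S2 k) x))"
          unfolding T_def
          by (rule Bochner_Integration.integral_norm_bound_integral[OF WG_integrable'(1)[OF WGQ t3] _ pt]) (use iS in simp)
        also have "\<dots> = ?C * (4 * r k * P)"
          using iS mS[of k] by simp
        also have "\<dots> = \<epsilon> * (cutL * B\<psi> * (4 * P))" using r(1)[of k] by (simp add: field_simps)
        also have "\<dots> < \<epsilon> * c" using \<epsilon> by (simp add: c_def)
        also have "\<dots> = e" using c by (simp add: \<epsilon>_def)
        finally show ?thesis by simp
      qed
      then show "\<exists>no. \<forall>n\<ge>no. norm (T n - 0) < e" by blast
    qed
    from tendsto_diff[OF tendsto_minus[OF this] l2]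
    have "(\<lambda>k. LINT x|lborel. \<eta> k x *\<^sub>R (\<phi>' x $ i * partial_deriv j \<psi> x)) \<longlonglongrightarrow> - 0 - (LINT x|lborel. G x $ i $ j * \<psi> x)"
      unfolding eq .
    from LIMSEQ_unique[OF l1 this]
    show "(LINT x|lborel. \<phi>' x $ i * partial_deriv j \<psi> x) = - (LINT x|lborel. G x $ i $ j * \<psi> x)" by simp
  qed
  moreover have "AE x in lborel. x \<in> ?Q \<longrightarrow> weak_gradient ?Q \<phi> x = G x"
    using 1(3) by eventually_elim (simp add: G_def)
  ultimately show thesis
    by (intro that[of \<phi>' G B] cont b) (auto simp: \<phi>'_def G_def)
qed

subsection \<open>Lipschitz representatives\<close>

text \<open>Moving a test function along a segment changes its integral against \<open>w\<close> by an amount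
  controlled by the gradient: the derivative along the segment is an integral against \<open>H\<close>.\<close>

lemma translation_estimate_test:
  fixes w :: "real^'d::finite \<Rightarrow> real^'m::finite" and \<psi> :: "real^'d \<Rightarrow> real"
  assumes wg: "WG D w H" and t: "\<And>s. s \<in> {0..1} \<Longrightarrow> test_function D (\<lambda>x. \<psi> (x - s *\<^sub>R v))"
    and C: "\<And>s. s \<in> {0..1} \<Longrightarrow> \<bar>LINT x|lborel. (H x $ i \<bullet> v) * \<psi> (x - s *\<^sub>R v)\<bar> \<le> C"
  shows "\<bar>(LINT x|lborel. w x $ i * \<psi> (x - v)) - (LINT x|lborel. w x $ i * \<psi> x)\<bar> \<le> C"
proof -
  define F where "F s = (LINT x|lborel. w x $ i * \<psi> (x - s *\<^sub>R v))" for s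
  have \<psi>: "test_function D \<psi>" using t[of 0] by simp
  have s\<psi>: "smooth \<psi>" by (rule test_function_smooth[OF \<psi>])
  note [measurable] = WG_meas(1,2)[OF wg] borel_measurable_continuous_onI[OF smooth_continuous[OF s\<psi>]]
  have mp [measurable]: "partial_deriv j \<psi> \<in> borel_measurable borel" for j
    by (intro borel_measurable_continuous_onI smooth_continuous smooth_partial_deriv s\<psi>)
  obtain K where K: "compact K" "\<And>x. x \<notin> K \<Longrightarrow> \<psi> x = 0" using test_functionE[OF \<psi>] by metis
  from compact_imp_bounded[OF K(1)] obtain R where R: "\<And>x. x \<in> K \<Longrightarrow> norm x \<le> R"
    unfolding bounded_iff by metis
  obtain B where B: "B \<ge> 0" "\<And>x y. \<bar>\<psi> x - \<psi> y\<bar> \<le> B * norm (x - y)"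
    by (rule test_function_lipschitz[OF \<psi>], rule that)
  define Q where "Q s x = (\<Sum>j\<in>UNIV. - v $ j * partial_deriv j \<psi> (x - s *\<^sub>R v))" for s x
  have D1: "(F has_real_derivative (LINT x|lborel. w x $ i * Q s x)) (at s)" for s
    unfolding DERIV_def tendsto_at_iff_sequentially
  proof (intro allI impI)
    fix X :: "nat \<Rightarrow> real" assume X0: "\<forall>n. X n \<in> UNIV - {0}" and X: "X \<longlonglongrightarrow> 0"
    obtain BX where BX: "BX > 0" "\<And>n. norm (X n) \<le> BX"
      using Bseq_def[of X] convergent_imp_Bseq[OF convergentI[OF X]] by metis
    \<comment> \<open>All shifts of \<open>\<psi>\<close> by at most
      \<open>\<bar>s\<bar> + BX\<close> times \<open>v\<close> vanish outside the ball of radius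
      \<open>R'\<close>, which yields an integrable majorant of the difference quotients.\<close>
    define R' where "R' = R + (\<bar>s\<bar> + BX) * norm v"
    obtain Bw where Bw: "\<And>x. norm x \<le> R' \<Longrightarrow> norm (w x) \<le> Bw"
      using WG_meas(3)[OF wg] unfolding bdd_local_def by metis
    define q where "q n x = w x $ i * ((\<psi> (x - (s + X n) *\<^sub>R v) - \<psi> (x - s *\<^sub>R v)) / X n)" for n x
    have shift: "test_function UNIV (\<lambda>x. \<psi> (x - t *\<^sub>R v))" for t
      using test_function_affine_arg[OF \<psi>, of 1 "- t *\<^sub>R v" UNIV] by simp
    have quot: "(F (s + X n) - F s) / X n = (LINT x|lborel. q n x)" for n
      unfolding F_def q_def using WG_integrable(1)[OF wg shift, of i]
      by (simp add: right_diff_distrib diff_divide_distrib)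
    have "(\<lambda>n. LINT x|lborel. q n x) \<longlonglongrightarrow> (LINT x|lborel. w x $ i * Q s x)"
    proof (rule integral_dominated_convergence[where w = "\<lambda>x. (Bw * (B * norm v)) * indicator (cball 0 R') x"])
      show "(\<lambda>x. w x $ i * Q s x) \<in> borel_measurable lborel" unfolding Q_def by measurable
      show "q n \<in> borel_measurable lborel" for n unfolding q_def by measurable
      show "integrable lborel (\<lambda>x. (Bw * (B * norm v)) * indicator (cball 0 R') x :: real)"
        by (intro integrable_mult_right integrable_real_indicator) (simp_all add: emeasure_compact_finite[OF compact_cball, unfolded infinity_ennreal_def])
      show "AE x in lborel. (\<lambda>n. q n x) \<longlonglongrightarrow> w x $ i * Q s x"
      proof (rule AE_I2)
        fix x
        have l: "((\<lambda>t. x - (s + t) *\<^sub>R v) has_derivative (\<lambda>t. - t *\<^sub>R v)) (at 0)"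
          by (auto intro!: derivative_eq_intros)
        have "(\<psi> has_derivative (\<lambda>h. \<Sum>j\<in>UNIV. h $ j * partial_deriv j \<psi> (x - s *\<^sub>R v))) (at (x - (s + 0) *\<^sub>R v))"
          using smooth_has_derivative[OF s\<psi>] by simp
        from has_derivative_compose[OF l this]
        have "((\<lambda>t. \<psi> (x - (s + t) *\<^sub>R v)) has_derivative (\<lambda>t. \<Sum>j\<in>UNIV. (- t *\<^sub>R v) $ j * partial_deriv j \<psi> (x - s *\<^sub>R v))) (at 0)" .
        moreover have "(\<Sum>j\<in>UNIV. (- t *\<^sub>R v) $ j * partial_deriv j \<psi> (x - s *\<^sub>R v)) = Q s x * t" for t
          unfolding Q_def sum_distrib_right by (rule sum.cong) auto
        ultimately have "((\<lambda>t. \<psi> (x - (s + t) *\<^sub>R v)) has_real_derivative Q s x) (at 0)"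
          by (simp only: has_field_derivative_def)
        then have "((\<lambda>t. (\<psi> (x - (s + t) *\<^sub>R v) - \<psi> (x - s *\<^sub>R v)) / t) \<longlongrightarrow> Q s x) (at 0)"
          by (simp add: DERIV_def)
        moreover have "filterlim X (at 0) sequentially"
          using X X0 by (auto simp: filterlim_at)
        ultimately have "(\<lambda>n. (\<psi> (x - (s + X n) *\<^sub>R v) - \<psi> (x - s *\<^sub>R v)) / X n) \<longlonglongrightarrow> Q s x"
          by (rule filterlim_compose)
        then show "(\<lambda>n. q n x) \<longlonglongrightarrow> w x $ i * Q s x" unfolding q_def by (intro tendsto_intros)
      qed
      show "AE x in lborel. norm (q n x) \<le> (Bw * (B * norm v)) * indicator (cball 0 R') x" for n
      proof (rule AE_I2)
        fix x
        show "norm (q n x) \<le> (Bw * (B * norm v)) * indicator (cball 0 R') x"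
        proof (cases "norm x \<le> R'")
          case True
          have X0': "X n \<noteq> 0" using X0 by auto
          have "\<bar>\<psi> (x - (s + X n) *\<^sub>R v) - \<psi> (x - s *\<^sub>R v)\<bar> \<le> B * norm ((x - (s + X n) *\<^sub>R v) - (x - s *\<^sub>R v))"
            by (rule B(2))
          also have "(x - (s + X n) *\<^sub>R v) - (x - s *\<^sub>R v) = - X n *\<^sub>R v" by (simp add: algebra_simps)
          also have "norm (- X n *\<^sub>R v) = \<bar>X n\<bar> * norm v" by simp
          finally have "\<bar>\<psi> (x - (s + X n) *\<^sub>R v) - \<psi> (x - s *\<^sub>R v)\<bar> / \<bar>X n\<bar> \<le> B * norm v"
            using X0' by (simp add: divide_le_eq mult_ac)
          moreover have "\<bar>w x $ i\<bar> \<le> Bw" using Bw[OF True] component_le_norm_cart order_trans by blast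
          ultimately have "\<bar>w x $ i\<bar> * (\<bar>\<psi> (x - (s + X n) *\<^sub>R v) - \<psi> (x - s *\<^sub>R v)\<bar> / \<bar>X n\<bar>) \<le> Bw * (B * norm v)"
            by (intro mult_mono) auto
          then show ?thesis using True by (simp add: q_def abs_mult abs_divide)
        next
          case False
          have "\<psi> (x - t *\<^sub>R v) = 0" if "\<bar>t\<bar> \<le> \<bar>s\<bar> + BX" for t
          proof (rule K(2))
            have "\<bar>t\<bar> * norm v \<le> (\<bar>s\<bar> + BX) * norm v" using that by (intro mult_right_mono) auto
            moreover have "norm x \<le> norm (x - t *\<^sub>R v) + \<bar>t\<bar> * norm v"
              using norm_triangle_ineq[of "x - t *\<^sub>R v" "t *\<^sub>R v"] by simp
            ultimately have "norm (x - t *\<^sub>R v) > R" using False unfolding R'_def by linarith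
            then show "x - t *\<^sub>R v \<notin> K" using R[of "x - t *\<^sub>R v"] by linarith
          qed
          moreover have "\<bar>s + X n\<bar> \<le> \<bar>s\<bar> + BX" "\<bar>s\<bar> \<le> \<bar>s\<bar> + BX" using BX(1) BX(2)[of n] by auto
          ultimately have "q n x = 0" by (simp add: q_def)
          then show ?thesis using False by simp
        qed
      qed
    qed
    then show "((\<lambda>h. (F (s + h) - F s) / h) \<circ> X) \<longlonglongrightarrow> (LINT x|lborel. w x $ i * Q s x)"
      by (simp add: o_def quot)
  qed
  have D2: "(LINT x|lborel. w x $ i * Q s x) = (LINT x|lborel. (H x $ i \<bullet> v) * \<psi> (x - s *\<^sub>R v))" if s: "s \<in> {0..1}" for s
  proof -
    let ?\<psi> = "\<lambda>x. \<psi> (x - s *\<^sub>R v)"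
    have pd: "partial_deriv j ?\<psi> x = partial_deriv j \<psi> (x - s *\<^sub>R v)" for j x
      using partial_deriv_affine_arg[OF smooth_differentiable[OF s\<psi>], of j 1 "- s *\<^sub>R v"] by (simp add: fun_eq_iff)
    have i1: "integrable lborel (\<lambda>x. w x $ i * partial_deriv j ?\<psi> x)" for j
      by (rule WG_integrable'(3)[OF wg t[OF s]])
    have i2: "integrable lborel (\<lambda>x. H x $ i $ j * ?\<psi> x)" for j
      by (rule WG_integrable'(2)[OF wg t[OF s]])
    have "(LINT x|lborel. w x $ i * Q s x) = (LINT x|lborel. (\<Sum>j\<in>UNIV. - v $ j * (w x $ i * partial_deriv j ?\<psi> x)))"
      by (simp add: Q_def pd sum_distrib_left mult_ac)
    also have "\<dots> = (\<Sum>j\<in>UNIV. - v $ j * (LINT x|lborel. w x $ i * partial_deriv j ?\<psi> x))"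
      using i1 by (subst Bochner_Integration.integral_sum) auto
    also have "\<dots> = (\<Sum>j\<in>UNIV. v $ j * (LINT x|lborel. H x $ i $ j * ?\<psi> x))"
      unfolding WG_weak[OF wg t[OF s]] by simp
    also have "\<dots> = (LINT x|lborel. (\<Sum>j\<in>UNIV. v $ j * (H x $ i $ j * ?\<psi> x)))"
      using i2 by (subst Bochner_Integration.integral_sum) auto
    also have "\<dots> = (LINT x|lborel. (H x $ i \<bullet> v) * ?\<psi> x)"
      by (simp add: inner_vec_def sum_distrib_right sum_distrib_left mult_ac)
    finally show ?thesis .
  qed
  have "norm (F 1 - F 0) \<le> C * norm (1 - 0 :: real)"
  proof (rule field_differentiable_bound[where S = "{0..1}" and f' = "\<lambda>s. LINT x|lborel. w x $ i * Q s x"])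
    show "(F has_field_derivative (LINT x|lborel. w x $ i * Q s x)) (at s within {0..1})" for s
      by (rule has_field_derivative_at_within[OF D1])
    show "norm (LINT x|lborel. w x $ i * Q s x) \<le> C" if "s \<in> {0..1}" for s
      using C[OF that] unfolding D2[OF that] by simp
  qed auto
  then show ?thesis by (simp add: F_def)
qed

text \<open>The estimate for test functions is applied to cutoffs of a moving cube, which stays in
  the box by convexity. Letting the layer width tend to 0 turns cutoffs into indicators;
  \<open>CARD('m)\<close> comes from summing over the components.\<close>

lemma translation_estimate:
  fixes w :: "real^'d::finite \<Rightarrow> real^'m::finite"
  assumes wg: "WG (box p q) w H" and h: "h > 0"
    and x: "box x (x + vec h) \<subseteq> box p q" and xv: "box (x + v) (x + v + vec h) \<subseteq> box p q"
    and C: "\<And>s. s \<in> {0..1} \<Longrightarrow>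
       (LINT z|lborel. indicator (box (x + s *\<^sub>R v) (x + s *\<^sub>R v + vec h)) z * norm (H z)) * norm v \<le> C"
  shows "norm ((LINT z|lborel. indicator (box (x + v) (x + v + vec h)) z *\<^sub>R w z)
      - (LINT z|lborel. indicator (box x (x + vec h)) z *\<^sub>R w z)) \<le> real CARD('m) * C"
proof -
  note [measurable] = WG_meas(1,2)[OF wg]
  define r where "r k = inverse (real (Suc k))" for k
  have r: "r k > 0" "r \<longlonglongrightarrow> 0" for k unfolding r_def by (rule inverse_Suc_seq)+
  have sub: "box (x + s *\<^sub>R v) (x + s *\<^sub>R v + vec h) \<subseteq> box p q" if s: "s \<in> {0..1}" for s
  proof
    fix z assume z: "z \<in> box (x + s *\<^sub>R v) (x + s *\<^sub>R v + vec h)"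
    have 1: "z - s *\<^sub>R v \<in> box x (x + vec h)" using z by (simp add: mem_box_cart algebra_simps)
    have 2: "z - s *\<^sub>R v + v \<in> box (x + v) (x + v + vec h)" using 1 by (simp add: mem_box_cart algebra_simps)
    have "(1 - s) *\<^sub>R (z - s *\<^sub>R v) + s *\<^sub>R (z - s *\<^sub>R v + v) \<in> box p q"
      using convex_box(2)[of p q] 1 2 x xv s unfolding convex_alt by (meson atLeastAtMost_iff subsetD)
    also have "(1 - s) *\<^sub>R (z - s *\<^sub>R v) + s *\<^sub>R (z - s *\<^sub>R v + v) = z" by (simp add: algebra_simps)
    finally show "z \<in> box p q" .
  qed
  have int: "integrable lborel (\<lambda>z. indicator (box a b) z *\<^sub>R f z)"
    if [measurable]: "f \<in> borel_measurable borel" and bl: "bdd_local f"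
    for a b and f :: "real^'d \<Rightarrow> 'c::euclidean_space"
  proof -
    from bounded_box[of a b] obtain R where R: "\<And>z. z \<in> box a b \<Longrightarrow> norm z \<le> R" unfolding bounded_iff by metis
    obtain Bf where Bf: "\<And>z. norm z \<le> R \<Longrightarrow> norm (f z) \<le> Bf" using bl unfolding bdd_local_def by metis
    show ?thesis
    proof (rule integrableI_bounded_set[where A = "box a b" and B = Bf])
      show "emeasure lborel (box a b) < \<infinity>" by (rule emeasure_bounded_finite[OF bounded_box])
    qed (use R Bf in auto)
  qed
  have shift: "cutoff x (x + vec h) (r k) (z - s *\<^sub>R v) = cutoff (x + s *\<^sub>R v) (x + s *\<^sub>R v + vec h) (r k) z" for k s z
    unfolding cutoff_def by (rule prod.cong) (auto simp: algebra_simps)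
  have comp: "\<bar>(LINT z|lborel. indicator (box (x + v) (x + v + vec h)) z * w z $ i)
      - (LINT z|lborel. indicator (box x (x + vec h)) z * w z $ i)\<bar> \<le> C" for i
  proof -
    let ?\<psi> = "\<lambda>k. cutoff x (x + vec h) (r k)"
    have k: "\<bar>(LINT z|lborel. w z $ i * ?\<psi> k (z - v)) - (LINT z|lborel. w z $ i * ?\<psi> k z)\<bar> \<le> C" for k
    proof (rule translation_estimate_test[OF wg])
      fix s :: real assume s: "s \<in> {0..1}"
      let ?B = "box (x + s *\<^sub>R v) (x + s *\<^sub>R v + vec h)"
      show t: "test_function (box p q) (\<lambda>z. ?\<psi> k (z - s *\<^sub>R v))"
        unfolding shift by (rule test_function_mono[OF cutoff_test_function[OF r(1)] sub[OF s]])
      have I: "integrable lborel (\<lambda>z. indicator ?B z * norm (H z))"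
        using integrable_norm[OF int[OF _ WG_meas(4)[OF wg], of "x + s *\<^sub>R v" "x + s *\<^sub>R v + vec h"]] by simp
      have J: "integrable lborel (\<lambda>z. (H z $ i \<bullet> v) * ?\<psi> k (z - s *\<^sub>R v))"
      proof -
        have "integrable lborel (\<lambda>z. \<Sum>j\<in>UNIV. v $ j * (H z $ i $ j * ?\<psi> k (z - s *\<^sub>R v)))"
          by (intro Bochner_Integration.integrable_sum integrable_mult_right WG_integrable'(2)[OF wg t])
        then show ?thesis by (simp add: inner_vec_def sum_distrib_right mult_ac)
      qed
      have "\<bar>LINT z|lborel. (H z $ i \<bullet> v) * ?\<psi> k (z - s *\<^sub>R v)\<bar> \<le> (LINT z|lborel. (indicator ?B z * norm (H z)) * norm v)"
        unfolding real_norm_def[symmetric]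
      proof (rule Bochner_Integration.integral_norm_bound_integral[OF J integrable_mult_left[OF I]])
        fix z
        have "\<bar>H z $ i \<bullet> v\<bar> \<le> norm (H z $ i) * norm v" by (rule Cauchy_Schwarz_ineq2)
        also have "\<dots> \<le> norm (H z) * norm v" by (intro mult_right_mono Finite_Cartesian_Product.norm_nth_le) auto
        finally have 1: "\<bar>H z $ i \<bullet> v\<bar> \<le> norm (H z) * norm v" .
        have "\<bar>H z $ i \<bullet> v\<bar> * ?\<psi> k (z - s *\<^sub>R v) \<le> (norm (H z) * norm v) * indicator ?B z"
          unfolding shift by (intro mult_mono 1 cutoff_le_indicator r cutoff_bounds) auto
        then show "norm ((H z $ i \<bullet> v) * ?\<psi> k (z - s *\<^sub>R v)) \<le> indicator ?B z * norm (H z) * norm v"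
          using cutoff_bounds(1)[of x "x + vec h" "r k" "z - s *\<^sub>R v"] by (simp add: abs_mult mult_ac)
      qed
      also have "\<dots> = (LINT z|lborel. indicator ?B z * norm (H z)) * norm v" by simp
      also have "\<dots> \<le> C" by (rule C[OF s])
      finally show "\<bar>LINT z|lborel. (H z $ i \<bullet> v) * ?\<psi> k (z - s *\<^sub>R v)\<bar> \<le> C" .
    qed
    define W where "W z = indicator (box p q) z *\<^sub>R w z $ i" for z
    have W: "integrable lborel W" unfolding W_def
      by (rule int[OF _ bdd_local_vec_nth[OF WG_meas(3)[OF wg]]]) measurable
    have l: "(\<lambda>k. LINT z|lborel. cutoff a (a + vec h) (r k) z *\<^sub>R W z) \<longlonglongrightarrow> (LINT z|lborel. indicator (box a (a + vec h)) z *\<^sub>R W z)" for a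
      by (rule cutoff_integral_tendsto[OF W r])
    have c1: "cutoff a (a + vec h) (r k) z *\<^sub>R W z = w z $ i * cutoff a (a + vec h) (r k) z"
      if a: "box a (a + vec h) \<subseteq> box p q" for a k z
    proof (cases "z \<in> box p q")
      case False
      then have "z \<notin> box a (a + vec h)" using a by blast
      then have "cutoff a (a + vec h) (r k) z \<le> 0"
        using cutoff_le_indicator[OF r(1)[of k], of a "a + vec h" z] by simp
      then have "cutoff a (a + vec h) (r k) z = 0" using cutoff_bounds(1)[of a "a + vec h" "r k" z] by linarith
      then show ?thesis by simp
    qed (simp add: W_def)
    have c2: "indicator (box a (a + vec h)) z *\<^sub>R W z = indicator (box a (a + vec h)) z * w z $ i"
      if a: "box a (a + vec h) \<subseteq> box p q" for a z
      using a by (auto simp: W_def indicator_def)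
    have L0: "(\<lambda>k. LINT z|lborel. w z $ i * ?\<psi> k z) \<longlonglongrightarrow> (LINT z|lborel. indicator (box x (x + vec h)) z * w z $ i)"
      using l[of x] unfolding c1[OF x] c2[OF x] .
    have L1: "(\<lambda>k. LINT z|lborel. w z $ i * ?\<psi> k (z - v)) \<longlonglongrightarrow> (LINT z|lborel. indicator (box (x + v) (x + v + vec h)) z * w z $ i)"
      using l[of "x + v"] unfolding c1[OF xv] c2[OF xv] using shift[of _ _ 1] by simp
    show ?thesis
      by (rule LIMSEQ_le_const2[OF tendsto_rabs[OF tendsto_diff[OF L1 L0]]]) (use k in auto)
  qed
  let ?I = "\<lambda>a. LINT z|lborel. indicator (box a (a + vec h)) z *\<^sub>R w z"
  have nth: "?I a $ i = (LINT z|lborel. indicator (box a (a + vec h)) z * w z $ i)" for a i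
    using integral_bounded_linear[OF bounded_linear_vec_nth int[OF WG_meas(1)[OF wg] WG_meas(3)[OF wg], of a "a + vec h"], of i]
    by simp
  have "norm (?I (x + v) - ?I x) \<le> (\<Sum>i\<in>UNIV. \<bar>(?I (x + v) - ?I x) $ i\<bar>)" by (rule norm_le_l1_cart)
  also have "\<dots> \<le> (\<Sum>i\<in>(UNIV::'m set). C)"
    by (rule sum_mono) (use comp nth in simp)
  finally show ?thesis by simp
qed

lemma integrable_indicator_box:
  fixes f :: "real^'d::finite \<Rightarrow> 'c::euclidean_space"
  assumes [measurable]: "f \<in> borel_measurable borel" and bl: "bdd_local f"
  shows "integrable lborel (\<lambda>z. indicator (box a b) z *\<^sub>R f z)"
proof -
  from bounded_box[of a b] obtain R where R: "\<And>z. z \<in> box a b \<Longrightarrow> norm z \<le> R" unfolding bounded_iff by metis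
  obtain Bf where Bf: "\<And>z. norm z \<le> R \<Longrightarrow> norm (f z) \<le> Bf" using bl unfolding bdd_local_def by metis
  show ?thesis
  proof (rule integrableI_bounded_set[where A = "box a b" and B = Bf])
    show "emeasure lborel (box a b) < \<infinity>" by (rule emeasure_bounded_finite[OF bounded_box])
  qed (use R Bf in auto)
qed

lemma norm_triangle_3:
  fixes x y a b :: "'a::euclidean_space"
  shows "norm (x - y) \<le> norm (a - x) + norm (b - y) + norm (b - a)"
  by norm

text \<open>At two Lebesgue points the values of \<open>w\<close> are limits of averages over small
  cubes, and translating one cube to the other changes the average by at most the Lipschitz bound.
  The resulting Lipschitz function on the Lebesgue points is then extended.\<close>

lemma WG_lipschitz_rep:
  fixes w :: "real^'d::finite \<Rightarrow> real^'m::finite"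
  assumes wg: "WG (box p q) w H" and M: "AE x in lborel. x \<in> box p q \<longrightarrow> norm (H x) \<le> M" "M \<ge> 0"
  obtains g where "\<And>x y. norm (g x - g y) \<le> real CARD('m) * M * norm (x - y)"
    "AE x in lborel. x \<in> box p q \<longrightarrow> w x = g x"
proof (cases "box p q = {}")
  case True
  then show thesis using M by (intro that[of "\<lambda>_. 0"]) auto
next
  case ne: False
  note [measurable] = WG_meas(1,2)[OF wg]
  let ?L = "real CARD('m) * M"
  let ?I = "\<lambda>x h. LINT z|lborel. indicator (box x (x + vec h)) z *\<^sub>R w z"
  define F where "F z = indicator (box p q) z *\<^sub>R w z" for z
  have intF: "integrable lborel F" unfolding F_def
    by (rule integrable_indicator_box) (use WG_meas[OF wg] in auto)
  define A where "A x \<longleftrightarrow> (\<forall>e>0. \<exists>d>0. \<forall>h. 0 < h \<and> h < d \<longrightarrow>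
     norm ((LINT z|lborel. indicator (box x (x + vec h)) z *\<^sub>R F z) /\<^sub>R h ^ CARD('d) - F x) < e)" for x
  have AE_A: "AE x in lborel. A x" unfolding A_def by (rule lebesgue_points[OF intF])
  have IF: "(LINT z|lborel. indicator (box x (x + vec h)) z *\<^sub>R F z) = ?I x h" if "box x (x + vec h) \<subseteq> box p q" for x h
    by (rule Bochner_Integration.integral_cong) (use that in \<open>auto simp: F_def indicator_def\<close>)
  have lip: "dist (w x) (w y) \<le> ?L * dist x y" if xy: "x \<in> box p q" "y \<in> box p q" "A x" "A y" for x y
  proof (rule field_le_epsilon)
    fix e :: real assume e: "e > 0"
    obtain d1 where d1: "d1 > 0" "\<And>h. 0 < h \<Longrightarrow> h < d1 \<Longrightarrow> box x (x + vec h) \<subseteq> box p q"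
      by (rule open_contains_small_cubes[OF open_box xy(1)], rule that)
    obtain d2 where d2: "d2 > 0" "\<And>h. 0 < h \<Longrightarrow> h < d2 \<Longrightarrow> box y (y + vec h) \<subseteq> box p q"
      by (rule open_contains_small_cubes[OF open_box xy(2)], rule that)
    have "e / 2 > 0" using e by simp
    from xy(3)[unfolded A_def, rule_format, OF this] obtain d3 where d3: "d3 > 0"
      "\<And>h. 0 < h \<and> h < d3 \<Longrightarrow> norm ((LINT z|lborel. indicator (box x (x + vec h)) z *\<^sub>R F z) /\<^sub>R h ^ CARD('d) - F x) < e / 2" by blast
    from xy(4)[unfolded A_def, rule_format, OF \<open>e / 2 > 0\<close>] obtain d4 where d4: "d4 > 0"
      "\<And>h. 0 < h \<and> h < d4 \<Longrightarrow> norm ((LINT z|lborel. indicator (box y (y + vec h)) z *\<^sub>R F z) /\<^sub>R h ^ CARD('d) - F y) < e / 2" by blast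
    define h where "h = Min {d1, d2, d3, d4} / 2"
    have h: "0 < h" "h < d1" "h < d2" "h < d3" "h < d4" using d1(1) d2(1) d3(1) d4(1) by (auto simp: h_def)
    define v where "v = y - x"
    have xv: "x + v = y" by (simp add: v_def)
    note bx = d1(2)[OF h(1,2)] and by' = d2(2)[OF h(1,3)]
    have hp: "h ^ CARD('d) > 0" using h(1) by simp
    have T: "norm (?I (x + v) h - ?I x h) \<le> real CARD('m) * (M * h ^ CARD('d) * norm v)"
    proof (rule translation_estimate[OF wg h(1) bx])
      show "box (x + v) (x + v + vec h) \<subseteq> box p q" unfolding xv by (rule by')
      fix s :: real assume s: "s \<in> {0..1}"
      let ?B = "box (x + s *\<^sub>R v) (x + s *\<^sub>R v + vec h)"
      have sub: "?B \<subseteq> box p q"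
      proof
        fix z assume z: "z \<in> ?B"
        have 1: "z - s *\<^sub>R v \<in> box x (x + vec h)" using z by (simp add: mem_box_cart algebra_simps)
        have 2: "z - s *\<^sub>R v + v \<in> box y (y + vec h)" using 1 unfolding v_def by (simp add: mem_box_cart algebra_simps)
        have "(1 - s) *\<^sub>R (z - s *\<^sub>R v) + s *\<^sub>R (z - s *\<^sub>R v + v) \<in> box p q"
          using convex_box(2)[of p q] 1 2 bx by' s unfolding convex_alt by (meson atLeastAtMost_iff subsetD)
        also have "(1 - s) *\<^sub>R (z - s *\<^sub>R v) + s *\<^sub>R (z - s *\<^sub>R v + v) = z" by (simp add: algebra_simps)
        finally show "z \<in> box p q" .
      qed
      have iH: "integrable lborel (\<lambda>z. indicator ?B z * norm (H z))"
        using integrable_norm[OF integrable_indicator_box[OF WG_meas(2,4)[OF wg], of "x + s *\<^sub>R v" "x + s *\<^sub>R v + vec h"]] by simp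
      have "(LINT z|lborel. indicator ?B z * norm (H z)) \<le> (LINT z|lborel. M * indicator ?B z)"
      proof (rule integral_mono_AE[OF iH])
        show "integrable lborel (\<lambda>z. M * indicator ?B z)"
          by (intro integrable_mult_right integrable_real_indicator) (simp_all add: emeasure_bounded_finite[OF bounded_box, unfolded infinity_ennreal_def])
        show "AE z in lborel. indicator ?B z * norm (H z) \<le> M * indicator ?B z"
          using M(1) by eventually_elim (use sub in \<open>auto simp: indicator_def\<close>)
      qed
      also have "\<dots> = M * h ^ CARD('d)" using measure_cube(1)[of h "x + s *\<^sub>R v"] h(1) by simp
      finally show "(LINT z|lborel. indicator ?B z * norm (H z)) * norm v \<le> M * h ^ CARD('d) * norm v"
        by (rule mult_right_mono) simp
    qed
    have "norm ((?I y h - ?I x h) /\<^sub>R h ^ CARD('d)) = norm (?I y h - ?I x h) / h ^ CARD('d)"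
      using hp by (simp add: divide_inverse)
    also have "\<dots> \<le> real CARD('m) * (M * h ^ CARD('d) * norm v) / h ^ CARD('d)"
      using T hp unfolding xv by (intro divide_right_mono) auto
    also have "\<dots> = ?L * norm v" using h(1) by simp
    finally have 1: "norm (?I y h /\<^sub>R h ^ CARD('d) - ?I x h /\<^sub>R h ^ CARD('d)) \<le> ?L * norm v"
      by (simp add: scaleR_diff_right)
    have 2: "norm (?I x h /\<^sub>R h ^ CARD('d) - w x) < e / 2" "norm (?I y h /\<^sub>R h ^ CARD('d) - w y) < e / 2"
      using d3(2)[of h] d4(2)[of h] h IF[OF bx] IF[OF by'] xy(1,2) by (auto simp: F_def)
    have "dist (w x) (w y) \<le> norm (?I x h /\<^sub>R h ^ CARD('d) - w x) + norm (?I y h /\<^sub>R h ^ CARD('d) - w y)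
       + norm (?I y h /\<^sub>R h ^ CARD('d) - ?I x h /\<^sub>R h ^ CARD('d))"
      unfolding dist_norm by (rule norm_triangle_3)
    also have "\<dots> \<le> ?L * dist x y + e" using 1 2 by (simp add: v_def dist_norm norm_minus_commute)
    finally show "dist (w x) (w y) \<le> ?L * dist x y + e" .
  qed
  define S where "S = {x \<in> box p q. A x}"
  have L: "?L-lipschitz_on S w"
    by (rule lipschitz_onI) (use lip M in \<open>auto simp: S_def\<close>)
  obtain g0 where g0: "?L-lipschitz_on (closure S) g0" "\<And>x. x \<in> S \<Longrightarrow> g0 x = w x"
    using lipschitz_extend_closure[OF L] by blast
  \<comment> \<open>The Lebesgue points have full measure in the box and are therefore dense in
    it.\<close>
  have cl: "cbox p q \<subseteq> closure S"
  proof -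
    have "box p q \<subseteq> closure S"
    proof
      fix x assume x: "x \<in> box p q"
      show "x \<in> closure S" unfolding closure_approachable
      proof (intro allI impI)
        fix e :: real assume "e > 0"
        have "open (ball x e \<inter> box p q)" "x \<in> ball x e \<inter> box p q" using \<open>e > 0\<close> x by auto
        then have "open (ball x e \<inter> box p q)" "ball x e \<inter> box p q \<noteq> {}" by blast+
        then have nn: "\<not> negligible (ball x e \<inter> box p q)" by (rule open_not_negligible)
        have "\<exists>y. y \<in> ball x e \<inter> box p q \<and> A y"
        proof (rule ccontr)
          assume "\<not> ?thesis"
          then have n: "\<And>y. y \<in> ball x e \<inter> box p q \<Longrightarrow> \<not> A y" by blast
          from AE_A have "AE y in lborel. y \<notin> ball x e \<inter> box p q" by eventually_elim (use n in blast)
          then have "ball x e \<inter> box p q \<in> null_sets lborel"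
            by (subst AE_iff_null_sets) simp_all
          then have "ball x e \<inter> box p q \<in> null_sets lebesgue" by (rule null_sets_completionI)
          then show False using nn negligible_iff_null_sets by blast
        qed
        then show "\<exists>y\<in>S. dist y x < e" by (auto simp: S_def dist_commute)
      qed
    qed
    then show ?thesis using closure_box[OF ne] closure_minimal by (metis closed_closure)
  qed
  have ne': "cbox p q \<noteq> {}" using ne box_subset_cbox by blast
  \<comment> \<open>The projection onto the closed box does not increase distances, so composing
    with it extends \<open>g0\<close> to the whole space with the same constant.\<close>
  define g where "g x = g0 (closest_point (cbox p q) x)" for x
  have "norm (g x - g y) \<le> ?L * norm (x - y)" for x y
  proof -
    have "dist (g x) (g y) \<le> ?L * dist (closest_point (cbox p q) x) (closest_point (cbox p q) y)"
      unfolding g_def using cl closest_point_in_set[OF closed_cbox ne']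
      by (intro lipschitz_onD[OF g0(1)]) auto
    also have "\<dots> \<le> ?L * dist x y"
      using M by (intro mult_left_mono closest_point_lipschitz closed_cbox convex_box ne') auto
    finally show ?thesis by (simp add: dist_norm)
  qed
  moreover have "AE x in lborel. x \<in> box p q \<longrightarrow> w x = g x"
    using AE_A
  proof eventually_elim
    case (elim x)
    show ?case
    proof
      assume x: "x \<in> box p q"
      then have "closest_point (cbox p q) x = x" using box_subset_cbox by (intro closest_point_self) blast
      then show "w x = g x" using g0(2)[of x] elim x by (simp add: g_def S_def)
    qed
  qed
  ultimately show thesis by (rule that)
qed

text \<open>A small mean gradient forces a small oscillation. The value of \<open>g\<close> at a
  point differs from its average over a subcube of side \<open>r * h\<close> near it by
  \<open>L\<close> times the subcube's size, and two such averages differ by at most a multiple of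
  the integral of the gradient divided by the subcube volume. The first error is small with
  \<open>r\<close>, the second with \<open>\<kappa>\<close> once \<open>r\<close> is fixed.\<close>

lemma oscillation_estimate:
  fixes w :: "real^'d::finite \<Rightarrow> real^'m::finite"
  assumes wg: "WG (box p (p + vec h)) w H" and h: "h > 0"
    and g: "\<And>x y. norm (g x - g y) \<le> L * norm (x - y)" "AE x in lborel. x \<in> box p (p + vec h) \<longrightarrow> w x = g x" "L \<ge> 0"
    and r: "0 < r" "r < 1"
    and \<kappa>: "(LINT z|lborel. indicator (box p (p + vec h)) z * norm (H z)) \<le> \<kappa> * h ^ CARD('d)"
    and x: "x \<in> box p (p + vec h)" and y: "y \<in> box p (p + vec h)"
  shows "norm (g x - g y) \<le> (2 * L * CARD('d) * r + real CARD('m) * CARD('d) * \<kappa> / r ^ CARD('d)) * h"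
proof -
  let ?Q = "box p (p + vec h)" and ?d = "real CARD('d)"
  note [measurable] = WG_meas(1,2)[OF wg]
  define \<rho> where "\<rho> = r * h"
  have \<rho>: "\<rho> > 0" "\<rho> < h" using r h by (auto simp: \<rho>_def)
  \<comment> \<open>The homothety with centre \<open>p\<close> and ratio \<open>1 - r\<close> places
    the corner so that the subcube of side \<open>r * h\<close> stays in the cube and remains close
    to \<open>x\<close>. Being affine, it also describes the intermediate positions of the subcube
    between \<open>a x\<close> and \<open>a y\<close>.\<close>
  define a where "a x = p + (1 - r) *\<^sub>R (x - p)" for x
  let ?I = "\<lambda>a. LINT z|lborel. indicator (box a (a + vec \<rho>)) z *\<^sub>R w z"
  have sub: "box (a x) (a x + vec \<rho>) \<subseteq> ?Q" and near: "\<And>z. z \<in> box (a x) (a x + vec \<rho>) \<Longrightarrow> norm (z - x) \<le> ?d * \<rho>"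
    if x: "x \<in> ?Q" for x
  proof -
    have xi: "0 < x $ i - p $ i" "x $ i - p $ i < h" for i
    proof -
      have "p $ i < x $ i \<and> x $ i < p $ i + h" using x by (simp add: mem_box_cart)
      then show "0 < x $ i - p $ i" "x $ i - p $ i < h" by auto
    qed
    have rx: "0 < r * (x $ i - p $ i)" "r * (x $ i - p $ i) < \<rho>" for i
      using xi[of i] r by (auto simp: \<rho>_def)
    have z: "x $ i - \<rho> < z $ i \<and> z $ i < x $ i + \<rho> \<and> p $ i < z $ i \<and> z $ i < p $ i + h" if "z \<in> box (a x) (a x + vec \<rho>)" for z i
    proof -
      have zi: "a x $ i < z $ i" "z $ i < a x $ i + \<rho>" using that by (auto simp: mem_box_cart)
      have ai: "a x $ i = x $ i - r * (x $ i - p $ i)" by (simp add: a_def algebra_simps)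
      have "a x $ i - p $ i = (1 - r) * (x $ i - p $ i)" by (simp add: a_def)
      moreover have "0 \<le> (1 - r) * (x $ i - p $ i)" "(1 - r) * (x $ i - p $ i) \<le> (1 - r) * h"
        using xi[of i] r by (auto intro!: mult_nonneg_nonneg mult_left_mono)
      moreover have "(1 - r) * h = h - \<rho>" by (simp add: \<rho>_def algebra_simps)
      ultimately show ?thesis using zi ai rx[of i] by linarith
    qed
    then show "box (a x) (a x + vec \<rho>) \<subseteq> ?Q" by (auto simp: mem_box_cart subset_iff)
    fix w assume w: "w \<in> box (a x) (a x + vec \<rho>)"
    have "norm (w - x) \<le> (\<Sum>i\<in>UNIV. \<bar>(w - x) $ i\<bar>)" by (rule norm_le_l1_cart)
    also have "\<dots> \<le> (\<Sum>i\<in>(UNIV::'d set). \<rho>)"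
    proof (rule sum_mono)
      fix i show "\<bar>(w - x) $ i\<bar> \<le> \<rho>" using z[OF w, of i] by auto
    qed
    finally show "norm (w - x) \<le> ?d * \<rho>" by simp
  qed
  have \<rho>p: "\<rho> ^ CARD('d) > 0" using \<rho> by simp
  have avg: "norm (?I (a x) /\<^sub>R \<rho> ^ CARD('d) - g x) \<le> L * (?d * \<rho>)" if x: "x \<in> ?Q" for x
  proof -
    let ?B = "box (a x) (a x + vec \<rho>)"
    have fin: "emeasure lborel ?B < \<infinity>" by (rule emeasure_bounded_finite[OF bounded_box])
    have iI: "integrable lborel (indicator ?B :: _ \<Rightarrow> real)" by (intro integrable_real_indicator fin) simp
    have i1: "integrable lborel (\<lambda>z. indicator ?B z *\<^sub>R w z)"
      by (rule integrable_indicator_box) (use WG_meas[OF wg] in auto)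
    have i2: "integrable lborel (\<lambda>z. indicator ?B z *\<^sub>R g x)" by (intro integrable_scaleR_left iI)
    have v: "(LINT z|lborel. indicator ?B z *\<^sub>R g x) = \<rho> ^ CARD('d) *\<^sub>R g x"
      using iI measure_cube(1)[of \<rho> "a x"] \<rho> by simp
    have "norm (?I (a x) - \<rho> ^ CARD('d) *\<^sub>R g x) = norm (LINT z|lborel. indicator ?B z *\<^sub>R (w z - g x))"
      using Bochner_Integration.integral_diff[OF i1 i2] v by (simp add: scaleR_diff_right)
    also have "\<dots> \<le> (LINT z|lborel. norm (indicator ?B z *\<^sub>R (w z - g x)))" by (rule integral_norm_bound)
    also have "\<dots> \<le> (LINT z|lborel. (L * (?d * \<rho>)) * indicator ?B z)"
    proof (rule integral_mono_AE)
      show "integrable lborel (\<lambda>z. norm (indicator ?B z *\<^sub>R (w z - g x)))"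
        using integrable_norm[OF Bochner_Integration.integrable_diff[OF i1 i2]] by (simp add: scaleR_diff_right)
      show "integrable lborel (\<lambda>z. (L * (?d * \<rho>)) * indicator ?B z)" by (intro integrable_mult_right iI)
      show "AE z in lborel. norm (indicator ?B z *\<^sub>R (w z - g x)) \<le> (L * (?d * \<rho>)) * indicator ?B z"
        using g(2)
      proof eventually_elim
        case (elim z)
        show ?case
        proof (cases "z \<in> ?B")
          case True
          have "norm (g z - g x) \<le> L * norm (z - x)" by (rule g(1))
          also have "\<dots> \<le> L * (?d * \<rho>)" using near[OF x True] g(3) by (intro mult_left_mono) auto
          finally show ?thesis using True elim sub[OF x] by auto
        qed simp
      qed
    qed
    also have "\<dots> = (L * (?d * \<rho>)) * \<rho> ^ CARD('d)" using measure_cube(1)[of \<rho> "a x"] \<rho> by simp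
    finally have *: "norm (?I (a x) - \<rho> ^ CARD('d) *\<^sub>R g x) \<le> (L * (?d * \<rho>)) * \<rho> ^ CARD('d)" .
    have "?I (a x) /\<^sub>R \<rho> ^ CARD('d) - g x = (?I (a x) - \<rho> ^ CARD('d) *\<^sub>R g x) /\<^sub>R \<rho> ^ CARD('d)"
      using less_imp_neq[OF \<rho>p] by (simp add: scaleR_diff_right)
    then have "norm (?I (a x) /\<^sub>R \<rho> ^ CARD('d) - g x) = norm (?I (a x) - \<rho> ^ CARD('d) *\<^sub>R g x) / \<rho> ^ CARD('d)"
      using \<rho>p by (simp add: divide_inverse)
    also have "\<dots> \<le> L * (?d * \<rho>)" using * \<rho>p by (simp add: divide_le_eq)
    finally show ?thesis .
  qed
  define v where "v = a y - a x"
  have v: "v = (1 - r) *\<^sub>R (y - x)" by (simp add: v_def a_def algebra_simps)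
  have nv: "norm v \<le> ?d * h"
  proof -
    have "norm (y - x) \<le> (\<Sum>i\<in>UNIV. \<bar>(y - x) $ i\<bar>)" by (rule norm_le_l1_cart)
    also have "\<dots> \<le> (\<Sum>i\<in>(UNIV::'d set). h)"
    proof (rule sum_mono)
      fix i
      have "p $ i < x $ i \<and> x $ i < p $ i + h" "p $ i < y $ i \<and> y $ i < p $ i + h" using x y by (simp_all add: mem_box_cart)
      then show "\<bar>(y - x) $ i\<bar> \<le> h" by auto
    qed
    finally have "norm (y - x) \<le> ?d * h" by simp
    then show ?thesis unfolding v using r mult_mono[of "1 - r" 1 "norm (y - x)" "?d * h"] by simp
  qed
  have av: "a x + v = a y" by (simp add: v_def)
  have iQ: "integrable lborel (\<lambda>z. indicator ?Q z * norm (H z))"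
    using integrable_norm[OF integrable_indicator_box[OF WG_meas(2,4)[OF wg], of p "p + vec h"]] by simp
  have IQ0: "0 \<le> (LINT z|lborel. indicator ?Q z * norm (H z))" by (rule integral_nonneg_AE) simp
  have T: "norm (?I (a x + v) - ?I (a x)) \<le> real CARD('m) * (\<kappa> * h ^ CARD('d) * (?d * h))"
  proof (rule translation_estimate[OF wg \<rho>(1) sub[OF x]])
    show "box (a x + v) (a x + v + vec \<rho>) \<subseteq> ?Q" unfolding av by (rule sub[OF y])
    fix s :: real assume s: "s \<in> {0..1}"
    have "(1 - s) *\<^sub>R x + s *\<^sub>R y \<in> ?Q"
      using convex_box(2)[of p "p + vec h"] x y s unfolding convex_alt by auto
    moreover have "a x + s *\<^sub>R v = a ((1 - s) *\<^sub>R x + s *\<^sub>R y)" by (simp add: v a_def algebra_simps)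
    ultimately have sb: "box (a x + s *\<^sub>R v) (a x + s *\<^sub>R v + vec \<rho>) \<subseteq> ?Q" using sub by metis
    let ?B = "box (a x + s *\<^sub>R v) (a x + s *\<^sub>R v + vec \<rho>)"
    have "integrable lborel (\<lambda>z. indicator ?B z * norm (H z))"
      using integrable_norm[OF integrable_indicator_box[OF WG_meas(2,4)[OF wg], of "a x + s *\<^sub>R v" "a x + s *\<^sub>R v + vec \<rho>"]] by simp
    then have "(LINT z|lborel. indicator ?B z * norm (H z)) \<le> (LINT z|lborel. indicator ?Q z * norm (H z))"
      using iQ by (rule integral_mono) (use sb in \<open>auto simp: indicator_def\<close>)
    then have "(LINT z|lborel. indicator ?B z * norm (H z)) * norm v \<le> (LINT z|lborel. indicator ?Q z * norm (H z)) * (?d * h)"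
      using nv IQ0 by (intro mult_mono) auto
    also have "\<dots> \<le> \<kappa> * h ^ CARD('d) * (?d * h)" using \<kappa> h by (intro mult_right_mono) auto
    finally show "(LINT z|lborel. indicator ?B z * norm (H z)) * norm v \<le> \<kappa> * h ^ CARD('d) * (?d * h)" .
  qed
  have "norm (?I (a y) /\<^sub>R \<rho> ^ CARD('d) - ?I (a x) /\<^sub>R \<rho> ^ CARD('d)) = norm (?I (a y) - ?I (a x)) / \<rho> ^ CARD('d)"
  proof -
    have "?I (a y) /\<^sub>R \<rho> ^ CARD('d) - ?I (a x) /\<^sub>R \<rho> ^ CARD('d) = inverse (\<rho> ^ CARD('d)) *\<^sub>R (?I (a y) - ?I (a x))"
      by (rule scaleR_diff_right[symmetric])
    moreover have "norm (inverse (\<rho> ^ CARD('d)) *\<^sub>R (?I (a y) - ?I (a x))) = \<bar>inverse (\<rho> ^ CARD('d))\<bar> * norm (?I (a y) - ?I (a x))"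
      by (rule norm_scaleR)
    moreover have "\<bar>inverse (\<rho> ^ CARD('d))\<bar> = inverse (\<rho> ^ CARD('d))" using \<rho>p by simp
    ultimately show ?thesis by (simp only: divide_inverse mult.commute)
  qed
  also have "\<dots> \<le> real CARD('m) * (\<kappa> * h ^ CARD('d) * (?d * h)) / \<rho> ^ CARD('d)"
    using T \<rho>p unfolding av by (intro divide_right_mono) auto
  also have "\<dots> = real CARD('m) * CARD('d) * \<kappa> / r ^ CARD('d) * h"
    using h r by (simp add: \<rho>_def power_mult_distrib field_simps)
  finally have D: "norm (?I (a y) /\<^sub>R \<rho> ^ CARD('d) - ?I (a x) /\<^sub>R \<rho> ^ CARD('d)) \<le> real CARD('m) * CARD('d) * \<kappa> / r ^ CARD('d) * h" .
  have "norm (g x - g y) \<le> norm (?I (a x) /\<^sub>R \<rho> ^ CARD('d) - g x) + norm (?I (a y) /\<^sub>R \<rho> ^ CARD('d) - g y)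
     + norm (?I (a y) /\<^sub>R \<rho> ^ CARD('d) - ?I (a x) /\<^sub>R \<rho> ^ CARD('d))" by (rule norm_triangle_3)
  also have "\<dots> \<le> L * (?d * \<rho>) + L * (?d * \<rho>) + real CARD('m) * CARD('d) * \<kappa> / r ^ CARD('d) * h"
    by (intro add_mono avg x y D)
  also have "\<dots> = (2 * L * CARD('d) * r + real CARD('m) * CARD('d) * \<kappa> / r ^ CARD('d)) * h"
    by (simp add: \<rho>_def algebra_simps)
  finally show ?thesis .
qed

subsection \<open>Gradients with values in a closed convex set\<close>

text \<open>A hyperplane separating the mean strictly from \<open>S\<close> would separate it from
  almost all values that carry weight.\<close>

lemma integral_in_closed_convex:
  fixes H :: "'a \<Rightarrow> 'b::euclidean_space" and \<psi> :: "'a \<Rightarrow> real"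
  assumes S: "closed S" "convex S" and \<psi>: "\<And>x. \<psi> x \<ge> 0" "integrable M \<psi>" "(LINT x|M. \<psi> x) = 1"
    and H: "integrable M (\<lambda>x. \<psi> x *\<^sub>R H x)" "AE x in M. \<psi> x \<noteq> 0 \<longrightarrow> H x \<in> S"
  shows "(LINT x|M. \<psi> x *\<^sub>R H x) \<in> S"
proof (rule ccontr)
  assume "(LINT x|M. \<psi> x *\<^sub>R H x) \<notin> S"
  from separating_hyperplane_closed_point[OF S(2,1) this] obtain a b where
    ab: "a \<bullet> (LINT x|M. \<psi> x *\<^sub>R H x) < b" "\<forall>x\<in>S. b < a \<bullet> x" by blast
  have "b = (LINT x|M. \<psi> x * b)" using \<psi> by simp
  also have "\<dots> \<le> (LINT x|M. a \<bullet> (\<psi> x *\<^sub>R H x))"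
  proof (rule integral_mono_AE)
    show "integrable M (\<lambda>x. \<psi> x * b)" using \<psi>(2) by simp
    show "integrable M (\<lambda>x. a \<bullet> (\<psi> x *\<^sub>R H x))" using H(1) by (rule integrable_inner_right)
    show "AE x in M. \<psi> x * b \<le> a \<bullet> (\<psi> x *\<^sub>R H x)"
      using H(2)
    proof eventually_elim
      case (elim x)
      show ?case
      proof (cases "\<psi> x = 0")
        case False
        then have "b \<le> a \<bullet> H x" using elim ab(2) less_imp_le by blast
        then show ?thesis using \<psi>(1)[of x] by (simp add: mult_left_mono)
      qed simp
    qed
  qed
  also have "\<dots> = a \<bullet> (LINT x|M. \<psi> x *\<^sub>R H x)" using H(1) by (intro integral_inner_right)
  finally show False using ab(1) by simp
qed

lemma WG_integrable_vec:
  fixes w :: "real^'d::finite \<Rightarrow> real^'m::finite"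
  assumes "WG D w H" "test_function E \<psi>"
  shows "integrable lborel (\<lambda>x. \<psi> x *\<^sub>R H x)" "(LINT x|lborel. \<psi> x *\<^sub>R H x) $ i $ j = (LINT x|lborel. H x $ i $ j * \<psi> x)"
proof -
  obtain K where K: "compact K" "\<And>x. x \<notin> K \<Longrightarrow> \<psi> x = 0" using test_functionE[OF assms(2)] by metis
  show I: "integrable lborel (\<lambda>x. \<psi> x *\<^sub>R H x)"
    by (rule integrable_mult_test[OF WG_meas(2)[OF assms(1)] WG_meas(4)[OF assms(1)] smooth_continuous[OF test_function_smooth[OF assms(2)]] K])
  have "bounded_linear (\<lambda>A :: real^'d^'m. A $ i $ j)"
    by (rule bounded_linear_compose[OF bounded_linear_vec_nth bounded_linear_vec_nth])
  from integral_bounded_linear[OF this I]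
  show "(LINT x|lborel. \<psi> x *\<^sub>R H x) $ i $ j = (LINT x|lborel. H x $ i $ j * \<psi> x)"
    by (simp add: mult.commute)
qed

text \<open>Weighted means of the gradients \<open>H\<close> lie in \<open>S\<close> by convexity.
  Moving the derivative onto the test function shows that they converge to the means of
  \<open>G\<close>, and these determine \<open>G\<close> almost everywhere.\<close>

lemma WG_limit_closed_convex:
  fixes u :: "real^'d::finite \<Rightarrow> real^'m::finite"
  assumes D: "open D" and S: "closed S" "convex S" and u: "WG D u G"
    and approx: "\<And>e. e > 0 \<Longrightarrow> \<exists>v H. WG D v H \<and> (AE x in lborel. x \<in> D \<longrightarrow> H x \<in> S) \<and>
       (\<integral>\<^sup>+ x. ennreal (norm (v x - u x)) * indicator D x \<partial>lborel) \<le> ennreal e"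
  shows "AE x in lborel. x \<in> D \<longrightarrow> G x \<in> S"
proof (rule open_AE_boxes[OF D])
  fix p q :: "real^'d" assume pq: "cbox p q \<subseteq> D"
  note [measurable] = WG_meas(1,2)[OF u]
  have iF: "integrable lborel (\<lambda>x. indicator (cbox p q) x *\<^sub>R G x)"
  proof -
    obtain R where R: "\<And>x. x \<in> cbox p q \<Longrightarrow> norm x \<le> R" using bounded_cbox[of p q] unfolding bounded_iff by metis
    obtain B where B: "\<And>x. norm x \<le> R \<Longrightarrow> norm (G x) \<le> B" using WG_meas(4)[OF u] unfolding bdd_local_def by metis
    show ?thesis
    proof (rule integrableI_bounded_set[where A = "cbox p q" and B = B])
      show "emeasure lborel (cbox p q) < \<infinity>" by (rule emeasure_bounded_finite[OF bounded_cbox])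
    qed (use R B in auto)
  qed
  show "AE x in lborel. x \<in> box p q \<longrightarrow> G x \<in> S"
  proof (rule fundamental_lemma_box[OF iF _ S(1)])
    fix \<psi> :: "real^'d \<Rightarrow> real"
    assume \<psi>: "test_function (box p q) \<psi>" "\<And>x. 0 \<le> \<psi> x" "(LINT x|lborel. \<psi> x) = 1"
    have \<psi>D: "test_function D \<psi>" by (rule test_function_mono[OF \<psi>(1)]) (use pq box_subset_cbox in blast)
    obtain K where K: "compact K" "K \<subseteq> box p q" "\<And>x. x \<notin> K \<Longrightarrow> \<psi> x = 0" "\<And>j x. x \<notin> K \<Longrightarrow> partial_deriv j \<psi> x = 0"
      using test_functionE[OF \<psi>(1)] by metis
    have e: "\<psi> x *\<^sub>R (indicator (cbox p q) x *\<^sub>R G x) = \<psi> x *\<^sub>R G x" for x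
      using K(2) K(3)[of x] box_subset_cbox[of p q] by (cases "x \<in> K") (auto simp: indicator_def)
    have "\<exists>B. \<forall>x. \<bar>partial_deriv j \<psi> x\<bar> \<le> B" for j
    proof -
      have "compact (partial_deriv j \<psi> ` K)"
        by (intro compact_continuous_image K smooth_continuous smooth_partial_deriv test_function_smooth[OF \<psi>(1)])
      from compact_imp_bounded[OF this] obtain B where B: "\<forall>x\<in>partial_deriv j \<psi> ` K. norm x \<le> B"
        unfolding bounded_iff ..
      have "\<bar>partial_deriv j \<psi> x\<bar> \<le> max B 0" for x
        using B K(4)[of x j] by (cases "x \<in> K") auto
      then show ?thesis by blast
    qed
    then obtain Bj where Bj: "\<And>j x. \<bar>partial_deriv j \<psi> x\<bar> \<le> Bj j" by metis
    define B where "B = (\<Sum>j\<in>UNIV. Bj j)"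
    have Bj0: "Bj j \<ge> 0" for j using Bj[of j 0] by linarith
    have B: "\<bar>partial_deriv j \<psi> x\<bar> \<le> B" for j x
    proof -
      have "Bj j \<le> B" unfolding B_def by (rule member_le_sum) (simp_all add: Bj0)
      with Bj[of j x] show ?thesis by linarith
    qed
    have B0: "B \<ge> 0" unfolding B_def using Bj0 by (intro sum_nonneg) auto
    have "(LINT x|lborel. \<psi> x *\<^sub>R G x) \<in> closure S"
      unfolding closure_approachable
    proof (intro allI impI)
      fix e :: real assume e0: "e > 0"
      \<comment> \<open>\<open>CARD('m) * CARD('d)\<close> counts the matrix entries and
        \<open>B\<close> bounds the derivatives of \<open>\<psi>\<close>; the factor 2 makes the
        final inequality strict.\<close>
      define e' where "e' = e / (2 * (real CARD('m) * real CARD('d)) * (B + 1))"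
      have e': "e' > 0" unfolding e'_def using e0 B0 by (intro divide_pos_pos mult_pos_pos) auto
      obtain v H where v: "WG D v H" "AE x in lborel. x \<in> D \<longrightarrow> H x \<in> S"
         "(\<integral>\<^sup>+ x. ennreal (norm (v x - u x)) * indicator D x \<partial>lborel) \<le> ennreal e'"
        using approx[OF e'] by blast
      note [measurable] = WG_meas(1,2)[OF v(1)]
      have "(LINT x|lborel. \<psi> x *\<^sub>R H x) \<in> S"
      proof (rule integral_in_closed_convex[OF S \<psi>(2) integrable_test[OF \<psi>(1)] \<psi>(3) WG_integrable_vec(1)[OF v(1) \<psi>(1)]])
        show "AE x in lborel. \<psi> x \<noteq> 0 \<longrightarrow> H x \<in> S"
          using v(2)
        proof eventually_elim
          case (elim x)
          then show ?case using K(2) K(3)[of x] pq box_subset_cbox[of p q] by blast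
        qed
      qed
      moreover have "dist (LINT x|lborel. \<psi> x *\<^sub>R H x) (LINT x|lborel. \<psi> x *\<^sub>R G x) < e"
      proof -
        let ?A = "(LINT x|lborel. \<psi> x *\<^sub>R H x) - (LINT x|lborel. \<psi> x *\<^sub>R G x)"
        have c: "\<bar>?A $ i $ j\<bar> \<le> B * e'" for i j
        proof -
          note i1 = WG_integrable'(3)[OF v(1) \<psi>D, of i j] and i2 = WG_integrable'(3)[OF u \<psi>D, of i j]
          have "?A $ i $ j = (LINT x|lborel. u x $ i * partial_deriv j \<psi> x) - (LINT x|lborel. v x $ i * partial_deriv j \<psi> x)"
            unfolding vector_minus_component WG_integrable_vec(2)[OF v(1) \<psi>(1)] WG_integrable_vec(2)[OF u \<psi>(1)]
              WG_weak[OF u \<psi>D] WG_weak[OF v(1) \<psi>D] by simp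
          also have "\<dots> = (LINT x|lborel. u x $ i * partial_deriv j \<psi> x - v x $ i * partial_deriv j \<psi> x)"
            using i1 i2 by simp
          finally have A: "?A $ i $ j = (LINT x|lborel. u x $ i * partial_deriv j \<psi> x - v x $ i * partial_deriv j \<psi> x)" .
          have "ennreal \<bar>LINT x|lborel. u x $ i * partial_deriv j \<psi> x - v x $ i * partial_deriv j \<psi> x\<bar>
             \<le> (\<integral>\<^sup>+ x. ennreal \<bar>u x $ i * partial_deriv j \<psi> x - v x $ i * partial_deriv j \<psi> x\<bar> \<partial>lborel)"
            using integral_norm_bound_ennreal[OF Bochner_Integration.integrable_diff[OF i2 i1]] by simp
          also have "\<dots> \<le> (\<integral>\<^sup>+ x. ennreal B * (ennreal (norm (v x - u x)) * indicator D x) \<partial>lborel)"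
          proof (rule nn_integral_mono)
            fix x
            show "ennreal \<bar>u x $ i * partial_deriv j \<psi> x - v x $ i * partial_deriv j \<psi> x\<bar> \<le> ennreal B * (ennreal (norm (v x - u x)) * indicator D x)"
            proof (cases "x \<in> K")
              case True
              then have xD: "x \<in> D" using K(2) pq box_subset_cbox by blast
              have "\<bar>u x $ i * partial_deriv j \<psi> x - v x $ i * partial_deriv j \<psi> x\<bar> = \<bar>(v x - u x) $ i\<bar> * \<bar>partial_deriv j \<psi> x\<bar>"
                by (simp add: abs_mult[symmetric] algebra_simps abs_minus_commute)
              also have "\<dots> \<le> norm (v x - u x) * B"
                by (intro mult_mono component_le_norm_cart B) auto
              finally show ?thesis using xD B0 by (simp add: ennreal_mult''[symmetric] mult.commute ennreal_leI)
            qed (simp add: K(4))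
          qed
          also have "\<dots> = ennreal B * (\<integral>\<^sup>+ x. ennreal (norm (v x - u x)) * indicator D x \<partial>lborel)"
            using D by (intro nn_integral_cmult) measurable
          also have "\<dots> \<le> ennreal B * ennreal e'" by (rule mult_left_mono[OF v(3)]) simp
          also have "\<dots> = ennreal (B * e')" using B0 e' by (simp add: ennreal_mult'')
          finally have "ennreal \<bar>LINT x|lborel. u x $ i * partial_deriv j \<psi> x - v x $ i * partial_deriv j \<psi> x\<bar> \<le> ennreal (B * e')" .
          then have "\<bar>LINT x|lborel. u x $ i * partial_deriv j \<psi> x - v x $ i * partial_deriv j \<psi> x\<bar> \<le> B * e'"
            using B0 e' by (subst (asm) ennreal_le_iff) auto
          then show ?thesis unfolding A .
        qed
        have "norm ?A \<le> (\<Sum>i\<in>UNIV. norm (?A $ i))"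
          unfolding norm_vec_def[of ?A] by (rule L2_set_le_sum) simp
        also have "\<dots> \<le> (\<Sum>i\<in>(UNIV::'m set). \<Sum>j\<in>(UNIV::'d set). B * e')"
          by (intro sum_mono order_trans[OF norm_le_l1_cart] c)
        also have "\<dots> = (real CARD('m) * real CARD('d)) * B * e'" by simp
        also have "\<dots> \<le> (real CARD('m) * real CARD('d)) * (B + 1) * e'"
          using e' by (intro mult_right_mono mult_left_mono) auto
        also have "\<dots> = ((2 * (real CARD('m) * real CARD('d)) * (B + 1)) * e') / 2" by simp
        also have "(2 * (real CARD('m) * real CARD('d)) * (B + 1)) * e' = e" unfolding e'_def
        proof (rule nonzero_mult_div_cancel_left[of _ e, unfolded times_divide_eq_right[symmetric]])
          have "B + 1 > 0" using B0 by linarith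
          then show "2 * (real CARD('m) * real CARD('d)) * (B + 1) \<noteq> 0" by simp
        qed
        also have "e / 2 < e" using e0 by simp
        finally show ?thesis by (simp add: dist_norm)
      qed
      ultimately show "\<exists>y\<in>S. dist y (LINT x|lborel. \<psi> x *\<^sub>R G x) < e" by blast
    qed
    then show "(LINT x|lborel. \<psi> x *\<^sub>R (indicator (cbox p q) x *\<^sub>R G x)) \<in> S" unfolding e using S(1) by simp
  qed (use box_subset_cbox in auto)
qed

section \<open>Matrices, integer grids and cutoffs of cubes\<close>

lemma norm_matrix_vector_mult_le:
  fixes A :: "real^'d::finite^'m::finite"
  shows "norm (A *v x) \<le> norm A * norm x"
proof -
  have "norm (A *v x) = L2_set (\<lambda>i. \<bar>A $ i \<bullet> x\<bar>) UNIV"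
    unfolding norm_vec_def by (simp add: matrix_vector_mult_def inner_vec_def)
  also have "\<dots> \<le> L2_set (\<lambda>i. norm (A $ i) * norm x) UNIV"
    by (rule L2_set_mono) (simp_all add: Cauchy_Schwarz_ineq2)
  also have "\<dots> = norm A * norm x" unfolding norm_vec_def[of A] by (rule L2_set_left_distrib[symmetric]) simp
  finally show ?thesis .
qed

definition int_vec :: "int ^ 'd::finite \<Rightarrow> real ^ 'd" where "int_vec k = (\<chi> i. of_int (k $ i))"

lemma int_vec_nth [simp]: "int_vec k $ i = of_int (k $ i)" by (simp add: int_vec_def)

text \<open>The faces of a grid lie in countably many hyperplanes. Open grid cubes therefore contain
  almost every point.\<close>

lemma AE_coord_not_Ints:
  assumes "N > 0"
  shows "AE x in lborel. \<forall>i. (x :: real^'d::finite) $ i / N \<notin> \<int>"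
proof -
  have "AE x in lborel. \<forall>z::int. x $ i \<noteq> of_int z * N" for i :: 'd
    unfolding AE_all_countable
  proof
    fix z :: int
    have "negligible {x::real^'d. x \<bullet> axis i 1 = of_int z * N}" by (rule negligible_standard_hyperplane) (simp add: axis_in_Basis_iff)
    then have "negligible {x::real^'d. x $ i = of_int z * N}" by (simp add: inner_axis)
    then have "{x::real^'d. x $ i = of_int z * N} \<in> null_sets lebesgue" by (simp add: negligible_iff_null_sets)
    then have "AE x in lebesgue. (x::real^'d) \<notin> {x. x $ i = of_int z * N}" by (rule AE_not_in)
    then show "AE x in lborel. (x::real^'d) $ i \<noteq> of_int z * N" by (simp add: AE_completion_iff)
  qed
  then have "AE x in lborel. \<forall>i. \<forall>z::int. (x::real^'d) $ i \<noteq> of_int z * N"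
    unfolding AE_all_countable by blast
  then show ?thesis
  proof eventually_elim
    case (elim x)
    show ?case
    proof (intro allI notI)
      fix i assume "x $ i / N \<in> \<int>"
      then obtain z where "x $ i / N = of_int z" by (rule Ints_cases)
      then have "x $ i = of_int z * N" using assms by (simp add: field_simps)
      with elim show False by blast
    qed
  qed
qed

lemma cell_eq_box: "n \<ge> 1 \<Longrightarrow> cell n = box 0 (vec (real n) :: real^'d::finite)"
proof -
  assume n: "n \<ge> 1"
  show "cell n = box 0 (vec (real n) :: real^'d)"
  proof (intro set_eqI iffI)
    fix x :: "real^'d" assume "x \<in> cell n"
    then show "x \<in> box 0 (vec (real n))" using n by (auto simp: cell_def unit_cell_def mem_box_cart)
  next
    fix x :: "real^'d" assume "x \<in> box 0 (vec (real n))"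
    then have "(1 / real n) *\<^sub>R x \<in> unit_cell" using n by (auto simp: unit_cell_def mem_box_cart)
    moreover have "x = real n *\<^sub>R ((1 / real n) *\<^sub>R x)" using n by simp
    ultimately show "x \<in> cell n" unfolding cell_def by blast
  qed
qed

text \<open>\<open>r\<close> is the layer width relative to the side: the transition takes place
  between the depths \<open>r * h\<close> and \<open>2 * r * h\<close>, and \<open>4 * r < 1\<close>
  leaves an inner cube of positive side.\<close>

lemma cutoff_cube:
  fixes p :: "real^'d::finite"
  assumes h: "h > 0" and r: "0 < r" "4 * r < 1"
  shows "test_function (box p (p + vec h)) (cutoff p (p + vec h) (r * h))"
    "x \<notin> box p (p + vec h) \<Longrightarrow> cutoff p (p + vec h) (r * h) x = 0"
    "x \<notin> box p (p + vec h) \<Longrightarrow> grad (cutoff p (p + vec h) (r * h)) x = 0"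
    "x \<in> box (p + vec (2 * (r * h))) (p + vec (h - 2 * (r * h))) \<Longrightarrow> cutoff p (p + vec h) (r * h) x = 1"
    "x \<in> box (p + vec (2 * (r * h))) (p + vec (h - 2 * (r * h))) \<Longrightarrow> grad (cutoff p (p + vec h) (r * h)) x = 0"
    "norm (grad (cutoff p (p + vec h) (r * h)) x) \<le> real CARD('d) * (cutL / (r * h))"
proof -
  let ?\<eta> = "cutoff p (p + vec h) (r * h)"
  have rh: "r * h > 0" "4 * (r * h) < h" using r h by auto
  show t: "test_function (box p (p + vec h)) ?\<eta>" by (rule cutoff_test_function[OF rh(1)])
  show "?\<eta> x = 0" "grad ?\<eta> x = 0" if "x \<notin> box p (p + vec h)"
  proof -
    obtain L where L: "L \<subseteq> box p (p + vec h)" "\<And>x. x \<notin> L \<Longrightarrow> ?\<eta> x = 0" "\<And>j x. x \<notin> L \<Longrightarrow> partial_deriv j ?\<eta> x = 0"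
      using test_functionE[OF t] by metis
    have "x \<notin> L" using that L(1) by blast
    then show "?\<eta> x = 0" "grad ?\<eta> x = 0" using L(2,3) by (auto simp: grad_def vec_eq_iff)
  qed
  show "?\<eta> x = 1" "grad ?\<eta> x = 0" if "x \<in> box (p + vec (2 * (r * h))) (p + vec (h - 2 * (r * h)))"
  proof -
    have xi: "p $ i + 2 * (r * h) \<le> x $ i" "x $ i \<le> (p + vec h) $ i - 2 * (r * h)" for i
    proof -
      have "p $ i + 2 * (r * h) < x $ i \<and> x $ i < p $ i + (h - 2 * (r * h))" using that by (simp add: mem_box_cart)
      then show "p $ i + 2 * (r * h) \<le> x $ i" "x $ i \<le> (p + vec h) $ i - 2 * (r * h)" by auto
    qed
    show "?\<eta> x = 1" by (rule cutoff_eq_1[OF rh(1) xi])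
    have "partial_deriv j ?\<eta> x = 0" for j
      using xi[of j] by (intro partial_deriv_cutoff_eq_0[OF rh(1)]) blast
    then show "grad ?\<eta> x = 0" by (simp add: grad_def vec_eq_iff)
  qed
  show "norm (grad ?\<eta> x) \<le> real CARD('d) * (cutL / (r * h))"
    by (rule norm_grad_le[OF partial_deriv_cutoff_bound[OF rh(1)]])
qed

lemma inner_cube:
  fixes p :: "real^'d::finite"
  assumes h: "h > 0" and r: "0 < r" "4 * r < 1"
  shows "box (p + vec (2 * (r * h))) (p + vec (h - 2 * (r * h))) =
     box (p + vec (2 * (r * h))) ((p + vec (2 * (r * h))) + vec (h - 4 * (r * h)))"
    "box (p + vec (2 * (r * h))) (p + vec (h - 2 * (r * h))) \<subseteq> box p (p + vec h)"
    "emeasure lborel (box (p + vec (2 * (r * h))) (p + vec (h - 2 * (r * h)))) = ennreal ((h - 4 * (r * h)) ^ CARD('d))"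
proof -
  have rh: "r * h > 0" "4 * (r * h) < h" using r h by auto
  show 1: "box (p + vec (2 * (r * h))) (p + vec (h - 2 * (r * h))) =
     box (p + vec (2 * (r * h))) ((p + vec (2 * (r * h))) + vec (h - 4 * (r * h)))"
    by (rule arg_cong2[where f = box]) (auto simp: vec_eq_iff)
  show "box (p + vec (2 * (r * h))) (p + vec (h - 2 * (r * h))) \<subseteq> box p (p + vec h)"
  proof
    fix x assume x: "x \<in> box (p + vec (2 * (r * h))) (p + vec (h - 2 * (r * h)))"
    show "x \<in> box p (p + vec h)" unfolding mem_box_cart
    proof
      fix i
      have "p $ i + 2 * (r * h) < x $ i \<and> x $ i < p $ i + (h - 2 * (r * h))" using x by (simp add: mem_box_cart)
      then show "p $ i < x $ i \<and> x $ i < (p + vec h) $ i" using rh by simp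
    qed
  qed
  have "0 \<le> h - 4 * (r * h)" using rh(2) by linarith
  then show "emeasure lborel (box (p + vec (2 * (r * h))) (p + vec (h - 2 * (r * h)))) = ennreal ((h - 4 * (r * h)) ^ CARD('d))"
    unfolding 1 by (rule measure_cube(2))
qed

section \<open>The integrand on compact subsets of the interior of \<open>C\<close>\<close>

locale homogenization =
  fixes C :: "(real ^ 'd::finite ^ 'm::finite) set"
    and W :: "real ^ 'd \<Rightarrow> real ^ 'd ^ 'm \<Rightarrow> ennreal"
  assumes bounded_C: "bounded C" and convex_C: "convex C" and zero_C: "0 \<in> interior C"
    and W_measurable: "(\<lambda>(x, \<xi>). W x \<xi>) \<in> borel_measurable borel"
    and periodic: "\<And>x z \<xi>. (\<forall>i. z $ i \<in> \<int>) \<Longrightarrow> W (x + z) \<xi> = W x \<xi>"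
    and dom: "\<And>x. effective_dom (W x) \<subseteq> closure C"
    and cond1: "\<forall>\<delta>::real. \<delta> > 0 \<longrightarrow> (\<exists>\<eta>::real. \<eta> > 0 \<and>
           (\<forall>x. \<forall>\<xi> \<in> effective_dom (W x). \<forall>t \<in> {0..<1}.
              1 - t \<le> \<eta> \<longrightarrow> W x (t *\<^sub>R \<xi>) \<le> W x \<xi> + ennreal \<delta>))"
    and cond2: "\<forall>K. compact K \<and> K \<subseteq> interior C \<longrightarrow> Linfty_loc_ennreal (\<lambda>x. SUP \<xi> \<in> K. W x \<xi>)"
begin

lemma W_comp_measurable:
  assumes "f \<in> borel_measurable M" "g \<in> borel_measurable M"
  shows "(\<lambda>x. W (f x) (g x)) \<in> borel_measurable M"
proof -
  have "(\<lambda>x. (f x, g x)) \<in> borel_measurable M" by (rule borel_measurable_Pair[OF assms])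
  from measurable_compose[OF this W_measurable] show ?thesis by simp
qed

lemma compact_closure_C: "compact (closure C)" using bounded_C by (simp add: compact_closure)

text \<open>Scaling a point of the closure towards the interior point 0 moves it into the interior.
  These are the convex compact sets in which all gluing takes place.\<close>

lemma shrunk:
  assumes "0 \<le> t" "t < 1"
  shows "compact ((\<lambda>\<xi>. t *\<^sub>R \<xi>) ` closure C)" "convex ((\<lambda>\<xi>. t *\<^sub>R \<xi>) ` closure C)"
    "(\<lambda>\<xi>. t *\<^sub>R \<xi>) ` closure C \<subseteq> interior C"
proof -
  show "compact ((\<lambda>\<xi>. t *\<^sub>R \<xi>) ` closure C)" by (rule compact_scaling[OF compact_closure_C])
  show "convex ((\<lambda>\<xi>. t *\<^sub>R \<xi>) ` closure C)" by (rule convex_scaling[OF convex_closure[OF convex_C]])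
  show "(\<lambda>\<xi>. t *\<^sub>R \<xi>) ` closure C \<subseteq> interior C"
  proof safe
    fix \<xi> assume "\<xi> \<in> closure C"
    from mem_interior_closure_convex_shrink[OF convex_C zero_C this, of "1 - t"] assms
    show "t *\<^sub>R \<xi> \<in> interior C" by (simp add: algebra_simps)
  qed
qed

text \<open>The local bound is used on the closed unit cube only and carried to the whole space by
  periodicity. Since condition (2) bounds a supremum, the exceptional null set does not depend on
  the matrix.\<close>

lemma W_bounded_compact:
  assumes K: "compact K" "K \<subseteq> interior C"
  obtains M where "M \<ge> 0" "AE x in lborel. \<forall>\<xi>\<in>K. W x \<xi> \<le> ennreal M"
proof -
  let ?Q = "cbox 0 (vec 1) :: (real^'d) set"
  have "Linfty_loc_ennreal (\<lambda>x. SUP \<xi> \<in> K. W x \<xi>)" using cond2 K by blast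
  then obtain B where "AE x in lebesgue_on ?Q. (SUP \<xi> \<in> K. W x \<xi>) \<le> ennreal B"
    unfolding Linfty_loc_ennreal_def using compact_cbox by blast
  then have B: "AE x in lborel. x \<in> ?Q \<longrightarrow> (SUP \<xi> \<in> K. W x \<xi>) \<le> ennreal B"
    by (subst (asm) AE_lebesgue_on_iff) auto
  \<comment> \<open>Countably many integer translates of the exceptional set still form a null
    set.\<close>
  have "AE x in lborel. \<forall>k::int^'d. x - int_vec k \<in> ?Q \<longrightarrow> (SUP \<xi> \<in> K. W (x - int_vec k) \<xi>) \<le> ennreal B"
    unfolding AE_all_countable
  proof
    fix k :: "int^'d"
    from AE_lborel_affine[OF B, of 1 "- int_vec k"]
    show "AE x in lborel. x - int_vec k \<in> ?Q \<longrightarrow> (SUP \<xi> \<in> K. W (x - int_vec k) \<xi>) \<le> ennreal B" by simp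
  qed
  then have "AE x in lborel. \<forall>\<xi>\<in>K. W x \<xi> \<le> ennreal (max B 0)"
  proof eventually_elim
    case (elim x)
    define k :: "int^'d" where "k = (\<chi> i. \<lfloor>x $ i\<rfloor>)"
    have "x - int_vec k \<in> ?Q" by (auto simp: mem_box_cart k_def) linarith
    then have le: "(SUP \<xi> \<in> K. W (x - int_vec k) \<xi>) \<le> ennreal B" using elim by blast
    show ?case
    proof
      fix \<xi> assume "\<xi> \<in> K"
      have "W x \<xi> = W ((x - int_vec k) + int_vec k) \<xi>" by simp
      also have "\<dots> = W (x - int_vec k) \<xi>" by (rule periodic) simp
      also have "\<dots> \<le> (SUP \<xi> \<in> K. W (x - int_vec k) \<xi>)" using \<open>\<xi> \<in> K\<close> by (rule SUP_upper)
      also have "\<dots> \<le> ennreal (max B 0)" using le by (rule order_trans) (rule ennreal_leI, simp)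
      finally show "W x \<xi> \<le> ennreal (max B 0)" .
    qed
  qed
  then show thesis by (intro that[of "max B 0"]) auto
qed

text \<open>The margin \<open>\<rho>\<close> absorbs the extra gradient term of a gluing. The same
  \<open>M\<close> serves all \<open>\<epsilon>\<close>, because rescaling preserves null
  sets.\<close>

lemma W_bounded_nbhd:
  assumes K: "compact K" "K \<subseteq> interior C"
  obtains \<rho> M where "\<rho> > 0" "M \<ge> 0"
    "\<And>\<epsilon>. \<epsilon> > 0 \<Longrightarrow> AE x in lborel. \<forall>\<xi>\<in>K. \<forall>\<zeta>. norm \<zeta> \<le> \<rho> \<longrightarrow> W (x /\<^sub>R \<epsilon>) (\<xi> + \<zeta>) \<le> ennreal M"
proof -
  obtain \<rho> where \<rho>: "\<rho> > 0" "(\<Union>x\<in>K. cball x \<rho>) \<subseteq> interior C"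
    by (rule compact_subset_open_imp_cball_epsilon_subset[OF K(1) open_interior K(2)], rule that)
  let ?K = "{x + y | x y. x \<in> K \<and> y \<in> cball 0 \<rho>}"
  have c1: "compact ?K" by (rule compact_sums[OF K(1) compact_cball])
  have c2: "?K \<subseteq> interior C"
  proof safe
    fix x y :: "real^'d^'m" assume "x \<in> K" "y \<in> cball 0 \<rho>"
    then have "x + y \<in> cball x \<rho>" by (simp add: dist_norm)
    then show "x + y \<in> interior C" using \<rho>(2) \<open>x \<in> K\<close> by blast
  qed
  obtain M where M: "M \<ge> 0" "AE x in lborel. \<forall>\<xi>\<in>?K. W x \<xi> \<le> ennreal M"
    by (rule W_bounded_compact[OF c1 c2], rule that)
  have "AE x in lborel. \<forall>\<xi>\<in>K. \<forall>\<zeta>. norm \<zeta> \<le> \<rho> \<longrightarrow> W (x /\<^sub>R \<epsilon>) (\<xi> + \<zeta>) \<le> ennreal M" if \<epsilon>: "\<epsilon> > 0" for \<epsilon>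
  proof -
    have "AE x in lborel. \<forall>\<xi>\<in>?K. W (0 + inverse \<epsilon> *\<^sub>R x) \<xi> \<le> ennreal M"
      by (rule AE_lborel_affine[OF M(2)]) (use \<epsilon> in simp)
    then show ?thesis
    proof eventually_elim
      case (elim x)
      show ?case
      proof (intro ballI allI impI)
        fix \<xi> \<zeta> assume "\<xi> \<in> K" "norm (\<zeta> :: real^'d^'m) \<le> \<rho>"
        then have "\<xi> + \<zeta> \<in> ?K" by auto
        with elim show "W (x /\<^sub>R \<epsilon>) (\<xi> + \<zeta>) \<le> ennreal M" by auto
      qed
    qed
  qed
  then show thesis by (rule that[OF \<rho>(1) M(1)])
qed

subsection \<open>Cell problems on large cubes\<close>

text \<open>The corner is an integer multiple of \<open>\<epsilon>\<close>, so that rescaling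
  followed by an integer shift leads back to the cube of side \<open>n\<close> at the
  origin.\<close>

abbreviation ecell :: "real \<Rightarrow> nat \<Rightarrow> int^'d \<Rightarrow> (real^'d) set" where
  "ecell \<epsilon> n k \<equiv> box (\<epsilon> *\<^sub>R int_vec k) (\<epsilon> *\<^sub>R int_vec k + vec (real n * \<epsilon>))"

lemma ecell_iff:
  assumes "\<epsilon> > 0"
  shows "\<epsilon> *\<^sub>R int_vec k + \<epsilon> *\<^sub>R y \<in> ecell \<epsilon> n k \<longleftrightarrow> y \<in> box 0 (vec (real n) :: real^'d)"
proof -
  have "(\<epsilon> * of_int (k $ i) < \<epsilon> * of_int (k $ i) + \<epsilon> * y $ i \<and> \<epsilon> * of_int (k $ i) + \<epsilon> * y $ i < \<epsilon> * of_int (k $ i) + real n * \<epsilon>) \<longleftrightarrow>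
    (0 < y $ i \<and> y $ i < real n)" for i
    using assms by (auto simp: mult.commute[of \<epsilon>] zero_less_mult_iff)
  then show ?thesis by (simp add: mem_box_cart)
qed

lemma cell_energy:
  assumes \<epsilon>: "\<epsilon> > 0" and [measurable]: "G \<in> borel_measurable borel"
  shows "(\<integral>\<^sup>+ x. W (x /\<^sub>R \<epsilon>) (\<xi> + G x) * indicator (ecell \<epsilon> n k) x \<partial>lborel) =
    ennreal (\<epsilon> ^ CARD('d)) * (\<integral>\<^sup>+ y. W y (\<xi> + G (\<epsilon> *\<^sub>R int_vec k + \<epsilon> *\<^sub>R y)) * indicator (box 0 (vec (real n))) y \<partial>lborel)"
proof -
  have m: "(\<lambda>x. W (x /\<^sub>R \<epsilon>) (\<xi> + G x) * indicator (ecell \<epsilon> n k) x) \<in> borel_measurable borel"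
    by (intro borel_measurable_times_ennreal W_comp_measurable) auto
  have "(\<epsilon> *\<^sub>R int_vec k + \<epsilon> *\<^sub>R y) /\<^sub>R \<epsilon> = y + int_vec k" for y :: "real^'d"
    using \<epsilon> by (simp add: scaleR_add_right)
  moreover have "W (y + int_vec k) A = W y A" for y A by (rule periodic) simp
  ultimately show ?thesis
    using nn_integral_lborel_affine[OF m, of \<epsilon> "\<epsilon> *\<^sub>R int_vec k"] \<epsilon> ecell_iff[OF \<epsilon>, of k _ n]
    by (simp add: indicator_def cong: if_cong)
qed

text \<open>Rescaled and shifted, \<open>\<Phi>\<close> becomes a competitor in the definition of
  \<open>HW\<close>; periodicity leaves the integrand unchanged.\<close>

lemma HW_upper:
  assumes n: "n \<ge> 1" and \<epsilon>: "\<epsilon> > 0" and wg: "WG UNIV \<Phi> G" and cont: "continuous_on UNIV \<Phi>"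
    and zero: "\<And>x. x \<notin> ecell \<epsilon> n k \<Longrightarrow> \<Phi> x = 0"
  shows "ennreal ((real n * \<epsilon>) ^ CARD('d)) * HW W \<xi> \<le> (\<integral>\<^sup>+ x. W (x /\<^sub>R \<epsilon>) (\<xi> + G x) * indicator (ecell \<epsilon> n k) x \<partial>lborel)"
proof -
  let ?T = "\<lambda>y. \<epsilon> *\<^sub>R int_vec k + \<epsilon> *\<^sub>R y"
  let ?Q = "box 0 (vec (real n)) :: (real^'d) set"
  define \<phi> where "\<phi> y = (1 / \<epsilon>) *\<^sub>R \<Phi> (?T y)" for y
  define g where "g y = G (?T y)" for y
  note [measurable] = WG_meas(1,2)[OF wg]
  have wg1: "WG UNIV \<phi> g"
    using WG_cmul[OF WG_dilate[OF wg \<epsilon>, of "\<epsilon> *\<^sub>R int_vec k"], of "1 / \<epsilon>"] \<epsilon> by (simp add: \<phi>_def[abs_def] g_def[abs_def])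
  have cont1: "continuous_on UNIV \<phi>" unfolding \<phi>_def
    by (intro continuous_intros continuous_on_compose2[OF cont]) auto
  have zero1: "\<phi> y = 0" if "y \<notin> ?Q" for y
    unfolding \<phi>_def using that zero ecell_iff[OF \<epsilon>] by simp
  have W0: "\<phi> \<in> W1inf0 ?Q" "AE x in lborel. x \<in> ?Q \<longrightarrow> weak_gradient ?Q \<phi> x = g x"
    by (rule WG_W1inf0(1)[OF wg1 cont1], erule zero1) (rule WG_W1inf0(2)[OF wg1 cont1], erule zero1)
  have gm [measurable]: "g \<in> borel_measurable borel" using WG_meas(2)[OF wg1] .
  let ?J = "\<integral>\<^sup>+ y. W y (\<xi> + g y) * indicator ?Q y \<partial>lborel"
  have eqJ: "(\<integral>\<^sup>+ x. W x (\<xi> + weak_gradient (cell n) \<phi> x) \<partial>lebesgue_on (cell n)) = ?J"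
    unfolding cell_eq_box[OF n]
  proof (rule nn_integral_lebesgue_on_eq)
    show "(\<lambda>y. W y (\<xi> + g y)) \<in> borel_measurable borel" by (rule W_comp_measurable) auto
    show "AE x in lborel. x \<in> ?Q \<longrightarrow> W x (\<xi> + weak_gradient ?Q \<phi> x) = W x (\<xi> + g x)"
      using W0(2) by eventually_elim simp
  qed simp
  have "\<phi> \<in> W1inf0 (cell n)" unfolding cell_eq_box[OF n] by (rule W0(1))
  then have "(INF \<phi> \<in> W1inf0 (cell n). \<integral>\<^sup>+ x. W x (\<xi> + weak_gradient (cell n) \<phi> x) \<partial>lebesgue_on (cell n)) \<le> ?J"
    by (rule INF_lower2) (simp only: eqJ order_refl)
  then have "HW W \<xi> \<le> ?J / ennreal (real n ^ CARD('d))"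
    unfolding HW_def using n by (intro INF_lower2[of n] divide_right_mono_ennreal) auto
  then have "ennreal (real n ^ CARD('d)) * HW W \<xi> \<le> ennreal (real n ^ CARD('d)) * (?J / ennreal (real n ^ CARD('d)))"
    by (rule mult_left_mono) simp
  also have "\<dots> = ?J"
    unfolding ennreal_times_divide mult.commute[of _ ?J] by (rule mult_divide_eq_ennreal) (use n in auto)
  finally have le: "ennreal (real n ^ CARD('d)) * HW W \<xi> \<le> ?J" .
  have "ennreal ((real n * \<epsilon>) ^ CARD('d)) * HW W \<xi> = ennreal (\<epsilon> ^ CARD('d)) * (ennreal (real n ^ CARD('d)) * HW W \<xi>)"
    using \<epsilon> by (simp add: power_mult_distrib ennreal_mult mult_ac)
  also have "\<dots> \<le> ennreal (\<epsilon> ^ CARD('d)) * ?J" by (rule mult_left_mono[OF le]) simp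
  also have "\<dots> = (\<integral>\<^sup>+ x. W (x /\<^sub>R \<epsilon>) (\<xi> + G x) * indicator (ecell \<epsilon> n k) x \<partial>lborel)"
    unfolding g_def by (rule cell_energy[symmetric, OF \<epsilon>]) simp
  finally show ?thesis .
qed

text \<open>A single near optimal function is transplanted into every aligned cube. The constants
  \<open>n\<close> and \<open>B\<close> depend on neither \<open>\<epsilon>\<close> nor
  \<open>k\<close>, so the amplitude \<open>\<epsilon> * B\<close> vanishes as
  \<open>\<epsilon>\<close> tends to 0.\<close>

lemma HW_lower:
  assumes "HW W \<xi> < c"
  obtains n B where "n \<ge> (1::nat)" "B \<ge> 0"
    "\<And>\<epsilon> k. \<epsilon> > 0 \<Longrightarrow> \<exists>\<Phi> G. WG UNIV \<Phi> G \<and> continuous_on UNIV \<Phi> \<and>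
       (\<forall>x. x \<notin> ecell \<epsilon> n k \<longrightarrow> \<Phi> x = 0 \<and> G x = 0) \<and> (\<forall>x. norm (\<Phi> x) \<le> \<epsilon> * B) \<and>
       (\<integral>\<^sup>+ x. W (x /\<^sub>R \<epsilon>) (\<xi> + G x) * indicator (ecell \<epsilon> n k) x \<partial>lborel) \<le> c * ennreal ((real n * \<epsilon>) ^ CARD('d))"
proof -
  obtain n where n: "n \<ge> 1" "(INF \<phi> \<in> W1inf0 (cell n). \<integral>\<^sup>+ x. W x (\<xi> + weak_gradient (cell n) \<phi> x) \<partial>lebesgue_on (cell n))
       / ennreal (real n ^ CARD('d)) < c"
    using assms unfolding HW_def INF_less_iff by auto
  let ?I = "INF \<phi> \<in> W1inf0 (cell n). \<integral>\<^sup>+ x. W x (\<xi> + weak_gradient (cell n) \<phi> x) \<partial>lebesgue_on (cell n)"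
  have np: "ennreal (real n ^ CARD('d)) \<noteq> 0" "ennreal (real n ^ CARD('d)) \<noteq> top" using n(1) by auto
  have "?I < c * ennreal (real n ^ CARD('d))"
    using n(2) unfolding divide_less_ennreal[OF np(1) ennreal_less_top] .
  then obtain \<phi>0 where \<phi>0: "\<phi>0 \<in> W1inf0 (cell n)"
    "(\<integral>\<^sup>+ x. W x (\<xi> + weak_gradient (cell n) \<phi>0 x) \<partial>lebesgue_on (cell n)) < c * ennreal (real n ^ CARD('d))"
    unfolding INF_less_iff by blast
  let ?Q = "box 0 (vec (real n)) :: (real^'d) set"
  have \<phi>0': "\<phi>0 \<in> W1inf0 ?Q" using \<phi>0(1) unfolding cell_eq_box[OF n(1)] .
  obtain \<phi> g B where wg: "WG UNIV \<phi> g" and cont: "continuous_on UNIV \<phi>"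
    and z1: "\<And>x. x \<notin> ?Q \<Longrightarrow> \<phi> x = 0" and z2: "\<And>x. x \<notin> ?Q \<Longrightarrow> g x = 0"
    and ae: "AE x in lborel. x \<in> ?Q \<longrightarrow> weak_gradient ?Q \<phi>0 x = g x"
    and B: "\<And>x. norm (\<phi> x) \<le> B"
    by (rule W1inf0_box_WG[OF \<phi>0'], use n(1) in simp, rule that)
  have B0: "B \<ge> 0" using B[of 0] norm_ge_zero order_trans by blast
  note [measurable] = WG_meas(1,2)[OF wg]
  have J: "(\<integral>\<^sup>+ y. W y (\<xi> + g y) * indicator ?Q y \<partial>lborel) \<le> c * ennreal (real n ^ CARD('d))"
  proof -
    have "(\<integral>\<^sup>+ x. W x (\<xi> + weak_gradient ?Q \<phi>0 x) \<partial>lebesgue_on ?Q) = (\<integral>\<^sup>+ y. W y (\<xi> + g y) * indicator ?Q y \<partial>lborel)"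
    proof (rule nn_integral_lebesgue_on_eq)
      show "(\<lambda>y. W y (\<xi> + g y)) \<in> borel_measurable borel" by (rule W_comp_measurable) auto
      show "AE x in lborel. x \<in> ?Q \<longrightarrow> W x (\<xi> + weak_gradient ?Q \<phi>0 x) = W x (\<xi> + g x)"
        using ae by eventually_elim simp
    qed simp
    with \<phi>0(2) show ?thesis unfolding cell_eq_box[OF n(1)] by simp
  qed
  have "\<exists>\<Phi> G. WG UNIV \<Phi> G \<and> continuous_on UNIV \<Phi> \<and>
       (\<forall>x. x \<notin> ecell \<epsilon> n k \<longrightarrow> \<Phi> x = 0 \<and> G x = 0) \<and> (\<forall>x. norm (\<Phi> x) \<le> \<epsilon> * B) \<and>
       (\<integral>\<^sup>+ x. W (x /\<^sub>R \<epsilon>) (\<xi> + G x) * indicator (ecell \<epsilon> n k) x \<partial>lborel) \<le> c * ennreal ((real n * \<epsilon>) ^ CARD('d))"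
    if \<epsilon>: "\<epsilon> > 0" for \<epsilon> k
  proof (intro exI conjI allI impI)
    let ?S = "\<lambda>x. - int_vec k + (1 / \<epsilon>) *\<^sub>R x"
    let ?\<Phi> = "\<lambda>x. \<epsilon> *\<^sub>R \<phi> (?S x)" and ?G = "\<lambda>x. g (?S x)"
    have S: "?S (\<epsilon> *\<^sub>R int_vec k + \<epsilon> *\<^sub>R y) = y" "\<epsilon> *\<^sub>R int_vec k + \<epsilon> *\<^sub>R ?S x = x" for x y
      using \<epsilon> by (simp_all add: algebra_simps)
    have i: "1 / \<epsilon> > 0" using \<epsilon> by simp
    show "WG UNIV ?\<Phi> ?G"
      using WG_cmul[OF WG_dilate[OF wg i, of "- int_vec k"], of "\<epsilon>"] \<epsilon> by simp
    show "continuous_on UNIV ?\<Phi>"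
      by (intro continuous_intros continuous_on_compose2[OF cont]) auto
    have out: "?S x \<notin> ?Q" if "x \<notin> ecell \<epsilon> n k" for x
      using that ecell_iff[OF \<epsilon>, of k "?S x" n] S(2)[of x] by simp
    show "?\<Phi> x = 0" "?G x = 0" if "x \<notin> ecell \<epsilon> n k" for x
      using z1[OF out[OF that]] z2[OF out[OF that]] by simp_all
    show "norm (?\<Phi> x) \<le> \<epsilon> * B" for x using B[of "?S x"] \<epsilon> by simp
    have "(\<integral>\<^sup>+ x. W (x /\<^sub>R \<epsilon>) (\<xi> + ?G x) * indicator (ecell \<epsilon> n k) x \<partial>lborel) =
       ennreal (\<epsilon> ^ CARD('d)) * (\<integral>\<^sup>+ y. W y (\<xi> + g y) * indicator ?Q y \<partial>lborel)"
      using cell_energy[OF \<epsilon>, of ?G \<xi> k n] unfolding S by simp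
    also have "\<dots> \<le> ennreal (\<epsilon> ^ CARD('d)) * (c * ennreal (real n ^ CARD('d)))"
      by (rule mult_left_mono[OF J]) simp
    also have "\<dots> = c * ennreal ((real n * \<epsilon>) ^ CARD('d))"
      using \<epsilon> by (simp add: power_mult_distrib ennreal_mult mult_ac)
    finally show "(\<integral>\<^sup>+ x. W (x /\<^sub>R \<epsilon>) (\<xi> + ?G x) * indicator (ecell \<epsilon> n k) x \<partial>lborel) \<le> \<dots>" .
  qed
  then show thesis by (rule that[OF n(1) B0])
qed

text \<open>Filling a cube with small copies of a near optimal cell function.\<close>

lemma recovery_cube:
  assumes \<zeta>: "HW W \<zeta> < ennreal c" "c \<ge> 0" and M: "M \<ge> 0" "\<And>\<epsilon>. \<epsilon> > 0 \<Longrightarrow> AE x in lborel. W (x /\<^sub>R \<epsilon>) \<zeta> \<le> ennreal M"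
    and l: "l > 0" and \<delta>: "\<delta> > 0"
  obtains \<epsilon>0 where "\<epsilon>0 > 0" "\<And>\<epsilon>. 0 < \<epsilon> \<Longrightarrow> \<epsilon> < \<epsilon>0 \<Longrightarrow> \<exists>\<Phi> G. WG UNIV \<Phi> G \<and> continuous_on UNIV \<Phi> \<and>
     (\<forall>x. x \<notin> box p (p + vec l) \<longrightarrow> \<Phi> x = 0 \<and> G x = 0) \<and> (\<forall>x. norm (\<Phi> x) \<le> \<delta>) \<and>
     (\<integral>\<^sup>+ x. W (x /\<^sub>R \<epsilon>) (\<zeta> + G x) * indicator (box p (p + vec l)) x \<partial>lborel) \<le> ennreal (c * l ^ CARD('d) + \<delta>)"
proof -
  obtain n B where n: "n \<ge> (1::nat)" "B \<ge> 0" and cellf: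
    "\<And>\<epsilon> k. \<epsilon> > 0 \<Longrightarrow> \<exists>\<Phi> G. WG UNIV \<Phi> G \<and> continuous_on UNIV \<Phi> \<and>
       (\<forall>x. x \<notin> ecell \<epsilon> n k \<longrightarrow> \<Phi> x = 0 \<and> G x = 0) \<and> (\<forall>x. norm (\<Phi> x) \<le> \<epsilon> * B) \<and>
       (\<integral>\<^sup>+ x. W (x /\<^sub>R \<epsilon>) (\<zeta> + G x) * indicator (ecell \<epsilon> n k) x \<partial>lborel) \<le> ennreal c * ennreal ((real n * \<epsilon>) ^ CARD('d))"
    by (rule HW_lower[OF \<zeta>(1)], rule that)
  \<comment> \<open>The cells that do not fit leave a boundary layer of width at most one cell side,
    \<open>real n * \<epsilon>\<close>. There the gradient is just \<open>\<zeta>\<close> and costs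
    at most \<open>M\<close> per volume.\<close>
  define err where "err \<epsilon> = M * (l ^ CARD('d) - (l - 2 * (real n * \<epsilon>)) ^ CARD('d))" for \<epsilon>
  have "(err \<longlongrightarrow> M * (l ^ CARD('d) - (l - 2 * (real n * 0)) ^ CARD('d))) (at_right 0)"
    unfolding err_def by (intro tendsto_intros)
  then have "eventually (\<lambda>\<epsilon>. err \<epsilon> < \<delta>) (at_right 0)" using \<delta> by (intro order_tendstoD) auto
  then obtain b1 where b1: "b1 > 0" "\<And>\<epsilon>. 0 < \<epsilon> \<Longrightarrow> \<epsilon> < b1 \<Longrightarrow> err \<epsilon> < \<delta>"
    unfolding eventually_at_right_field by blast
  \<comment> \<open>The three bounds make the layer cost less than \<open>\<delta>\<close>, keep the
    amplitude \<open>\<epsilon> * B\<close> at most \<open>\<delta>\<close>, and make two cell sides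
    shorter than the cube.\<close>
  define \<epsilon>0 where "\<epsilon>0 = min b1 (min (\<delta> / (B + 1)) (l / (2 * real n)))"
  have \<epsilon>0: "\<epsilon>0 > 0" using b1(1) \<delta> n l by (auto simp: \<epsilon>0_def)
  let ?Q = "box p (p + vec l)"
  have "\<exists>\<Phi> G. WG UNIV \<Phi> G \<and> continuous_on UNIV \<Phi> \<and>
     (\<forall>x. x \<notin> ?Q \<longrightarrow> \<Phi> x = 0 \<and> G x = 0) \<and> (\<forall>x. norm (\<Phi> x) \<le> \<delta>) \<and>
     (\<integral>\<^sup>+ x. W (x /\<^sub>R \<epsilon>) (\<zeta> + G x) * indicator ?Q x \<partial>lborel) \<le> ennreal (c * l ^ CARD('d) + \<delta>)"
    if \<epsilon>: "0 < \<epsilon>" "\<epsilon> < \<epsilon>0" for \<epsilon>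
  proof -
    define N where "N = real n * \<epsilon>"
    have N: "N > 0" using n \<epsilon> by (simp add: N_def)
    have N2: "2 * N < l" using \<epsilon> n by (simp add: \<epsilon>0_def N_def field_simps)
    \<comment> \<open>Taking multiples of \<open>n\<close> as indices turns the aligned cubes into a
      tiling of side \<open>N\<close>, up to faces.\<close>
    define E where "E k = ecell \<epsilon> n ((\<chi> i. int n * k $ i) :: int^'d)" for k :: "int^'d"
    have E: "x \<in> E k \<longleftrightarrow> (\<forall>i. N * of_int (k $ i) < x $ i \<and> x $ i < N * (of_int (k $ i) + 1))" for x k
      by (simp add: E_def mem_box_cart N_def algebra_simps)
    have Efl: "k $ i = \<lfloor>x $ i / N\<rfloor>" if "x \<in> E k" for x k i
    proof -
      have "N * of_int (k $ i) < x $ i \<and> x $ i < N * (of_int (k $ i) + 1)" using that E by blast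
      then show ?thesis using N by (intro floor_unique[symmetric]) (auto simp: field_simps)
    qed
    have Edisj: "k = k'" if "x \<in> E k" "x \<in> E k'" for x k k'
      using Efl[OF that(1)] Efl[OF that(2)] by (simp add: vec_eq_iff)
    define J where "J = {k :: int^'d. \<forall>i. p $ i \<le> N * of_int (k $ i) \<and> N * (of_int (k $ i) + 1) \<le> p $ i + l}"
    have EQ: "E k \<subseteq> ?Q" if "k \<in> J" for k
    proof
      fix x assume "x \<in> E k"
      show "x \<in> ?Q" unfolding mem_box_cart
      proof
        fix i
        have "N * of_int (k $ i) < x $ i \<and> x $ i < N * (of_int (k $ i) + 1)" using \<open>x \<in> E k\<close> E by blast
        moreover have "p $ i \<le> N * of_int (k $ i) \<and> N * (of_int (k $ i) + 1) \<le> p $ i + l" using that by (simp add: J_def)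
        ultimately show "p $ i < x $ i \<and> x $ i < (p + vec l) $ i" by simp
      qed
    qed
    have finJ: "finite J"
    proof -
      obtain b :: int where b: "\<And>i. \<lceil>p $ i / N\<rceil> \<ge> - b" "\<And>i. \<lfloor>(p $ i + l) / N\<rfloor> \<le> b"
      proof -
        let ?A = "range (\<lambda>i. \<bar>\<lceil>p $ i / N\<rceil>\<bar>) \<union> range (\<lambda>i. \<bar>\<lfloor>(p $ i + l) / N\<rfloor>\<bar>)"
        have "\<bar>\<lceil>p $ i / N\<rceil>\<bar> \<le> Max ?A" "\<bar>\<lfloor>(p $ i + l) / N\<rfloor>\<bar> \<le> Max ?A" for i by (rule Max_ge; auto)+
        then show thesis by (intro that[of "Max ?A"]) (smt (verit))+
      qed
      have "J \<subseteq> (\<lambda>f. \<chi> i. f i) ` (UNIV \<rightarrow>\<^sub>E {-b..b})"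
      proof
        fix k assume k: "k \<in> J"
        have "k $ i \<in> {-b..b}" for i
        proof -
          have "p $ i / N \<le> of_int (k $ i)" "of_int (k $ i) \<le> (p $ i + l) / N"
            using k N by (auto simp: J_def field_simps dest!: spec[of _ i])
          then have "\<lceil>p $ i / N\<rceil> \<le> k $ i" "k $ i \<le> \<lfloor>(p $ i + l) / N\<rfloor>" by (simp_all add: ceiling_le_iff le_floor_iff)
          then show ?thesis using b[of i] by auto
        qed
        then have "(\<lambda>i. k $ i) \<in> UNIV \<rightarrow>\<^sub>E {-b..b}" by auto
        then show "k \<in> (\<lambda>f. \<chi> i. f i) ` (UNIV \<rightarrow>\<^sub>E {-b..b})" by (rule image_eqI[rotated]) (simp add: vec_eq_iff)
      qed
      then show ?thesis by (rule finite_subset) (intro finite_imageI finite_PiE; simp)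
    qed
    have "\<forall>k. \<exists>\<Phi>G. WG UNIV (fst \<Phi>G) (snd \<Phi>G) \<and> continuous_on UNIV (fst \<Phi>G) \<and>
       (\<forall>x. x \<notin> E k \<longrightarrow> fst \<Phi>G x = 0 \<and> snd \<Phi>G x = 0) \<and> (\<forall>x. norm (fst \<Phi>G x) \<le> \<epsilon> * B) \<and>
       (\<integral>\<^sup>+ x. W (x /\<^sub>R \<epsilon>) (\<zeta> + snd \<Phi>G x) * indicator (E k) x \<partial>lborel) \<le> ennreal c * ennreal ((real n * \<epsilon>) ^ CARD('d))"
      unfolding E_def using cellf[OF \<epsilon>(1)] by simp
    from choice[OF this] obtain \<Phi>G where \<Phi>G: "\<forall>k. WG UNIV (fst (\<Phi>G k)) (snd (\<Phi>G k)) \<and> continuous_on UNIV (fst (\<Phi>G k)) \<and>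
       (\<forall>x. x \<notin> E k \<longrightarrow> fst (\<Phi>G k) x = 0 \<and> snd (\<Phi>G k) x = 0) \<and> (\<forall>x. norm (fst (\<Phi>G k) x) \<le> \<epsilon> * B) \<and>
       (\<integral>\<^sup>+ x. W (x /\<^sub>R \<epsilon>) (\<zeta> + snd (\<Phi>G k) x) * indicator (E k) x \<partial>lborel) \<le> ennreal c * ennreal ((real n * \<epsilon>) ^ CARD('d))" ..
    define P where "P k = fst (\<Phi>G k)" for k
    define H where "H k = snd (\<Phi>G k)" for k
    have PH: "WG UNIV (P k) (H k)" "continuous_on UNIV (P k)" "x \<notin> E k \<Longrightarrow> P k x = 0" "x \<notin> E k \<Longrightarrow> H k x = 0"
       "norm (P k x) \<le> \<epsilon> * B"
       "(\<integral>\<^sup>+ x. W (x /\<^sub>R \<epsilon>) (\<zeta> + H k x) * indicator (E k) x \<partial>lborel) \<le> ennreal c * ennreal (N ^ CARD('d))" for k x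
      using \<Phi>G unfolding P_def H_def N_def by blast+
    define \<Phi> where "\<Phi> x = (\<Sum>k\<in>J. P k x)" for x
    define G where "G x = (\<Sum>k\<in>J. H k x)" for x
    have single: "\<Phi> x = P k x" "G x = H k x" if "k \<in> J" "x \<in> E k" for k x
    proof -
      have "x \<notin> E k'" if "k' \<noteq> k" for k' using that \<open>x \<in> E k\<close> Edisj by blast
      then have "P k' x = 0" "H k' x = 0" if "k' \<in> J - {k}" for k' using that PH(3,4) by blast+
      then show "\<Phi> x = P k x" "G x = H k x"
        unfolding \<Phi>_def G_def sum.remove[OF finJ \<open>k \<in> J\<close>] by (simp_all add: sum.neutral)
    qed
    have none: "\<Phi> x = 0" "G x = 0" if "\<And>k. k \<in> J \<Longrightarrow> x \<notin> E k" for x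
      using that PH(3,4) by (auto simp: \<Phi>_def G_def intro!: sum.neutral)
    have wg: "WG UNIV \<Phi> G" unfolding \<Phi>_def[abs_def] G_def[abs_def] by (rule WG_sum[OF PH(1)])
    have cont: "continuous_on UNIV \<Phi>" unfolding \<Phi>_def[abs_def] by (rule continuous_on_sum[OF PH(2)])
    have zero: "\<Phi> x = 0 \<and> G x = 0" if "x \<notin> ?Q" for x using none EQ that by blast
    have \<epsilon>B: "\<epsilon> * B \<le> \<delta>"
    proof -
      have "\<epsilon> * B \<le> \<epsilon> * (B + 1)" using \<epsilon> by simp
      also have "\<dots> \<le> \<delta>" using \<epsilon> n by (simp add: \<epsilon>0_def pos_less_divide_eq)
      finally show ?thesis .
    qed
    have small: "norm (\<Phi> x) \<le> \<delta>" for x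
    proof (cases "\<exists>k\<in>J. x \<in> E k")
      case True
      then obtain k where "k \<in> J" "x \<in> E k" by blast
      then show ?thesis using single(1)[of k x] PH(5)[of k x] \<epsilon>B by simp
    next
      case False
      then show ?thesis using none(1)[of x] \<delta> by auto
    qed
    let ?In = "box (p + vec N) (p + vec (l - N))"
    note [measurable] = WG_meas(1,2)[OF wg] WG_meas(1,2)[OF PH(1)]
    have ae: "AE x in lborel. W (x /\<^sub>R \<epsilon>) (\<zeta> + G x) * indicator ?Q x \<le>
        (\<Sum>k\<in>J. W (x /\<^sub>R \<epsilon>) (\<zeta> + H k x) * indicator (E k) x) + ennreal M * indicator (?Q - ?In) x"
      using M(2)[OF \<epsilon>(1)] AE_coord_not_Ints[OF N]
    proof eventually_elim
      case (elim x)
      show ?case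
      proof (cases "\<exists>k\<in>J. x \<in> E k")
        case True
        then obtain k where k: "k \<in> J" "x \<in> E k" by blast
        have "W (x /\<^sub>R \<epsilon>) (\<zeta> + G x) * indicator ?Q x \<le> W (x /\<^sub>R \<epsilon>) (\<zeta> + H k x) * indicator (E k) x"
          using single(2)[OF k] k EQ[OF k(1)] by (auto simp: indicator_def)
        also have "\<dots> \<le> (\<Sum>k\<in>J. W (x /\<^sub>R \<epsilon>) (\<zeta> + H k x) * indicator (E k) x)"
          by (rule member_le_sum[OF k(1) _ finJ]) simp
        finally show ?thesis by (rule order_trans) simp
      next
        case False
        then have G0: "G x = 0" using none(2) by blast
        \<comment> \<open>A point at depth more than \<open>N\<close> and on no face lies in a cell
          that fits entirely into the cube. All other points belong to the layer.\<close>
        have "x \<notin> ?In"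
        proof
          assume xI: "x \<in> ?In"
          define k :: "int^'d" where "k = (\<chi> i. \<lfloor>x $ i / N\<rfloor>)"
          have fl: "N * of_int (k $ i) < x $ i" "x $ i < N * (of_int (k $ i) + 1)" for i
          proof -
            have "of_int (k $ i) \<le> x $ i / N" "x $ i / N < of_int (k $ i) + 1" unfolding k_def by simp_all
            moreover have "of_int (k $ i) \<noteq> x $ i / N" using elim(2) by (metis Ints_of_int)
            ultimately show "N * of_int (k $ i) < x $ i" "x $ i < N * (of_int (k $ i) + 1)"
              using N by (auto simp: field_simps)
          qed
          have xi: "p $ i + N < x $ i \<and> x $ i < p $ i + (l - N)" for i using xI by (simp add: mem_box_cart)
          have "p $ i \<le> N * of_int (k $ i) \<and> N * (of_int (k $ i) + 1) \<le> p $ i + l" for i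
          proof -
            have "N * (of_int (k $ i) + 1) = N * of_int (k $ i) + N" by (simp add: algebra_simps)
            then show ?thesis using xi[of i] fl[of i] by linarith
          qed
          then have "k \<in> J" by (simp add: J_def)
          moreover have "x \<in> E k" using fl by (simp add: E)
          ultimately show False using False by blast
        qed
        then have "W (x /\<^sub>R \<epsilon>) (\<zeta> + G x) * indicator ?Q x \<le> ennreal M * indicator (?Q - ?In) x"
          using G0 elim(1) by (auto simp: indicator_def)
        then show ?thesis by (rule add_increasing[OF zero_le])
      qed
    qed
    have "(\<integral>\<^sup>+ x. W (x /\<^sub>R \<epsilon>) (\<zeta> + G x) * indicator ?Q x \<partial>lborel) \<le>
       (\<integral>\<^sup>+ x. (\<Sum>k\<in>J. W (x /\<^sub>R \<epsilon>) (\<zeta> + H k x) * indicator (E k) x) + ennreal M * indicator (?Q - ?In) x \<partial>lborel)"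
      by (rule nn_integral_mono_AE[OF ae])
    also have "\<dots> = (\<Sum>k\<in>J. \<integral>\<^sup>+ x. W (x /\<^sub>R \<epsilon>) (\<zeta> + H k x) * indicator (E k) x \<partial>lborel) + ennreal M * emeasure lborel (?Q - ?In)"
    proof -
      have m: "(\<lambda>x. W (x /\<^sub>R \<epsilon>) (\<zeta> + H k x) * indicator (E k) x) \<in> borel_measurable lborel" for k
        unfolding E_def by (intro borel_measurable_times_ennreal W_comp_measurable) auto
      show ?thesis
        using m by (subst nn_integral_add) (auto simp: nn_integral_sum nn_integral_cmult_indicator)
    qed
    also have "(\<Sum>k\<in>J. \<integral>\<^sup>+ x. W (x /\<^sub>R \<epsilon>) (\<zeta> + H k x) * indicator (E k) x \<partial>lborel) \<le> (\<Sum>k\<in>J. ennreal c * ennreal (N ^ CARD('d)))"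
      by (rule sum_mono[OF PH(6)])
    also have "(\<Sum>k\<in>J. ennreal c * ennreal (N ^ CARD('d))) = ennreal c * (\<Sum>k\<in>J. emeasure lborel (E k))"
    proof -
      have "emeasure lborel (E k) = ennreal (N ^ CARD('d))" for k
        unfolding E_def using measure_cube(2)[of N] N unfolding N_def by simp
      then show ?thesis by (simp add: mult_ac)
    qed
    also have "(\<Sum>k\<in>J. emeasure lborel (E k)) = emeasure lborel (\<Union>k\<in>J. E k)"
      by (rule sum_emeasure[OF _ _ finJ]) (use Edisj in \<open>auto simp: E_def disjoint_family_on_def\<close>)
    also have "\<dots> \<le> emeasure lborel ?Q" by (rule emeasure_mono) (use EQ in auto)
    also have "emeasure lborel ?Q = ennreal (l ^ CARD('d))" using l by (intro measure_cube) simp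
    also have "emeasure lborel (?Q - ?In) = ennreal (l ^ CARD('d) - (l - 2 * N) ^ CARD('d))"
    proof -
      have In: "?In = box (p + vec N) ((p + vec N) + vec (l - 2 * N))"
        by (rule arg_cong2[where f = box]) (auto simp: vec_eq_iff)
      have m: "emeasure lborel ?In = ennreal ((l - 2 * N) ^ CARD('d))"
        unfolding In using N2 by (intro measure_cube) simp
      have "?In \<subseteq> ?Q"
      proof
        fix x assume "x \<in> ?In"
        show "x \<in> ?Q" unfolding mem_box_cart
        proof
          fix i
          have "p $ i + N < x $ i \<and> x $ i < p $ i + (l - N)" using \<open>x \<in> ?In\<close> by (simp add: mem_box_cart)
          then show "p $ i < x $ i \<and> x $ i < (p + vec l) $ i" using N by simp
        qed
      qed
      then have "emeasure lborel (?Q - ?In) = emeasure lborel ?Q - emeasure lborel ?In"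
        by (intro emeasure_Diff) (auto simp: m)
      also have "\<dots> = ennreal (l ^ CARD('d)) - ennreal ((l - 2 * N) ^ CARD('d))"
        unfolding m using measure_cube(2)[of l p] l by simp
      also have "\<dots> = ennreal (l ^ CARD('d) - (l - 2 * N) ^ CARD('d))"
        using N2 by (intro ennreal_minus) simp
      finally show ?thesis .
    qed
    finally have "(\<integral>\<^sup>+ x. W (x /\<^sub>R \<epsilon>) (\<zeta> + G x) * indicator ?Q x \<partial>lborel) \<le>
        ennreal c * ennreal (l ^ CARD('d)) + ennreal M * ennreal (l ^ CARD('d) - (l - 2 * N) ^ CARD('d))"
      by (simp add: add_right_mono mult_left_mono)
    also have "\<dots> = ennreal (c * l ^ CARD('d) + err \<epsilon>)"
    proof -
      have "0 \<le> l ^ CARD('d) - (l - 2 * N) ^ CARD('d)"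
        using N2 N power_mono[of "l - 2 * N" l "CARD('d)"] by simp
      then show ?thesis unfolding err_def N_def[symmetric] using \<zeta>(2) M(1) l
        by (simp add: ennreal_mult ennreal_plus)
    qed
    also have "\<dots> \<le> ennreal (c * l ^ CARD('d) + \<delta>)"
      using b1(2)[of \<epsilon>] \<epsilon> by (intro ennreal_leI) (simp add: \<epsilon>0_def)
    finally show ?thesis using wg cont zero small by blast
  qed
  then show thesis by (rule that[OF \<epsilon>0])
qed

end

subsection \<open>Lower semicontinuous envelopes\<close>

lemma lsc_eventually:
  assumes "lsc f" "a < f x" shows "eventually (\<lambda>y. a < f y) (nhds x)"
proof -
  have "a < Liminf (at x) f" using assms unfolding lsc_def by (meson less_le_trans)
  then have "eventually (\<lambda>y. a < f y) (at x)" by (rule less_LiminfD)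
  with assms(2) show ?thesis unfolding eventually_nhds_conv_at by simp
qed

lemma lsc_borel_measurable: "lsc (f :: 'a::topological_space \<Rightarrow> ennreal) \<Longrightarrow> f \<in> borel_measurable borel"
proof (rule borel_measurableI_greater)
  fix a assume f: "lsc f"
  have "open {x. a < f x}"
  proof (subst open_subopen, safe)
    fix x assume "a < f x"
    from lsc_eventually[OF f this] obtain S where "open S" "x \<in> S" "\<forall>y\<in>S. a < f y"
      unfolding eventually_nhds by blast
    then show "\<exists>T. open T \<and> x \<in> T \<and> T \<subseteq> {x. a < f x}" by blast
  qed
  then show "{x \<in> space borel. a < f x} \<in> sets borel" by simp
qed

lemma lsc_envelope_le: "lsc_envelope f x \<le> f x"
  unfolding lsc_envelope_def by (rule SUP_least) (simp add: le_fun_def)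

lemma lsc_lsc_envelope: "lsc (lsc_envelope f)"
  unfolding lsc_def
proof
  fix x
  show "lsc_envelope f x \<le> Liminf (at x) (lsc_envelope f)"
    unfolding lsc_envelope_def[of f x]
  proof (rule SUP_least)
    fix g assume g: "g \<in> {g. lsc g \<and> g \<le> f}"
    then have "g x \<le> Liminf (at x) g" by (simp add: lsc_def)
    also have "\<dots> \<le> Liminf (at x) (lsc_envelope f)"
      by (rule Liminf_mono) (use g in \<open>auto simp: lsc_envelope_def intro!: always_eventually SUP_upper\<close>)
    finally show "g x \<le> Liminf (at x) (lsc_envelope f)" .
  qed
qed

text \<open>The function equal to \<open>c\<close> on the open set and to 0 elsewhere is a lower
  semicontinuous minorant.\<close>

lemma lsc_envelope_greatest_local:
  assumes "open U" "\<xi> \<in> U" "\<And>\<zeta>. \<zeta> \<in> U \<Longrightarrow> c \<le> f \<zeta>"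
  shows "c \<le> lsc_envelope f \<xi>"
proof -
  let ?g = "\<lambda>\<zeta>. if \<zeta> \<in> U then c else 0"
  have "lsc ?g" unfolding lsc_def
  proof
    fix x
    show "?g x \<le> Liminf (at x) ?g"
    proof (cases "x \<in> U")
      case True
      have "c \<le> Liminf (at x) ?g"
      proof (rule Liminf_bounded)
        show "\<forall>\<^sub>F y in at x. c \<le> ?g y"
          unfolding eventually_at_topological using True assms(1) by (auto intro!: exI[of _ U])
      qed
      then show ?thesis using True by simp
    qed simp
  qed
  moreover have "?g \<le> f" using assms(3) by (auto simp: le_fun_def)
  ultimately have "?g \<xi> \<le> lsc_envelope f \<xi>" unfolding lsc_envelope_def by (intro SUP_upper) simp
  then show ?thesis using assms(2) by simp
qed

subsection \<open>The homogenized density and its envelope\<close>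

context homogenization
begin

text \<open>The competitor is the cutoff times the difference of \<open>g\<close> and the affine
  map: its total gradient is \<open>H\<close> on the inner cube, \<open>\<xi>\<close> outside the
  cube, and in between a convex combination plus a term of norm at most \<open>\<rho>\<close>. As
  the cube need not be aligned with the period, it is enclosed in an aligned one of side at most
  \<open>h + 2 * \<epsilon>\<close>; everything outside the inner cube is charged with
  \<open>M\<close>.\<close>

lemma HW_le_cube:
  fixes p :: "real^'d" and g :: "real^'d \<Rightarrow> real^'m"
  defines "Q h \<equiv> box p (p + vec h)" and "In r h \<equiv> box (p + vec (2 * (r * h))) (p + vec (h - 2 * (r * h)))"
  assumes K: "convex K" "\<xi> \<in> K" and M: "M \<ge> 0"
      "\<And>\<epsilon>. \<epsilon> > 0 \<Longrightarrow> AE x in lborel. \<forall>\<xi>\<in>K. \<forall>\<zeta>. norm \<zeta> \<le> \<rho> \<longrightarrow> W (x /\<^sub>R \<epsilon>) (\<xi> + \<zeta>) \<le> ennreal M"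
    and wg: "WG (Q h) g H" and h: "h > 0" and cont: "continuous_on UNIV g" and r: "0 < r" "4 * r < 1"
    and HK: "AE x in lborel. x \<in> Q h - In r h \<longrightarrow> H x \<in> K"
    and near: "\<And>x. x \<in> Q h \<Longrightarrow> norm (g x - (\<xi> *v x + b)) \<le> \<kappa> * h"
    and \<kappa>: "real CARD('d) * cutL * \<kappa> / r \<le> \<rho>" and \<epsilon>: "\<epsilon> > 0"
  shows "ennreal (h ^ CARD('d)) * HW W \<xi> \<le>
     (\<integral>\<^sup>+ x. W (x /\<^sub>R \<epsilon>) (H x) * indicator (In r h) x \<partial>lborel) + ennreal (M * ((h + 2 * \<epsilon>) ^ CARD('d) - (h - 4 * (r * h)) ^ CARD('d)))"
proof -
  define \<eta> where "\<eta> = cutoff p (p + vec h) (r * h)"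
  note c = cutoff_cube[OF h r, where p = p, folded \<eta>_def Q_def In_def]
  note inn = inner_cube[OF h r, where p = p, folded Q_def In_def]
  have \<eta>01: "0 \<le> \<eta> x" "\<eta> x \<le> 1" for x unfolding \<eta>_def by (rule cutoff_bounds)+
  define v where "v x = g x - (\<xi> *v x + b)" for x
  have wv: "WG (Q h) v (\<lambda>x. H x - \<xi>)" unfolding v_def[abs_def] by (rule WG_diff[OF wg WG_affine])
  define \<Phi> where "\<Phi> x = \<eta> x *\<^sub>R v x" for x
  define G where "G x = \<eta> x *\<^sub>R (H x - \<xi>) + outer (v x) (grad \<eta> x)" for x
  have w\<Phi>: "WG UNIV \<Phi> G" unfolding \<Phi>_def[abs_def] G_def[abs_def] by (rule WG_mult_test[OF wv c(1)])
  have cont\<Phi>: "continuous_on UNIV \<Phi>" unfolding \<Phi>_def v_def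
    by (intro continuous_intros cont smooth_continuous[OF test_function_smooth[OF c(1)]]
        linear_continuous_on[OF matrix_vector_mul_bounded_linear])
  \<comment> \<open>One extra cell makes up for rounding the corner \<open>p\<close> down by less
    than \<open>\<epsilon>\<close>; hence the side lies between \<open>h + \<epsilon>\<close> and
    \<open>h + 2 * \<epsilon>\<close>.\<close>
  define n where "n = nat \<lceil>h / \<epsilon>\<rceil> + 1"
  define k :: "int^'d" where "k = (\<chi> i. \<lfloor>p $ i / \<epsilon>\<rfloor>)"
  have n1: "n \<ge> 1" by (simp add: n_def)
  have "h / \<epsilon> > 0" using h \<epsilon> by simp
  then have "real n = of_int \<lceil>h / \<epsilon>\<rceil> + 1" unfolding n_def by (simp add: of_nat_nat)
  then have "h / \<epsilon> + 1 \<le> real n" "real n \<le> h / \<epsilon> + 2" by linarith+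
  then have nh: "h + \<epsilon> \<le> real n * \<epsilon>" "real n * \<epsilon> \<le> h + 2 * \<epsilon>" using \<epsilon> by (auto simp: field_simps)
  let ?E = "ecell \<epsilon> n k"
  have QE: "Q h \<subseteq> ?E"
  proof
    fix x assume x: "x \<in> Q h"
    show "x \<in> ?E" unfolding mem_box_cart
    proof
      fix i
      have xi: "p $ i < x $ i \<and> x $ i < p $ i + h" using x by (simp add: Q_def mem_box_cart)
      have "of_int (k $ i) \<le> p $ i / \<epsilon>" "p $ i / \<epsilon> < of_int (k $ i) + 1" unfolding k_def by simp_all
      then have "\<epsilon> * of_int (k $ i) \<le> p $ i" "p $ i < \<epsilon> * of_int (k $ i) + \<epsilon>" using \<epsilon> by (auto simp: field_simps)
      then show "(\<epsilon> *\<^sub>R int_vec k) $ i < x $ i \<and> x $ i < (\<epsilon> *\<^sub>R int_vec k + vec (real n * \<epsilon>)) $ i"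
        using xi nh(1) by simp
    qed
  qed
  have "ennreal (h ^ CARD('d)) * HW W \<xi> \<le> ennreal ((real n * \<epsilon>) ^ CARD('d)) * HW W \<xi>"
    using h nh \<epsilon> by (intro mult_right_mono ennreal_leI power_mono) auto
  also have "\<dots> \<le> (\<integral>\<^sup>+ x. W (x /\<^sub>R \<epsilon>) (\<xi> + G x) * indicator ?E x \<partial>lborel)"
    by (rule HW_upper[OF n1 \<epsilon> w\<Phi> cont\<Phi>]) (use QE c(2) in \<open>auto simp: \<Phi>_def\<close>)
  also have "\<dots> \<le> (\<integral>\<^sup>+ x. W (x /\<^sub>R \<epsilon>) (H x) * indicator (In r h) x + ennreal M * indicator (?E - In r h) x \<partial>lborel)"
  proof (rule nn_integral_mono_AE)
    show "AE x in lborel. W (x /\<^sub>R \<epsilon>) (\<xi> + G x) * indicator ?E x \<le> W (x /\<^sub>R \<epsilon>) (H x) * indicator (In r h) x + ennreal M * indicator (?E - In r h) x"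
      using M(2)[OF \<epsilon>] HK
    proof eventually_elim
      case (elim x)
      show ?case
      proof (cases "x \<in> In r h")
        case True
        then have "\<xi> + G x = H x" using c(4,5)[OF True] by (simp add: G_def outer_def vec_eq_iff)
        then show ?thesis using True by (simp add: indicator_def)
      next
        case False
        have "W (x /\<^sub>R \<epsilon>) (\<xi> + G x) \<le> ennreal M"
        proof (cases "x \<in> Q h")
          case True
          then have HK: "H x \<in> K" using elim(2) False by blast
          have "(1 - \<eta> x) *\<^sub>R \<xi> + \<eta> x *\<^sub>R H x \<in> K"
            using K(1) \<eta>01[of x] K(2) HK unfolding convex_alt by blast
          moreover have "norm (outer (v x) (grad \<eta> x)) \<le> \<rho>"
          proof -
            have "norm (v x) * norm (grad \<eta> x) \<le> (\<kappa> * h) * (real CARD('d) * (cutL / (r * h)))"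
              using near[OF True] unfolding v_def by (intro mult_mono c(6)) (auto intro: order_trans[OF norm_ge_zero])
            also have "\<dots> = real CARD('d) * cutL * \<kappa> / r" using h by (simp add: field_simps)
            finally show ?thesis using \<kappa> by (simp add: norm_outer)
          qed
          \<comment> \<open>The first summand stays in the convex set \<open>K\<close>, and the
            second is the perturbation allowed by the margin.\<close>
          moreover have "\<xi> + G x = ((1 - \<eta> x) *\<^sub>R \<xi> + \<eta> x *\<^sub>R H x) + outer (v x) (grad \<eta> x)"
            by (simp add: G_def algebra_simps)
          ultimately show ?thesis using elim(1) by metis
        next
          case False
          then have "G x = 0" using c(2,3)[OF False] by (simp add: G_def outer_def vec_eq_iff)
          \<comment> \<open>The perturbation is 0 here, so \<open>\<rho>\<close> has to be
            nonnegative: since the cube is nonempty, \<open>near\<close> forces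
            \<open>\<kappa>\<close> to be nonnegative, and \<open>\<rho>\<close> dominates a
            nonnegative multiple of it.\<close>
          moreover have "norm (0::real^'d^'m) \<le> \<rho>"
          proof -
            have "0 \<le> \<kappa> * h" if "Q h \<noteq> {}" using near that norm_ge_zero order_trans by blast
            moreover have "Q h \<noteq> {}" using h by (auto simp: Q_def interval_ne_empty_cart)
            ultimately have "0 \<le> \<kappa>" using h by (simp add: zero_le_mult_iff)
            then have "0 \<le> real CARD('d) * cutL * \<kappa> / r" using cutL_nonneg r by simp
            then show ?thesis using \<kappa> by simp
          qed
          ultimately show ?thesis using elim(1) K(2) by metis
        qed
        then show ?thesis using False by (auto simp: indicator_def)
      qed
    qed
  qed
  also have "\<dots> = (\<integral>\<^sup>+ x. W (x /\<^sub>R \<epsilon>) (H x) * indicator (In r h) x \<partial>lborel) + ennreal M * emeasure lborel (?E - In r h)"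
  proof -
    note [measurable] = WG_meas(2)[OF wg]
    have "(\<lambda>x. W (x /\<^sub>R \<epsilon>) (H x) * indicator (In r h) x) \<in> borel_measurable lborel"
      unfolding In_def by (intro borel_measurable_times_ennreal W_comp_measurable) auto
    then show ?thesis by (subst nn_integral_add) (auto simp: nn_integral_cmult_indicator In_def)
  qed
  also have "emeasure lborel (?E - In r h) = ennreal ((real n * \<epsilon>) ^ CARD('d)) - ennreal ((h - 4 * (r * h)) ^ CARD('d))"
  proof -
    have "emeasure lborel (?E - In r h) = emeasure lborel ?E - emeasure lborel (In r h)"
      using inn(2,3) QE by (intro emeasure_Diff) (auto simp: In_def)
    then show ?thesis unfolding inn(3) using measure_cube(2)[of "real n * \<epsilon>" "\<epsilon> *\<^sub>R int_vec k"] \<epsilon> by simp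
  qed
  also have "\<dots> = ennreal ((real n * \<epsilon>) ^ CARD('d) - (h - 4 * (r * h)) ^ CARD('d))"
    by (intro ennreal_minus zero_le_power) (use r h in simp)
  also have "\<dots> \<le> ennreal ((h + 2 * \<epsilon>) ^ CARD('d) - (h - 4 * (r * h)) ^ CARD('d))"
    using nh \<epsilon> by (intro ennreal_leI diff_right_mono power_mono) auto
  also have "ennreal M * \<dots> = ennreal (M * ((h + 2 * \<epsilon>) ^ CARD('d) - (h - 4 * (r * h)) ^ CARD('d)))"
    by (rule ennreal_mult'[symmetric, OF M(1)])
  finally show ?thesis by (simp add: add_left_mono mult_left_mono)
qed

lemma HW_le_bound:
  assumes "M \<ge> 0" "AE x in lborel. W x \<xi> \<le> ennreal M"
  shows "HW W \<xi> \<le> ennreal M"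
proof -
  have "ennreal ((real 1 * 1) ^ CARD('d)) * HW W \<xi> \<le> (\<integral>\<^sup>+ x. W (x /\<^sub>R 1) (\<xi> + (\<lambda>_. 0) x) * indicator (ecell 1 1 0) x \<partial>lborel)"
    by (rule HW_upper[OF _ _ WG_zero]) auto
  also have "\<dots> \<le> (\<integral>\<^sup>+ x. ennreal M * indicator (ecell 1 1 0) x \<partial>lborel)"
    by (rule nn_integral_mono_AE) (use assms(2) in \<open>auto simp: indicator_def elim!: eventually_mono\<close>)
  also have "\<dots> = ennreal M * emeasure lborel (ecell 1 1 0)" by (rule nn_integral_cmult_indicator) simp
  also have "emeasure lborel (ecell 1 1 0) = 1" using measure_cube(2)[of 1] by simp
  finally show ?thesis by simp
qed

lemma HW_le_bound_nbhd:
  assumes "M \<ge> 0" "\<rho> \<ge> 0" "\<And>\<epsilon>. \<epsilon> > 0 \<Longrightarrow> AE x in lborel. \<forall>\<xi>\<in>K. \<forall>\<zeta>. norm \<zeta> \<le> \<rho> \<longrightarrow> W (x /\<^sub>R \<epsilon>) (\<xi> + \<zeta>) \<le> ennreal M" "\<xi> \<in> K"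
  shows "HW W \<xi> \<le> ennreal M" "\<epsilon> > 0 \<Longrightarrow> AE x in lborel. W (x /\<^sub>R \<epsilon>) \<xi> \<le> ennreal M"
proof -
  have *: "AE x in lborel. W (x /\<^sub>R \<epsilon>) \<xi> \<le> ennreal M" if "\<epsilon> > 0" for \<epsilon>
    using assms(3)[OF that]
  proof eventually_elim
    case (elim x)
    then have "\<forall>\<zeta>. norm \<zeta> \<le> \<rho> \<longrightarrow> W (x /\<^sub>R \<epsilon>) (\<xi> + \<zeta>) \<le> ennreal M" using assms(4) by blast
    from spec[OF this, of 0] show ?case using assms(2) by simp
  qed
  then show "\<epsilon> > 0 \<Longrightarrow> AE x in lborel. W (x /\<^sub>R \<epsilon>) \<xi> \<le> ennreal M" .
  from *[of 1] show "HW W \<xi> \<le> ennreal M" by (intro HW_le_bound[OF assms(1)]) simp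
qed

text \<open>A near optimal function for \<open>\<zeta>\<close> is placed in the inner cube of the
  unit cube and glued in the layer to the affine map with gradient \<open>\<xi>\<close>. The modulus
  depends only on the bound near \<open>K\<close>, although \<open>W\<close> itself need not be
  continuous.\<close>

lemma HW_uniformly_continuous:
  assumes K: "compact K" "convex K" "K \<subseteq> interior C" and \<delta>: "\<delta> > 0"
  obtains \<kappa> where "\<kappa> > 0" "\<And>\<xi> \<zeta>. \<xi> \<in> K \<Longrightarrow> \<zeta> \<in> K \<Longrightarrow> norm (\<xi> - \<zeta>) \<le> \<kappa> \<Longrightarrow> HW W \<xi> \<le> HW W \<zeta> + ennreal \<delta>"
proof -
  let ?d = "real CARD('d)"
  obtain \<rho> M where \<rho>: "\<rho> > 0" and M: "M \<ge> 0"
    "\<And>\<epsilon>. \<epsilon> > 0 \<Longrightarrow> AE x in lborel. \<forall>\<xi>\<in>K. \<forall>\<zeta>. norm \<zeta> \<le> \<rho> \<longrightarrow> W (x /\<^sub>R \<epsilon>) (\<xi> + \<zeta>) \<le> ennreal M"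
    by (rule W_bounded_nbhd[OF K(1,3)], rule that)
  \<comment> \<open>\<open>1 - (1 - 4 * r) ^ CARD('d)\<close> is the volume of the unit cube outside
    its inner cube.\<close>
  have "((\<lambda>r. M * (1 - (1 - 4 * r) ^ CARD('d))) \<longlongrightarrow> M * (1 - (1 - 4 * 0) ^ CARD('d))) (at_right 0)"
    by (intro tendsto_intros)
  then have "eventually (\<lambda>r. M * (1 - (1 - 4 * r) ^ CARD('d)) < \<delta> / 4) (at_right 0)"
    using \<delta> by (intro order_tendstoD) auto
  then obtain b1 where b1: "b1 > 0" "\<And>r. 0 < r \<Longrightarrow> r < b1 \<Longrightarrow> M * (1 - (1 - 4 * r) ^ CARD('d)) < \<delta> / 4"
    unfolding eventually_at_right_field by blast
  define r where "r = min b1 (1/4) / 2"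
  have r: "0 < r" "4 * r < 1" using b1 by (auto simp: r_def)
  have r3: "M * (1 - (1 - 4 * r) ^ CARD('d)) < \<delta> / 4"
    using b1 by (intro b1(2)) (auto simp: r_def)
  \<comment> \<open>The largest distance that the margin tolerates in a layer of width
    \<open>r\<close>; adding 1 keeps the denominator positive.\<close>
  define \<kappa>' where "\<kappa>' = \<rho> * r / (?d * cutL + 1)"
  have dc: "?d * cutL + 1 > 0" using cutL_nonneg by (simp add: add_nonneg_pos)
  have \<kappa>': "\<kappa>' > 0" using \<rho> r dc by (simp add: \<kappa>'_def)
  have \<kappa>'2: "?d * cutL * \<kappa>' / r \<le> \<rho>"
  proof -
    have "?d * cutL * \<kappa>' / r = \<rho> * (?d * cutL / (?d * cutL + 1))" using r by (simp add: \<kappa>'_def)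
    also have "\<dots> \<le> \<rho> * 1" using \<rho> dc by (intro mult_left_mono) auto
    finally show ?thesis by simp
  qed
  \<comment> \<open>Half of \<open>\<kappa>'\<close> is reserved for the amplitude of the cell
    functions and half for the difference of the two affine maps, which on the unit cube is at most
    \<open>CARD('d) * \<kappa>\<close>. The energy error takes a quarter of \<open>\<delta>\<close>;
    two more quarters go to near optimality and to the layer.\<close>
  define \<delta>' where "\<delta>' = min (\<kappa>' / 2) (\<delta> / 4)"
  have \<delta>': "\<delta>' > 0" "\<delta>' \<le> \<kappa>' / 2" "\<delta>' \<le> \<delta> / 4" using \<delta> \<kappa>' by (auto simp: \<delta>'_def)
  define \<kappa> where "\<kappa> = \<kappa>' / (2 * ?d)"
  have \<kappa>: "\<kappa> > 0" using \<kappa>' by (simp add: \<kappa>_def)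
  have "HW W \<xi> \<le> HW W \<zeta> + ennreal \<delta>" if \<xi>: "\<xi> \<in> K" and \<zeta>: "\<zeta> \<in> K" and n: "norm (\<xi> - \<zeta>) \<le> \<kappa>" for \<xi> \<zeta>
  proof -
    have HM: "HW W \<zeta> \<le> ennreal M" by (rule HW_le_bound_nbhd(1)[OF M(1) _ M(2) \<zeta>]) (use \<rho> in simp)
    then obtain a where a: "HW W \<zeta> = ennreal a" "a \<ge> 0" by (cases "HW W \<zeta>") (auto simp: top_unique)
    define c where "c = a + \<delta> / 4"
    have c: "HW W \<zeta> < ennreal c" "c \<ge> 0" using a \<delta> by (auto simp: c_def intro!: ennreal_lessI)
    \<comment> \<open>The cube with corner \<open>p\<close> and side \<open>l\<close> is the inner
      cube of the unit cube.\<close>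
    define p :: "real^'d" where "p = vec (2 * r)"
    define l where "l = 1 - 4 * r"
    have l: "l > 0" "l \<le> 1" using r by (auto simp: l_def)
    have M\<zeta>: "AE x in lborel. W (x /\<^sub>R \<epsilon>) \<zeta> \<le> ennreal M" if "\<epsilon> > 0" for \<epsilon>
      by (rule HW_le_bound_nbhd(2)[OF M(1) less_imp_le[OF \<rho>] M(2) \<zeta> that])
    obtain \<epsilon>0 where \<epsilon>0: "\<epsilon>0 > 0" "\<And>\<epsilon>. 0 < \<epsilon> \<Longrightarrow> \<epsilon> < \<epsilon>0 \<Longrightarrow> \<exists>\<Phi> G. WG UNIV \<Phi> G \<and> continuous_on UNIV \<Phi> \<and>
     (\<forall>x. x \<notin> box p (p + vec l) \<longrightarrow> \<Phi> x = 0 \<and> G x = 0) \<and> (\<forall>x. norm (\<Phi> x) \<le> \<delta>') \<and>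
     (\<integral>\<^sup>+ x. W (x /\<^sub>R \<epsilon>) (\<zeta> + G x) * indicator (box p (p + vec l)) x \<partial>lborel) \<le> ennreal (c * l ^ CARD('d) + \<delta>')"
      by (rule recovery_cube[OF c M(1) _ l(1) \<delta>'(1)], erule M\<zeta>, rule that)
    have "((\<lambda>\<epsilon>. M * ((1 + 2 * \<epsilon>) ^ CARD('d) - (1 - 4 * r) ^ CARD('d))) \<longlongrightarrow> M * ((1 + 2 * 0) ^ CARD('d) - (1 - 4 * r) ^ CARD('d))) (at_right 0)"
      by (intro tendsto_intros)
    then have "eventually (\<lambda>\<epsilon>. M * ((1 + 2 * \<epsilon>) ^ CARD('d) - (1 - 4 * r) ^ CARD('d)) < \<delta> / 4) (at_right 0)"
      using r3 by (intro order_tendstoD) auto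
    then obtain b2 where b2: "b2 > 0" "\<And>\<epsilon>. 0 < \<epsilon> \<Longrightarrow> \<epsilon> < b2 \<Longrightarrow> M * ((1 + 2 * \<epsilon>) ^ CARD('d) - (1 - 4 * r) ^ CARD('d)) < \<delta> / 4"
      unfolding eventually_at_right_field by blast
    define \<epsilon> where "\<epsilon> = min \<epsilon>0 b2 / 2"
    have \<epsilon>: "0 < \<epsilon>" "\<epsilon> < \<epsilon>0" "\<epsilon> < b2" using \<epsilon>0(1) b2(1) by (auto simp: \<epsilon>_def)
    obtain \<Phi> G where \<Phi>: "WG UNIV \<Phi> G" "continuous_on UNIV \<Phi>" "\<And>x. x \<notin> box p (p + vec l) \<Longrightarrow> \<Phi> x = 0 \<and> G x = 0"
      "\<And>x. norm (\<Phi> x) \<le> \<delta>'"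
      "(\<integral>\<^sup>+ x. W (x /\<^sub>R \<epsilon>) (\<zeta> + G x) * indicator (box p (p + vec l)) x \<partial>lborel) \<le> ennreal (c * l ^ CARD('d) + \<delta>')"
      using \<epsilon>0(2)[OF \<epsilon>(1,2)] by blast
    let ?g = "\<lambda>x. (\<zeta> *v x + 0) + \<Phi> x"
    have In: "box (0 + vec (2 * (r * 1))) (0 + vec (1 - 2 * (r * 1))) = box p (p + vec l)"
      by (rule arg_cong2[where f = box]) (auto simp: vec_eq_iff p_def l_def)
    have "ennreal (1 ^ CARD('d)) * HW W \<xi> \<le> (\<integral>\<^sup>+ x. W (x /\<^sub>R \<epsilon>) (\<zeta> + G x) * indicator (box (0 + vec (2 * (r * 1))) (0 + vec (1 - 2 * (r * 1)))) x \<partial>lborel)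
      + ennreal (M * ((1 + 2 * \<epsilon>) ^ CARD('d) - (1 - 4 * (r * 1)) ^ CARD('d)))"
    proof (rule HW_le_cube[where K = K and \<rho> = \<rho> and g = ?g and b = 0 and \<kappa> = \<kappa>'])
      show "WG (box 0 (0 + vec 1)) ?g (\<lambda>x. \<zeta> + G x)"
        by (rule WG_add[OF WG_affine WG_subset[OF \<Phi>(1)]]) simp
      show "continuous_on UNIV ?g"
        by (intro continuous_intros \<Phi>(2) linear_continuous_on[OF matrix_vector_mul_bounded_linear])
      show "AE x in lborel. x \<in> box 0 (0 + vec 1) - box (0 + vec (2 * (r * 1))) (0 + vec (1 - 2 * (r * 1))) \<longrightarrow> \<zeta> + G x \<in> K"
        unfolding In by (intro AE_I2) (use \<Phi>(3) \<zeta> in auto)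
      show "norm (?g x - (\<xi> *v x + 0)) \<le> \<kappa>' * 1" if x: "x \<in> box 0 (0 + vec 1)" for x
      proof -
        have e: "?g x - (\<xi> *v x + 0) = (\<zeta> - \<xi>) *v x + \<Phi> x" by (simp add: matrix_vector_mult_diff_rdistrib)
        have "norm (?g x - (\<xi> *v x + 0)) \<le> norm (\<zeta> - \<xi>) * norm x + norm (\<Phi> x)"
          unfolding e using norm_triangle_ineq[of "(\<zeta> - \<xi>) *v x" "\<Phi> x"] norm_matrix_vector_mult_le[of "\<zeta> - \<xi>" x] by linarith
        also have "norm (\<zeta> - \<xi>) * norm x \<le> \<kappa> * (?d * 1)"
          using n box_subset_norm[OF x] by (intro mult_mono) (auto simp: norm_minus_commute intro: order_trans[OF norm_ge_zero n])
        also have "\<kappa> * (?d * 1) = \<kappa>' / 2" by (simp add: \<kappa>_def)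
        finally show ?thesis using \<Phi>(4)[of x] \<delta>'(2) by simp
      qed
    qed (use K \<xi> M r \<epsilon> \<kappa>'2 in auto)
    also have "\<dots> \<le> ennreal (c * l ^ CARD('d) + \<delta>') + ennreal (\<delta> / 4)"
      unfolding In using \<Phi>(5) b2(2)[OF \<epsilon>(1,3)] by (intro add_mono ennreal_leI) auto
    also have "\<dots> \<le> ennreal (c + \<delta> / 4) + ennreal (\<delta> / 4)"
    proof (intro add_right_mono ennreal_leI)
      have "c * l ^ CARD('d) \<le> c * 1" using c(2) l by (intro mult_left_mono power_le_one) auto
      then show "c * l ^ CARD('d) + \<delta>' \<le> c + \<delta> / 4" using \<delta>'(3) by simp
    qed
    also have "\<dots> = ennreal (c + \<delta> / 4 + \<delta> / 4)" using c(2) \<delta> by (intro ennreal_plus[symmetric]) auto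
    also have "\<dots> \<le> ennreal (a + \<delta>)" using \<delta> by (intro ennreal_leI) (simp add: c_def)
    also have "\<dots> = HW W \<zeta> + ennreal \<delta>" using a \<delta> by (simp add: ennreal_plus)
    finally show ?thesis by simp
  qed
  then show thesis by (rule that[OF \<kappa>])
qed

text \<open>Condition (1) in a form without the effective domain: off the domain the right-hand side
  is infinite. The threshold \<open>\<eta>\<close> is uniform in \<open>x\<close> and in the
  matrix.\<close>

lemma W_scale:
  assumes "\<delta> > 0"
  obtains \<eta> where "\<eta> > 0" "\<And>x \<xi> t. 0 \<le> t \<Longrightarrow> t < 1 \<Longrightarrow> 1 - t \<le> \<eta> \<Longrightarrow> W x (t *\<^sub>R \<xi>) \<le> W x \<xi> + ennreal \<delta>"
proof -
  obtain \<eta> where \<eta>: "\<eta> > 0" "\<forall>x. \<forall>\<xi> \<in> effective_dom (W x). \<forall>t \<in> {0..<1}. 1 - t \<le> \<eta> \<longrightarrow> W x (t *\<^sub>R \<xi>) \<le> W x \<xi> + ennreal \<delta>"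
    using cond1 assms by blast
  have "W x (t *\<^sub>R \<xi>) \<le> W x \<xi> + ennreal \<delta>" if "0 \<le> t" "t < 1" "1 - t \<le> \<eta>" for x \<xi> t
  proof (cases "W x \<xi> = top")
    case False
    then have "\<xi> \<in> effective_dom (W x)" by (simp add: effective_dom_def less_top)
    with \<eta>(2) that show ?thesis by simp
  qed simp
  with \<eta>(1) show thesis by (rule that)
qed

text \<open>If \<open>\<Phi>\<close> competes for \<open>\<xi>\<close>, then \<open>t\<close> times
  \<open>\<Phi>\<close> competes for \<open>t\<close> times \<open>\<xi>\<close>, and the pointwise
  excess \<open>\<delta>\<close> is also the excess per unit volume.\<close>

lemma HW_scale:
  assumes \<delta>: "\<delta> > 0" and \<eta>: "\<And>x \<xi>. W x (t *\<^sub>R \<xi>) \<le> W x \<xi> + ennreal \<delta>"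
  shows "HW W (t *\<^sub>R \<xi>) \<le> HW W \<xi> + ennreal \<delta>"
proof -
  have "HW W (t *\<^sub>R \<xi>) \<le> c + ennreal \<delta>" if c: "HW W \<xi> < c" for c
  proof -
    obtain n B where n: "n \<ge> (1::nat)" and ex: "\<And>\<epsilon> k. \<epsilon> > 0 \<Longrightarrow> \<exists>\<Phi> G. WG UNIV \<Phi> G \<and> continuous_on UNIV \<Phi> \<and>
       (\<forall>x. x \<notin> ecell \<epsilon> n k \<longrightarrow> \<Phi> x = 0 \<and> G x = 0) \<and> (\<forall>x. norm (\<Phi> x) \<le> \<epsilon> * B) \<and>
       (\<integral>\<^sup>+ x. W (x /\<^sub>R \<epsilon>) (\<xi> + G x) * indicator (ecell \<epsilon> n k) x \<partial>lborel) \<le> c * ennreal ((real n * \<epsilon>) ^ CARD('d))"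
      by (rule HW_lower[OF c], rule that)
    let ?E = "ecell 1 n 0"
    obtain \<Phi> G where \<Phi>: "WG UNIV \<Phi> G" "continuous_on UNIV \<Phi>" "\<And>x. x \<notin> ?E \<Longrightarrow> \<Phi> x = 0 \<and> G x = 0"
      "(\<integral>\<^sup>+ x. W (x /\<^sub>R 1) (\<xi> + G x) * indicator ?E x \<partial>lborel) \<le> c * ennreal ((real n * 1) ^ CARD('d))"
      using ex[of 1 0] by auto
    note [measurable] = WG_meas(1,2)[OF \<Phi>(1)]
    let ?N = "ennreal ((real n * 1) ^ CARD('d))"
    have N: "?N \<noteq> 0" "?N \<noteq> top" using n by auto
    have "?N * HW W (t *\<^sub>R \<xi>) \<le> (\<integral>\<^sup>+ x. W (x /\<^sub>R 1) (t *\<^sub>R \<xi> + t *\<^sub>R G x) * indicator ?E x \<partial>lborel)"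
      by (rule HW_upper[OF n _ WG_cmul[OF \<Phi>(1)]]) (use \<Phi>(3) in \<open>auto intro!: continuous_intros \<Phi>(2)\<close>)
    also have "\<dots> \<le> (\<integral>\<^sup>+ x. W (x /\<^sub>R 1) (\<xi> + G x) * indicator ?E x + ennreal \<delta> * indicator ?E x \<partial>lborel)"
      using \<eta> by (intro nn_integral_mono) (auto simp: indicator_def simp flip: scaleR_add_right)
    also have "\<dots> = (\<integral>\<^sup>+ x. W (x /\<^sub>R 1) (\<xi> + G x) * indicator ?E x \<partial>lborel) + ennreal \<delta> * emeasure lborel ?E"
    proof -
      have "(\<lambda>x. W (x /\<^sub>R 1) (\<xi> + G x) * indicator ?E x) \<in> borel_measurable lborel"
        by (intro borel_measurable_times_ennreal W_comp_measurable) auto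
      then show ?thesis by (subst nn_integral_add) (auto simp: nn_integral_cmult_indicator)
    qed
    also have "emeasure lborel ?E = ?N" using measure_cube(2)[of "real n * 1"] by simp
    also have "(\<integral>\<^sup>+ x. W (x /\<^sub>R 1) (\<xi> + G x) * indicator ?E x \<partial>lborel) + ennreal \<delta> * ?N \<le> c * ?N + ennreal \<delta> * ?N"
      by (rule add_right_mono[OF \<Phi>(4)])
    also have "\<dots> = (c + ennreal \<delta>) * ?N" by (simp add: distrib_right)
    finally have "?N * HW W (t *\<^sub>R \<xi>) / ?N \<le> (c + ennreal \<delta>) * ?N / ?N" by (rule divide_right_mono_ennreal)
    then show ?thesis unfolding mult.commute[of ?N "HW W (t *\<^sub>R \<xi>)"] ennreal_mult_divide_eq[OF N] .
  qed
  then have "HW W (t *\<^sub>R \<xi>) - ennreal \<delta> \<le> c" if "HW W \<xi> < c" for c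
    using that by (simp add: ennreal_minus_le_iff add.commute)
  then have "HW W (t *\<^sub>R \<xi>) - ennreal \<delta> \<le> HW W \<xi>" by (rule dense_ge)
  then show ?thesis by (simp add: ennreal_minus_le_iff add.commute)
qed

text \<open>The average of an admissible gradient over the cell is \<open>\<xi>\<close>.\<close>

lemma HW_eq_top:
  assumes "\<xi> \<notin> closure C" shows "HW W \<xi> = top"
proof (rule ccontr)
  assume "HW W \<xi> \<noteq> top"
  then obtain c where c: "HW W \<xi> < c" "c < top" using dense[of "HW W \<xi>" top] by (auto simp: less_top)
  obtain n B where n: "n \<ge> (1::nat)" and ex: "\<And>\<epsilon> k. \<epsilon> > 0 \<Longrightarrow> \<exists>\<Phi> G. WG UNIV \<Phi> G \<and> continuous_on UNIV \<Phi> \<and>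
     (\<forall>x. x \<notin> ecell \<epsilon> n k \<longrightarrow> \<Phi> x = 0 \<and> G x = 0) \<and> (\<forall>x. norm (\<Phi> x) \<le> \<epsilon> * B) \<and>
     (\<integral>\<^sup>+ x. W (x /\<^sub>R \<epsilon>) (\<xi> + G x) * indicator (ecell \<epsilon> n k) x \<partial>lborel) \<le> c * ennreal ((real n * \<epsilon>) ^ CARD('d))"
    by (rule HW_lower[OF c(1)], rule that)
  define E :: "(real^'d) set" where "E = box 0 (vec (real n))"
  have Ee: "ecell 1 n 0 = E" unfolding E_def by (rule arg_cong2[where f = box]) (auto simp: vec_eq_iff)
  obtain \<Phi> G where \<Phi>: "WG UNIV \<Phi> G" "\<And>x. x \<notin> E \<Longrightarrow> \<Phi> x = 0" "\<And>x. x \<notin> E \<Longrightarrow> G x = 0"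
    "(\<integral>\<^sup>+ x. W (x /\<^sub>R 1) (\<xi> + G x) * indicator E x \<partial>lborel) \<le> c * ennreal ((real n * 1) ^ CARD('d))"
    using ex[of 1 0] unfolding Ee by auto
  note [measurable] = WG_meas(1,2)[OF \<Phi>(1)]
  have Em [measurable]: "E \<in> sets borel" by (simp add: E_def)
  have m: "(\<lambda>x. W (x /\<^sub>R 1) (\<xi> + G x) * indicator E x) \<in> borel_measurable lborel"
    by (intro borel_measurable_times_ennreal W_comp_measurable) auto
  have "(\<integral>\<^sup>+ x. W (x /\<^sub>R 1) (\<xi> + G x) * indicator E x \<partial>lborel) < top"
    by (rule le_less_trans[OF \<Phi>(4)]) (simp add: ennreal_mult_less_top c(2))
  then have "AE x in lborel. W (x /\<^sub>R 1) (\<xi> + G x) * indicator E x \<noteq> \<infinity>"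
    by (intro nn_integral_PInf_AE[OF m]) auto
  then have inC: "AE x in lborel. x \<in> E \<longrightarrow> \<xi> + G x \<in> closure C"
  proof eventually_elim
    case (elim x)
    then show ?case using dom[of x] by (auto simp: effective_dom_def indicator_def less_top)
  qed
  have iG: "integrable lborel G"
  proof -
    have "(\<lambda>z. indicator E z *\<^sub>R G z) = G" using \<Phi>(3) by (auto simp: indicator_def)
    then show ?thesis using integrable_indicator_box[OF WG_meas(2,4)[OF \<Phi>(1)], of 0 "vec (real n)"] unfolding E_def by simp
  qed
  have G0: "(LINT x|lborel. G x) = 0"
  proof -
    \<comment> \<open>This cutoff equals 1 with zero derivatives on a neighbourhood of the cell:
      with layer width 1 the transition ends one unit outside it. Testing against it shows that the
      gradient of \<open>\<Phi>\<close> has mean zero.\<close>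
    define \<psi> :: "real^'d \<Rightarrow> real" where "\<psi> = cutoff (vec (-3)) (vec (real n + 3)) 1"
    have t: "test_function UNIV \<psi>" unfolding \<psi>_def by (rule test_function_mono[OF cutoff_test_function]) auto
    have E1: "\<psi> x = 1" "partial_deriv j \<psi> x = 0" if "x \<in> E" for x j
    proof -
      have xi: "0 < x $ i \<and> x $ i < real n" for i using that by (simp add: E_def mem_box_cart)
      show "\<psi> x = 1" unfolding \<psi>_def
      proof (rule cutoff_eq_1)
        fix i
        show "vec (- 3) $ i + 2 * 1 \<le> x $ i" "x $ i \<le> vec (real n + 3) $ i - 2 * 1" using xi[of i] by auto
      qed simp
      show "partial_deriv j \<psi> x = 0" unfolding \<psi>_def
        by (rule partial_deriv_cutoff_eq_0) (use xi[of j] in auto)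
    qed
    have "(LINT x|lborel. G x) $ i $ j = 0" for i j
    proof -
      have "bounded_linear (\<lambda>A :: real^'d^'m. A $ i $ j)"
        by (rule bounded_linear_compose[OF bounded_linear_vec_nth bounded_linear_vec_nth])
      from integral_bounded_linear[OF this iG]
      have "(LINT x|lborel. G x) $ i $ j = (LINT x|lborel. G x $ i $ j)" by simp
      also have "\<dots> = (LINT x|lborel. G x $ i $ j * \<psi> x)"
      proof (rule Bochner_Integration.integral_cong[OF refl])
        fix x show "G x $ i $ j = G x $ i $ j * \<psi> x" using E1(1)[of x] \<Phi>(3)[of x] by (cases "x \<in> E") auto
      qed
      also have "\<dots> = - (LINT x|lborel. \<Phi> x $ i * partial_deriv j \<psi> x)" using WG_weak[OF \<Phi>(1) t, of i j] by simp
      also have "(LINT x|lborel. \<Phi> x $ i * partial_deriv j \<psi> x) = (LINT x|(lborel :: (real^'d) measure). 0)"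
      proof (rule Bochner_Integration.integral_cong[OF refl])
        fix x :: "real^'d" show "\<Phi> x $ i * partial_deriv j \<psi> x = 0" using E1(2)[of x j] \<Phi>(2)[of x] by (cases "x \<in> E") auto
      qed
      finally show ?thesis by simp
    qed
    then show ?thesis by (simp add: vec_eq_iff)
  qed
  let ?N = "real n ^ CARD('d)"
  have N: "?N > 0" using n by simp
  have mE: "measure lborel E = ?N" using measure_cube(1)[of "real n" 0] by (simp add: E_def)
  have iE: "integrable lborel (indicator E :: _ \<Rightarrow> real)"
    unfolding E_def by (intro integrable_real_indicator) (auto simp: emeasure_bounded_finite[OF bounded_box, unfolded infinity_ennreal_def])
  \<comment> \<open>The uniform density on the cell; the mean of \<open>\<xi> + G\<close> with
    respect to it is \<open>\<xi>\<close>.\<close>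
  define \<psi> where "\<psi> x = indicator E x / ?N" for x
  have eq: "\<psi> x *\<^sub>R (\<xi> + G x) = \<psi> x *\<^sub>R \<xi> + (1 / ?N) *\<^sub>R G x" for x
    using \<Phi>(3)[of x] by (auto simp: \<psi>_def indicator_def scaleR_add_right)
  have i\<psi>: "integrable lborel \<psi>" unfolding \<psi>_def using iE by simp
  have I\<psi>: "(LINT x|lborel. \<psi> x) = 1" unfolding \<psi>_def using mE N by simp
  have i1: "integrable lborel (\<lambda>x. \<psi> x *\<^sub>R \<xi>)" and i2: "integrable lborel (\<lambda>x. (1 / ?N) *\<^sub>R G x)"
    using i\<psi> iG by (auto intro: integrable_scaleR_left integrable_scaleR_right)
  have "(LINT x|lborel. \<psi> x *\<^sub>R (\<xi> + G x)) \<in> closure C"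
  proof (rule integral_in_closed_convex[OF closed_closure convex_closure[OF convex_C] _ i\<psi> I\<psi>])
    show "0 \<le> \<psi> x" for x by (simp add: \<psi>_def)
    show "integrable lborel (\<lambda>x. \<psi> x *\<^sub>R (\<xi> + G x))" unfolding eq by (rule Bochner_Integration.integrable_add[OF i1 i2])
    show "AE x in lborel. \<psi> x \<noteq> 0 \<longrightarrow> \<xi> + G x \<in> closure C"
      using inC by eventually_elim (auto simp: \<psi>_def indicator_def)
  qed
  also have "(LINT x|lborel. \<psi> x *\<^sub>R (\<xi> + G x)) = \<xi>"
  proof -
    have "(LINT x|lborel. \<psi> x *\<^sub>R (\<xi> + G x)) = (LINT x|lborel. \<psi> x *\<^sub>R \<xi>) + (LINT x|lborel. (1 / ?N) *\<^sub>R G x)"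
      unfolding eq by (rule Bochner_Integration.integral_add[OF i1 i2])
    also have "(LINT x|lborel. \<psi> x *\<^sub>R \<xi>) = (LINT x|lborel. \<psi> x) *\<^sub>R \<xi>" using i\<psi> by simp
    also have "(LINT x|lborel. (1 / ?N) *\<^sub>R G x) = (1 / ?N) *\<^sub>R (LINT x|lborel. G x)" by (rule integral_scaleR_right)
    finally show ?thesis using G0 I\<psi> by simp
  qed
  finally show False using assms by blast
qed

lemma Whom_eq_top: "\<xi> \<notin> closure C \<Longrightarrow> lsc_envelope (HW W) \<xi> = top"
proof -
  assume \<xi>: "\<xi> \<notin> closure C"
  have "top \<le> lsc_envelope (HW W) \<xi>"
    by (rule lsc_envelope_greatest_local[of "- closure C"]) (use \<xi> HW_eq_top in auto)
  then show ?thesis by (simp add: top_unique)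
qed

text \<open>Bounds the unrelaxed density by the relaxed one, at the price of the factor
  \<open>t\<close>. For \<open>\<zeta>\<close> near \<open>\<xi>\<close>, uniform continuity on the
  shrunk set and \<open>HW_scale\<close> give \<open>HW W (t *\<^sub>R \<xi>) - 2 * \<delta>\<close>
  as a lower bound of \<open>HW W \<zeta>\<close>; such a local constant bound passes to the
  envelope. Points outside the closure of \<open>C\<close> have infinite density.\<close>

lemma HW_scale_le_Whom:
  assumes t: "0 \<le> t" "t < 1" and \<delta>: "\<delta> > 0" and \<eta>: "\<And>x \<xi>. W x (t *\<^sub>R \<xi>) \<le> W x \<xi> + ennreal \<delta>"
    and \<xi>: "\<xi> \<in> closure C"
  shows "HW W (t *\<^sub>R \<xi>) \<le> lsc_envelope (HW W) \<xi> + ennreal (2 * \<delta>)"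
proof -
  obtain \<kappa> where \<kappa>: "\<kappa> > 0" "\<And>\<xi> \<zeta>. \<xi> \<in> (\<lambda>\<xi>. t *\<^sub>R \<xi>) ` closure C \<Longrightarrow> \<zeta> \<in> (\<lambda>\<xi>. t *\<^sub>R \<xi>) ` closure C \<Longrightarrow>
      norm (\<xi> - \<zeta>) \<le> \<kappa> \<Longrightarrow> HW W \<xi> \<le> HW W \<zeta> + ennreal \<delta>"
    by (rule HW_uniformly_continuous[OF shrunk[OF t] \<delta>], rule that)
  have "HW W (t *\<^sub>R \<xi>) - ennreal (2 * \<delta>) \<le> lsc_envelope (HW W) \<xi>"
  proof (rule lsc_envelope_greatest_local[of "ball \<xi> \<kappa>"])
    fix \<zeta> assume \<zeta>: "\<zeta> \<in> ball \<xi> \<kappa>"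
    show "HW W (t *\<^sub>R \<xi>) - ennreal (2 * \<delta>) \<le> HW W \<zeta>"
    proof (cases "\<zeta> \<in> closure C")
      case True
      have "norm (t *\<^sub>R \<xi> - t *\<^sub>R \<zeta>) = t * norm (\<xi> - \<zeta>)" using t by (simp flip: scaleR_diff_right)
      also have "\<dots> \<le> 1 * norm (\<xi> - \<zeta>)" using t by (intro mult_right_mono) auto
      also have "\<dots> \<le> \<kappa>" using \<zeta> by (simp add: dist_norm)
      finally have "HW W (t *\<^sub>R \<xi>) \<le> HW W (t *\<^sub>R \<zeta>) + ennreal \<delta>"
        using \<xi> True by (intro \<kappa>(2)) auto
      also have "\<dots> \<le> (HW W \<zeta> + ennreal \<delta>) + ennreal \<delta>"
        by (intro add_right_mono HW_scale[OF \<delta> \<eta>])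
      also have "\<dots> = HW W \<zeta> + ennreal (2 * \<delta>)" using \<delta> by (simp add: add.assoc flip: ennreal_plus)
      finally show ?thesis by (simp add: ennreal_minus_le_iff add.commute)
    qed (simp add: HW_eq_top)
  qed (use \<kappa> in auto)
  then show ?thesis by (simp add: ennreal_minus_le_iff add.commute)
qed

lemma Whom_le_liminf:
  assumes "t \<longlonglongrightarrow> (1::real)"
  shows "lsc_envelope (HW W) \<xi> \<le> liminf (\<lambda>k. lsc_envelope (HW W) (t k *\<^sub>R \<xi>))"
proof (rule dense_le)
  fix a assume "a < lsc_envelope (HW W) \<xi>"
  from lsc_eventually[OF lsc_lsc_envelope this]
  have e: "eventually (\<lambda>y. a < lsc_envelope (HW W) y) (nhds \<xi>)" .
  have "(\<lambda>k. t k *\<^sub>R \<xi>) \<longlonglongrightarrow> 1 *\<^sub>R \<xi>" by (intro tendsto_intros assms)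
  then have "filterlim (\<lambda>k. t k *\<^sub>R \<xi>) (nhds \<xi>) sequentially" by simp
  from eventually_compose_filterlim[OF e this]
  have "eventually (\<lambda>k. a < lsc_envelope (HW W) (t k *\<^sub>R \<xi>)) sequentially" .
  then have "eventually (\<lambda>k. a \<le> lsc_envelope (HW W) (t k *\<^sub>R \<xi>)) sequentially"
    by eventually_elim simp
  then show "a \<le> liminf (\<lambda>k. lsc_envelope (HW W) (t k *\<^sub>R \<xi>))" by (rule Liminf_bounded)
qed

end

subsection \<open>Grids of cubes on which a Sobolev function is almost affine\<close>

abbreviation gcube :: "real \<Rightarrow> int^'d::finite \<Rightarrow> (real^'d) set" where
  "gcube h z \<equiv> box (h *\<^sub>R int_vec z) (h *\<^sub>R int_vec z + vec h)"

lemma gcube_iff: "x \<in> gcube h z \<longleftrightarrow> (\<forall>i. h * of_int (z $ i) < x $ i \<and> x $ i < h * of_int (z $ i) + h)"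
  by (simp add: mem_box_cart)

lemma gcube_disjoint:
  assumes "h > 0" "x \<in> gcube h z" "x \<in> gcube h z'" shows "z = z'"
proof -
  have "z $ i = \<lfloor>x $ i / h\<rfloor>" if "x \<in> gcube h z" for z i
  proof -
    have "h * of_int (z $ i) < x $ i \<and> x $ i < h * of_int (z $ i) + h" using that gcube_iff by blast
    then show ?thesis using assms(1) by (intro floor_unique[symmetric]) (auto simp: field_simps)
  qed
  then show ?thesis using assms by (simp add: vec_eq_iff)
qed

text \<open>A measurable function is an almost everywhere limit of continuous ones. Truncation at 1
  supplies the dominating function on the bounded set without any bound on the
  approximations.\<close>

lemma continuous_approximation:
  fixes G :: "real^'d::finite \<Rightarrow> 'b::euclidean_space"
  assumes [measurable]: "G \<in> borel_measurable borel" "\<Omega> \<in> sets borel" and "bounded \<Omega>" "\<sigma> > 0"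
  obtains F where "continuous_on UNIV F" "(LINT x|lborel. indicator \<Omega> x * min 1 (norm (F x - G x))) < \<sigma>"
proof -
  have "G \<in> borel_measurable lebesgue" by (simp add: measurable_completion)
  then have "G measurable_on UNIV" by (rule lebesgue_measurable_imp_measurable_on) simp
  then obtain N F where N: "negligible N" and F: "\<And>n. continuous_on UNIV (F n)"
    "\<And>x. x \<notin> N \<Longrightarrow> (\<lambda>n. F n x) \<longlonglongrightarrow> (if x \<in> UNIV then G x else 0)"
    unfolding measurable_on_def by blast
  have [measurable]: "F n \<in> borel_measurable borel" for n by (rule borel_measurable_continuous_onI[OF F(1)])
  have "AE x in lebesgue. x \<notin> N" using N by (simp add: AE_not_in negligible_iff_null_sets)
  then have aeN: "AE x in lborel. x \<notin> N" unfolding AE_completion_iff .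
  have i\<Omega>: "integrable lborel (indicator \<Omega> :: _ \<Rightarrow> real)"
    using emeasure_bounded_finite[OF assms(3)] by (intro integrable_real_indicator) auto
  have "(\<lambda>n. LINT x|lborel. indicator \<Omega> x * min 1 (norm (F n x - G x))) \<longlonglongrightarrow> (LINT x|(lborel :: (real^'d) measure). 0)"
  proof (rule integral_dominated_convergence[where w = "indicator \<Omega>"])
    show "AE x in lborel. (\<lambda>n. indicator \<Omega> x * min 1 (norm (F n x - G x))) \<longlonglongrightarrow> 0"
      using aeN
    proof eventually_elim
      case (elim x)
      have "(\<lambda>n. F n x) \<longlonglongrightarrow> G x" using F(2)[OF elim] by simp
      then have "(\<lambda>n. indicator \<Omega> x * min 1 (norm (F n x - G x))) \<longlonglongrightarrow> indicator \<Omega> x * min 1 (norm (G x - G x))"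
        by (intro tendsto_intros)
      then show ?case by simp
    qed
    show "AE x in lborel. norm (indicator \<Omega> x * min 1 (norm (F n x - G x))) \<le> indicator \<Omega> x" for n
      by (intro AE_I2) (auto simp: indicator_def)
  qed (use i\<Omega> in \<open>measurable\<close>)
  then have "eventually (\<lambda>n. (LINT x|lborel. indicator \<Omega> x * min 1 (norm (F n x - G x))) < \<sigma>) sequentially"
    using \<open>\<sigma> > 0\<close> by (intro order_tendstoD) auto
  then obtain n where "(LINT x|lborel. indicator \<Omega> x * min 1 (norm (F n x - G x))) < \<sigma>"
    unfolding eventually_sequentially by blast
  then show thesis by (rule that[OF F(1)])
qed

text \<open>A point off all grid faces lies in a cube contained in the open set as soon as the grid
  is fine enough; dominated convergence then makes the uncovered volume vanish.\<close>

lemma grid_exhaustion: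
  fixes \<Omega> :: "(real^'d::finite) set"
  assumes "open \<Omega>" "bounded \<Omega>" "\<tau> > 0" "d0 > 0"
  obtains h where "0 < h" "h < d0" "measure lborel (\<Omega> - (\<Union>z\<in>{z. gcube h z \<subseteq> \<Omega>}. gcube h z)) < \<tau>"
proof -
  define h where "h k = d0 * inverse (real (Suc k)) / 2" for k
  have h: "0 < h k" "h k < d0" for k
  proof -
    have "inverse (real (Suc k)) > 0" "inverse (real (Suc k)) \<le> 1" by (auto simp: field_simps)
    then have "0 < d0 * inverse (real (Suc k))" "d0 * inverse (real (Suc k)) \<le> d0 * 1"
      using assms(4) by (auto intro!: mult_left_mono simp del: mult_1_right)
    then show "0 < h k" "h k < d0" using assms(4) unfolding h_def by simp_all
  qed
  have hl: "h \<longlonglongrightarrow> 0"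
  proof -
    have "h \<longlonglongrightarrow> d0 * 0 / 2" unfolding h_def by (intro tendsto_intros LIMSEQ_inverse_real_of_nat) simp
    then show ?thesis by simp
  qed
  define U where "U k = (\<Union>z\<in>{z. gcube (h k) z \<subseteq> \<Omega>}. gcube (h k) z)" for k
  have [measurable]: "U k \<in> sets borel" for k unfolding U_def by (intro borel_open open_UN ballI open_box)
  have [measurable]: "\<Omega> \<in> sets borel" using assms(1) by simp
  have fin\<Omega>: "emeasure lborel \<Omega> < \<infinity>" by (rule emeasure_bounded_finite[OF assms(2)])
  have i\<Omega>: "integrable lborel (indicator \<Omega> :: _ \<Rightarrow> real)" using fin\<Omega> by (intro integrable_real_indicator) auto
  have "(\<lambda>k. LINT x|lborel. indicator (\<Omega> - U k) x :: real) \<longlonglongrightarrow> (LINT x|(lborel :: (real^'d) measure). 0)"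
  proof (rule integral_dominated_convergence[where w = "indicator \<Omega>"])
    \<comment> \<open>Only countably many grids occur, so one null set contains all their
      faces.\<close>
    have "AE x in lborel. \<forall>k. \<forall>i. (x :: real^'d) $ i / h k \<notin> \<int>"
      unfolding AE_all_countable[where M = lborel and P = "\<lambda>k x. \<forall>i. (x :: real^'d) $ i / h k \<notin> \<int>"]
      using AE_coord_not_Ints[OF h(1)] by blast
    then show "AE x in lborel. (\<lambda>k. indicator (\<Omega> - U k) x :: real) \<longlonglongrightarrow> 0"
    proof eventually_elim
      case (elim x)
      show ?case
      proof (cases "x \<in> \<Omega>")
        case True
        then obtain e where e: "e > 0" "ball x e \<subseteq> \<Omega>" using assms(1) open_contains_ball by metis
        have "eventually (\<lambda>k. h k < e / (real CARD('d) + 1)) sequentially"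
          using hl e(1) by (intro order_tendstoD) auto
        then have "eventually (\<lambda>k. indicator (\<Omega> - U k) x = (0::real)) sequentially"
        proof eventually_elim
          fix k assume k: "h k < e / (real CARD('d) + 1)"
          define z :: "int^'d" where "z = (\<chi> i. \<lfloor>x $ i / h k\<rfloor>)"
          have xz: "x \<in> gcube (h k) z" unfolding gcube_iff
          proof
            fix i
            have "of_int (z $ i) \<le> x $ i / h k" "x $ i / h k < of_int (z $ i) + 1" unfolding z_def by simp_all
            moreover have "of_int (z $ i) \<noteq> x $ i / h k" using elim by (metis Ints_of_int)
            ultimately show "h k * of_int (z $ i) < x $ i \<and> x $ i < h k * of_int (z $ i) + h k"
              using h(1)[of k] by (auto simp: field_simps)
          qed
          have "gcube (h k) z \<subseteq> \<Omega>"
          proof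
            fix y assume y: "y \<in> gcube (h k) z"
            have "norm (y - x) \<le> (\<Sum>i\<in>UNIV. \<bar>(y - x) $ i\<bar>)" by (rule norm_le_l1_cart)
            also have "\<dots> \<le> (\<Sum>i\<in>(UNIV::'d set). h k)"
            proof (rule sum_mono)
              fix i
              show "\<bar>(y - x) $ i\<bar> \<le> h k"
                using spec[OF xz[unfolded gcube_iff], of i] spec[OF y[unfolded gcube_iff], of i] by auto
            qed
            also have "\<dots> = real CARD('d) * h k" by simp
            also have "\<dots> < e"
            proof -
              have "(real CARD('d) + 1) * h k < e" using k by (simp add: field_simps)
              moreover have "real CARD('d) * h k \<le> (real CARD('d) + 1) * h k" using h(1)[of k] by (intro mult_right_mono) auto
              ultimately show ?thesis by linarith
            qed
            finally show "y \<in> \<Omega>" using e(2) by (auto simp: dist_norm norm_minus_commute)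
          qed
          then have "x \<in> U k" unfolding U_def using xz by blast
          then show "indicator (\<Omega> - U k) x = (0::real)" by simp
        qed
        then show ?thesis by (rule tendsto_eventually)
      qed simp
    qed
    show "AE x in lborel. norm (indicator (\<Omega> - U k) x :: real) \<le> indicator \<Omega> x" for k
      by (intro AE_I2) (auto simp: indicator_def)
  qed (use i\<Omega> in \<open>measurable\<close>)
  then have "(\<lambda>k. measure lborel (\<Omega> - U k)) \<longlonglongrightarrow> 0" by simp
  then have "eventually (\<lambda>k. measure lborel (\<Omega> - U k) < \<tau>) sequentially" using assms(3) by (intro order_tendstoD) auto
  then obtain k where "measure lborel (\<Omega> - U k) < \<tau>" unfolding eventually_sequentially by blast
  then show thesis using h[of k] unfolding U_def by (intro that[of "h k"])
qed

lemma finite_gcubes: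
  fixes \<Omega> :: "(real^'d::finite) set"
  assumes "bounded \<Omega>" "h > 0" shows "finite {z. gcube h z \<subseteq> \<Omega>}"
proof -
  obtain R where R: "\<And>x. x \<in> \<Omega> \<Longrightarrow> norm x \<le> R" using assms(1) unfolding bounded_iff by blast
  define b where "b = \<lceil>R / h\<rceil> + 1"
  have "{z. gcube h z \<subseteq> \<Omega>} \<subseteq> (\<lambda>f. \<chi> i. f i) ` ((UNIV::'d set) \<rightarrow>\<^sub>E {-b..b})"
  proof
    fix z :: "int^'d" assume z: "z \<in> {z. gcube h z \<subseteq> \<Omega>}"
    define c where "c = h *\<^sub>R int_vec z + vec (h / 2)"
    have "c \<in> gcube h z" using assms(2) by (auto simp: gcube_iff c_def)
    then have "norm c \<le> R" using z R by blast
    have "z $ i \<in> {-b..b}" for i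
    proof -
      have "\<bar>c $ i\<bar> \<le> R" using \<open>norm c \<le> R\<close> component_le_norm_cart order_trans by blast
      moreover have "c $ i = h * (of_int (z $ i) + 1 / 2)" by (simp add: c_def algebra_simps)
      moreover have "\<bar>h * (of_int (z $ i) + 1 / 2)\<bar> = h * \<bar>of_int (z $ i) + 1 / 2\<bar>"
        using assms(2) by (simp only: abs_mult abs_of_pos)
      ultimately have "h * \<bar>of_int (z $ i) + 1 / 2\<bar> \<le> R" by simp
      then have "\<bar>of_int (z $ i) + 1 / 2\<bar> \<le> R / h" using assms(2) by (simp only: pos_le_divide_eq mult.commute)
      moreover have "R / h \<le> of_int \<lceil>R / h\<rceil>" by (rule le_of_int_ceiling)
      ultimately have "of_int (z $ i) \<le> (of_int b :: real)" "(of_int (- b) :: real) \<le> of_int (z $ i)"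
        unfolding b_def by simp_all linarith+
      then show ?thesis by (simp only: of_int_le_iff atLeastAtMost_iff)
    qed
    then have "(\<lambda>i. z $ i) \<in> UNIV \<rightarrow>\<^sub>E {-b..b}" by auto
    then show "z \<in> (\<lambda>f. \<chi> i. f i) ` (UNIV \<rightarrow>\<^sub>E {-b..b})" by (rule image_eqI[rotated]) (simp add: vec_eq_iff)
  qed
  then show ?thesis by (rule finite_subset) (intro finite_imageI finite_PiE; simp)
qed

text \<open>\<open>G\<close> is replaced by a continuous \<open>F\<close>, which is nearly constant
  on small cubes. Cubes on which \<open>F\<close> and \<open>G\<close> differ on too large a part
  are discarded. On the others \<open>G\<close> is close to one of its values \<open>A\<close>
  except on a small bad part, so \<open>G - A\<close> has small mean and
  \<open>oscillation_estimate\<close> makes \<open>u - A x\<close> nearly constant relative to the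
  side of the cube.\<close>

lemma good_cubes:
  fixes u :: "real^'d::finite \<Rightarrow> real^'m::finite"
  assumes \<Omega>: "open \<Omega>" "bounded \<Omega>" and wg: "WG \<Omega> u G" and S: "AE x in lborel. x \<in> \<Omega> \<longrightarrow> G x \<in> S"
    and B: "\<And>\<xi>. \<xi> \<in> S \<Longrightarrow> norm \<xi> \<le> B" "B \<ge> 0" and \<kappa>: "\<kappa> > 0" and \<tau>: "\<tau> > 0"
  obtains h Z \<xi> b where "h > 0" "h < 1" "finite Z" "\<And>z. z \<in> Z \<Longrightarrow> gcube h z \<subseteq> \<Omega>" "\<And>z. z \<in> Z \<Longrightarrow> \<xi> z \<in> S"
    "measure lborel (\<Omega> - (\<Union>z\<in>Z. gcube h z)) \<le> \<tau>"
    "\<And>z. z \<in> Z \<Longrightarrow> measure lborel {x \<in> gcube h z. norm (G x - \<xi> z) > \<kappa>} \<le> \<kappa> * h ^ CARD('d)"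
    "\<And>z. z \<in> Z \<Longrightarrow> AE x in lborel. x \<in> gcube h z \<longrightarrow> norm (u x - (\<xi> z *v x + b z)) \<le> \<kappa> * h"
proof -
  let ?d = "real CARD('d)" and ?m = "real CARD('m)"
  note [measurable] = WG_meas(1,2)[OF wg]
  have \<Omega>m [measurable]: "\<Omega> \<in> sets borel" using \<Omega>(1) by simp
  \<comment> \<open>Lipschitz constant of \<open>u\<close> minus an affine map with gradient in
    \<open>S\<close>: the gradients differ by at most \<open>2 * B\<close>.\<close>
  define L where "L = ?m * (2 * B)"
  have L: "L \<ge> 0" using B(2) by (simp add: L_def)
  \<comment> \<open>\<open>r\<close> makes the first term of \<open>oscillation_estimate\<close> at
    most \<open>\<kappa> / 2\<close>; below, \<open>\<kappa>''\<close> is the mean gradient for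
    which the second term equals \<open>\<kappa> / 2\<close>.\<close>
  define r where "r = min (1/2) (\<kappa> / (4 * (L * ?d + 1)))"
  have Ld: "L * ?d + 1 > 0" using L by (simp add: add_nonneg_pos)
  have r: "0 < r" "r < 1" using \<kappa> Ld by (auto simp: r_def)
  have r2: "2 * L * ?d * r \<le> \<kappa> / 2"
  proof -
    have "r \<le> \<kappa> / (4 * (L * ?d + 1))" by (simp add: r_def)
    then have "2 * L * ?d * r \<le> 2 * L * ?d * (\<kappa> / (4 * (L * ?d + 1)))" using L by (intro mult_left_mono) auto
    also have "\<dots> = \<kappa> / 2 * (L * ?d / (L * ?d + 1))" using Ld by (simp add: field_simps)
    also have "\<dots> \<le> \<kappa> / 2 * 1" using \<kappa> Ld by (intro mult_left_mono) auto
    finally show ?thesis by simp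
  qed
  define \<kappa>'' where "\<kappa>'' = \<kappa> * r ^ CARD('d) / (2 * ?m * ?d)"
  have \<kappa>'': "\<kappa>'' > 0" "?m * ?d * \<kappa>'' / r ^ CARD('d) = \<kappa> / 2" using \<kappa> r by (auto simp: \<kappa>''_def)
  \<comment> \<open>A common tolerance for \<open>F - G\<close> off the bad part and for the
    oscillation of \<open>F\<close> on a cube; three times it bounds \<open>G - A\<close> on the
    good part. The bound by 1 keeps it below the truncation in
    \<open>continuous_approximation\<close>.\<close>
  define \<kappa>3 where "\<kappa>3 = min 1 (min \<kappa> \<kappa>'') / 8"
  have \<kappa>3: "\<kappa>3 > 0" "\<kappa>3 \<le> 1" "4 * \<kappa>3 \<le> \<kappa>" "4 * \<kappa>3 \<le> \<kappa>'' / 2" using \<kappa> \<kappa>'' by (auto simp: \<kappa>3_def)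
  define q where "q = min (1/2) (min \<kappa> (\<kappa>'' / (4 * B + 4)))"
  have q: "q > 0" "q \<le> \<kappa>" using \<kappa> \<kappa>''(1) B(2) by (simp_all add: q_def)
  have q12: "q \<le> 1/2" unfolding q_def by (rule min.cobounded1)
  have q2: "2 * B * q \<le> \<kappa>'' / 2"
  proof -
    have "q \<le> \<kappa>'' / (4 * B + 4)" by (simp add: q_def)
    then have "2 * B * q \<le> 2 * B * (\<kappa>'' / (4 * B + 4))" using B(2) by (intro mult_left_mono) auto
    also have "\<dots> = \<kappa>'' / 2 * (B / (B + 1))" using B(2) by (simp add: field_simps)
    also have "\<dots> \<le> \<kappa>'' / 2 * 1" using \<kappa>'' B(2) by (intro mult_left_mono) auto
    finally show ?thesis by simp
  qed
  \<comment> \<open>Two applications of Chebyshev's inequality: a cube with integral at most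
    \<open>\<kappa>2\<close> times its volume has a bad fraction of at most \<open>q\<close>, and a
    total integral below \<open>\<sigma>\<close> leaves at most volume \<open>\<tau> / 2\<close> for
    the cubes where this fails.\<close>
  define \<kappa>2 where "\<kappa>2 = \<kappa>3 * q"
  have \<kappa>2: "\<kappa>2 > 0" using \<kappa>3 q by (simp add: \<kappa>2_def)
  define \<sigma> where "\<sigma> = \<kappa>2 * (\<tau> / 2)"
  have \<sigma>: "\<sigma> > 0" using \<kappa>2 \<tau> by (simp add: \<sigma>_def)
  obtain F where F: "continuous_on UNIV F" "(LINT x|lborel. indicator \<Omega> x * min 1 (norm (F x - G x))) < \<sigma>"
    by (rule continuous_approximation[OF WG_meas(2)[OF wg] \<Omega>m \<Omega>(2) \<sigma>], rule that)
  have [measurable]: "F \<in> borel_measurable borel" by (rule borel_measurable_continuous_onI[OF F(1)])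
  obtain R where R: "\<And>x. x \<in> \<Omega> \<Longrightarrow> norm x \<le> R" using \<Omega>(2) unfolding bounded_iff by blast
  have "uniformly_continuous_on (cball 0 R) F"
    by (rule compact_uniformly_continuous[OF continuous_on_subset[OF F(1)]]) auto
  then obtain d1 where d1: "d1 > 0" "\<And>x y. x \<in> cball 0 R \<Longrightarrow> y \<in> cball 0 R \<Longrightarrow> dist y x < d1 \<Longrightarrow> dist (F y) (F x) < \<kappa>3"
    using \<kappa>3(1) unfolding uniformly_continuous_on_def by meson
  have pos: "\<tau> / 2 > 0" "min 1 (d1 / (?d + 1)) > 0" using \<tau> d1 by auto
  obtain h where h': "0 < h" "h < min 1 (d1 / (?d + 1))"
    "measure lborel (\<Omega> - (\<Union>z\<in>{z. gcube h z \<subseteq> \<Omega>}. gcube h z)) < \<tau> / 2"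
    by (rule grid_exhaustion[OF \<Omega> pos], rule that)
  then have h: "0 < h" "h < d1 / (?d + 1)"
    "measure lborel (\<Omega> - (\<Union>z\<in>{z. gcube h z \<subseteq> \<Omega>}. gcube h z)) < \<tau> / 2" by simp_all
  have dh: "?d * h < d1"
  proof -
    have "(?d + 1) * h < d1" using h(2) by (simp add: field_simps)
    moreover have "?d * h \<le> (?d + 1) * h" using h(1) by (intro mult_right_mono) auto
    ultimately show ?thesis by linarith
  qed
  define Z0 where "Z0 = {z. gcube h z \<subseteq> \<Omega>}"
  have finZ0: "finite Z0" unfolding Z0_def by (rule finite_gcubes[OF \<Omega>(2) h(1)])
  define mn where "mn x = min 1 (norm (F x - G x))" for x
  have [measurable]: "mn \<in> borel_measurable borel" unfolding mn_def by measurable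
  have mn: "0 \<le> mn x" "mn x \<le> 1" for x by (auto simp: mn_def)
  define I where "I z = (LINT x|lborel. indicator (gcube h z) x * mn x)" for z
  have int: "integrable lborel (\<lambda>x. indicator A x * mn x)" if [measurable]: "A \<in> sets borel" and A: "bounded A" for A :: "(real^'d) set"
  proof (rule integrableI_bounded_set[where A = A and B = 1])
    show "emeasure lborel A < \<infinity>" by (rule emeasure_bounded_finite[OF A])
  qed (use mn in \<open>auto simp: indicator_def\<close>)
  have intz: "integrable lborel (\<lambda>x. indicator (gcube h z) x * mn x)" for z by (rule int) auto
  have sumI: "(\<Sum>z\<in>Z0. I z) < \<sigma>"
  proof -
    have "(\<Sum>z\<in>Z0. I z) = (LINT x|lborel. (\<Sum>z\<in>Z0. indicator (gcube h z) x * mn x))"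
      unfolding I_def using intz by (intro Bochner_Integration.integral_sum[symmetric]) auto
    also have "\<dots> \<le> (LINT x|lborel. indicator \<Omega> x * mn x)"
    proof (rule integral_mono)
      show "integrable lborel (\<lambda>x. \<Sum>z\<in>Z0. indicator (gcube h z) x * mn x)" using intz by (intro Bochner_Integration.integrable_sum)
      show "integrable lborel (\<lambda>x. indicator \<Omega> x * mn x)" by (rule int) (use \<Omega> in auto)
      fix x
      have dj: "disjoint_family_on (gcube h) Z0" unfolding disjoint_family_on_def using gcube_disjoint[OF h(1)] by blast
      have e: "(\<Sum>z\<in>Z0. indicator (gcube h z) x) = (indicator (\<Union>z\<in>Z0. gcube h z) x :: real)"
        by (rule indicator_UN_disjoint[OF finZ0 dj, symmetric])
      have "(\<Sum>z\<in>Z0. indicator (gcube h z) x * mn x) = indicator (\<Union>z\<in>Z0. gcube h z) x * mn x"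
        unfolding e[symmetric] by (simp add: sum_distrib_right)
      also have "\<dots> \<le> indicator \<Omega> x * mn x"
        using mn(1)[of x] by (intro mult_right_mono) (auto simp: indicator_def Z0_def)
      finally show "(\<Sum>z\<in>Z0. indicator (gcube h z) x * mn x) \<le> indicator \<Omega> x * mn x" .
    qed
    also have "\<dots> < \<sigma>" using F(2) unfolding mn_def .
    finally show ?thesis .
  qed
  have I0: "I z \<ge> 0" for z unfolding I_def using mn by (intro integral_nonneg_AE) auto
  let ?hd = "h ^ CARD('d)"
  have hd: "?hd > 0" using h by simp
  define Z1 where "Z1 = {z \<in> Z0. I z > \<kappa>2 * ?hd}"
  define Z where "Z = Z0 - Z1"
  have Z1: "finite Z1" "Z1 \<subseteq> Z0" using finZ0 by (auto simp: Z1_def)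
  have card1: "real (card Z1) * ?hd \<le> \<tau> / 2"
  proof -
    have "real (card Z1) * (\<kappa>2 * ?hd) = (\<Sum>z\<in>Z1. \<kappa>2 * ?hd)" by simp
    also have "\<dots> \<le> (\<Sum>z\<in>Z1. I z)" by (rule sum_mono) (auto simp: Z1_def)
    also have "\<dots> \<le> (\<Sum>z\<in>Z0. I z)" by (rule sum_mono2[OF finZ0 Z1(2)]) (rule I0)
    also have "\<dots> \<le> \<kappa>2 * (\<tau> / 2)" using sumI by (simp add: \<sigma>_def)
    finally have "\<kappa>2 * (real (card Z1) * ?hd) \<le> \<kappa>2 * (\<tau> / 2)" by (simp add: mult_ac)
    then show ?thesis using \<kappa>2 by simp
  qed
  have cov: "measure lborel (\<Omega> - (\<Union>z\<in>Z. gcube h z)) \<le> \<tau>"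
  proof -
    let ?A = "\<Omega> - (\<Union>z\<in>Z0. gcube h z)" and ?B = "\<Union>z\<in>Z1. gcube h z"
    have fm: "?A \<in> fmeasurable lborel" "?B \<in> fmeasurable lborel"
    proof -
      have "emeasure lborel ?A < \<infinity>" by (rule emeasure_bounded_finite) (use \<Omega>(2) in \<open>auto intro: bounded_subset\<close>)
      then show "?A \<in> fmeasurable lborel" using finZ0 by (intro fmeasurableI) auto
      have "emeasure lborel ?B < \<infinity>" by (rule emeasure_bounded_finite) (use Z1 in auto)
      then show "?B \<in> fmeasurable lborel" using Z1 by (intro fmeasurableI) auto
    qed
    have "measure lborel (\<Omega> - (\<Union>z\<in>Z. gcube h z)) \<le> measure lborel (?A \<union> ?B)"
      by (rule measure_mono_fmeasurable) (use fm finZ0 in \<open>auto simp: Z_def\<close>)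
    also have "\<dots> \<le> measure lborel ?A + measure lborel ?B" using fm by (intro measure_Un_le) auto
    also have "measure lborel ?B \<le> (\<Sum>z\<in>Z1. measure lborel (gcube h z))"
      by (rule measure_UNION_le[OF Z1(1)]) auto
    also have "\<dots> = (\<Sum>z\<in>Z1. ?hd)" by (rule sum.cong[OF refl], rule measure_cube(1)[OF less_imp_le[OF h(1)]])
    also have "\<dots> = real (card Z1) * ?hd" by simp
    also have "\<dots> \<le> \<tau> / 2" by (rule card1)
    finally show ?thesis using h(3) unfolding Z0_def by simp
  qed
  have "\<exists>A b. A \<in> S \<and> measure lborel {x \<in> gcube h z. norm (G x - A) > \<kappa>} \<le> \<kappa> * ?hd \<and>
     (AE x in lborel. x \<in> gcube h z \<longrightarrow> norm (u x - (A *v x + b)) \<le> \<kappa> * h)" if z: "z \<in> Z" for z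
  proof -
    let ?Q = "gcube h z"
    have Q\<Omega>: "?Q \<subseteq> \<Omega>" and Iz: "I z \<le> \<kappa>2 * ?hd" using z by (auto simp: Z_def Z0_def Z1_def)
    have mQ: "measure lborel ?Q = ?hd" by (rule measure_cube(1)[OF less_imp_le[OF h(1)]])
    define bad where "bad = {x \<in> ?Q. norm (F x - G x) > \<kappa>3}"
    have [measurable]: "bad \<in> sets borel" unfolding bad_def by measurable
    have fbad: "emeasure lborel bad < \<infinity>" by (rule emeasure_bounded_finite) (auto simp: bad_def intro: bounded_subset[OF bounded_box])
    have ibad: "integrable lborel (indicator bad :: _ \<Rightarrow> real)" using fbad by (intro integrable_real_indicator) auto
    have mbad: "measure lborel bad \<le> q * ?hd"
    proof -
      have "\<kappa>3 * measure lborel bad = (LINT x|lborel. \<kappa>3 * indicator bad x)" by simp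
      also have "\<dots> \<le> I z" unfolding I_def
      proof (rule integral_mono)
        show "integrable lborel (\<lambda>x. \<kappa>3 * indicator bad x)" using ibad by simp
        show "\<kappa>3 * indicator bad x \<le> indicator ?Q x * mn x" for x
          using \<kappa>3(2) mn(1)[of x] by (auto simp: bad_def mn_def indicator_def)
      qed (rule intz)
      finally have "\<kappa>3 * measure lborel bad \<le> \<kappa>3 * (q * ?hd)" using Iz by (simp add: \<kappa>2_def mult_ac)
      then show ?thesis using \<kappa>3(1) by simp
    qed
    \<comment> \<open>The bad part fills at most half of the cube. Taking the value of
      \<open>G\<close> at a good point as the matrix keeps it in \<open>S\<close>; an average over
      the cube would require \<open>S\<close> to be convex.\<close>
    have "\<exists>y\<in>?Q. G y \<in> S \<and> y \<notin> bad"
    proof (rule ccontr)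
      assume c: "\<not> ?thesis"
      have "measure lborel ?Q \<le> measure lborel bad"
      proof -
        have iQ: "integrable lborel (indicator ?Q :: _ \<Rightarrow> real)"
          by (intro integrable_real_indicator) (auto simp: emeasure_bounded_finite[OF bounded_box, unfolded infinity_ennreal_def])
        have "(LINT x|lborel. indicator ?Q x :: real) \<le> (LINT x|lborel. indicator bad x)"
        proof (rule integral_mono_AE[OF iQ ibad])
          show "AE x in lborel. (indicator ?Q x :: real) \<le> indicator bad x"
            using S by eventually_elim (use c Q\<Omega> in \<open>auto simp: indicator_def\<close>)
        qed
        then show ?thesis by simp
      qed
      moreover have "q * ?hd < ?hd" using q12 hd by simp
      ultimately show False using mbad mQ by linarith
    qed
    then obtain y where y: "y \<in> ?Q" "G y \<in> S" "y \<notin> bad" by blast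
    define A where "A = G y"
    have AB: "norm A \<le> B" using B(1) y(2) by (simp add: A_def)
    have FA: "norm (F x - A) \<le> 2 * \<kappa>3" if x: "x \<in> ?Q" for x
    proof -
      have "norm (x - y) \<le> (\<Sum>i\<in>UNIV. \<bar>(x - y) $ i\<bar>)" by (rule norm_le_l1_cart)
      also have "\<dots> \<le> (\<Sum>i\<in>(UNIV::'d set). h)"
      proof (rule sum_mono)
        fix i
        show "\<bar>(x - y) $ i\<bar> \<le> h"
          using spec[OF x[unfolded gcube_iff], of i] spec[OF y(1)[unfolded gcube_iff], of i] by auto
      qed
      finally have "dist x y < d1" using dh by (simp add: dist_norm)
      moreover have "x \<in> cball 0 R" "y \<in> cball 0 R" using R x y(1) Q\<Omega> by auto
      ultimately have "norm (F x - F y) < \<kappa>3" using d1(2) by (simp add: dist_norm)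
      moreover have "norm (F y - G y) \<le> \<kappa>3" using y(1,3) by (simp add: bad_def)
      ultimately show ?thesis unfolding A_def using norm_triangle_ineq[of "F x - F y" "F y - G y"] by simp
    qed
    have GA: "norm (G x - A) \<le> 3 * \<kappa>3" if "x \<in> ?Q" "x \<notin> bad" for x
    proof -
      have "norm (F x - G x) \<le> \<kappa>3" using that by (simp add: bad_def)
      then show ?thesis using FA[OF that(1)] norm_triangle_ineq[of "F x - A" "G x - F x"] by (simp add: norm_minus_commute)
    qed
    have m1: "measure lborel {x \<in> ?Q. norm (G x - A) > \<kappa>} \<le> \<kappa> * ?hd"
    proof -
      have "measure lborel {x \<in> ?Q. norm (G x - A) > \<kappa>} \<le> measure lborel bad"
      proof (rule measure_mono_fmeasurable)
        show "{x \<in> ?Q. norm (G x - A) > \<kappa>} \<subseteq> bad"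
        proof safe
          fix x assume "x \<in> ?Q" "\<kappa> < norm (G x - A)"
          then show "x \<in> bad" using GA[of x] \<kappa>3(1,3) by (cases "x \<in> bad") auto
        qed
        show "bad \<in> fmeasurable lborel" using fbad by (intro fmeasurableI) auto
      qed measurable
      also have "\<dots> \<le> \<kappa> * ?hd" using mbad q(2) hd by (meson mult_right_mono less_imp_le order_trans)
      finally show ?thesis .
    qed
    have wQ: "WG ?Q (\<lambda>x. u x - (A *v x + 0)) (\<lambda>x. G x - A)"
      by (rule WG_diff[OF WG_subset[OF wg Q\<Omega>] WG_affine])
    have ae2B: "AE x in lborel. x \<in> ?Q \<longrightarrow> norm (G x - A) \<le> 2 * B"
      using S
    proof eventually_elim
      case (elim x)
      show ?case
      proof
        assume "x \<in> ?Q"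
        then have "norm (G x) \<le> B" using elim Q\<Omega> B(1) by blast
        then show "norm (G x - A) \<le> 2 * B" using AB norm_triangle_ineq4[of "G x" A] by simp
      qed
    qed
    obtain g where g: "\<And>x y. norm (g x - g y) \<le> ?m * (2 * B) * norm (x - y)"
      "AE x in lborel. x \<in> ?Q \<longrightarrow> u x - (A *v x + 0) = g x"
      by (rule WG_lipschitz_rep[OF wQ ae2B], use B(2) in simp, rule that)
    have intH: "(LINT x|lborel. indicator ?Q x * norm (G x - A)) \<le> \<kappa>'' * ?hd"
    proof -
      have iQ: "integrable lborel (indicator ?Q :: _ \<Rightarrow> real)"
        by (intro integrable_real_indicator) (auto simp: emeasure_bounded_finite[OF bounded_box, unfolded infinity_ennreal_def])
      have "(LINT x|lborel. indicator ?Q x * norm (G x - A)) \<le> (LINT x|lborel. (4 * \<kappa>3) * indicator ?Q x + (2 * B) * indicator bad x)"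
      proof (rule integral_mono_AE)
        show "integrable lborel (\<lambda>x. indicator ?Q x * norm (G x - A))"
          using integrable_norm[OF integrable_indicator_box[OF WG_meas(2,4)[OF wQ]]] by simp
        show "integrable lborel (\<lambda>x. (4 * \<kappa>3) * indicator ?Q x + (2 * B) * indicator bad x)" using iQ ibad by simp
        show "AE x in lborel. indicator ?Q x * norm (G x - A) \<le> (4 * \<kappa>3) * indicator ?Q x + (2 * B) * indicator bad x"
          using ae2B
        proof eventually_elim
          case (elim x)
          show ?case
          proof (cases "x \<in> ?Q")
            case True
            show ?thesis
            proof (cases "x \<in> bad")
              case False
              then show ?thesis using GA[OF True False] True \<kappa>3(1) by simp
            next
              case bd: True
              have "norm (G x - A) \<le> 2 * B" using elim True by blast
              then show ?thesis using True bd \<kappa>3(1) by simp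
            qed
          qed (use B(2) in \<open>auto simp: bad_def indicator_def\<close>)
        qed
      qed
      also have "\<dots> = 4 * \<kappa>3 * ?hd + 2 * B * measure lborel bad" using iQ ibad mQ by simp
      also have "\<dots> \<le> 4 * \<kappa>3 * ?hd + 2 * B * (q * ?hd)" using mbad B(2) by (intro add_left_mono mult_left_mono) auto
      also have "\<dots> = (4 * \<kappa>3 + 2 * B * q) * ?hd" by (simp add: algebra_simps)
      also have "\<dots> \<le> \<kappa>'' * ?hd" using \<kappa>3(4) q2 hd by (intro mult_right_mono) auto
      finally show ?thesis .
    qed
    have osc: "norm (g x - g y) \<le> \<kappa> * h" if x: "x \<in> ?Q" for x
    proof -
      have "norm (g x - g y) \<le> (2 * L * CARD('d) * r + ?m * CARD('d) * \<kappa>'' / r ^ CARD('d)) * h"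
        unfolding L_def by (rule oscillation_estimate[OF wQ h(1) g _ r intH x y(1)]) (use B(2) in simp)
      also have "\<dots> \<le> \<kappa> * h"
      proof (rule mult_right_mono)
        show "2 * L * CARD('d) * r + ?m * CARD('d) * \<kappa>'' / r ^ CARD('d) \<le> \<kappa>"
          using add_mono[OF r2 eq_refl[OF \<kappa>''(2)]] by (simp only: field_sum_of_halves)
      qed (use h(1) in simp)
      finally show ?thesis .
    qed
    have "AE x in lborel. x \<in> ?Q \<longrightarrow> norm (u x - (A *v x + g y)) \<le> \<kappa> * h"
      using g(2)
    proof eventually_elim
      case (elim x)
      show ?case
      proof
        assume x: "x \<in> ?Q"
        with elim have e: "u x - (A *v x + g y) = g x - g y" by (simp add: algebra_simps)
        show "norm (u x - (A *v x + g y)) \<le> \<kappa> * h" unfolding e by (rule osc[OF x])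
      qed
    qed
    then show ?thesis using m1 y(2) unfolding A_def by blast
  qed
  then have "\<forall>z. \<exists>A b. z \<in> Z \<longrightarrow> A \<in> S \<and> measure lborel {x \<in> gcube h z. norm (G x - A) > \<kappa>} \<le> \<kappa> * ?hd \<and>
     (AE x in lborel. x \<in> gcube h z \<longrightarrow> norm (u x - (A *v x + b)) \<le> \<kappa> * h)" by blast
  from choice[OF this] obtain \<xi> where "\<forall>z. \<exists>b. z \<in> Z \<longrightarrow> \<xi> z \<in> S \<and> measure lborel {x \<in> gcube h z. norm (G x - \<xi> z) > \<kappa>} \<le> \<kappa> * ?hd \<and>
     (AE x in lborel. x \<in> gcube h z \<longrightarrow> norm (u x - (\<xi> z *v x + b)) \<le> \<kappa> * h)" ..
  from choice[OF this] obtain b where b: "\<forall>z. z \<in> Z \<longrightarrow> \<xi> z \<in> S \<and> measure lborel {x \<in> gcube h z. norm (G x - \<xi> z) > \<kappa>} \<le> \<kappa> * ?hd \<and>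
     (AE x in lborel. x \<in> gcube h z \<longrightarrow> norm (u x - (\<xi> z *v x + b z)) \<le> \<kappa> * h)" ..
  show thesis
    by (rule that[of h Z \<xi> b]) (use h'(1,2) finZ0 cov b in \<open>auto simp: Z_def Z0_def\<close>)
qed

subsection \<open>The lower bound\<close>

text \<open>If \<open>f\<close> exceeded \<open>2 * \<kappa> * h\<close> at one point, the Lipschitz
  bound would keep \<open>f\<close> at least \<open>\<kappa> * h / 2\<close> away from
  \<open>f0\<close> on a whole subcube of side \<open>s * h\<close>, which contradicts the bound on
  the integral.\<close>

lemma near_from_L1:
  fixes p :: "real^'d::finite" and f :: "real^'d \<Rightarrow> real^'m::finite"
  defines "Q h \<equiv> box p (p + vec h)"
  assumes h: "h > 0" and s: "0 < s" "s < 1" and lip: "\<And>x y. norm (f x - f y) \<le> L * norm (x - y)" "L * (real CARD('d) * s) \<le> \<kappa> / 2" "L \<ge> 0"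
    and [measurable]: "f \<in> borel_measurable borel" "f0 \<in> borel_measurable borel"
    and f0: "AE x in lborel. x \<in> Q h \<longrightarrow> norm (f0 x) \<le> \<kappa> * h" and \<kappa>: "\<kappa> > 0"
    and e: "(\<integral>\<^sup>+ x. ennreal (norm (f x - f0 x)) * indicator (Q h) x \<partial>lborel) \<le> ennreal e" "e < \<kappa> * h / 2 * (s * h) ^ CARD('d)"
    and x: "x \<in> Q h"
  shows "norm (f x) \<le> 2 * \<kappa> * h"
proof (rule ccontr)
  assume "\<not> ?thesis"
  then have big: "norm (f x) > 2 * \<kappa> * h" by simp
  \<comment> \<open>The same homothety as in \<open>oscillation_estimate\<close>: it keeps the
    subcube in the cube and close to \<open>x\<close>, also when \<open>x\<close> is near a
    face.\<close>
  define a where "a = p + (1 - s) *\<^sub>R (x - p)"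
  let ?B = "box a (a + vec (s * h))"
  have sh: "s * h > 0" using s h by simp
  have B: "y \<in> Q h \<and> norm (y - x) \<le> real CARD('d) * (s * h)" if y: "y \<in> ?B" for y
  proof -
    have yi: "p $ i < y $ i \<and> y $ i < p $ i + h \<and> \<bar>y $ i - x $ i\<bar> \<le> s * h" for i
    proof -
      have xi: "0 < x $ i - p $ i" "x $ i - p $ i < h"
      proof -
        have "p $ i < x $ i \<and> x $ i < p $ i + h" using x by (simp add: Q_def mem_box_cart)
        then show "0 < x $ i - p $ i" "x $ i - p $ i < h" by auto
      qed
      have m: "0 < s * (x $ i - p $ i)" "s * (x $ i - p $ i) < s * h" using xi s by auto
      have n: "0 \<le> (1 - s) * (x $ i - p $ i)" "(1 - s) * (x $ i - p $ i) \<le> (1 - s) * h"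
        using xi s by (auto intro!: mult_nonneg_nonneg mult_left_mono)
      have ai: "a $ i = x $ i - s * (x $ i - p $ i)" "a $ i = p $ i + (1 - s) * (x $ i - p $ i)" by (simp_all add: a_def algebra_simps)
      have hh: "(1 - s) * h = h - s * h" by (simp add: algebra_simps)
      have "a $ i < y $ i \<and> y $ i < a $ i + s * h" using y by (simp add: mem_box_cart)
      then show ?thesis using ai m n hh by auto
    qed
    have "norm (y - x) \<le> (\<Sum>i\<in>UNIV. \<bar>(y - x) $ i\<bar>)" by (rule norm_le_l1_cart)
    also have "\<dots> \<le> (\<Sum>i\<in>(UNIV::'d set). s * h)" by (rule sum_mono) (use yi in simp)
    finally show ?thesis using yi by (simp add: Q_def mem_box_cart)
  qed
  have "ennreal (\<kappa> * h / 2) * emeasure lborel ?B = (\<integral>\<^sup>+ y. ennreal (\<kappa> * h / 2) * indicator ?B y \<partial>lborel)"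
    by (rule nn_integral_cmult_indicator[symmetric]) simp
  also have "\<dots> \<le> (\<integral>\<^sup>+ x. ennreal (norm (f x - f0 x)) * indicator (Q h) x \<partial>lborel)"
  proof (rule nn_integral_mono_AE)
    show "AE y in lborel. ennreal (\<kappa> * h / 2) * indicator ?B y \<le> ennreal (norm (f y - f0 y)) * indicator (Q h) y"
      using f0
    proof eventually_elim
      case (elim y)
      show ?case
      proof (cases "y \<in> ?B")
        case True
        note By = B[OF True]
        have "norm (f x - f y) \<le> L * norm (x - y)" by (rule lip(1))
        also have "\<dots> \<le> L * (real CARD('d) * (s * h))" using By lip(3) by (intro mult_left_mono) (auto simp: norm_minus_commute)
        also have "\<dots> = L * (real CARD('d) * s) * h" by simp
        also have "\<dots> \<le> \<kappa> / 2 * h" using lip(2) h by (intro mult_right_mono) auto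
        finally have 1: "norm (f x - f y) \<le> \<kappa> * h / 2" by simp
        have "norm (f x) \<le> norm (f x - f y) + norm (f y - f0 y) + norm (f0 y)"
          using norm_triangle_ineq[of "f x - f y" "f y"] norm_triangle_ineq[of "f y - f0 y" "f0 y"] by simp
        then have "\<kappa> * h / 2 \<le> norm (f y - f0 y)" using 1 big elim By by simp
        then show ?thesis using True By by (simp add: ennreal_leI)
      qed simp
    qed
  qed
  also have "\<dots> \<le> ennreal e" by (rule e(1))
  finally have "ennreal (\<kappa> * h / 2) * ennreal ((s * h) ^ CARD('d)) \<le> ennreal e"
    using measure_cube(2)[of "s * h" a] sh by simp
  moreover have "ennreal (\<kappa> * h / 2 * (s * h) ^ CARD('d)) = ennreal (\<kappa> * h / 2) * ennreal ((s * h) ^ CARD('d))"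
    using \<kappa> h sh by (intro ennreal_mult) auto
  ultimately have le: "ennreal (\<kappa> * h / 2 * (s * h) ^ CARD('d)) \<le> ennreal e" by (simp only:)
  have "0 \<le> e"
  proof (rule ccontr)
    assume "\<not> 0 \<le> e"
    then have "ennreal e = 0" by (simp add: ennreal_neg)
    with le have "ennreal (\<kappa> * h / 2 * (s * h) ^ CARD('d)) = 0" by simp
    then have "\<kappa> * h / 2 * (s * h) ^ CARD('d) \<le> 0" by (simp only: ennreal_eq_0_iff)
    moreover have "\<kappa> * h / 2 * (s * h) ^ CARD('d) > 0" using \<kappa> h sh by simp
    ultimately show False by simp
  qed
  then have "\<kappa> * h / 2 * (s * h) ^ CARD('d) \<le> e" using le by (simp only: ennreal_le_iff)
  then show False using e(2) by simp
qed

lemma sum_gcube_bounds: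
  fixes \<Omega> :: "(real^'d::finite) set"
  assumes h: "h > 0" and Z: "finite Z" "\<And>z. z \<in> Z \<Longrightarrow> gcube h z \<subseteq> \<Omega>" and \<Omega>: "open \<Omega>" "bounded \<Omega>"
  shows "(\<Sum>z\<in>Z. h ^ CARD('d)) \<le> measure lborel \<Omega>"
    "f \<in> borel_measurable borel \<Longrightarrow> (\<Sum>z\<in>Z. \<integral>\<^sup>+ x. f x * indicator (gcube h z) x \<partial>lborel) \<le> (\<integral>\<^sup>+ x. f x * indicator \<Omega> x \<partial>lborel)"
proof -
  have dj: "disjoint_family_on (gcube h) Z" unfolding disjoint_family_on_def using gcube_disjoint[OF h] by blast
  have fin: "emeasure lborel \<Omega> < \<infinity>" by (rule emeasure_bounded_finite[OF \<Omega>(2)])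
  have ind: "(\<Sum>z\<in>Z. indicator (gcube h z) x) = (indicator (\<Union>z\<in>Z. gcube h z) x :: ennreal)" for x
    by (rule indicator_UN_disjoint[OF Z(1) dj, symmetric])
  have *: "(\<Sum>z\<in>Z. \<integral>\<^sup>+ x. f x * indicator (gcube h z) x \<partial>lborel) \<le> (\<integral>\<^sup>+ x. f x * indicator \<Omega> x \<partial>lborel)"
    if [measurable]: "f \<in> borel_measurable borel" for f
  proof -
    have "(\<Sum>z\<in>Z. \<integral>\<^sup>+ x. f x * indicator (gcube h z) x \<partial>lborel) = (\<integral>\<^sup>+ x. (\<Sum>z\<in>Z. f x * indicator (gcube h z) x) \<partial>lborel)"
      by (intro nn_integral_sum[symmetric]) measurable
    also have "\<dots> \<le> (\<integral>\<^sup>+ x. f x * indicator \<Omega> x \<partial>lborel)"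
    proof (rule nn_integral_mono)
      fix x
      have "(\<Sum>z\<in>Z. f x * indicator (gcube h z) x) = f x * indicator (\<Union>z\<in>Z. gcube h z) x"
        unfolding ind[symmetric] by (simp add: sum_distrib_left)
      also have "\<dots> \<le> f x * indicator \<Omega> x" using Z(2) by (intro mult_left_mono) (auto simp: indicator_def)
      finally show "(\<Sum>z\<in>Z. f x * indicator (gcube h z) x) \<le> f x * indicator \<Omega> x" .
    qed
    finally show ?thesis .
  qed
  then show "f \<in> borel_measurable borel \<Longrightarrow> (\<Sum>z\<in>Z. \<integral>\<^sup>+ x. f x * indicator (gcube h z) x \<partial>lborel) \<le> (\<integral>\<^sup>+ x. f x * indicator \<Omega> x \<partial>lborel)" .
  have "(\<Sum>z\<in>Z. ennreal (h ^ CARD('d))) \<le> emeasure lborel \<Omega>"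
  proof -
    have "(\<integral>\<^sup>+ x. 1 * indicator (gcube h z) x \<partial>lborel) = ennreal (h ^ CARD('d))" for z :: "int^'d"
      using measure_cube(2)[OF less_imp_le[OF h], of "h *\<^sub>R int_vec z"] by simp
    then show ?thesis using *[of "\<lambda>_. 1"] \<Omega>(1) by simp
  qed
  moreover have "ennreal (\<Sum>z\<in>Z. h ^ CARD('d)) = (\<Sum>z\<in>Z. ennreal (h ^ CARD('d)))"
    using h by (intro sum_ennreal[symmetric]) simp
  moreover have "emeasure lborel \<Omega> = ennreal (measure lborel \<Omega>)"
    using fin by (intro emeasure_eq_ennreal_measure) simp
  ultimately have "ennreal (\<Sum>z\<in>Z. h ^ CARD('d)) \<le> ennreal (measure lborel \<Omega>)" by (simp only:)
  then show "(\<Sum>z\<in>Z. h ^ CARD('d)) \<le> measure lborel \<Omega>" by (subst (asm) ennreal_le_iff) auto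
qed

lemma tendsto_at_right_obtain:
  fixes f :: "real \<Rightarrow> real"
  assumes "(f \<longlongrightarrow> l) (at_right 0)" "l < c" "b > 0"
  obtains r where "0 < r" "r < b" "f r < c"
proof -
  have "eventually (\<lambda>r. f r < c) (at_right 0)" using assms(1,2) by (rule order_tendstoD)
  then obtain b1 where b1: "b1 > 0" "\<And>r. 0 < r \<Longrightarrow> r < b1 \<Longrightarrow> f r < c" unfolding eventually_at_right_field by blast
  then show thesis using assms(3) by (intro that[of "min b b1 / 2"] b1(2)) auto
qed

text \<open>Serves the choices of small parameters; the summand 1 in the denominator admits
  \<open>c = 0\<close>.\<close>

lemma mult_divide_le:
  fixes c a r k :: real
  assumes "0 \<le> c" "0 \<le> a" "0 < r" "k \<le> a * r / (c + 1)"
  shows "c * k / r \<le> a"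
proof -
  have "c * k / r \<le> c * (a * r / (c + 1)) / r" using assms by (intro divide_right_mono mult_left_mono) auto
  also have "\<dots> = a * (c / (c + 1))" using assms by simp
  also have "\<dots> \<le> a * 1" using assms by (intro mult_left_mono) auto
  finally show ?thesis by simp
qed

context homogenization
begin

abbreviation Whom :: "real^'d^'m \<Rightarrow> ennreal" where "Whom \<equiv> lsc_envelope (HW W)"

lemma Whom_measurable: "Whom \<in> borel_measurable borel" by (rule lsc_borel_measurable[OF lsc_lsc_envelope])

text \<open>On each cube the competitor for \<open>HW\<close> costs \<open>2 * \<delta>\<close> per
  volume, one part for scaling by \<open>t\<close> and one for the layer. Replacing the cubewise
  matrices by \<open>G\<close> costs another \<open>2 * \<delta>\<close>, for the variation of
  \<open>HW\<close> and for the bad parts, and the uncovered rest costs \<open>\<delta>\<close>.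
  This explains the constant \<open>4 * measure lborel \<Omega> + 1\<close>.\<close>

lemma liminf_estimate_scaled:
  fixes \<Omega> :: "(real^'d) set"
  assumes \<Omega>: "open \<Omega>" "bounded \<Omega>" and wu: "WG \<Omega> u G" and GC: "AE x in lborel. x \<in> \<Omega> \<longrightarrow> G x \<in> closure C"
    and freq: "\<And>b e. b > 0 \<Longrightarrow> e > 0 \<Longrightarrow> \<exists>\<epsilon> v H. 0 < \<epsilon> \<and> \<epsilon> < b \<and> WG \<Omega> v H \<and>
        (AE x in lborel. x \<in> \<Omega> \<longrightarrow> H x \<in> closure C) \<and>
        (\<integral>\<^sup>+ x. W (x /\<^sub>R \<epsilon>) (H x) * indicator \<Omega> x \<partial>lborel) \<le> c \<and>
        (\<integral>\<^sup>+ x. ennreal (norm (v x - u x)) * indicator \<Omega> x \<partial>lborel) \<le> ennreal e"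
    and \<delta>: "\<delta> > 0" and t: "0 \<le> t" "t < 1" and \<eta>: "\<And>x \<xi>. W x (t *\<^sub>R \<xi>) \<le> W x \<xi> + ennreal \<delta>"
  shows "(\<integral>\<^sup>+ x. Whom (t *\<^sub>R G x) * indicator \<Omega> x \<partial>lborel) \<le> c + ennreal (\<delta> * (4 * measure lborel \<Omega> + 1))"
proof -
  let ?d = "real CARD('d)" and ?m = "real CARD('m)" and ?A = "measure lborel \<Omega>"
  note [measurable] = WG_meas(1,2)[OF wu]
  have \<Omega>m [measurable]: "\<Omega> \<in> sets borel" using \<Omega>(1) by simp
  let ?K = "(\<lambda>\<xi>. t *\<^sub>R \<xi>) ` closure C"
  note K = shrunk[OF t]
  obtain \<rho> M where \<rho>: "\<rho> > 0" and M: "M \<ge> 0"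
    "\<And>\<epsilon>. \<epsilon> > 0 \<Longrightarrow> AE x in lborel. \<forall>\<xi>\<in>?K. \<forall>\<zeta>. norm \<zeta> \<le> \<rho> \<longrightarrow> W (x /\<^sub>R \<epsilon>) (\<xi> + \<zeta>) \<le> ennreal M"
    by (rule W_bounded_nbhd[OF K(1,3)], rule that)
  have HWM: "HW W \<xi> \<le> ennreal M" if "\<xi> \<in> ?K" for \<xi>
    by (rule HW_le_bound_nbhd(1)[OF M(1) less_imp_le[OF \<rho>] M(2) that])
  obtain \<kappa>1 where \<kappa>1: "\<kappa>1 > 0" "\<And>\<xi> \<zeta>. \<xi> \<in> ?K \<Longrightarrow> \<zeta> \<in> ?K \<Longrightarrow> norm (\<xi> - \<zeta>) \<le> \<kappa>1 \<Longrightarrow> HW W \<xi> \<le> HW W \<zeta> + ennreal \<delta>"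
    by (rule HW_uniformly_continuous[OF K \<delta>], rule that)
  obtain Bc0 where Bc0: "\<And>\<xi>. \<xi> \<in> closure C \<Longrightarrow> norm \<xi> \<le> Bc0"
    using compact_imp_bounded[OF compact_closure_C] unfolding bounded_iff by blast
  define Bc where "Bc = max Bc0 0"
  have Bc: "norm \<xi> \<le> Bc" if "\<xi> \<in> closure C" for \<xi> using Bc0[OF that] by (simp add: Bc_def)
  have Bcn: "Bc \<ge> 0" by (simp add: Bc_def)
  \<comment> \<open>The term \<open>(1 + r) ^ CARD('d)\<close> anticipates the enclosing cube of
    side \<open>h + 2 * \<epsilon>\<close> in \<open>HW_le_cube\<close>, with
    \<open>\<epsilon>\<close> below \<open>r * h / 2\<close>.\<close>
  have "((\<lambda>r. M * ((1 + r) ^ CARD('d) - (1 - 4 * r) ^ CARD('d))) \<longlongrightarrow> M * ((1 + 0) ^ CARD('d) - (1 - 4 * 0) ^ CARD('d))) (at_right 0)"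
    by (intro tendsto_intros)
  then obtain r where r: "0 < r" "r < 1/4" "M * ((1 + r) ^ CARD('d) - (1 - 4 * r) ^ CARD('d)) < \<delta>"
    by (rule tendsto_at_right_obtain[of _ _ \<delta> "1/4"]) (use \<delta> in auto)
  have r4: "4 * r < 1" using r(2) by simp
  \<comment> \<open>The three bounds serve the continuity of \<open>HW\<close>, the margin
    \<open>\<rho>\<close>, and the cost \<open>M * \<kappa>\<close> of the bad parts. The middle one
    is halved because the distance obtained from the integral bound is
    \<open>2 * \<kappa> * h\<close>.\<close>
  define \<kappa> where "\<kappa> = min \<kappa>1 (min (\<rho> * r / (?d * cutL + 1) / 2) (\<delta> / (M + 1)))"
  have dc: "?d * cutL + 1 > 0" using cutL_nonneg by (simp add: add_nonneg_pos)
  have \<kappa>: "\<kappa> > 0" "\<kappa> \<le> \<kappa>1" using \<kappa>1 \<rho> r dc \<delta> M(1) by (simp_all add: \<kappa>_def)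
  have \<kappa>\<rho>: "?d * cutL * (2 * \<kappa>) / r \<le> \<rho>"
  proof (rule mult_divide_le[OF _ less_imp_le[OF \<rho>] r(1)])
    have half: "k \<le> x / 2 \<Longrightarrow> 2 * k \<le> x" for k x :: real by simp
    show "2 * \<kappa> \<le> \<rho> * r / (?d * cutL + 1)"
      unfolding \<kappa>_def by (rule half, rule min.coboundedI2, rule min.cobounded1)
  qed (simp add: cutL_nonneg)
  have M\<kappa>: "M * \<kappa> \<le> \<delta>"
    using mult_divide_le[of M \<delta> 1 \<kappa>] M(1) \<delta> by (simp add: \<kappa>_def)
  define \<tau> where "\<tau> = \<delta> / (M + 1)"
  have \<tau>: "\<tau> > 0" using \<delta> M(1) by (simp add: \<tau>_def)
  have M\<tau>: "M * \<tau> \<le> \<delta>" using mult_divide_le[of M \<delta> 1 \<tau>] M(1) \<delta> by (simp add: \<tau>_def)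
  obtain h Z \<xi> b where h: "h > 0" and Z: "finite Z" "\<And>z. z \<in> Z \<Longrightarrow> gcube h z \<subseteq> \<Omega>" and \<xi>C: "\<And>z. z \<in> Z \<Longrightarrow> \<xi> z \<in> closure C"
    and cov: "measure lborel (\<Omega> - (\<Union>z\<in>Z. gcube h z)) \<le> \<tau>"
    and mb: "\<And>z. z \<in> Z \<Longrightarrow> measure lborel {x \<in> gcube h z. norm (G x - \<xi> z) > \<kappa>} \<le> \<kappa> * h ^ CARD('d)"
    and aff: "\<And>z. z \<in> Z \<Longrightarrow> AE x in lborel. x \<in> gcube h z \<longrightarrow> norm (u x - (\<xi> z *v x + b z)) \<le> \<kappa> * h"
    by (rule good_cubes[OF \<Omega> wu GC Bc Bcn \<kappa>(1) \<tau>], assumption, rule that)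
  have \<xi>K: "t *\<^sub>R \<xi> z \<in> ?K" if "z \<in> Z" for z using \<xi>C[OF that] by blast
  note sumA = sum_gcube_bounds(1)[OF h Z \<Omega>]
  let ?hd = "h ^ CARD('d)"
  have hd: "?hd > 0" using h by simp
  \<comment> \<open>\<open>CARD('m) * Bc\<close> is the Lipschitz constant of the representative
    \<open>g\<close>, and the second \<open>Bc\<close> accounts for the linear map subtracted from
    it.\<close>
  define L where "L = ?m * Bc + Bc"
  have L: "L \<ge> 0" using Bcn by (simp add: L_def)
  define s where "s = min (1/2) (\<kappa> / (2 * (L * ?d + 1)))"
  have Ld: "L * ?d + 1 > 0" using L by (simp add: add_nonneg_pos)
  have s: "0 < s" "s < 1" using \<kappa> Ld by (auto simp: s_def)
  have sL: "L * (?d * s) \<le> \<kappa> / 2"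
    using mult_divide_le[of "L * ?d" "\<kappa> / 2" 1 s] L \<kappa>(1) by (simp add: s_def mult.assoc)
  \<comment> \<open>Half of the threshold in \<open>near_from_L1\<close>, which asks for a strict
    inequality. It is fixed before \<open>\<epsilon>\<close>, since it depends on the grid
    only.\<close>
  define e where "e = \<kappa> * h / 4 * (s * h) ^ CARD('d)"
  have e: "e > 0" "e < \<kappa> * h / 2 * (s * h) ^ CARD('d)" using \<kappa> h s by (simp_all add: e_def)
  have "r * h / 2 > 0" using r h by simp
  from freq[OF this e(1)] obtain \<epsilon> v H where \<epsilon>: "0 < \<epsilon>" "\<epsilon> < r * h / 2" and wv: "WG \<Omega> v H"
    and HC: "AE x in lborel. x \<in> \<Omega> \<longrightarrow> H x \<in> closure C"
    and en: "(\<integral>\<^sup>+ x. W (x /\<^sub>R \<epsilon>) (H x) * indicator \<Omega> x \<partial>lborel) \<le> c"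
    and vu: "(\<integral>\<^sup>+ x. ennreal (norm (v x - u x)) * indicator \<Omega> x \<partial>lborel) \<le> ennreal e" by blast
  note [measurable] = WG_meas(1,2)[OF wv]
  have Wm: "(\<lambda>x. W (x /\<^sub>R \<epsilon>) (H x)) \<in> borel_measurable borel" by (intro W_comp_measurable) auto
  have cube: "ennreal ?hd * HW W (t *\<^sub>R \<xi> z) \<le>
      (\<integral>\<^sup>+ x. W (x /\<^sub>R \<epsilon>) (H x) * indicator (gcube h z) x \<partial>lborel) + ennreal (2 * \<delta> * ?hd)" if z: "z \<in> Z" for z
  proof -
    let ?p = "h *\<^sub>R int_vec z :: real^'d"
    let ?Q = "gcube h z"
    have Q\<Omega>: "?Q \<subseteq> \<Omega>" by (rule Z(2)[OF z])
    have wvQ: "WG ?Q v H" by (rule WG_subset[OF wv Q\<Omega>])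
    have HB: "AE x in lborel. x \<in> ?Q \<longrightarrow> norm (H x) \<le> Bc"
      using HC by eventually_elim (use Q\<Omega> Bc in blast)
    obtain g where g: "\<And>x y. norm (g x - g y) \<le> ?m * Bc * norm (x - y)" "AE x in lborel. x \<in> ?Q \<longrightarrow> v x = g x"
      by (rule WG_lipschitz_rep[OF wvQ HB Bcn], rule that)
    have contg: "continuous_on UNIV g"
    proof -
      have "(?m * Bc)-lipschitz_on UNIV g" by (rule lipschitz_onI) (use g(1) Bcn in \<open>auto simp: dist_norm\<close>)
      then show ?thesis by (rule lipschitz_on_continuous_on)
    qed
    have gm [measurable]: "g \<in> borel_measurable borel" by (rule borel_measurable_continuous_onI[OF contg])
    have wg: "WG ?Q g H"
      by (rule WG_cong_AE[OF wvQ gm _ bdd_local_continuous[OF contg] WG_meas(4)[OF wv] g(2)]) auto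
    let ?l = "\<lambda>x. \<xi> z *v x + b z"
    have contl: "continuous_on UNIV ?l"
      by (intro continuous_intros linear_continuous_on[OF matrix_vector_mul_bounded_linear])
    have lm [measurable]: "?l \<in> borel_measurable borel" by (rule borel_measurable_continuous_onI[OF contl])
    have near: "norm (g x - ?l x) \<le> 2 * \<kappa> * h" if x: "x \<in> ?Q" for x
    proof (rule near_from_L1[where f = "\<lambda>x. g x - ?l x" and f0 = "\<lambda>x. u x - ?l x", OF h s _ sL L])
      show "norm (g x - ?l x - (g y - ?l y)) \<le> L * norm (x - y)" for x y
      proof -
        have e: "g x - ?l x - (g y - ?l y) = (g x - g y) - \<xi> z *v (x - y)"
          by (simp add: matrix_vector_mult_diff_distrib)
        have "norm (g x - ?l x - (g y - ?l y)) \<le> norm (g x - g y) + norm (\<xi> z *v (x - y))"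
          unfolding e by (rule norm_triangle_ineq4)
        also have "\<dots> \<le> ?m * Bc * norm (x - y) + Bc * norm (x - y)"
          by (intro add_mono g(1) order_trans[OF norm_matrix_vector_mult_le] mult_right_mono Bc \<xi>C[OF z]) simp
        finally show ?thesis by (simp add: L_def algebra_simps)
      qed
      show "AE x in lborel. x \<in> ?Q \<longrightarrow> norm (u x - ?l x) \<le> \<kappa> * h" by (rule aff[OF z])
      have "(\<integral>\<^sup>+ x. ennreal (norm (g x - ?l x - (u x - ?l x))) * indicator ?Q x \<partial>lborel) \<le>
         (\<integral>\<^sup>+ x. ennreal (norm (v x - u x)) * indicator \<Omega> x \<partial>lborel)"
      proof (rule nn_integral_mono_AE)
        show "AE x in lborel. ennreal (norm (g x - ?l x - (u x - ?l x))) * indicator ?Q x \<le> ennreal (norm (v x - u x)) * indicator \<Omega> x"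
          using g(2)
        proof eventually_elim
          case (elim x)
          show ?case using elim Q\<Omega> by (cases "x \<in> ?Q") (auto simp: indicator_def)
        qed
      qed
      then show "(\<integral>\<^sup>+ x. ennreal (norm (g x - ?l x - (u x - ?l x))) * indicator ?Q x \<partial>lborel) \<le> ennreal e"
        using vu by (rule order_trans)
    qed (use \<kappa> e x in auto)
    let ?In = "box (?p + vec (2 * (r * h))) (?p + vec (h - 2 * (r * h)))"
    have "ennreal ?hd * HW W (t *\<^sub>R \<xi> z) \<le> (\<integral>\<^sup>+ x. W (x /\<^sub>R \<epsilon>) (t *\<^sub>R H x) * indicator ?In x \<partial>lborel)
       + ennreal (M * ((h + 2 * \<epsilon>) ^ CARD('d) - (h - 4 * (r * h)) ^ CARD('d)))"
    proof (rule HW_le_cube[where K = ?K and \<rho> = \<rho> and g = "\<lambda>x. t *\<^sub>R g x" and b = "t *\<^sub>R b z" and \<kappa> = "2 * \<kappa>"])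
      show "WG ?Q (\<lambda>x. t *\<^sub>R g x) (\<lambda>x. t *\<^sub>R H x)" by (rule WG_cmul[OF wg])
      show "continuous_on UNIV (\<lambda>x. t *\<^sub>R g x)" by (intro continuous_intros contg)
      show "AE x in lborel. x \<in> ?Q - ?In \<longrightarrow> t *\<^sub>R H x \<in> ?K"
        using HC by eventually_elim (use Q\<Omega> in blast)
      show "norm (t *\<^sub>R g x - ((t *\<^sub>R \<xi> z) *v x + t *\<^sub>R b z)) \<le> 2 * \<kappa> * h" if x: "x \<in> ?Q" for x
      proof -
        have "t *\<^sub>R g x - ((t *\<^sub>R \<xi> z) *v x + t *\<^sub>R b z) = t *\<^sub>R (g x - ?l x)"
          by (simp add: scaleR_matrix_vector_assoc[symmetric] algebra_simps)
        then have "norm (t *\<^sub>R g x - ((t *\<^sub>R \<xi> z) *v x + t *\<^sub>R b z)) = t * norm (g x - ?l x)" using t by simp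
        also have "\<dots> \<le> 1 * norm (g x - ?l x)" using t by (intro mult_right_mono) auto
        finally show ?thesis using near[OF x] by simp
      qed
    qed (use K(2) \<xi>K[OF z] M h r r4 \<epsilon> \<kappa>\<rho> in auto)
    also have "(\<integral>\<^sup>+ x. W (x /\<^sub>R \<epsilon>) (t *\<^sub>R H x) * indicator ?In x \<partial>lborel) \<le>
       (\<integral>\<^sup>+ x. W (x /\<^sub>R \<epsilon>) (H x) * indicator ?Q x + ennreal \<delta> * indicator ?Q x \<partial>lborel)"
    proof (rule nn_integral_mono)
      fix x
      have "?In \<subseteq> ?Q"
      proof
        fix x assume x: "x \<in> ?In"
        show "x \<in> ?Q" unfolding gcube_iff
        proof
          fix i
          have "h * of_int (z $ i) + 2 * (r * h) < x $ i \<and> x $ i < h * of_int (z $ i) + (h - 2 * (r * h))" using x by (simp add: mem_box_cart)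
          moreover have "r * h > 0" using r h by simp
          ultimately show "h * of_int (z $ i) < x $ i \<and> x $ i < h * of_int (z $ i) + h" by linarith
        qed
      qed
      then show "W (x /\<^sub>R \<epsilon>) (t *\<^sub>R H x) * indicator ?In x \<le> W (x /\<^sub>R \<epsilon>) (H x) * indicator ?Q x + ennreal \<delta> * indicator ?Q x"
        using \<eta>[of "x /\<^sub>R \<epsilon>" "H x"] by (auto simp: indicator_def)
    qed
    also have "\<dots> = (\<integral>\<^sup>+ x. W (x /\<^sub>R \<epsilon>) (H x) * indicator ?Q x \<partial>lborel) + ennreal \<delta> * emeasure lborel ?Q"
      using Wm by (subst nn_integral_add) (auto simp: nn_integral_cmult_indicator)
    also have "emeasure lborel ?Q = ennreal ?hd" by (rule measure_cube(2)[OF less_imp_le[OF h]])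
    also have "M * ((h + 2 * \<epsilon>) ^ CARD('d) - (h - 4 * (r * h)) ^ CARD('d)) \<le> \<delta> * ?hd"
    proof -
      have "(h + 2 * \<epsilon>) ^ CARD('d) \<le> (h * (1 + r)) ^ CARD('d)" using \<epsilon> h by (intro power_mono) (auto simp: algebra_simps)
      moreover have "(h - 4 * (r * h)) ^ CARD('d) = ?hd * (1 - 4 * r) ^ CARD('d)"
        unfolding power_mult_distrib[symmetric] by (simp add: algebra_simps)
      ultimately have "(h + 2 * \<epsilon>) ^ CARD('d) - (h - 4 * (r * h)) ^ CARD('d) \<le> ?hd * ((1 + r) ^ CARD('d) - (1 - 4 * r) ^ CARD('d))"
        by (simp add: power_mult_distrib right_diff_distrib)
      then have "M * ((h + 2 * \<epsilon>) ^ CARD('d) - (h - 4 * (r * h)) ^ CARD('d)) \<le> M * (?hd * ((1 + r) ^ CARD('d) - (1 - 4 * r) ^ CARD('d)))"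
        using M(1) by (rule mult_left_mono)
      also have "\<dots> = (M * ((1 + r) ^ CARD('d) - (1 - 4 * r) ^ CARD('d))) * ?hd" by simp
      also have "\<dots> \<le> \<delta> * ?hd" using r(3) hd by (intro mult_right_mono) auto
      finally show ?thesis .
    qed
    finally have "ennreal ?hd * HW W (t *\<^sub>R \<xi> z) \<le> (\<integral>\<^sup>+ x. W (x /\<^sub>R \<epsilon>) (H x) * indicator ?Q x \<partial>lborel)
       + ennreal \<delta> * ennreal ?hd + ennreal (\<delta> * ?hd)"
      by (simp add: ennreal_leI add_left_mono add_right_mono)
    also have "\<dots> = (\<integral>\<^sup>+ x. W (x /\<^sub>R \<epsilon>) (H x) * indicator ?Q x \<partial>lborel) + ennreal (2 * \<delta> * ?hd)"
    proof -
      have "ennreal \<delta> * ennreal ?hd = ennreal (\<delta> * ?hd)" using \<delta> hd by (simp add: ennreal_mult)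
      moreover have "ennreal (\<delta> * ?hd) + ennreal (\<delta> * ?hd) = ennreal (2 * \<delta> * ?hd)"
        using \<delta> hd by (subst ennreal_plus[symmetric]) auto
      ultimately show ?thesis by (simp add: add.assoc)
    qed
    finally show ?thesis .
  qed
  have sum1: "(\<Sum>z\<in>Z. ennreal ?hd * HW W (t *\<^sub>R \<xi> z)) \<le> c + ennreal (2 * \<delta> * ?A)"
  proof -
    have "(\<Sum>z\<in>Z. ennreal ?hd * HW W (t *\<^sub>R \<xi> z)) \<le> (\<Sum>z\<in>Z. (\<integral>\<^sup>+ x. W (x /\<^sub>R \<epsilon>) (H x) * indicator (gcube h z) x \<partial>lborel) + ennreal (2 * \<delta> * ?hd))"
      by (rule sum_mono[OF cube])
    also have "\<dots> = (\<Sum>z\<in>Z. \<integral>\<^sup>+ x. W (x /\<^sub>R \<epsilon>) (H x) * indicator (gcube h z) x \<partial>lborel) + ennreal (2 * \<delta> * (\<Sum>z\<in>Z. ?hd))"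
      using \<delta> hd by (simp add: sum.distrib sum_ennreal sum_distrib_left del: sum_constant)
    also have "\<dots> \<le> c + ennreal (2 * \<delta> * ?A)"
      using sum_gcube_bounds(2)[OF h Z \<Omega> Wm] en sumA \<delta> by (intro add_mono ennreal_leI mult_left_mono) auto
    finally show ?thesis .
  qed
  define bad where "bad z = {x \<in> gcube h z. norm (G x - \<xi> z) > \<kappa>}" for z
  have [measurable]: "bad z \<in> sets borel" for z unfolding bad_def by measurable
  let ?R = "\<Omega> - (\<Union>z\<in>Z. gcube h z)"
  have Rm [measurable]: "?R \<in> sets borel" using Z(1) by auto
  have eR: "emeasure lborel ?R \<le> ennreal \<tau>"
  proof -
    have "emeasure lborel ?R < \<infinity>" by (rule emeasure_bounded_finite) (use \<Omega>(2) in \<open>auto intro: bounded_subset\<close>)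
    then show ?thesis using cov by (simp add: emeasure_eq_ennreal_measure less_top ennreal_leI)
  qed
  have ebad: "emeasure lborel (bad z) \<le> ennreal (\<kappa> * ?hd)" if "z \<in> Z" for z
  proof -
    have "emeasure lborel (bad z) < \<infinity>" by (rule emeasure_bounded_finite) (auto simp: bad_def intro: bounded_subset[OF bounded_box])
    then show ?thesis using mb[OF that] unfolding bad_def by (simp add: emeasure_eq_ennreal_measure less_top ennreal_leI)
  qed
  \<comment> \<open>On the good part of a cube \<open>HW\<close> varies by at most
    \<open>\<delta>\<close>; on the bad parts and outside all cubes the crude bound \<open>M\<close>
    is used.\<close>
  have pt: "AE x in lborel. Whom (t *\<^sub>R G x) * indicator \<Omega> x \<le>
     (\<Sum>z\<in>Z. (HW W (t *\<^sub>R \<xi> z) + ennreal \<delta>) * indicator (gcube h z) x + ennreal M * indicator (bad z) x) + ennreal M * indicator ?R x"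
    using GC
  proof eventually_elim
    case (elim x)
    show ?case
    proof (cases "x \<in> \<Omega>")
      case x\<Omega>: True
      then have GK: "t *\<^sub>R G x \<in> ?K" using elim by blast
      have le: "Whom (t *\<^sub>R G x) \<le> HW W (t *\<^sub>R G x)" by (rule lsc_envelope_le)
      show ?thesis
      proof (cases "\<exists>z\<in>Z. x \<in> gcube h z")
        case True
        then obtain z where z: "z \<in> Z" "x \<in> gcube h z" by blast
        have "Whom (t *\<^sub>R G x) \<le> (HW W (t *\<^sub>R \<xi> z) + ennreal \<delta>) * indicator (gcube h z) x + ennreal M * indicator (bad z) x"
        proof (cases "x \<in> bad z")
          case True
          have "Whom (t *\<^sub>R G x) \<le> ennreal M" using le HWM[OF GK] by (rule order_trans)
          also have "\<dots> \<le> (HW W (t *\<^sub>R \<xi> z) + ennreal \<delta>) * indicator (gcube h z) x + ennreal M * indicator (bad z) x"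
            using True by (simp add: add_increasing)
          finally show ?thesis .
        next
          case False
          then have "norm (G x - \<xi> z) \<le> \<kappa>" using z by (simp add: bad_def)
          have "norm (t *\<^sub>R G x - t *\<^sub>R \<xi> z) = t * norm (G x - \<xi> z)" using t by (simp flip: scaleR_diff_right)
          also have "\<dots> \<le> 1 * norm (G x - \<xi> z)" using t by (intro mult_right_mono) auto
          also have "\<dots> \<le> \<kappa>1" using \<open>norm (G x - \<xi> z) \<le> \<kappa>\<close> \<kappa>(2) by simp
          finally have "HW W (t *\<^sub>R G x) \<le> HW W (t *\<^sub>R \<xi> z) + ennreal \<delta>" by (rule \<kappa>1(2)[OF GK \<xi>K[OF z(1)]])
          with le have "Whom (t *\<^sub>R G x) \<le> HW W (t *\<^sub>R \<xi> z) + ennreal \<delta>" by (rule order_trans)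
          then show ?thesis using z False by simp
        qed
        also have "\<dots> \<le> (\<Sum>z\<in>Z. (HW W (t *\<^sub>R \<xi> z) + ennreal \<delta>) * indicator (gcube h z) x + ennreal M * indicator (bad z) x)"
          by (rule member_le_sum[OF z(1) _ Z(1)]) simp
        also have "\<dots> \<le> \<dots> + ennreal M * indicator ?R x" by (rule add_increasing2) simp_all
        finally show ?thesis using x\<Omega> by simp
      next
        case False
        then have "x \<in> ?R" using x\<Omega> by blast
        moreover have "Whom (t *\<^sub>R G x) \<le> ennreal M" using le HWM[OF GK] by (rule order_trans)
        ultimately show ?thesis using x\<Omega> by (simp add: add_increasing)
      qed
    qed simp
  qed
  have "(\<integral>\<^sup>+ x. Whom (t *\<^sub>R G x) * indicator \<Omega> x \<partial>lborel) \<le>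
     (\<integral>\<^sup>+ x. (\<Sum>z\<in>Z. (HW W (t *\<^sub>R \<xi> z) + ennreal \<delta>) * indicator (gcube h z) x + ennreal M * indicator (bad z) x) + ennreal M * indicator ?R x \<partial>lborel)"
    by (rule nn_integral_mono_AE[OF pt])
  also have "\<dots> = (\<Sum>z\<in>Z. (HW W (t *\<^sub>R \<xi> z) + ennreal \<delta>) * emeasure lborel (gcube h z) + ennreal M * emeasure lborel (bad z)) + ennreal M * emeasure lborel ?R"
    using Rm by (subst nn_integral_add) (auto simp: nn_integral_sum nn_integral_add nn_integral_cmult_indicator)
  also have "\<dots> \<le> (\<Sum>z\<in>Z. ennreal ?hd * HW W (t *\<^sub>R \<xi> z) + ennreal (2 * \<delta> * ?hd)) + ennreal \<delta>"
  proof (rule add_mono[OF sum_mono])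
    fix z assume z: "z \<in> Z"
    have "ennreal M * emeasure lborel (bad z) \<le> ennreal M * ennreal (\<kappa> * ?hd)" by (rule mult_left_mono[OF ebad[OF z]]) simp
    also have "\<dots> = ennreal ((M * \<kappa>) * ?hd)" using M(1) \<kappa>(1) hd by (simp add: ennreal_mult[symmetric] mult.assoc)
    also have "\<dots> \<le> ennreal (\<delta> * ?hd)" using M\<kappa> hd by (intro ennreal_leI mult_right_mono) auto
    finally have 1: "ennreal M * emeasure lborel (bad z) \<le> ennreal (\<delta> * ?hd)" .
    have "(HW W (t *\<^sub>R \<xi> z) + ennreal \<delta>) * emeasure lborel (gcube h z) = ennreal ?hd * HW W (t *\<^sub>R \<xi> z) + ennreal (\<delta> * ?hd)"
    proof -
      have "ennreal (\<delta> * ?hd) = ennreal ?hd * ennreal \<delta>" using \<delta> hd by (subst mult.commute) (intro ennreal_mult, auto)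
      then show ?thesis unfolding measure_cube(2)[OF less_imp_le[OF h]] by (simp only: distrib_left mult.commute[of _ "ennreal ?hd"])
    qed
    then have "(HW W (t *\<^sub>R \<xi> z) + ennreal \<delta>) * emeasure lborel (gcube h z) + ennreal M * emeasure lborel (bad z)
       \<le> ennreal ?hd * HW W (t *\<^sub>R \<xi> z) + (ennreal (\<delta> * ?hd) + ennreal (\<delta> * ?hd))"
      using 1 by (simp add: add.assoc add_left_mono)
    also have "ennreal (\<delta> * ?hd) + ennreal (\<delta> * ?hd) = ennreal (2 * \<delta> * ?hd)"
      using \<delta> hd by (subst ennreal_plus[symmetric]) auto
    finally show "(HW W (t *\<^sub>R \<xi> z) + ennreal \<delta>) * emeasure lborel (gcube h z) + ennreal M * emeasure lborel (bad z)
       \<le> ennreal ?hd * HW W (t *\<^sub>R \<xi> z) + ennreal (2 * \<delta> * ?hd)" .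
  next
    have "ennreal M * emeasure lborel ?R \<le> ennreal M * ennreal \<tau>" by (rule mult_left_mono[OF eR]) simp
    also have "\<dots> = ennreal (M * \<tau>)" using M(1) \<tau> by (simp add: ennreal_mult)
    also have "\<dots> \<le> ennreal \<delta>" using M\<tau> by (rule ennreal_leI)
    finally show "ennreal M * emeasure lborel ?R \<le> ennreal \<delta>" .
  qed
  also have "\<dots> = (\<Sum>z\<in>Z. ennreal ?hd * HW W (t *\<^sub>R \<xi> z)) + ennreal (2 * \<delta> * (\<Sum>z\<in>Z. ?hd)) + ennreal \<delta>"
    using \<delta> hd by (simp add: sum.distrib sum_ennreal sum_distrib_left del: sum_constant)
  also have "\<dots> \<le> (c + ennreal (2 * \<delta> * ?A)) + ennreal (2 * \<delta> * ?A) + ennreal \<delta>"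
    using sum1 sumA \<delta> by (intro add_mono ennreal_leI mult_left_mono) auto
  also have "\<dots> = c + ennreal (\<delta> * (4 * ?A + 1))"
  proof -
    have "ennreal (\<delta> * (4 * ?A + 1)) = ennreal (2 * \<delta> * ?A) + ennreal (2 * \<delta> * ?A) + ennreal \<delta>"
      using \<delta> by (simp add: algebra_simps flip: ennreal_plus)
    then show ?thesis by (simp add: add.assoc)
  qed
  finally show ?thesis .
qed

text \<open>The chosen gradient need not be Borel measurable; it is exchanged for the Borel
  representative under the integral.\<close>

lemma I_eps_WG:
  assumes "open \<Omega>" "WG \<Omega> v H" "AE x in lborel. x \<in> \<Omega> \<longrightarrow> weak_gradient \<Omega> u x = H x"
  shows "I_eps W \<Omega> \<epsilon> u = (\<integral>\<^sup>+ x. W (x /\<^sub>R \<epsilon>) (H x) * indicator \<Omega> x \<partial>lborel)"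
  unfolding I_eps_def
proof (rule nn_integral_lebesgue_on_eq)
  note [measurable] = WG_meas(1,2)[OF assms(2)]
  show "(\<lambda>x. W (x /\<^sub>R \<epsilon>) (H x)) \<in> borel_measurable borel" by (intro W_comp_measurable) auto
  show "AE x in lborel. x \<in> \<Omega> \<longrightarrow> W (x /\<^sub>R \<epsilon>) (weak_gradient \<Omega> u x) = W (x /\<^sub>R \<epsilon>) (H x)"
    using assms(3) by eventually_elim simp
qed (use assms(1) in simp)

lemma I_hom_WG:
  assumes "open \<Omega>" "WG \<Omega> v H" "AE x in lborel. x \<in> \<Omega> \<longrightarrow> weak_gradient \<Omega> u x = H x"
  shows "I_hom W \<Omega> u = (\<integral>\<^sup>+ x. Whom (H x) * indicator \<Omega> x \<partial>lborel)"
  unfolding I_hom_def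
proof (rule nn_integral_lebesgue_on_eq)
  show "(\<lambda>x. Whom (H x)) \<in> borel_measurable borel"
    by (rule measurable_compose[OF WG_meas(2)[OF assms(2)] Whom_measurable])
  show "AE x in lborel. x \<in> \<Omega> \<longrightarrow> Whom (weak_gradient \<Omega> u x) = Whom (H x)"
    using assms(3) by eventually_elim simp
qed (use assms(1) in simp)

lemma L1_distance_WG:
  fixes u v u' v' :: "real^'d \<Rightarrow> real^'m"
  assumes "open \<Omega>" "u' \<in> borel_measurable borel" "v' \<in> borel_measurable borel"
    "AE x in lborel. x \<in> \<Omega> \<longrightarrow> u x = u' x" "AE x in lborel. x \<in> \<Omega> \<longrightarrow> v x = v' x"
  shows "(\<integral>\<^sup>+ x. ennreal (norm (v x - u x)) \<partial>lebesgue_on \<Omega>) = (\<integral>\<^sup>+ x. ennreal (norm (v' x - u' x)) * indicator \<Omega> x \<partial>lborel)"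
proof (rule nn_integral_lebesgue_on_eq)
  note [measurable] = assms(2,3)
  show "(\<lambda>x. ennreal (norm (v' x - u' x))) \<in> borel_measurable borel" by measurable
  show "AE x in lborel. x \<in> \<Omega> \<longrightarrow> ennreal (norm (v x - u x)) = ennreal (norm (v' x - u' x))"
    using assms(4,5) by eventually_elim simp
qed (use assms(1) in simp)

lemma effective_dom_closure: "W x \<xi> < top \<Longrightarrow> \<xi> \<in> closure C"
  using dom[of x] by (auto simp: effective_dom_def)

lemma ennreal_le_scaled_epsilon:
  assumes "\<And>\<delta>. \<delta> > 0 \<Longrightarrow> x \<le> y + ennreal (\<delta> * a)" "a > 0"
  shows "x \<le> (y::ennreal)"
proof (rule ennreal_le_epsilon)
  fix e :: real assume "0 < e"
  then have "x \<le> y + ennreal (e / a * a)" using assms by (intro assms(1)) simp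
  then show "x \<le> y + ennreal e" using assms(2) by simp
qed

text \<open>The scaled estimate controls the relaxed density at \<open>t\<close> times the gradient
  of the limit. The factor \<open>t\<close> is removed by the lower semicontinuity of the
  envelope.\<close>

theorem Gamma_liminf_ge:
  fixes \<Omega> :: "(real^'d) set"
  assumes \<Omega>: "open \<Omega>" "bounded \<Omega>" and u: "u \<in> W1inf \<Omega>"
  shows "I_hom W \<Omega> u \<le> Gamma_liminf \<Omega> (I_eps W \<Omega>) u"
  unfolding Gamma_liminf_def
proof (rule INF_greatest)
  fix U assume U: "U \<in> L1_families \<Omega> u"
  have UW: "U \<epsilon> \<in> W1inf \<Omega>" if "\<epsilon> > 0" for \<epsilon> using U that by (simp add: L1_families_def)
  have UL: "((\<lambda>\<epsilon>. \<integral>\<^sup>+ x. ennreal (norm (U \<epsilon> x - u x)) \<partial>lebesgue_on \<Omega>) \<longlongrightarrow> 0) (at_right 0)"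
    using U by (simp add: L1_families_def)
  obtain v G B where v: "WG \<Omega> v G" "AE x in lborel. x \<in> \<Omega> \<longrightarrow> u x = v x"
    "AE x in lborel. x \<in> \<Omega> \<longrightarrow> weak_gradient \<Omega> u x = G x"
    by (rule W1inf_WG[OF \<Omega>(1) u], rule that)
  note [measurable] = WG_meas(1,2)[OF v(1)]
  have \<Omega>m [measurable]: "\<Omega> \<in> sets borel" using \<Omega>(1) by simp
  show "I_hom W \<Omega> u \<le> Liminf (at_right 0) (\<lambda>\<epsilon>. I_eps W \<Omega> \<epsilon> (U \<epsilon>))"
  proof (rule dense_ge)
    fix c assume c: "Liminf (at_right 0) (\<lambda>\<epsilon>. I_eps W \<Omega> \<epsilon> (U \<epsilon>)) < c"
    \<comment> \<open>A lower limit below \<open>c\<close> yields energies below \<open>c\<close> at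
      arbitrarily small \<open>\<epsilon>\<close> only, not at all small \<open>\<epsilon>\<close>.
      For this reason \<open>liminf_estimate_scaled\<close> asks for a single
      \<open>\<epsilon>\<close> per pair of tolerances.\<close>
    have nev: "\<not> eventually (\<lambda>\<epsilon>. c \<le> I_eps W \<Omega> \<epsilon> (U \<epsilon>)) (at_right 0)"
      using c Liminf_bounded[of c "\<lambda>\<epsilon>. I_eps W \<Omega> \<epsilon> (U \<epsilon>)" "at_right 0"] by (auto simp: not_le[symmetric])
    have freq: "\<exists>\<epsilon> w H. 0 < \<epsilon> \<and> \<epsilon> < b \<and> WG \<Omega> w H \<and>
        (AE x in lborel. x \<in> \<Omega> \<longrightarrow> H x \<in> closure C) \<and>
        (\<integral>\<^sup>+ x. W (x /\<^sub>R \<epsilon>) (H x) * indicator \<Omega> x \<partial>lborel) \<le> c \<and>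
        (\<integral>\<^sup>+ x. ennreal (norm (w x - v x)) * indicator \<Omega> x \<partial>lborel) \<le> ennreal e" if b: "b > 0" and e: "e > 0" for b e
    proof -
      have "eventually (\<lambda>\<epsilon>. (\<integral>\<^sup>+ x. ennreal (norm (U \<epsilon> x - u x)) \<partial>lebesgue_on \<Omega>) < ennreal e) (at_right 0)"
        using UL e by (intro order_tendstoD) auto
      then obtain b1 where b1: "b1 > 0" "\<And>\<epsilon>. 0 < \<epsilon> \<Longrightarrow> \<epsilon> < b1 \<Longrightarrow> (\<integral>\<^sup>+ x. ennreal (norm (U \<epsilon> x - u x)) \<partial>lebesgue_on \<Omega>) < ennreal e"
        unfolding eventually_at_right_field by blast
      have "\<exists>\<epsilon>>0. \<epsilon> < min b b1 \<and> I_eps W \<Omega> \<epsilon> (U \<epsilon>) < c"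
      proof (rule ccontr)
        assume n: "\<not> ?thesis"
        have "eventually (\<lambda>\<epsilon>. c \<le> I_eps W \<Omega> \<epsilon> (U \<epsilon>)) (at_right 0)"
          unfolding eventually_at_right_field using b b1(1) by (intro exI[of _ "min b b1"]) (use n in \<open>simp, meson not_less\<close>)
        with nev show False by blast
      qed
      then obtain \<epsilon> where \<epsilon>: "\<epsilon> > 0" "\<epsilon> < b" "\<epsilon> < b1" "I_eps W \<Omega> \<epsilon> (U \<epsilon>) < c" by auto
      obtain w H Bw where w: "WG \<Omega> w H" "AE x in lborel. x \<in> \<Omega> \<longrightarrow> U \<epsilon> x = w x"
        "AE x in lborel. x \<in> \<Omega> \<longrightarrow> weak_gradient \<Omega> (U \<epsilon>) x = H x"
        by (rule W1inf_WG[OF \<Omega>(1) UW[OF \<epsilon>(1)]], rule that)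
      note [measurable] = WG_meas(1,2)[OF w(1)]
      have en: "(\<integral>\<^sup>+ x. W (x /\<^sub>R \<epsilon>) (H x) * indicator \<Omega> x \<partial>lborel) < c"
        using \<epsilon>(4) unfolding I_eps_WG[OF \<Omega>(1) w(1,3)] .
      have m: "(\<lambda>x. W (x /\<^sub>R \<epsilon>) (H x) * indicator \<Omega> x) \<in> borel_measurable lborel"
        by (intro borel_measurable_times_ennreal W_comp_measurable) auto
      have "AE x in lborel. W (x /\<^sub>R \<epsilon>) (H x) * indicator \<Omega> x \<noteq> \<infinity>"
        using en by (intro nn_integral_PInf_AE[OF m]) auto
      then have "AE x in lborel. x \<in> \<Omega> \<longrightarrow> H x \<in> closure C"
      proof eventually_elim
        case (elim x)
        then show ?case using effective_dom_closure[of "x /\<^sub>R \<epsilon>" "H x"] by (auto simp: less_top)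
      qed
      moreover have "(\<integral>\<^sup>+ x. ennreal (norm (w x - v x)) * indicator \<Omega> x \<partial>lborel) \<le> ennreal e"
        using b1(2)[OF \<epsilon>(1,3)] L1_distance_WG[OF \<Omega>(1) WG_meas(1)[OF v(1)] WG_meas(1)[OF w(1)] v(2) w(2)] by simp
      ultimately show ?thesis using \<epsilon> w(1) less_imp_le[OF en] by blast
    qed
    \<comment> \<open>Finite energy confines the approximating gradients to the closure of
      \<open>C\<close>, and closed convex constraints survive convergence in the mean of the
      functions.\<close>
    have GC: "AE x in lborel. x \<in> \<Omega> \<longrightarrow> G x \<in> closure C"
    proof (rule WG_limit_closed_convex[OF \<Omega>(1) closed_closure convex_closure[OF convex_C] v(1)])
      fix e :: real assume "e > 0"
      from freq[OF zero_less_one this]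
      show "\<exists>w H. WG \<Omega> w H \<and> (AE x in lborel. x \<in> \<Omega> \<longrightarrow> H x \<in> closure C) \<and>
         (\<integral>\<^sup>+ x. ennreal (norm (w x - v x)) * indicator \<Omega> x \<partial>lborel) \<le> ennreal e" by blast
    qed
    define t where "t k = 1 - inverse (real (Suc k))" for k
    have t01: "0 \<le> t k" "t k < 1" for k by (auto simp: t_def field_simps)
    have tl: "t \<longlonglongrightarrow> 1"
    proof -
      have "t \<longlonglongrightarrow> 1 - 0" unfolding t_def by (intro tendsto_intros LIMSEQ_inverse_real_of_nat)
      then show ?thesis by simp
    qed
    have "I_hom W \<Omega> u = (\<integral>\<^sup>+ x. Whom (G x) * indicator \<Omega> x \<partial>lborel)" by (rule I_hom_WG[OF \<Omega>(1) v(1,3)])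
    also have "\<dots> \<le> (\<integral>\<^sup>+ x. liminf (\<lambda>k. Whom (t k *\<^sub>R G x) * indicator \<Omega> x) \<partial>lborel)"
    proof (rule nn_integral_mono)
      fix x
      have "Whom (G x) \<le> liminf (\<lambda>k. Whom (t k *\<^sub>R G x))" by (rule Whom_le_liminf[OF tl])
      then show "Whom (G x) * indicator \<Omega> x \<le> liminf (\<lambda>k. Whom (t k *\<^sub>R G x) * indicator \<Omega> x)"
        by (cases "x \<in> \<Omega>") simp_all
    qed
    also have "\<dots> \<le> liminf (\<lambda>k. \<integral>\<^sup>+ x. Whom (t k *\<^sub>R G x) * indicator \<Omega> x \<partial>lborel)"
      by (rule nn_integral_liminf) (intro borel_measurable_times_ennreal measurable_compose[OF _ Whom_measurable], measurable)
    \<comment> \<open>For fixed \<open>\<delta>\<close> the estimate holds for all large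
      \<open>k\<close>, namely once \<open>1 - t k\<close> is below the threshold
      \<open>\<eta>\<close>. The limit in \<open>k\<close> is taken first, and only then
      \<open>\<delta>\<close> tends to 0.\<close>
    also have "\<dots> \<le> c"
    proof (rule ennreal_le_scaled_epsilon)
      fix \<delta> :: real assume \<delta>: "\<delta> > 0"
      obtain \<eta> where \<eta>: "\<eta> > 0" "\<And>x \<xi> t. 0 \<le> t \<Longrightarrow> t < 1 \<Longrightarrow> 1 - t \<le> \<eta> \<Longrightarrow> W x (t *\<^sub>R \<xi>) \<le> W x \<xi> + ennreal \<delta>"
        by (rule W_scale[OF \<delta>], rule that)
      have "eventually (\<lambda>k. t k > 1 - \<eta>) sequentially" using tl \<eta>(1) by (intro order_tendstoD) auto
      then have "eventually (\<lambda>k. (\<integral>\<^sup>+ x. Whom (t k *\<^sub>R G x) * indicator \<Omega> x \<partial>lborel) \<le> c + ennreal (\<delta> * (4 * measure lborel \<Omega> + 1))) sequentially"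
      proof eventually_elim
        case (elim k)
        show ?case
          by (rule liminf_estimate_scaled[OF \<Omega> v(1) GC freq \<delta> t01 \<eta>(2)[OF t01]]) (use elim in auto)
      qed
      then have "eventually (\<lambda>k. (\<integral>\<^sup>+ x. Whom (t k *\<^sub>R G x) * indicator \<Omega> x \<partial>lborel) \<le> c + ennreal (\<delta> * (4 * measure lborel \<Omega> + 1))) sequentially" .
      then have "limsup (\<lambda>k. \<integral>\<^sup>+ x. Whom (t k *\<^sub>R G x) * indicator \<Omega> x \<partial>lborel) \<le> c + ennreal (\<delta> * (4 * measure lborel \<Omega> + 1))"
        by (rule Limsup_bounded)
      moreover have "liminf (\<lambda>k. \<integral>\<^sup>+ x. Whom (t k *\<^sub>R G x) * indicator \<Omega> x \<partial>lborel) \<le> limsup (\<lambda>k. \<integral>\<^sup>+ x. Whom (t k *\<^sub>R G x) * indicator \<Omega> x \<partial>lborel)"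
        by (rule Liminf_le_Limsup) simp
      ultimately show "liminf (\<lambda>k. \<integral>\<^sup>+ x. Whom (t k *\<^sub>R G x) * indicator \<Omega> x \<partial>lborel) \<le> c + ennreal (\<delta> * (4 * measure lborel \<Omega> + 1))"
        by (rule order_trans[rotated])
    qed (simp add: add_nonneg_pos)
    finally show "I_hom W \<Omega> u \<le> c" .
  qed
qed

subsection \<open>The upper bound\<close>

text \<open>If near optimal competitors exist for every tolerance and all small \<open>\<epsilon>\<close>, a diagonal choice
  of the tolerance as a function of \<open>\<epsilon>\<close> yields a recovery family.\<close>

lemma Gamma_limsup_le_diagonal:
  fixes F :: "real \<Rightarrow> (real^'d \<Rightarrow> real^'m) \<Rightarrow> ennreal"
  assumes u: "u \<in> W1inf \<Omega>"
    and ex: "\<And>e. e > 0 \<Longrightarrow> \<exists>\<epsilon>0>0. \<forall>\<epsilon>. 0 < \<epsilon> \<and> \<epsilon> < \<epsilon>0 \<longrightarrow> (\<exists>v\<in>W1inf \<Omega>.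
       (\<integral>\<^sup>+ x. ennreal (norm (v x - u x)) \<partial>lebesgue_on \<Omega>) \<le> ennreal e \<and> F \<epsilon> v \<le> I + ennreal e)"
  shows "Gamma_limsup \<Omega> F u \<le> I"
proof -
  define e where "e k = inverse (real (Suc k))" for k
  have e: "e k > 0" for k by (simp add: e_def)
  have "\<forall>k. \<exists>\<epsilon>0>0. \<forall>\<epsilon>. 0 < \<epsilon> \<and> \<epsilon> < \<epsilon>0 \<longrightarrow> (\<exists>v\<in>W1inf \<Omega>.
       (\<integral>\<^sup>+ x. ennreal (norm (v x - u x)) \<partial>lebesgue_on \<Omega>) \<le> ennreal (e k) \<and> F \<epsilon> v \<le> I + ennreal (e k))"
    using ex[OF e] by blast
  from choice[OF this] obtain E where E: "\<forall>k. E k > 0 \<and> (\<forall>\<epsilon>. 0 < \<epsilon> \<and> \<epsilon> < E k \<longrightarrow> (\<exists>v\<in>W1inf \<Omega>.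
       (\<integral>\<^sup>+ x. ennreal (norm (v x - u x)) \<partial>lebesgue_on \<Omega>) \<le> ennreal (e k) \<and> F \<epsilon> v \<le> I + ennreal (e k)))" ..
  \<comment> \<open>The indices of the tolerances available at \<open>\<epsilon>\<close>. The bound
    by \<open>1 / \<epsilon>\<close> makes the set finite, so that the best index
    \<open>Max (S \<epsilon>)\<close> exists; it grows beyond every \<open>k\<close> as
    \<open>\<epsilon>\<close> tends to 0.\<close>
  define S where "S \<epsilon> = {k. real k \<le> 1 / \<epsilon> \<and> \<epsilon> < E k}" for \<epsilon> :: real
  have finS: "finite (S \<epsilon>)" for \<epsilon>
  proof (rule finite_subset)
    show "S \<epsilon> \<subseteq> {k. k \<le> nat \<lfloor>1 / \<epsilon>\<rfloor>}" by (auto simp: S_def le_nat_floor)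
  qed simp
  \<comment> \<open>The default value \<open>u\<close> keeps the family in \<open>W1inf\<close>
    where no tolerance is available; this does not happen for small
    \<open>\<epsilon>\<close>.\<close>
  define U where "U \<epsilon> = (if 0 < \<epsilon> \<and> S \<epsilon> \<noteq> {} then (SOME v. v \<in> W1inf \<Omega> \<and>
       (\<integral>\<^sup>+ x. ennreal (norm (v x - u x)) \<partial>lebesgue_on \<Omega>) \<le> ennreal (e (Max (S \<epsilon>))) \<and> F \<epsilon> v \<le> I + ennreal (e (Max (S \<epsilon>)))) else u)" for \<epsilon>
  have U: "U \<epsilon> \<in> W1inf \<Omega> \<and> (\<integral>\<^sup>+ x. ennreal (norm (U \<epsilon> x - u x)) \<partial>lebesgue_on \<Omega>) \<le> ennreal (e (Max (S \<epsilon>))) \<and> F \<epsilon> (U \<epsilon>) \<le> I + ennreal (e (Max (S \<epsilon>)))"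
    if \<epsilon>: "0 < \<epsilon>" "S \<epsilon> \<noteq> {}" for \<epsilon>
  proof -
    have "Max (S \<epsilon>) \<in> S \<epsilon>" by (rule Max_in[OF finS \<epsilon>(2)])
    then have "\<epsilon> < E (Max (S \<epsilon>))" by (simp add: S_def)
    then have "\<exists>v. v \<in> W1inf \<Omega> \<and>
       (\<integral>\<^sup>+ x. ennreal (norm (v x - u x)) \<partial>lebesgue_on \<Omega>) \<le> ennreal (e (Max (S \<epsilon>))) \<and> F \<epsilon> v \<le> I + ennreal (e (Max (S \<epsilon>)))"
      using E \<epsilon>(1) by blast
    from someI_ex[OF this] show ?thesis unfolding U_def using \<epsilon> by simp
  qed
  have ev: "eventually (\<lambda>\<epsilon>. (\<integral>\<^sup>+ x. ennreal (norm (U \<epsilon> x - u x)) \<partial>lebesgue_on \<Omega>) \<le> ennreal (e k) \<and> F \<epsilon> (U \<epsilon>) \<le> I + ennreal (e k)) (at_right 0)" for k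
  proof -
    have main: "(\<integral>\<^sup>+ x. ennreal (norm (U \<epsilon> x - u x)) \<partial>lebesgue_on \<Omega>) \<le> ennreal (e k) \<and> F \<epsilon> (U \<epsilon>) \<le> I + ennreal (e k)"
      if \<epsilon>: "0 < \<epsilon>" "\<epsilon> < min (E k) (1 / (real k + 1))" for \<epsilon>
    proof -
      have "\<epsilon> * (real k + 1) < 1" using \<epsilon> by (simp add: pos_less_divide_eq)
      then have "real k \<le> 1 / \<epsilon>" using \<epsilon>(1) by (simp add: pos_le_divide_eq algebra_simps)
      then have kS: "k \<in> S \<epsilon>" using \<epsilon> by (simp add: S_def)
      then have "k \<le> Max (S \<epsilon>)" by (rule Max_ge[OF finS])
      then have "e (Max (S \<epsilon>)) \<le> e k" by (simp add: e_def le_imp_inverse_le)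
      then have le: "ennreal (e (Max (S \<epsilon>))) \<le> ennreal (e k)" by (rule ennreal_leI)
      have "S \<epsilon> \<noteq> {}" using kS by blast
      from U[OF \<epsilon>(1) this] show ?thesis using le by (meson add_left_mono order_trans)
    qed
    have pos: "min (E k) (1 / (real k + 1)) > 0" using E by simp
    show ?thesis unfolding eventually_at_right_field
      by (rule exI[of _ "min (E k) (1 / (real k + 1))"]) (use main pos in blast)
  qed
  have small: "\<exists>k. ennreal (e k) < a" if "a > 0" for a :: ennreal
  proof -
    have "(\<lambda>k. ennreal (e k)) \<longlonglongrightarrow> ennreal 0" unfolding e_def
      by (intro tendsto_ennrealI LIMSEQ_inverse_real_of_nat)
    then have "(\<lambda>k. ennreal (e k)) \<longlonglongrightarrow> 0" by simp
    from order_tendstoD(2)[OF this that] show ?thesis unfolding eventually_sequentially by blast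
  qed
  have "U \<in> L1_families \<Omega> u"
    unfolding L1_families_def
  proof (intro CollectI conjI allI impI)
    fix \<epsilon> :: real assume "0 < \<epsilon>"
    then show "U \<epsilon> \<in> W1inf \<Omega>" using U[of \<epsilon>] u by (cases "S \<epsilon> = {}") (auto simp: U_def)
  next
    show "((\<lambda>\<epsilon>. \<integral>\<^sup>+ x. ennreal (norm (U \<epsilon> x - u x)) \<partial>lebesgue_on \<Omega>) \<longlongrightarrow> 0) (at_right 0)"
    proof (rule order_tendstoI)
      fix a :: ennreal assume "0 < a"
      from small[OF this] obtain k where k: "ennreal (e k) < a" by blast
      show "eventually (\<lambda>\<epsilon>. (\<integral>\<^sup>+ x. ennreal (norm (U \<epsilon> x - u x)) \<partial>lebesgue_on \<Omega>) < a) (at_right 0)"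
        using ev[of k] by eventually_elim (use k in \<open>auto intro: le_less_trans\<close>)
    qed simp
  qed
  then have "Gamma_limsup \<Omega> F u \<le> Limsup (at_right 0) (\<lambda>\<epsilon>. F \<epsilon> (U \<epsilon>))"
    unfolding Gamma_limsup_def by (rule INF_lower)
  also have "\<dots> \<le> I"
  proof (rule ennreal_le_epsilon)
    fix a :: real assume "0 < a"
    then have "0 < ennreal a" by simp
    from small[OF this] obtain k where k: "ennreal (e k) < ennreal a" by blast
    show "Limsup (at_right 0) (\<lambda>\<epsilon>. F \<epsilon> (U \<epsilon>)) \<le> I + ennreal a"
    proof (rule Limsup_bounded)
      show "eventually (\<lambda>\<epsilon>. F \<epsilon> (U \<epsilon>) \<le> I + ennreal a) (at_right 0)"
        using ev[of k] by eventually_elim (use k in \<open>meson add_left_mono less_imp_le order_trans\<close>)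
    qed
  qed
  finally show ?thesis .
qed

text \<open>The counterpart of \<open>HW_le_cube\<close> with the roles exchanged: the affine map is
  used inside and \<open>u\<close> is kept at the boundary. The oscillating part is supported in the
  inner cube, where the cutoff equals 1, so it does not interact with the blending in the
  layer.\<close>

lemma cube_competitor:
  fixes p :: "real^'d" and u :: "real^'d \<Rightarrow> real^'m"
  assumes K: "convex K" "\<xi> \<in> K" and M: "M \<ge> 0" "\<rho> \<ge> 0"
      "\<And>\<epsilon>. \<epsilon> > 0 \<Longrightarrow> AE x in lborel. \<forall>\<xi>\<in>K. \<forall>\<zeta>. norm \<zeta> \<le> \<rho> \<longrightarrow> W (x /\<^sub>R \<epsilon>) (\<xi> + \<zeta>) \<le> ennreal M"
    and wg: "WG (box p (p + vec h)) u G" and h: "h > 0" and r: "0 < r" "4 * r < 1"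
    and GK: "AE x in lborel. x \<in> box p (p + vec h) \<longrightarrow> G x \<in> K"
    and near: "AE x in lborel. x \<in> box p (p + vec h) \<longrightarrow> norm (u x - (\<xi> *v x + b)) \<le> \<kappa> * h"
    and \<kappa>: "real CARD('d) * cutL * \<kappa> / r \<le> \<rho>" and \<sigma>: "\<sigma> > 0"
  obtains \<epsilon>0 where "\<epsilon>0 > 0" "\<And>\<epsilon>. 0 < \<epsilon> \<Longrightarrow> \<epsilon> < \<epsilon>0 \<Longrightarrow> \<exists>\<Phi> H. WG UNIV \<Phi> H \<and>
     (\<forall>x. x \<notin> box p (p + vec h) \<longrightarrow> \<Phi> x = 0 \<and> H x = 0) \<and>
     (AE x in lborel. x \<in> box p (p + vec h) \<longrightarrow> norm (\<Phi> x) \<le> \<kappa> * h + \<sigma>) \<and>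
     (\<integral>\<^sup>+ x. W (x /\<^sub>R \<epsilon>) (G x + H x) * indicator (box p (p + vec h)) x \<partial>lborel) \<le>
       ennreal (h ^ CARD('d)) * HW W \<xi> + ennreal (\<sigma> * h ^ CARD('d) + \<sigma> + M * (h ^ CARD('d) - (h - 4 * (r * h)) ^ CARD('d)))"
proof -
  let ?Q = "box p (p + vec h)" and ?In = "box (p + vec (2 * (r * h))) (p + vec (h - 2 * (r * h)))"
  let ?l = "h - 4 * (r * h)"
  note [measurable] = WG_meas(1,2)[OF wg]
  define \<eta> where "\<eta> = cutoff p (p + vec h) (r * h)"
  note c = cutoff_cube[OF h r, where p = p, folded \<eta>_def]
  have \<eta>01: "0 \<le> \<eta> x" "\<eta> x \<le> 1" for x unfolding \<eta>_def by (rule cutoff_bounds)+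
  note inn = inner_cube[OF h r, of p]
  have l: "0 < ?l" "?l \<le> h" using r h by auto
  have HWM: "HW W \<xi> \<le> ennreal M" by (rule HW_le_bound_nbhd(1)[OF M K(2)])
  then have HWf: "HW W \<xi> < top" by (rule le_less_trans) simp
  \<comment> \<open>\<open>recovery_cube\<close> needs a strict real bound on \<open>HW\<close>; the
    value is finite because \<open>M\<close> bounds it.\<close>
  define d where "d = enn2real (HW W \<xi>)"
  have d: "HW W \<xi> = ennreal d" "d \<ge> 0" using HWf by (simp_all add: d_def)
  have HWd: "HW W \<xi> < ennreal (d + \<sigma>)" "d + \<sigma> \<ge> 0" using \<sigma> d by (auto simp: ennreal_less_iff)
  have Wb: "AE x in lborel. W (x /\<^sub>R \<epsilon>) \<xi> \<le> ennreal M" if "\<epsilon> > 0" for \<epsilon>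
    by (rule HW_le_bound_nbhd(2)[OF M K(2) that])
  obtain \<epsilon>0 where \<epsilon>0: "\<epsilon>0 > 0" "\<And>\<epsilon>. 0 < \<epsilon> \<Longrightarrow> \<epsilon> < \<epsilon>0 \<Longrightarrow> \<exists>\<Phi> G. WG UNIV \<Phi> G \<and> continuous_on UNIV \<Phi> \<and>
     (\<forall>x. x \<notin> ?In \<longrightarrow> \<Phi> x = 0 \<and> G x = 0) \<and> (\<forall>x. norm (\<Phi> x) \<le> \<sigma>) \<and>
     (\<integral>\<^sup>+ x. W (x /\<^sub>R \<epsilon>) (\<xi> + G x) * indicator ?In x \<partial>lborel) \<le> ennreal ((d + \<sigma>) * ?l ^ CARD('d) + \<sigma>)"
    by (rule recovery_cube[where p = "p + vec (2 * (r * h))" and l = ?l, unfolded inn(1)[symmetric], OF HWd M(1) Wb l(1) \<sigma>], assumption, rule that)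
  show ?thesis
  proof (rule that[OF \<epsilon>0(1)])
    fix \<epsilon> :: real assume \<epsilon>: "0 < \<epsilon>" "\<epsilon> < \<epsilon>0"
    from \<epsilon>0(2)[OF this] obtain F E where F: "WG UNIV F E" "\<And>x. x \<notin> ?In \<Longrightarrow> F x = 0 \<and> E x = 0" "\<And>x. norm (F x) \<le> \<sigma>"
      "(\<integral>\<^sup>+ x. W (x /\<^sub>R \<epsilon>) (\<xi> + E x) * indicator ?In x \<partial>lborel) \<le> ennreal ((d + \<sigma>) * ?l ^ CARD('d) + \<sigma>)" by blast
    note [measurable] = WG_meas(1,2)[OF F(1)]
    define v where "v x = (\<xi> *v x + b) - u x" for x
    have wv: "WG ?Q v (\<lambda>x. \<xi> - G x)" unfolding v_def[abs_def] by (rule WG_diff[OF WG_affine wg])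
    define \<Phi> where "\<Phi> x = \<eta> x *\<^sub>R v x + F x" for x
    define H where "H x = (\<eta> x *\<^sub>R (\<xi> - G x) + outer (v x) (grad \<eta> x)) + E x" for x
    have w\<Phi>: "WG UNIV \<Phi> H" unfolding \<Phi>_def[abs_def] H_def[abs_def]
      by (rule WG_add[OF WG_mult_test[OF wv c(1)] F(1)])
    have zero: "\<Phi> x = 0 \<and> H x = 0" if "x \<notin> ?Q" for x
    proof -
      have "x \<notin> ?In" using that inn(2) by blast
      from F(2)[OF this] show ?thesis using c(2,3)[OF that] by (simp add: \<Phi>_def H_def outer_def vec_eq_iff)
    qed
    have nv: "AE x in lborel. x \<in> ?Q \<longrightarrow> norm (v x) \<le> \<kappa> * h"
      using near by eventually_elim (simp add: v_def norm_minus_commute)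
    have small: "AE x in lborel. x \<in> ?Q \<longrightarrow> norm (\<Phi> x) \<le> \<kappa> * h + \<sigma>"
      using nv
    proof eventually_elim
      case (elim x)
      show ?case
      proof
        assume "x \<in> ?Q"
        then have "norm (v x) \<le> \<kappa> * h" using elim by blast
        moreover have "\<eta> x * norm (v x) \<le> 1 * norm (v x)" by (rule mult_right_mono[OF \<eta>01(2)]) simp
        moreover have "norm (\<Phi> x) \<le> \<eta> x * norm (v x) + norm (F x)"
          unfolding \<Phi>_def by (rule order_trans[OF norm_triangle_ineq]) (simp add: \<eta>01(1))
        ultimately show "norm (\<Phi> x) \<le> \<kappa> * h + \<sigma>" using F(3)[of x] by linarith
      qed
    qed
    have "(\<integral>\<^sup>+ x. W (x /\<^sub>R \<epsilon>) (G x + H x) * indicator ?Q x \<partial>lborel) \<le>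
      (\<integral>\<^sup>+ x. W (x /\<^sub>R \<epsilon>) (\<xi> + E x) * indicator ?In x + ennreal M * indicator (?Q - ?In) x \<partial>lborel)"
    proof (rule nn_integral_mono_AE)
      show "AE x in lborel. W (x /\<^sub>R \<epsilon>) (G x + H x) * indicator ?Q x \<le> W (x /\<^sub>R \<epsilon>) (\<xi> + E x) * indicator ?In x + ennreal M * indicator (?Q - ?In) x"
        using M(3)[OF \<epsilon>(1)] GK nv
      proof eventually_elim
        case (elim x)
        show ?case
        proof (cases "x \<in> ?In")
          case True
          then have "G x + H x = \<xi> + E x" using c(4,5)[OF True] by (simp add: H_def outer_def vec_eq_iff)
          then show ?thesis using True inn(2) by (simp add: indicator_def)
        next
          case In: False
          show ?thesis
          proof (cases "x \<in> ?Q")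
            case True
            then have Gx: "G x \<in> K" and vx: "norm (v x) \<le> \<kappa> * h" using elim(2,3) by blast+
            have "(1 - \<eta> x) *\<^sub>R G x + \<eta> x *\<^sub>R \<xi> \<in> K"
              using K(1) \<eta>01[of x] K(2) Gx unfolding convex_alt by blast
            moreover have "norm (outer (v x) (grad \<eta> x)) \<le> \<rho>"
            proof -
              have "norm (v x) * norm (grad \<eta> x) \<le> (\<kappa> * h) * (real CARD('d) * (cutL / (r * h)))"
                using vx by (intro mult_mono c(6)) (auto intro: order_trans[OF norm_ge_zero])
              also have "\<dots> = real CARD('d) * cutL * \<kappa> / r" using h by (simp add: field_simps)
              finally show ?thesis using \<kappa> by (simp add: norm_outer)
            qed
            moreover have "G x + H x = ((1 - \<eta> x) *\<^sub>R G x + \<eta> x *\<^sub>R \<xi>) + outer (v x) (grad \<eta> x)"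
              using F(2)[OF In] by (simp add: H_def algebra_simps)
            ultimately have "W (x /\<^sub>R \<epsilon>) (G x + H x) \<le> ennreal M" using elim(1) by metis
            then show ?thesis using True In by simp
          qed simp
        qed
      qed
    qed
    also have "\<dots> = (\<integral>\<^sup>+ x. W (x /\<^sub>R \<epsilon>) (\<xi> + E x) * indicator ?In x \<partial>lborel) + ennreal M * emeasure lborel (?Q - ?In)"
    proof -
      have "(\<lambda>x. W (x /\<^sub>R \<epsilon>) (\<xi> + E x) * indicator ?In x) \<in> borel_measurable lborel"
        by (intro borel_measurable_times_ennreal W_comp_measurable) auto
      then show ?thesis by (subst nn_integral_add) (auto simp: nn_integral_cmult_indicator)
    qed
    also have "emeasure lborel (?Q - ?In) = ennreal (h ^ CARD('d) - ?l ^ CARD('d))"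
    proof -
      have "emeasure lborel (?Q - ?In) = emeasure lborel ?Q - emeasure lborel ?In"
        using inn by (intro emeasure_Diff) auto
      also have "\<dots> = ennreal (h ^ CARD('d)) - ennreal (?l ^ CARD('d))"
        unfolding inn(3) measure_cube(2)[OF less_imp_le[OF h]] ..
      also have "\<dots> = ennreal (h ^ CARD('d) - ?l ^ CARD('d))"
        by (intro ennreal_minus zero_le_power) (use l in linarith)
      finally show ?thesis .
    qed
    also have "ennreal M * \<dots> = ennreal (M * (h ^ CARD('d) - ?l ^ CARD('d)))"
      by (rule ennreal_mult'[symmetric, OF M(1)])
    also have "(\<integral>\<^sup>+ x. W (x /\<^sub>R \<epsilon>) (\<xi> + E x) * indicator ?In x \<partial>lborel) + ennreal (M * (h ^ CARD('d) - ?l ^ CARD('d)))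
       \<le> ennreal ((d + \<sigma>) * h ^ CARD('d) + \<sigma>) + ennreal (M * (h ^ CARD('d) - ?l ^ CARD('d)))"
    proof (rule add_right_mono, rule order_trans[OF F(4)], rule ennreal_leI)
      have "?l ^ CARD('d) \<le> h ^ CARD('d)" using l by (intro power_mono) auto
      then show "(d + \<sigma>) * ?l ^ CARD('d) + \<sigma> \<le> (d + \<sigma>) * h ^ CARD('d) + \<sigma>" using d \<sigma> by (intro add_right_mono mult_left_mono) auto
    qed
    also have "\<dots> = ennreal (h ^ CARD('d)) * HW W \<xi> + ennreal (\<sigma> * h ^ CARD('d) + \<sigma> + M * (h ^ CARD('d) - ?l ^ CARD('d)))"
    proof -
      have lh: "?l ^ CARD('d) \<le> h ^ CARD('d)" using l by (intro power_mono) auto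
      then have nn: "0 \<le> M * (h ^ CARD('d) - ?l ^ CARD('d))" using M(1) by simp
      have hp: "0 \<le> h ^ CARD('d)" using h by simp
      have "ennreal (h ^ CARD('d)) * HW W \<xi> + ennreal (\<sigma> * h ^ CARD('d) + \<sigma> + M * (h ^ CARD('d) - ?l ^ CARD('d)))
        = ennreal (h ^ CARD('d) * d + (\<sigma> * h ^ CARD('d) + \<sigma> + M * (h ^ CARD('d) - ?l ^ CARD('d))))"
        unfolding d(1) ennreal_mult[OF hp d(2), symmetric]
        by (intro ennreal_plus[symmetric] add_nonneg_nonneg mult_nonneg_nonneg nn hp d(2)) (use \<sigma> in auto)
      moreover have "ennreal ((d + \<sigma>) * h ^ CARD('d) + \<sigma>) + ennreal (M * (h ^ CARD('d) - ?l ^ CARD('d)))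
        = ennreal (((d + \<sigma>) * h ^ CARD('d) + \<sigma>) + M * (h ^ CARD('d) - ?l ^ CARD('d)))"
        by (intro ennreal_plus[symmetric] add_nonneg_nonneg mult_nonneg_nonneg nn hp d(2)) (use \<sigma> in auto)
      moreover have "((d + \<sigma>) * h ^ CARD('d) + \<sigma>) + M * (h ^ CARD('d) - ?l ^ CARD('d)) = h ^ CARD('d) * d + (\<sigma> * h ^ CARD('d) + \<sigma> + M * (h ^ CARD('d) - ?l ^ CARD('d)))"
        by (simp add: distrib_right mult.commute)
      ultimately show ?thesis by simp
    qed
    finally have energy: "(\<integral>\<^sup>+ x. W (x /\<^sub>R \<epsilon>) (G x + H x) * indicator ?Q x \<partial>lborel) \<le>
       ennreal (h ^ CARD('d)) * HW W \<xi> + ennreal (\<sigma> * h ^ CARD('d) + \<sigma> + M * (h ^ CARD('d) - ?l ^ CARD('d)))" .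
    show "\<exists>\<Phi> H. WG UNIV \<Phi> H \<and> (\<forall>x. x \<notin> ?Q \<longrightarrow> \<Phi> x = 0 \<and> H x = 0) \<and>
     (AE x in lborel. x \<in> ?Q \<longrightarrow> norm (\<Phi> x) \<le> \<kappa> * h + \<sigma>) \<and>
     (\<integral>\<^sup>+ x. W (x /\<^sub>R \<epsilon>) (G x + H x) * indicator ?Q x \<partial>lborel) \<le>
       ennreal (h ^ CARD('d)) * HW W \<xi> + ennreal (\<sigma> * h ^ CARD('d) + \<sigma> + M * (h ^ CARD('d) - ?l ^ CARD('d)))"
      by (rule exI[of _ \<Phi>], rule exI[of _ H]) (intro conjI allI impI w\<Phi> zero[THEN conjunct1] zero[THEN conjunct2] small energy)
  qed
qed

text \<open>The competitor is \<open>t *\<^sub>R u x\<close> plus one modification per cube, each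
  vanishing outside its cube. Per volume, \<open>3 * \<delta>\<close> comes from
  \<open>cube_competitor\<close> and \<open>4 * \<delta>\<close> from passing to the relaxed
  density; the uncovered rest adds \<open>\<delta>\<close>. This explains the constant
  \<open>7 * measure lborel \<Omega> + 1\<close>.\<close>

lemma limsup_estimate_scaled:
  fixes \<Omega> :: "(real^'d) set"
  assumes \<Omega>: "open \<Omega>" "bounded \<Omega>" and wu: "WG \<Omega> u G" and GC: "AE x in lborel. x \<in> \<Omega> \<longrightarrow> G x \<in> closure C"
    and \<delta>: "\<delta> > 0" and t: "0 \<le> t" "t < 1" and \<eta>: "\<And>x \<xi>. W x (t *\<^sub>R \<xi>) \<le> W x \<xi> + ennreal \<delta>" and e: "e > 0"
  obtains \<epsilon>0 where "\<epsilon>0 > 0" "\<And>\<epsilon>. 0 < \<epsilon> \<Longrightarrow> \<epsilon> < \<epsilon>0 \<Longrightarrow> \<exists>v H. WG \<Omega> v H \<and>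
     (AE x in lborel. x \<in> \<Omega> \<longrightarrow> norm (v x - t *\<^sub>R u x) \<le> e) \<and>
     (\<integral>\<^sup>+ x. W (x /\<^sub>R \<epsilon>) (H x) * indicator \<Omega> x \<partial>lborel) \<le>
       (\<integral>\<^sup>+ x. Whom (G x) * indicator \<Omega> x \<partial>lborel) + ennreal (\<delta> * (7 * measure lborel \<Omega> + 1))"
proof -
  let ?d = "real CARD('d)" and ?A = "measure lborel \<Omega>"
  note [measurable] = WG_meas(1,2)[OF wu]
  have \<Omega>m [measurable]: "\<Omega> \<in> sets borel" using \<Omega>(1) by simp
  let ?K = "(\<lambda>\<xi>. t *\<^sub>R \<xi>) ` closure C"
  note K = shrunk[OF t]
  obtain \<rho> M where \<rho>: "\<rho> > 0" and M: "M \<ge> 0"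
    "\<And>\<epsilon>. \<epsilon> > 0 \<Longrightarrow> AE x in lborel. \<forall>\<xi>\<in>?K. \<forall>\<zeta>. norm \<zeta> \<le> \<rho> \<longrightarrow> W (x /\<^sub>R \<epsilon>) (\<xi> + \<zeta>) \<le> ennreal M"
    by (rule W_bounded_nbhd[OF K(1,3)], rule that)
  have HWM: "HW W \<xi> \<le> ennreal M" if "\<xi> \<in> ?K" for \<xi>
    by (rule HW_le_bound_nbhd(1)[OF M(1) less_imp_le[OF \<rho>] M(2) that])
  obtain \<kappa>1 where \<kappa>1: "\<kappa>1 > 0" "\<And>\<xi> \<zeta>. \<xi> \<in> ?K \<Longrightarrow> \<zeta> \<in> ?K \<Longrightarrow> norm (\<xi> - \<zeta>) \<le> \<kappa>1 \<Longrightarrow> HW W \<xi> \<le> HW W \<zeta> + ennreal \<delta>"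
    by (rule HW_uniformly_continuous[OF K \<delta>], rule that)
  obtain B0 where B0: "\<And>\<xi>. \<xi> \<in> ?K \<Longrightarrow> norm \<xi> \<le> B0"
    using compact_imp_bounded[OF K(1)] unfolding bounded_iff by blast
  define B where "B = max B0 0"
  have B: "norm \<xi> \<le> B" if "\<xi> \<in> ?K" for \<xi> using B0[OF that] by (simp add: B_def)
  have Bn: "B \<ge> 0" by (simp add: B_def)
  have "((\<lambda>r. M * (1 - (1 - 4 * r) ^ CARD('d))) \<longlongrightarrow> M * (1 - (1 - 4 * 0) ^ CARD('d))) (at_right 0)"
    by (intro tendsto_intros)
  then obtain r where r: "0 < r" "r < 1/4" "M * (1 - (1 - 4 * r) ^ CARD('d)) < \<delta>"
    by (rule tendsto_at_right_obtain[of _ _ \<delta> "1/4"]) (use \<delta> in auto)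
  have r4: "4 * r < 1" using r(2) by simp
  define \<kappa> where "\<kappa> = min (min \<kappa>1 (e / 2)) (min (\<rho> * r / (?d * cutL + 1)) (\<delta> / (M + 1)))"
  have dc: "?d * cutL + 1 > 0" using cutL_nonneg by (simp add: add_nonneg_pos)
  have \<kappa>: "\<kappa> > 0" "\<kappa> \<le> \<kappa>1" using \<kappa>1 \<rho> r dc \<delta> M(1) e by (simp_all add: \<kappa>_def)
  have \<kappa>e: "\<kappa> \<le> e / 2" unfolding \<kappa>_def by (rule min.coboundedI1) simp
  have \<kappa>\<rho>: "?d * cutL * \<kappa> / r \<le> \<rho>"
    by (rule mult_divide_le[OF _ less_imp_le[OF \<rho>] r(1)]) (simp_all add: cutL_nonneg \<kappa>_def)
  have M\<kappa>: "M * \<kappa> \<le> \<delta>"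
    using mult_divide_le[of M \<delta> 1 \<kappa>] M(1) \<delta> by (simp add: \<kappa>_def)
  define \<tau> where "\<tau> = \<delta> / (M + 1)"
  have \<tau>: "\<tau> > 0" using \<delta> M(1) by (simp add: \<tau>_def)
  have M\<tau>: "M * \<tau> \<le> \<delta>" using mult_divide_le[of M \<delta> 1 \<tau>] M(1) \<delta> by (simp add: \<tau>_def)
  have wt: "WG \<Omega> (\<lambda>x. t *\<^sub>R u x) (\<lambda>x. t *\<^sub>R G x)" by (rule WG_cmul[OF wu])
  have GK: "AE x in lborel. x \<in> \<Omega> \<longrightarrow> t *\<^sub>R G x \<in> ?K" using GC by eventually_elim blast
  obtain h Z \<xi> b where h: "h > 0" "h < 1" and Z: "finite Z" "\<And>z. z \<in> Z \<Longrightarrow> gcube h z \<subseteq> \<Omega>" and \<xi>K: "\<And>z. z \<in> Z \<Longrightarrow> \<xi> z \<in> ?K"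
    and cov: "measure lborel (\<Omega> - (\<Union>z\<in>Z. gcube h z)) \<le> \<tau>"
    and mb: "\<And>z. z \<in> Z \<Longrightarrow> measure lborel {x \<in> gcube h z. norm (t *\<^sub>R G x - \<xi> z) > \<kappa>} \<le> \<kappa> * h ^ CARD('d)"
    and aff: "\<And>z. z \<in> Z \<Longrightarrow> AE x in lborel. x \<in> gcube h z \<longrightarrow> norm (t *\<^sub>R u x - (\<xi> z *v x + b z)) \<le> \<kappa> * h"
    by (rule good_cubes[OF \<Omega> wt GK B Bn \<kappa>(1) \<tau>], assumption, rule that)
  note sumA = sum_gcube_bounds(1)[OF h(1) Z \<Omega>]
  let ?hd = "h ^ CARD('d)"
  have hd: "?hd > 0" using h by simp
  \<comment> \<open>The amplitude takes half of \<open>e\<close>, the other half being reserved for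
    \<open>\<kappa> * h\<close>. Both \<open>\<delta>\<close> and \<open>\<delta> * ?hd\<close> are
    needed because \<open>\<sigma>\<close> enters the energy bound once multiplied by the volume of
    the cube and once alone.\<close>
  define \<sigma> where "\<sigma> = min (e / 2) (min \<delta> (\<delta> * ?hd))"
  have \<sigma>: "\<sigma> > 0" "\<sigma> \<le> e / 2" "\<sigma> \<le> \<delta>" "\<sigma> \<le> \<delta> * ?hd" using e \<delta> hd by (simp_all add: \<sigma>_def)
  have \<kappa>he: "\<kappa> * h + \<sigma> \<le> e"
  proof -
    have "\<kappa> * h \<le> \<kappa> * 1" using \<kappa>(1) h by (intro mult_left_mono) auto
    then show ?thesis using \<kappa>e \<sigma>(2) by linarith
  qed
  have err: "\<sigma> * ?hd + \<sigma> + M * (?hd - (h - 4 * (r * h)) ^ CARD('d)) \<le> 3 * \<delta> * ?hd"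
  proof -
    have "h - 4 * (r * h) = h * (1 - 4 * r)" by (simp add: algebra_simps)
    then have "(h - 4 * (r * h)) ^ CARD('d) = ?hd * (1 - 4 * r) ^ CARD('d)" by (simp only: power_mult_distrib)
    then have "M * (?hd - (h - 4 * (r * h)) ^ CARD('d)) = (M * (1 - (1 - 4 * r) ^ CARD('d))) * ?hd"
      by (simp add: right_diff_distrib mult_ac)
    also have "\<dots> \<le> \<delta> * ?hd" using r(3) hd by (intro mult_right_mono) auto
    finally have "M * (?hd - (h - 4 * (r * h)) ^ CARD('d)) \<le> \<delta> * ?hd" .
    moreover have "\<sigma> * ?hd \<le> \<delta> * ?hd" using \<sigma>(3) hd by (intro mult_right_mono) auto
    ultimately show ?thesis using \<sigma>(4) by linarith
  qed
  define comp where "comp \<epsilon> z \<Phi> H \<longleftrightarrow> WG UNIV \<Phi> H \<and> (\<forall>x. x \<notin> gcube h z \<longrightarrow> \<Phi> x = 0 \<and> H x = 0) \<and>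
     (AE x in lborel. x \<in> gcube h z \<longrightarrow> norm (\<Phi> x) \<le> e) \<and>
     (\<integral>\<^sup>+ x. W (x /\<^sub>R \<epsilon>) (t *\<^sub>R G x + H x) * indicator (gcube h z) x \<partial>lborel) \<le> ennreal ?hd * HW W (\<xi> z) + ennreal (3 * \<delta> * ?hd)"
    for \<epsilon> z \<Phi> H
  have "\<forall>z\<in>Z. \<exists>\<epsilon>0>0. \<forall>\<epsilon>. 0 < \<epsilon> \<longrightarrow> \<epsilon> < \<epsilon>0 \<longrightarrow> (\<exists>\<Phi> H. comp \<epsilon> z \<Phi> H)"
  proof
    fix z assume z: "z \<in> Z"
    have GKz: "AE x in lborel. x \<in> gcube h z \<longrightarrow> t *\<^sub>R G x \<in> ?K"
      using GK by eventually_elim (use Z(2)[OF z] in blast)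
    obtain \<epsilon>0 where \<epsilon>0: "\<epsilon>0 > 0" "\<And>\<epsilon>. 0 < \<epsilon> \<Longrightarrow> \<epsilon> < \<epsilon>0 \<Longrightarrow> \<exists>\<Phi> H. WG UNIV \<Phi> H \<and>
     (\<forall>x. x \<notin> gcube h z \<longrightarrow> \<Phi> x = 0 \<and> H x = 0) \<and>
     (AE x in lborel. x \<in> gcube h z \<longrightarrow> norm (\<Phi> x) \<le> \<kappa> * h + \<sigma>) \<and>
     (\<integral>\<^sup>+ x. W (x /\<^sub>R \<epsilon>) (t *\<^sub>R G x + H x) * indicator (gcube h z) x \<partial>lborel) \<le>
       ennreal (h ^ CARD('d)) * HW W (\<xi> z) + ennreal (\<sigma> * h ^ CARD('d) + \<sigma> + M * (h ^ CARD('d) - (h - 4 * (r * h)) ^ CARD('d)))"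
      by (rule cube_competitor[OF K(2) \<xi>K[OF z] M(1) less_imp_le[OF \<rho>] M(2) WG_subset[OF wt Z(2)[OF z]] h(1) r(1) r4 GKz aff[OF z] \<kappa>\<rho> \<sigma>(1)], assumption, rule that)
    show "\<exists>\<epsilon>0>0. \<forall>\<epsilon>. 0 < \<epsilon> \<longrightarrow> \<epsilon> < \<epsilon>0 \<longrightarrow> (\<exists>\<Phi> H. comp \<epsilon> z \<Phi> H)"
    proof (intro exI[of _ \<epsilon>0] conjI allI impI \<epsilon>0(1))
      fix \<epsilon> assume "0 < \<epsilon>" "\<epsilon> < \<epsilon>0"
      from \<epsilon>0(2)[OF this] obtain \<Phi> H where 1: "WG UNIV \<Phi> H" "\<forall>x. x \<notin> gcube h z \<longrightarrow> \<Phi> x = 0 \<and> H x = 0"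
         and 2: "AE x in lborel. x \<in> gcube h z \<longrightarrow> norm (\<Phi> x) \<le> \<kappa> * h + \<sigma>"
         and 3: "(\<integral>\<^sup>+ x. W (x /\<^sub>R \<epsilon>) (t *\<^sub>R G x + H x) * indicator (gcube h z) x \<partial>lborel) \<le>
       ennreal (h ^ CARD('d)) * HW W (\<xi> z) + ennreal (\<sigma> * h ^ CARD('d) + \<sigma> + M * (h ^ CARD('d) - (h - 4 * (r * h)) ^ CARD('d)))"
        by blast
      have "AE x in lborel. x \<in> gcube h z \<longrightarrow> norm (\<Phi> x) \<le> e"
        using 2 by eventually_elim (use \<kappa>he in auto)
      moreover have "(\<integral>\<^sup>+ x. W (x /\<^sub>R \<epsilon>) (t *\<^sub>R G x + H x) * indicator (gcube h z) x \<partial>lborel) \<le> ennreal ?hd * HW W (\<xi> z) + ennreal (3 * \<delta> * ?hd)"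
        by (rule order_trans[OF 3 add_left_mono[OF ennreal_leI[OF err]]])
      ultimately have "comp \<epsilon> z \<Phi> H" using 1 unfolding comp_def by (intro conjI)
      then show "\<exists>\<Phi> H. comp \<epsilon> z \<Phi> H" by (intro exI)
    qed
  qed
  from bchoice[OF this] obtain E where E: "\<forall>z\<in>Z. E z > 0 \<and> (\<forall>\<epsilon>. 0 < \<epsilon> \<longrightarrow> \<epsilon> < E z \<longrightarrow> (\<exists>\<Phi> H. comp \<epsilon> z \<Phi> H))" ..
  \<comment> \<open>Inserting 1 keeps the minimum defined when there are no cubes.\<close>
  define \<epsilon>0 where "\<epsilon>0 = Min (insert 1 (E ` Z))"
  have \<epsilon>0: "\<epsilon>0 > 0" "\<And>z. z \<in> Z \<Longrightarrow> \<epsilon>0 \<le> E z" using Z(1) E by (auto simp: \<epsilon>0_def)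
  define bad where "bad z = {x \<in> gcube h z. norm (t *\<^sub>R G x - \<xi> z) > \<kappa>}" for z
  have [measurable]: "bad z \<in> sets borel" for z unfolding bad_def by measurable
  let ?R = "\<Omega> - (\<Union>z\<in>Z. gcube h z)"
  have Rm [measurable]: "?R \<in> sets borel" using Z(1) by auto
  have eR: "emeasure lborel ?R \<le> ennreal \<tau>"
  proof -
    have "emeasure lborel ?R < \<infinity>" by (rule emeasure_bounded_finite) (use \<Omega>(2) in \<open>auto intro: bounded_subset\<close>)
    then show ?thesis using cov by (simp add: emeasure_eq_ennreal_measure less_top ennreal_leI)
  qed
  have ebad: "emeasure lborel (bad z) \<le> ennreal (\<kappa> * ?hd)" if "z \<in> Z" for z
  proof -
    have "emeasure lborel (bad z) < \<infinity>" by (rule emeasure_bounded_finite) (auto simp: bad_def intro: bounded_subset[OF bounded_box])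
    then show ?thesis using mb[OF that] unfolding bad_def by (simp add: emeasure_eq_ennreal_measure less_top ennreal_leI)
  qed
  \<comment> \<open>On the good part the continuity of \<open>HW\<close> costs
    \<open>\<delta>\<close> and \<open>HW_scale_le_Whom\<close> costs \<open>2 * \<delta>\<close>;
    the fourth \<open>\<delta>\<close> pays for the bad part, of measure at most
    \<open>\<kappa>\<close> times the volume.\<close>
  have HWcube: "ennreal ?hd * HW W (\<xi> z) \<le> (\<integral>\<^sup>+ x. Whom (G x) * indicator (gcube h z) x \<partial>lborel) + ennreal (4 * \<delta> * ?hd)" if z: "z \<in> Z" for z
  proof -
    have e3: "ennreal (3 * \<delta>) = ennreal (2 * \<delta>) + ennreal \<delta>" using \<delta> by (subst ennreal_plus[symmetric]) auto
    have "ennreal ?hd * HW W (\<xi> z) = (\<integral>\<^sup>+ x. HW W (\<xi> z) * indicator (gcube h z) x \<partial>lborel)"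
      by (subst nn_integral_cmult_indicator) (simp_all add: measure_cube(2)[OF less_imp_le[OF h(1)]] mult.commute)
    also have "\<dots> \<le> (\<integral>\<^sup>+ x. Whom (G x) * indicator (gcube h z) x + (ennreal (3 * \<delta>) * indicator (gcube h z) x + ennreal M * indicator (bad z) x) \<partial>lborel)"
    proof (rule nn_integral_mono_AE)
      show "AE x in lborel. HW W (\<xi> z) * indicator (gcube h z) x \<le> Whom (G x) * indicator (gcube h z) x + (ennreal (3 * \<delta>) * indicator (gcube h z) x + ennreal M * indicator (bad z) x)"
        using GC
      proof eventually_elim
        case (elim x)
        show ?case
        proof (cases "x \<in> gcube h z")
          case True
          then have Gx: "G x \<in> closure C" using elim Z(2)[OF z] by blast
          show ?thesis
          proof (cases "x \<in> bad z")
            case True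
            then show ?thesis using HWM[OF \<xi>K[OF z]] \<open>x \<in> gcube h z\<close> by (simp add: add_increasing)
          next
            case False
            then have "norm (\<xi> z - t *\<^sub>R G x) \<le> \<kappa>1" using True \<kappa>(2) by (simp add: bad_def norm_minus_commute)
            then have "HW W (\<xi> z) \<le> HW W (t *\<^sub>R G x) + ennreal \<delta>" by (intro \<kappa>1(2) \<xi>K[OF z] imageI Gx)
            also have "\<dots> \<le> (Whom (G x) + ennreal (2 * \<delta>)) + ennreal \<delta>"
              by (intro add_right_mono HW_scale_le_Whom[OF t \<delta> \<eta> Gx])
            finally show ?thesis using True False unfolding e3 by (simp add: add.assoc)
          qed
        qed simp
      qed
    qed
    also have "\<dots> = (\<integral>\<^sup>+ x. Whom (G x) * indicator (gcube h z) x \<partial>lborel) + (ennreal (3 * \<delta>) * emeasure lborel (gcube h z) + ennreal M * emeasure lborel (bad z))"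
    proof -
      have "(\<lambda>x. Whom (G x) * indicator (gcube h z) x) \<in> borel_measurable lborel"
        by (intro borel_measurable_times_ennreal measurable_compose[OF _ Whom_measurable]) measurable
      then show ?thesis by (subst nn_integral_add) (auto simp: nn_integral_add nn_integral_cmult_indicator)
    qed
    also have "\<dots> \<le> (\<integral>\<^sup>+ x. Whom (G x) * indicator (gcube h z) x \<partial>lborel) + ennreal (4 * \<delta> * ?hd)"
    proof (rule add_left_mono)
      have "ennreal M * emeasure lborel (bad z) \<le> ennreal M * ennreal (\<kappa> * ?hd)" by (rule mult_left_mono[OF ebad[OF z]]) simp
      also have "\<dots> = ennreal ((M * \<kappa>) * ?hd)" using M(1) \<kappa>(1) hd by (simp add: ennreal_mult[symmetric] mult.assoc)
      also have "\<dots> \<le> ennreal (\<delta> * ?hd)" using M\<kappa> hd by (intro ennreal_leI mult_right_mono) auto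
      finally have "ennreal M * emeasure lborel (bad z) \<le> ennreal (\<delta> * ?hd)" .
      moreover have "ennreal (3 * \<delta>) * emeasure lborel (gcube h z) = ennreal (3 * \<delta> * ?hd)"
        unfolding measure_cube(2)[OF less_imp_le[OF h(1)]] using \<delta> hd by (intro ennreal_mult[symmetric]) auto
      ultimately have "ennreal (3 * \<delta>) * emeasure lborel (gcube h z) + ennreal M * emeasure lborel (bad z) \<le> ennreal (3 * \<delta> * ?hd) + ennreal (\<delta> * ?hd)"
        by (simp add: add_left_mono)
      also have "\<dots> = ennreal (4 * \<delta> * ?hd)" using \<delta> hd by (subst ennreal_plus[symmetric]) auto
      finally show "ennreal (3 * \<delta>) * emeasure lborel (gcube h z) + ennreal M * emeasure lborel (bad z) \<le> ennreal (4 * \<delta> * ?hd)" .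
    qed
    finally show ?thesis .
  qed
  show ?thesis
  proof (rule that[OF \<epsilon>0(1)])
    fix \<epsilon> :: real assume \<epsilon>: "0 < \<epsilon>" "\<epsilon> < \<epsilon>0"
    have "\<forall>z\<in>Z. \<exists>p. comp \<epsilon> z (fst p) (snd p)"
    proof
      fix z assume z: "z \<in> Z"
      have "\<epsilon> < E z" using \<epsilon>(2) \<epsilon>0(2)[OF z] by linarith
      then obtain \<Phi> H where "comp \<epsilon> z \<Phi> H" using bspec[OF E z] \<epsilon>(1) by blast
      then show "\<exists>p. comp \<epsilon> z (fst p) (snd p)" by (intro exI[of _ "(\<Phi>, H)"]) simp
    qed
    from bchoice[OF this] obtain P where P: "\<forall>z\<in>Z. comp \<epsilon> z (fst (P z)) (snd (P z))" ..
    define \<Phi> where "\<Phi> z = fst (P z)" for z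
    define H where "H z = snd (P z)" for z
    have comp: "comp \<epsilon> z (\<Phi> z) (H z)" if "z \<in> Z" for z unfolding \<Phi>_def H_def by (rule bspec[OF P that])
    note wP = comp[unfolded comp_def, THEN conjunct1]
    note compD = comp[unfolded comp_def, THEN conjunct2]
    have zP: "\<Phi> z x = 0" "H z x = 0" if "z \<in> Z" "x \<notin> gcube h z" for z x
      using compD[OF that(1), THEN conjunct1] that(2) by blast+
    note sP = compD[THEN conjunct2, THEN conjunct1]
    note eP = compD[THEN conjunct2, THEN conjunct2]
    have in_sum: "(\<Sum>z\<in>Z. \<Phi> z x) = \<Phi> z0 x" "(\<Sum>z\<in>Z. H z x) = H z0 x" if "z0 \<in> Z" "x \<in> gcube h z0" for z0 x
    proof -
      have *: "x \<notin> gcube h z" if "z \<noteq> z0" for z using gcube_disjoint[OF h(1) \<open>x \<in> gcube h z0\<close>] that by blast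
      show "(\<Sum>z\<in>Z. \<Phi> z x) = \<Phi> z0 x"
        using sum.remove[OF Z(1) \<open>z0 \<in> Z\<close>, of "\<lambda>z. \<Phi> z x"] sum.neutral[of "Z - {z0}" "\<lambda>z. \<Phi> z x"] zP(1) * by simp
      show "(\<Sum>z\<in>Z. H z x) = H z0 x"
        using sum.remove[OF Z(1) \<open>z0 \<in> Z\<close>, of "\<lambda>z. H z x"] sum.neutral[of "Z - {z0}" "\<lambda>z. H z x"] zP(2) * by simp
    qed
    have wv: "WG \<Omega> (\<lambda>x. t *\<^sub>R u x + (\<Sum>z\<in>Z. \<Phi> z x)) (\<lambda>x. t *\<^sub>R G x + (\<Sum>z\<in>Z. H z x))"
      by (rule WG_add[OF wt WG_sum]) (rule WG_subset[OF wP], auto)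
    have "AE x in lborel. \<forall>z\<in>Z. x \<in> gcube h z \<longrightarrow> norm (\<Phi> z x) \<le> e"
      by (rule AE_finite_allI[OF Z(1)]) (rule sP)
    then have close: "AE x in lborel. x \<in> \<Omega> \<longrightarrow> norm ((t *\<^sub>R u x + (\<Sum>z\<in>Z. \<Phi> z x)) - t *\<^sub>R u x) \<le> e"
    proof eventually_elim
      case (elim x)
      show ?case
      proof (cases "\<exists>z\<in>Z. x \<in> gcube h z")
        case True
        then obtain z where z: "z \<in> Z" "x \<in> gcube h z" by blast
        then show ?thesis using elim in_sum(1)[OF z] by simp
      next
        case False
        then have "(\<Sum>z\<in>Z. \<Phi> z x) = 0" using zP(1) by (intro sum.neutral) blast
        then show ?thesis using e by simp
      qed
    qed
    have Wm: "(\<lambda>x. W (x /\<^sub>R \<epsilon>) (t *\<^sub>R G x + H z x) * indicator (gcube h z) x) \<in> borel_measurable lborel" if "z \<in> Z" for z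
    proof -
      note [measurable] = WG_meas(2)[OF wP[OF that]]
      show ?thesis by (intro borel_measurable_times_ennreal W_comp_measurable) auto
    qed
    have "(\<integral>\<^sup>+ x. W (x /\<^sub>R \<epsilon>) (t *\<^sub>R G x + (\<Sum>z\<in>Z. H z x)) * indicator \<Omega> x \<partial>lborel) \<le>
      (\<integral>\<^sup>+ x. (\<Sum>z\<in>Z. W (x /\<^sub>R \<epsilon>) (t *\<^sub>R G x + H z x) * indicator (gcube h z) x) + ennreal M * indicator ?R x \<partial>lborel)"
    proof (rule nn_integral_mono_AE)
      show "AE x in lborel. W (x /\<^sub>R \<epsilon>) (t *\<^sub>R G x + (\<Sum>z\<in>Z. H z x)) * indicator \<Omega> x \<le>
         (\<Sum>z\<in>Z. W (x /\<^sub>R \<epsilon>) (t *\<^sub>R G x + H z x) * indicator (gcube h z) x) + ennreal M * indicator ?R x"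
        using M(2)[OF \<epsilon>(1)] GK
      proof eventually_elim
        case (elim x)
        show ?case
        proof (cases "\<exists>z\<in>Z. x \<in> gcube h z")
          case True
          then obtain z where z: "z \<in> Z" "x \<in> gcube h z" by blast
          have "W (x /\<^sub>R \<epsilon>) (t *\<^sub>R G x + (\<Sum>z\<in>Z. H z x)) * indicator \<Omega> x = W (x /\<^sub>R \<epsilon>) (t *\<^sub>R G x + H z x) * indicator (gcube h z) x"
            using in_sum(2)[OF z] z(2) Z(2)[OF z(1)] by (auto simp: indicator_def)
          also have "\<dots> \<le> (\<Sum>z\<in>Z. W (x /\<^sub>R \<epsilon>) (t *\<^sub>R G x + H z x) * indicator (gcube h z) x)"
            by (rule member_le_sum[OF z(1) _ Z(1)]) simp
          also have "\<dots> \<le> \<dots> + ennreal M * indicator ?R x" by (rule add_increasing2) simp_all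
          finally show ?thesis .
        next
          case False
          show ?thesis
          proof (cases "x \<in> \<Omega>")
            case True
            have "(\<Sum>z\<in>Z. H z x) = 0" using zP(2) False by (intro sum.neutral) blast
            then have "W (x /\<^sub>R \<epsilon>) (t *\<^sub>R G x + (\<Sum>z\<in>Z. H z x)) \<le> ennreal M"
              using elim(1)[rule_format, of "t *\<^sub>R G x" 0] elim(2) True \<rho> by simp
            moreover have "x \<in> ?R" using True False by blast
            ultimately show ?thesis using True by (simp add: add_increasing)
          qed simp
        qed
      qed
    qed
    also have "\<dots> = (\<Sum>z\<in>Z. \<integral>\<^sup>+ x. W (x /\<^sub>R \<epsilon>) (t *\<^sub>R G x + H z x) * indicator (gcube h z) x \<partial>lborel) + ennreal M * emeasure lborel ?R"
    proof -
      have "(\<lambda>x. \<Sum>z\<in>Z. W (x /\<^sub>R \<epsilon>) (t *\<^sub>R G x + H z x) * indicator (gcube h z) x) \<in> borel_measurable lborel"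
        using Wm by (intro borel_measurable_sum) auto
      moreover have "(\<lambda>x. ennreal M * indicator ?R x) \<in> borel_measurable lborel" by measurable
      moreover have "(\<integral>\<^sup>+ x. ennreal M * indicator ?R x \<partial>lborel) = ennreal M * emeasure lborel ?R"
        by (rule nn_integral_cmult_indicator) simp
      ultimately show ?thesis using Wm by (simp only: nn_integral_add nn_integral_sum)
    qed
    also have "\<dots> \<le> (\<Sum>z\<in>Z. (\<integral>\<^sup>+ x. Whom (G x) * indicator (gcube h z) x \<partial>lborel) + ennreal (7 * \<delta> * ?hd)) + ennreal \<delta>"
    proof (rule add_mono[OF sum_mono])
      fix z assume z: "z \<in> Z"
      have "(\<integral>\<^sup>+ x. W (x /\<^sub>R \<epsilon>) (t *\<^sub>R G x + H z x) * indicator (gcube h z) x \<partial>lborel) \<le> ennreal ?hd * HW W (\<xi> z) + ennreal (3 * \<delta> * ?hd)" by (rule eP[OF z])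
      also have "\<dots> \<le> ((\<integral>\<^sup>+ x. Whom (G x) * indicator (gcube h z) x \<partial>lborel) + ennreal (4 * \<delta> * ?hd)) + ennreal (3 * \<delta> * ?hd)"
        by (rule add_right_mono[OF HWcube[OF z]])
      also have "\<dots> = (\<integral>\<^sup>+ x. Whom (G x) * indicator (gcube h z) x \<partial>lborel) + ennreal (7 * \<delta> * ?hd)"
      proof -
        have "ennreal (7 * \<delta> * ?hd) = ennreal (4 * \<delta> * ?hd) + ennreal (3 * \<delta> * ?hd)" using \<delta> hd by (subst ennreal_plus[symmetric]) auto
        then show ?thesis by (simp only: add.assoc)
      qed
      finally show "(\<integral>\<^sup>+ x. W (x /\<^sub>R \<epsilon>) (t *\<^sub>R G x + H z x) * indicator (gcube h z) x \<partial>lborel) \<le> (\<integral>\<^sup>+ x. Whom (G x) * indicator (gcube h z) x \<partial>lborel) + ennreal (7 * \<delta> * ?hd)" .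
    next
      have "ennreal M * emeasure lborel ?R \<le> ennreal M * ennreal \<tau>" by (rule mult_left_mono[OF eR]) simp
      also have "\<dots> = ennreal (M * \<tau>)" using M(1) \<tau> by (simp add: ennreal_mult)
      also have "\<dots> \<le> ennreal \<delta>" using M\<tau> by (rule ennreal_leI)
      finally show "ennreal M * emeasure lborel ?R \<le> ennreal \<delta>" .
    qed
    also have "\<dots> = (\<Sum>z\<in>Z. \<integral>\<^sup>+ x. Whom (G x) * indicator (gcube h z) x \<partial>lborel) + ennreal (7 * \<delta> * (\<Sum>z\<in>Z. ?hd)) + ennreal \<delta>"
      using \<delta> hd by (simp add: sum.distrib sum_ennreal sum_distrib_left del: sum_constant)
    also have "\<dots> \<le> (\<integral>\<^sup>+ x. Whom (G x) * indicator \<Omega> x \<partial>lborel) + ennreal (7 * \<delta> * ?A) + ennreal \<delta>"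
    proof (intro add_mono ennreal_leI mult_left_mono sumA order_refl)
      show "(\<Sum>z\<in>Z. \<integral>\<^sup>+ x. Whom (G x) * indicator (gcube h z) x \<partial>lborel) \<le> (\<integral>\<^sup>+ x. Whom (G x) * indicator \<Omega> x \<partial>lborel)"
        by (rule sum_gcube_bounds(2)[OF h(1) Z \<Omega>], assumption) (rule measurable_compose[OF WG_meas(2)[OF wu] Whom_measurable])
    qed (use \<delta> in auto)
    also have "\<dots> = (\<integral>\<^sup>+ x. Whom (G x) * indicator \<Omega> x \<partial>lborel) + ennreal (\<delta> * (7 * ?A + 1))"
    proof -
      have "ennreal (\<delta> * (7 * ?A + 1)) = ennreal (7 * \<delta> * ?A) + ennreal \<delta>"
        using \<delta> by (simp add: algebra_simps flip: ennreal_plus)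
      then show ?thesis by (simp add: add.assoc)
    qed
    finally have energy: "(\<integral>\<^sup>+ x. W (x /\<^sub>R \<epsilon>) (t *\<^sub>R G x + (\<Sum>z\<in>Z. H z x)) * indicator \<Omega> x \<partial>lborel) \<le>
       (\<integral>\<^sup>+ x. Whom (G x) * indicator \<Omega> x \<partial>lborel) + ennreal (\<delta> * (7 * ?A + 1))" .
    show "\<exists>v H. WG \<Omega> v H \<and> (AE x in lborel. x \<in> \<Omega> \<longrightarrow> norm (v x - t *\<^sub>R u x) \<le> e) \<and>
      (\<integral>\<^sup>+ x. W (x /\<^sub>R \<epsilon>) (H x) * indicator \<Omega> x \<partial>lborel) \<le>
       (\<integral>\<^sup>+ x. Whom (G x) * indicator \<Omega> x \<partial>lborel) + ennreal (\<delta> * (7 * ?A + 1))"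
      by (rule exI, rule exI, intro conjI) (rule wv, rule close, rule energy)
  qed
qed

text \<open>Only finite values of the limit functional matter. Recovery functions are built for
  \<open>t\<close> times \<open>u\<close>, and \<open>t\<close> is chosen so close to 1 that this
  shift is itself within the tolerance.\<close>

theorem Gamma_limsup_le:
  fixes \<Omega> :: "(real^'d) set"
  assumes \<Omega>: "open \<Omega>" "bounded \<Omega>" and u: "u \<in> W1inf \<Omega>"
  shows "Gamma_limsup \<Omega> (I_eps W \<Omega>) u \<le> I_hom W \<Omega> u"
proof (cases "I_hom W \<Omega> u = top")
  case False
  let ?A = "measure lborel \<Omega>"
  have \<Omega>m [measurable]: "\<Omega> \<in> sets borel" using \<Omega>(1) by simp
  obtain v G B where v: "WG \<Omega> v G" "AE x in lborel. x \<in> \<Omega> \<longrightarrow> u x = v x"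
    "AE x in lborel. x \<in> \<Omega> \<longrightarrow> weak_gradient \<Omega> u x = G x" and B: "\<And>x. norm (v x) \<le> B"
    by (rule W1inf_WG[OF \<Omega>(1) u], rule that)
  note [measurable] = WG_meas(1,2)[OF v(1)]
  have B0: "B \<ge> 0" by (rule order_trans[OF norm_ge_zero B])
  note I = I_hom_WG[OF \<Omega>(1) v(1,3)]
  \<comment> \<open>The relaxed density is infinite outside the closure of \<open>C\<close>, so a
    finite integral confines the gradient.\<close>
  have GC: "AE x in lborel. x \<in> \<Omega> \<longrightarrow> G x \<in> closure C"
  proof -
    have "(\<lambda>x. Whom (G x) * indicator \<Omega> x) \<in> borel_measurable lborel"
      by (intro borel_measurable_times_ennreal measurable_compose[OF _ Whom_measurable]) measurable
    then have "AE x in lborel. Whom (G x) * indicator \<Omega> x \<noteq> \<infinity>"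
      using False unfolding I by (intro nn_integral_PInf_AE) auto
    then show ?thesis
    proof eventually_elim
      case (elim x)
      then show ?case using Whom_eq_top[of "G x"] by (cases "G x \<in> closure C") auto
    qed
  qed
  have e\<Omega>: "emeasure lborel \<Omega> = ennreal ?A"
    using emeasure_bounded_finite[OF \<Omega>(2)] by (simp add: emeasure_eq_ennreal_measure less_top)
  show ?thesis
  proof (rule Gamma_limsup_le_diagonal[OF u])
    fix e :: real assume e: "e > 0"
    define \<delta> where "\<delta> = e / (7 * ?A + 1)"
    have A1: "7 * ?A + 1 > 0" "?A + 1 > 0" by (simp_all add: add_nonneg_pos)
    have \<delta>: "\<delta> > 0" "\<delta> * (7 * ?A + 1) = e" using e A1 by (simp_all add: \<delta>_def)
    \<comment> \<open>One \<open>e1\<close> is spent on the distance of the competitor to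
      \<open>t\<close> times \<open>v\<close> and one on the distance of the latter to
      \<open>v\<close>; integrated over the domain they amount to at most \<open>e\<close>.\<close>
    define e1 where "e1 = e / (?A + 1) / 2"
    have e1: "e1 > 0" using e A1 by (simp add: e1_def)
    have "2 * e1 \<le> e * 1 / (?A + 1)" by (simp add: e1_def mult.commute del: divide_divide_eq_left)
    from mult_divide_le[OF measure_nonneg less_imp_le[OF e] zero_less_one this]
    have e1A: "2 * e1 * ?A \<le> e" by (simp only: div_by_1 mult_ac)
    obtain \<eta> where \<eta>: "\<eta> > 0" "\<And>x \<xi> t. 0 \<le> t \<Longrightarrow> t < 1 \<Longrightarrow> 1 - t \<le> \<eta> \<Longrightarrow> W x (t *\<^sub>R \<xi>) \<le> W x \<xi> + ennreal \<delta>"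
      by (rule W_scale[OF \<delta>(1)], rule that)
    \<comment> \<open>\<open>s\<close> is the amount \<open>1 - t\<close>: the bounds keep
      \<open>t\<close> nonnegative, meet the threshold of condition (1), and make
      \<open>s * B\<close> at most \<open>e1\<close>.\<close>
    define s where "s = min 1 (min \<eta> (e1 / (B + 1)))"
    define t where "t = 1 - s"
    have s: "0 < s" "s \<le> 1" "s \<le> \<eta>" "s \<le> e1 / (B + 1)" using \<eta>(1) e1 B0 by (simp_all add: s_def)
    have t: "0 \<le> t" "t < 1" "1 - t \<le> \<eta>" using s by (simp_all add: t_def)
    have sB: "s * B \<le> e1" using mult_divide_le[of B e1 1 s] s(4) B0 e1 by (simp add: mult.commute)
    obtain \<epsilon>0 where \<epsilon>0: "\<epsilon>0 > 0" "\<And>\<epsilon>. 0 < \<epsilon> \<Longrightarrow> \<epsilon> < \<epsilon>0 \<Longrightarrow> \<exists>w H. WG \<Omega> w H \<and>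
     (AE x in lborel. x \<in> \<Omega> \<longrightarrow> norm (w x - t *\<^sub>R v x) \<le> e1) \<and>
     (\<integral>\<^sup>+ x. W (x /\<^sub>R \<epsilon>) (H x) * indicator \<Omega> x \<partial>lborel) \<le>
       (\<integral>\<^sup>+ x. Whom (G x) * indicator \<Omega> x \<partial>lborel) + ennreal (\<delta> * (7 * ?A + 1))"
      by (rule limsup_estimate_scaled[OF \<Omega> v(1) GC \<delta>(1) t(1,2) \<eta>(2)[OF t] e1], rule that)
    show "\<exists>\<epsilon>0>0. \<forall>\<epsilon>. 0 < \<epsilon> \<and> \<epsilon> < \<epsilon>0 \<longrightarrow> (\<exists>w\<in>W1inf \<Omega>.
       (\<integral>\<^sup>+ x. ennreal (norm (w x - u x)) \<partial>lebesgue_on \<Omega>) \<le> ennreal e \<and> I_eps W \<Omega> \<epsilon> w \<le> I_hom W \<Omega> u + ennreal e)"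
    proof (rule exI[of _ \<epsilon>0], intro conjI allI impI \<epsilon>0(1))
      fix \<epsilon> assume "0 < \<epsilon> \<and> \<epsilon> < \<epsilon>0"
      then obtain w H where w: "WG \<Omega> w H" and close: "AE x in lborel. x \<in> \<Omega> \<longrightarrow> norm (w x - t *\<^sub>R v x) \<le> e1"
        and en: "(\<integral>\<^sup>+ x. W (x /\<^sub>R \<epsilon>) (H x) * indicator \<Omega> x \<partial>lborel) \<le>
          (\<integral>\<^sup>+ x. Whom (G x) * indicator \<Omega> x \<partial>lborel) + ennreal (\<delta> * (7 * ?A + 1))"
        using \<epsilon>0(2)[of \<epsilon>] by blast
      note wW = WG_W1inf[OF \<Omega> w]
      have "(\<integral>\<^sup>+ x. ennreal (norm (w x - u x)) \<partial>lebesgue_on \<Omega>) = (\<integral>\<^sup>+ x. ennreal (norm (w x - v x)) * indicator \<Omega> x \<partial>lborel)"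
        by (rule L1_distance_WG[OF \<Omega>(1) WG_meas(1)[OF v(1)] WG_meas(1)[OF w] v(2)]) simp
      also have "\<dots> \<le> (\<integral>\<^sup>+ x. ennreal (2 * e1) * indicator \<Omega> x \<partial>lborel)"
      proof (rule nn_integral_mono_AE)
        show "AE x in lborel. ennreal (norm (w x - v x)) * indicator \<Omega> x \<le> ennreal (2 * e1) * indicator \<Omega> x"
          using close
        proof eventually_elim
          case (elim x)
          show ?case
          proof (cases "x \<in> \<Omega>")
            case True
            have "norm (w x - v x) \<le> norm (w x - t *\<^sub>R v x) + norm (t *\<^sub>R v x - v x)"
              using norm_triangle_ineq[of "w x - t *\<^sub>R v x" "t *\<^sub>R v x - v x"] by simp
            moreover have "t *\<^sub>R v x - v x = (- s) *\<^sub>R v x" by (simp add: t_def scaleR_diff_left)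
            then have "norm (t *\<^sub>R v x - v x) \<le> s * B" using s(1) B[of x] by (simp add: mult_left_mono)
            moreover have "norm (w x - t *\<^sub>R v x) \<le> e1" using elim True by blast
            ultimately have "norm (w x - v x) \<le> 2 * e1" using sB by linarith
            then show ?thesis using True by (simp add: ennreal_leI)
          qed simp
        qed
      qed
      also have "\<dots> = ennreal (2 * e1) * ennreal ?A" by (simp add: nn_integral_cmult_indicator e\<Omega>)
      also have "\<dots> = ennreal (2 * e1 * ?A)" using e1 by (intro ennreal_mult[symmetric]) auto
      also have "\<dots> \<le> ennreal e" by (rule ennreal_leI[OF e1A])
      finally have 1: "(\<integral>\<^sup>+ x. ennreal (norm (w x - u x)) \<partial>lebesgue_on \<Omega>) \<le> ennreal e" .
      have 2: "I_eps W \<Omega> \<epsilon> w \<le> I_hom W \<Omega> u + ennreal e"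
        using en unfolding I_eps_WG[OF \<Omega>(1) w wW(2)] I \<delta>(2) .
      show "\<exists>w\<in>W1inf \<Omega>. (\<integral>\<^sup>+ x. ennreal (norm (w x - u x)) \<partial>lebesgue_on \<Omega>) \<le> ennreal e \<and> I_eps W \<Omega> \<epsilon> w \<le> I_hom W \<Omega> u + ennreal e"
        using 1 2 wW(1) by (intro bexI conjI)
    qed
  qed
qed simp

end

theorem theorem1p1:
  fixes \<Omega> :: "(real ^ 'd::finite) set"
    and C :: "(real ^ 'd ^ 'm::finite) set"
    and W :: "real ^ 'd \<Rightarrow> real ^ 'd ^ 'm \<Rightarrow> ennreal"
  assumes "\<Omega> \<noteq> {}" and "bounded \<Omega>" and "open \<Omega>" and "connected \<Omega>" and "Lipschitz_boundary \<Omega>"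
    and "bounded C" and "convex C" and "0 \<in> interior C"
    and "(\<lambda>(x, \<xi>). W x \<xi>) \<in> borel_measurable borel"
    and periodic: "\<And>x z \<xi>. (\<forall>i. z $ i \<in> \<int>) \<Longrightarrow> W (x + z) \<xi> = W x \<xi>"
    and "\<And>x. effective_dom (W x) \<subseteq> closure C"
    and cond1: "\<forall>\<delta>::real. \<delta> > 0 \<longrightarrow> (\<exists>\<eta>::real. \<eta> > 0 \<and>
           (\<forall>x. \<forall>\<xi> \<in> effective_dom (W x). \<forall>t \<in> {0..<1}.
              1 - t \<le> \<eta> \<longrightarrow> W x (t *\<^sub>R \<xi>) \<le> W x \<xi> + ennreal \<delta>))"
    and cond2: "\<forall>K. compact K \<and> K \<subseteq> interior C \<longrightarrow> Linfty_loc_ennreal (\<lambda>x. SUP \<xi> \<in> K. W x \<xi>)"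
    and cond3: "\<forall>s::real. s > 0 \<longrightarrow> (\<exists>K. compact K \<and> K \<subseteq> interior C \<and>
           (\<forall>x. (INF \<xi> \<in> closure C - K. W x \<xi>) \<ge> ennreal s))"
  shows "Gamma_converges \<Omega> (I_eps W \<Omega>) (I_hom W \<Omega>)"
proof -
  interpret homogenization C W
    by unfold_locales (fact assms)+
  show ?thesis
    unfolding Gamma_converges_def
    using Gamma_liminf_ge[OF \<open>open \<Omega>\<close> \<open>bounded \<Omega>\<close>] Gamma_limsup_le[OF \<open>open \<Omega>\<close> \<open>bounded \<Omega>\<close>] by blast
qed

end
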